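(* Let $A$ be a bialgebra over a field $K$. Suppose that the coradical $H$ of $A$ is a semisimple sub-bialgebra of $A$ with antipode. Then $A$ is isomorphic as a bialgebra to the bosonization $R\#^bH$ of a certain dual Yetter–Drinfeld quadruple $(R,1,m,\xi)$. In fact, $A$ and $R\#^bH$ are isomorphic Hopf algebras.
   Context: ${}_H^H\mathcal{YD}$: left $H$-modules (action $\mu_R(h\otimes v)={}^hv$) and left $H$-comodules (coaction $\rho(v)=\sum v_{\langle-1\rangle}\otimes v_{\langle0\rangle}$) with $\rho({}^hv)=\sum h_{(1)}v_{\langle-1\rangle}S(h_{(3)})\otimes{}^{h_{(2)}}v_{\langle0\rangle}$; tensor product over $K$ with diagonal action and coaction $\rho_{R\otimes R}$. In composites of maps an object denotes its identity map; $m_H,m_K$ are the multiplications of $H,K$. Let $(R,\delta,\varepsilon)$ be a coalgebra in ${}_H^H\mathcal{YD}$, $\delta(r)=\sum r^{(1)}\otimes r^{(2)}$. $R\otimes R$ is a coalgebra with $\delta_{R\otimes R}(r\otimes s)=\sum(r^{(1)}\otimes{}^{r^{(2)}_{\langle-1\rangle}}s^{(1)})\otimes(r^{(2)}_{\langle0\rangle}\otimes s^{(2)})$. Put $c_{R,H}(r\otimes h)=\sum r_{\langle-1\rangle}h\otimes r_{\langle0\rangle}$ and $c_{H,R}(h\otimes r)=\sum{}^{h_{(1)}}r\otimes h_{(2)}$. Given $1\in R$ and linear maps $m:R\otimes R\to R$, $\xi:R\otimes R\to H$, $(R,1,m,\xi)$ is a dual Yetter–Drinfeld quadruple if for all $r,s\in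 R$, $h\in H$: 1. ${}^h1=\varepsilon_H(h)1$ and $\rho_R(1)=1_H\otimes1$; 2. $\delta(1)=1\otimes1$ and $\varepsilon(1)=1_K$; 3. ${}^hm(r\otimes s)=\sum m({}^{h_{(1)}}r\otimes{}^{h_{(2)}}s)$; 4. $\sum\xi({}^{h_{(1)}}r\otimes{}^{h_{(2)}}s)=\sum h_{(1)}\xi(r\otimes s)S(h_{(2)})$; 5. $\delta m=(m\otimes m)\delta_{R\otimes R}$ and $\varepsilon m=m_K(\varepsilon\otimes\varepsilon)$; 6. $\Delta_H\xi=(m_H\otimes H)(\xi\otimes H\otimes\xi)(R\otimes R\otimes\rho_{R\otimes R})\delta_{R\otimes R}$ and $\varepsilon_H\xi=m_K(\varepsilon\otimes\varepsilon)$; 7. $c_{R,H}(m\otimes\xi)\delta_{R\otimes R}=(m_H\otimes R)(\xi\otimes H\otimes m)(R\otimes R\otimes\rho_{R\otimes R})\delta_{R\otimes R}$; 8. $m(R\otimes m)=m(m\otimes R)(R\otimes R\otimes\mu_R)(R\otimes R\otimes\xi\otimes R)(\delta_{R\otimes R}\otimes R)$; 9. $m_H(\xi\otimes H)(R\otimes m\otimes\xi)(R\otimes\delta_{R\otimes R})=m_H(\xi\otimes H)(R\otimes c_{H,R})(m\otimes\xi\otimes R)(\delta_{R\otimes R}\otimes R)$; 10. $m(r\otimes1)=r=m(1\otimes r)$; 11. $\xi(r\otimes1)=\xi(1\otimes r)=\varepsilon(r)1_H$. Its bosonization $R\#^bH$ is the bialgebra on $R\otimes H$ with smash coproduct $\Delta(r\#h)=\sum(r^{(1)}\#r^{(2)}_{\langle-1\rangle}h_{(1)})\otimes(r^{(2)}_{\langle0\rangle}\#h_{(2)})$,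 counit $\varepsilon\otimes\varepsilon_H$, unit $1\#1_H$ and multiplication $(r\#h)(s\#k)=\sum m\bigl(r^{(1)}\otimes{}^{r^{(2)}_{\langle-1\rangle}h_{(1)}}s^{(1)}\bigr)\#\,\xi\bigl(r^{(2)}_{\langle0\rangle}\otimes{}^{h_{(2)}}s^{(2)}\bigr)h_{(3)}k$. *)

theory Defs
  imports Complex_Main "HOL-Library.Function_Algebras"
begin

section \<open>Vector spaces and tensor products\<close>

text \<open>
  A vector space over the field \<open>'k\<close> is a subspace \<open>car V\<close> of an ambient vector space whose
  elements form the whole type \<open>'a\<close>; the addition is that of \<open>'a\<close>.  Structure maps of the records
  below only matter on carriers.
\<close>

record ('k, 'a) vspace =
  car :: "'a set"
  scl :: "'k \<Rightarrow> 'a \<Rightarrow> 'a"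

definition is_vspace :: "('k::field, 'a::ab_group_add, 'm) vspace_scheme \<Rightarrow> bool" where
  "is_vspace V \<longleftrightarrow> vector_space (scl V) \<and> module.subspace (scl V) (car V)"

definition base_field :: "('k::field, 'k) vspace" where
  "base_field = \<lparr>car = UNIV, scl = (*)\<rparr>"

definition linear_map ::
  "('k::field, 'a::ab_group_add, 'm) vspace_scheme \<Rightarrow> ('k, 'b::ab_group_add, 'n) vspace_scheme
    \<Rightarrow> ('a \<Rightarrow> 'b) \<Rightarrow> bool" where
  "linear_map V W f \<longleftrightarrow>
     (\<forall>x\<in>car V. f x \<in> car W) \<and>
     (\<forall>x\<in>car V. \<forall>y\<in>car V. f (x + y) = f x + f y) \<and>
     (\<forall>c. \<forall>x\<in>car V. f (scl V c x) = scl W c (f x))"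

definition bilinear_map ::
  "('k::field, 'a::ab_group_add, 'm) vspace_scheme \<Rightarrow> ('k, 'b::ab_group_add, 'n) vspace_scheme
    \<Rightarrow> ('k, 'c::ab_group_add, 'p) vspace_scheme \<Rightarrow> ('a \<Rightarrow> 'b \<Rightarrow> 'c) \<Rightarrow> bool" where
  "bilinear_map V W U f \<longleftrightarrow>
     (\<forall>y\<in>car W. linear_map V U (\<lambda>x. f x y)) \<and> (\<forall>x\<in>car V. linear_map W U (f x))"

text \<open>
  \<open>V \<otimes> W\<close> is realised inside the dual of the space of bilinear forms: \<open>v \<otimes> w\<close> is evaluation
  at \<open>(v, w)\<close>, and \<open>V \<otimes> W\<close> is the span of these evaluations.  Only bilinear forms on the ambient
  spaces are used, so that for subspaces \<open>V' \<subseteq> V\<close> and \<open>W' \<subseteq> W\<close> the space \<open>V' \<otimes> W'\<close> is literally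
  a subspace of \<open>V \<otimes> W\<close>.  The universal property is proved below
  (\<open>sweedler_tens\<close>, \<open>linear_map_sweedler\<close>).
\<close>

type_synonym ('k, 'a, 'b) tensor = "('a \<Rightarrow> 'b \<Rightarrow> 'k) \<Rightarrow> 'k"

definition bilinear_form ::
  "('k::field, 'a::ab_group_add, 'm) vspace_scheme \<Rightarrow> ('k, 'b::ab_group_add, 'n) vspace_scheme
    \<Rightarrow> ('a \<Rightarrow> 'b \<Rightarrow> 'k) \<Rightarrow> bool" where
  "bilinear_form V W \<beta> \<longleftrightarrow>
     (\<forall>w. Vector_Spaces.linear (scl V) (*) (\<lambda>v. \<beta> v w)) \<and>
     (\<forall>v. Vector_Spaces.linear (scl W) (*) (\<beta> v))"

definition tens ::
  "('k::field, 'a::ab_group_add, 'm) vspace_scheme \<Rightarrow> ('k, 'b::ab_group_add, 'n) vspace_scheme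
    \<Rightarrow> 'a \<Rightarrow> 'b \<Rightarrow> ('k, 'a, 'b) tensor" where
  "tens V W v w = (\<lambda>\<beta>. if bilinear_form V W \<beta> then \<beta> v w else 0)"

abbreviation tens_infix ("(_ \<otimes>\<^bsub>_,_\<^esub>/ _)" [71, 0, 0, 71] 70) where
  "v \<otimes>\<^bsub>V,W\<^esub> w \<equiv> tens V W v w"

definition tensor ::
  "('k::field, 'a::ab_group_add, 'm) vspace_scheme \<Rightarrow> ('k, 'b::ab_group_add, 'n) vspace_scheme
    \<Rightarrow> ('k, ('k, 'a, 'b) tensor) vspace" where
  "tensor V W =
     \<lparr>car = module.span (\<lambda>c t \<beta>. c * t \<beta>) {v \<otimes>\<^bsub>V,W\<^esub> w | v w. v \<in> car V \<and> w \<in> car W},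
      scl = (\<lambda>c t \<beta>. c * t \<beta>)\<rparr>"

text \<open>
  Sweedler sums: \<open>sweedler V W t f\<close> is \<open>\<Sum> f t\<^sub>1 t\<^sub>2\<close> for \<open>t = \<Sum> t\<^sub>1 \<otimes> t\<^sub>2\<close> in \<open>V \<otimes> W\<close>,
  that is, the value at \<open>t\<close> of the linear map on \<open>V \<otimes> W\<close> induced by \<open>f\<close>.  For \<open>f\<close> bilinear on
  \<open>V \<times> W\<close> it does not depend on the chosen presentation of \<open>t\<close>
  (scalars are absorbed in the first factors).
\<close>

definition presents ::
  "('k::field, 'a::ab_group_add, 'm) vspace_scheme \<Rightarrow> ('k, 'b::ab_group_add, 'n) vspace_scheme
    \<Rightarrow> ('a \<times> 'b) list \<Rightarrow> ('k, 'a, 'b) tensor \<Rightarrow> bool" where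
  "presents V W ps t \<longleftrightarrow>
     set ps \<subseteq> car V \<times> car W \<and> t = (\<Sum>(v, w)\<leftarrow>ps. v \<otimes>\<^bsub>V,W\<^esub> w)"

definition sweedler ::
  "('k::field, 'a::ab_group_add, 'm) vspace_scheme \<Rightarrow> ('k, 'b::ab_group_add, 'n) vspace_scheme
    \<Rightarrow> ('k, 'a, 'b) tensor \<Rightarrow> ('a \<Rightarrow> 'b \<Rightarrow> 'c::comm_monoid_add) \<Rightarrow> 'c" where
  "sweedler V W t f = (\<Sum>(v, w)\<leftarrow>(SOME ps. presents V W ps t). f v w)"

lemma vector_space_pointwise: "vector_space (\<lambda>(c::'k::field) (t::'x \<Rightarrow> 'k) \<beta>. c * t \<beta>)"
  by unfold_locales (auto simp: fun_eq_iff algebra_simps)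

lemma is_vspace_tensor:
  fixes V :: "('k::field, 'b::ab_group_add, 'm) vspace_scheme"
    and W :: "('k, 'c::ab_group_add, 'n) vspace_scheme"
  shows "is_vspace (tensor V W)"
proof -
  interpret T: vector_space "\<lambda>(c::'k) (t::('k, 'b, 'c) tensor) \<beta>. c * t \<beta>"
    by (rule vector_space_pointwise)
  show ?thesis
    unfolding is_vspace_def tensor_def by (simp add: vector_space_pointwise T.subspace_span)
qed

lemma sum_list_apply: "(\<Sum>x\<leftarrow>xs. f x) \<beta> = (\<Sum>x\<leftarrow>xs. f x \<beta>)"
  by (induction xs) auto

lemma linear_sum_list:
  assumes "Vector_Spaces.linear s1 s2 f"
  shows "f (\<Sum>x\<leftarrow>xs. g x) = (\<Sum>x\<leftarrow>xs. f (g x))"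
proof -
  interpret Vector_Spaces.linear s1 s2 f by fact
  show ?thesis by (induction xs) (auto simp: zero add)
qed

lemma exists_projection:
  assumes "is_vspace V"
  shows "\<exists>p. Vector_Spaces.linear (scl V) (scl V) p \<and> (\<forall>x. p x \<in> car V) \<and> (\<forall>x\<in>car V. p x = x)"
proof -
  interpret v: vector_space "scl V" using assms by (simp add: is_vspace_def)
  interpret vp: vector_space_pair "scl V" "scl V" ..
  have sub: "v.subspace (car V)" using assms by (simp add: is_vspace_def)
  have id: "Vector_Spaces.linear (scl V) (scl V) (\<lambda>x. x)" by (rule v.linear_ident)
  from vp.linear_exists_left_inverse_on[OF id sub] 
  obtain g where "range g \<subseteq> car V" "Vector_Spaces.linear (scl V) (scl V) g" "\<forall>v\<in>car V. g v = v"
    by auto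
  then show ?thesis by blast
qed

lemma presentation_independent:
  fixes V :: "('k::field, 'b::ab_group_add, 'm) vspace_scheme"
    and W :: "('k, 'c::ab_group_add, 'n) vspace_scheme"
    and U :: "('k, 'd::ab_group_add, 'p) vspace_scheme"
  assumes V: "is_vspace V" and W: "is_vspace W" and U: "is_vspace U"
    and f: "bilinear_map V W U f"
    and xs: "presents V W xs t" and ys: "presents V W ys t"
  shows "(\<Sum>(v, w)\<leftarrow>xs. f v w) = (\<Sum>(v, w)\<leftarrow>ys. f v w)"
proof (rule ccontr)
  assume ne: "\<not> ?thesis"
  define u where "u = (\<Sum>(v, w)\<leftarrow>xs. f v w) - (\<Sum>(v, w)\<leftarrow>ys. f v w)"
  interpret v: vector_space "scl V" using V by (simp add: is_vspace_def)
  interpret w: vector_space "scl W" using W by (simp add: is_vspace_def)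
  interpret u: vector_space "scl U" using U by (simp add: is_vspace_def)
  interpret k: vector_space "(*) :: 'k \<Rightarrow> 'k \<Rightarrow> 'k"
    by unfold_locales (auto simp: algebra_simps)
  interpret uk: vector_space_pair "scl U" "(*) :: 'k \<Rightarrow> 'k \<Rightarrow> 'k" ..
  have "u \<noteq> 0" using ne by (simp add: u_def)
  then have "u.independent {u}" by simp
  from uk.linear_independent_extend[OF this, of "\<lambda>_. 1"]
  obtain l where l: "Vector_Spaces.linear (scl U) (*) l" "l u = 1" by auto
  obtain p where p: "Vector_Spaces.linear (scl V) (scl V) p" "\<And>x. p x \<in> car V"
      "\<And>x. x \<in> car V \<Longrightarrow> p x = x" using exists_projection[OF V] by blast
  obtain q where q: "Vector_Spaces.linear (scl W) (scl W) q" "\<And>x. q x \<in> car W"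
      "\<And>x. x \<in> car W \<Longrightarrow> q x = x" using exists_projection[OF W] by blast
  define \<beta> where "\<beta> = (\<lambda>a b. l (f (p a) (q b)))"
  have \<beta>: "bilinear_form V W \<beta>"
    using f l(1) p(1,2) q(1,2) v.vector_space_axioms w.vector_space_axioms k.vector_space_axioms
    unfolding bilinear_form_def bilinear_map_def linear_map_def \<beta>_def
    by (auto simp: Vector_Spaces.linear_iff)
  have eval: "l (\<Sum>(v, w)\<leftarrow>zs. f v w) = t \<beta>" if zs: "presents V W zs t" for zs
  proof -
    have "t \<beta> = (\<Sum>z\<leftarrow>zs. (case z of (a, b) \<Rightarrow> a \<otimes>\<^bsub>V,W\<^esub> b) \<beta>)"
      using zs by (simp add: presents_def sum_list_apply)
    also have "\<dots> = (\<Sum>z\<leftarrow>zs. l (case z of (a, b) \<Rightarrow> f a b))"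
    proof (intro arg_cong[where f = sum_list] map_cong refl)
      fix z assume "z \<in> set zs"
      then show "(case z of (a, b) \<Rightarrow> a \<otimes>\<^bsub>V,W\<^esub> b) \<beta> = l (case z of (a, b) \<Rightarrow> f a b)"
        using zs \<beta> p(3) q(3) by (auto simp: presents_def tens_def \<beta>_def)
    qed
    finally show ?thesis by (simp add: linear_sum_list[OF l(1)])
  qed
  have "l u = 0"
    using eval[OF xs] eval[OF ys] uk.linear_diff[OF l(1)] by (simp add: u_def)
  with l(2) show False by simp
qed

lemma tens_add_scale:
  assumes "vector_space (scl V)" "vector_space (scl W)"
  shows "(x + y) \<otimes>\<^bsub>V,W\<^esub> w = x \<otimes>\<^bsub>V,W\<^esub> w + y \<otimes>\<^bsub>V,W\<^esub> w"
    and "v \<otimes>\<^bsub>V,W\<^esub> (x' + y') = v \<otimes>\<^bsub>V,W\<^esub> x' + v \<otimes>\<^bsub>V,W\<^esub> y'"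
    and "scl V c x \<otimes>\<^bsub>V,W\<^esub> w = scl (tensor V W) c (x \<otimes>\<^bsub>V,W\<^esub> w)"
    and "v \<otimes>\<^bsub>V,W\<^esub> scl W c x' = scl (tensor V W) c (v \<otimes>\<^bsub>V,W\<^esub> x')"
  by (auto simp: tens_def tensor_def fun_eq_iff bilinear_form_def Vector_Spaces.linear_iff)

lemma tens_mem:
  fixes V :: "('k::field, 'b::ab_group_add, 'm) vspace_scheme"
    and W :: "('k, 'c::ab_group_add, 'n) vspace_scheme"
  shows "v \<in> car V \<Longrightarrow> w \<in> car W \<Longrightarrow> v \<otimes>\<^bsub>V,W\<^esub> w \<in> car (tensor V W)"
proof -
  interpret T: vector_space "\<lambda>(c::'k) (t::('k, 'b, 'c) tensor) \<beta>. c * t \<beta>"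
    by (rule vector_space_pointwise)
  show "v \<in> car V \<Longrightarrow> w \<in> car W \<Longrightarrow> v \<otimes>\<^bsub>V,W\<^esub> w \<in> car (tensor V W)"
    by (auto simp: tensor_def intro: T.span_base)
qed

lemma presents_scale:
  assumes V: "is_vspace V" and W: "is_vspace W" and ps: "presents V W ps t"
  shows "presents V W (map (\<lambda>(v, w). (scl V c v, w)) ps) (scl (tensor V W) c t)"
proof -
  interpret v: vector_space "scl V" using V by (simp add: is_vspace_def)
  have vs: "vector_space (scl V)" "vector_space (scl W)" and sub: "v.subspace (car V)"
    using V W by (simp_all add: is_vspace_def)
  have "scl (tensor V W) c (\<Sum>(v, w)\<leftarrow>ps. v \<otimes>\<^bsub>V,W\<^esub> w) =
      (\<Sum>(v, w)\<leftarrow>ps. scl V c v \<otimes>\<^bsub>V,W\<^esub> w)"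
    by (induction ps)
      (auto simp: tensor_def fun_eq_iff zero_fun_def algebra_simps tens_add_scale(3)[OF vs])
  then show ?thesis
    using ps v.subspace_scale[OF sub]
    by (force simp: presents_def o_def case_prod_beta')
qed

lemma exists_presentation:
  fixes V :: "('k::field, 'b::ab_group_add, 'm) vspace_scheme"
    and W :: "('k, 'c::ab_group_add, 'n) vspace_scheme"
  assumes V: "is_vspace V" and W: "is_vspace W" and t: "t \<in> car (tensor V W)"
  shows "\<exists>ps. presents V W ps t"
proof -
  interpret T: vector_space "\<lambda>(c::'k) (t::('k, 'b, 'c) tensor) \<beta>. c * t \<beta>"
    by (rule vector_space_pointwise)
  have "t \<in> T.span {v \<otimes>\<^bsub>V,W\<^esub> w | v w. v \<in> car V \<and> w \<in> car W}"
    using t by (simp add: tensor_def)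
  then show ?thesis
  proof (induction rule: T.span_induct_alt)
    case base
    show ?case by (rule exI[of _ "[]"]) (simp add: presents_def zero_fun_def)
  next
    case (step c x y)
    then obtain v w ps where *: "x = v \<otimes>\<^bsub>V,W\<^esub> w" "v \<in> car V" "w \<in> car W" "presents V W ps y"
      by auto
    then have "presents V W [(v, w)] x" by (simp add: presents_def)
    from presents_scale[OF V W this, of c]
    have "presents V W ((scl V c v, w) # ps) ((\<lambda>\<beta>. c * x \<beta>) + y)"
      using *(4) by (simp add: presents_def tensor_def)
    then show ?case by blast
  qed
qed

lemma sweedler_eq:
  assumes "is_vspace V" "is_vspace W" "is_vspace U" "bilinear_map V W U f" "presents V W ps t"
  shows "sweedler V W t f = (\<Sum>(v, w)\<leftarrow>ps. f v w)"
  unfolding sweedler_def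
  by (rule presentation_independent[OF assms(1-4) someI[of "\<lambda>ps. presents V W ps t"] assms(5)])
    (rule assms(5))

lemma sweedler_tens:
  assumes "is_vspace V" "is_vspace W" "is_vspace U" "bilinear_map V W U f"
    and "v \<in> car V" "w \<in> car W"
  shows "sweedler V W (v \<otimes>\<^bsub>V,W\<^esub> w) f = f v w"
  using sweedler_eq[OF assms(1-4), of "[(v, w)]" "v \<otimes>\<^bsub>V,W\<^esub> w"] assms(5,6)
  by (simp add: presents_def)

lemma linear_map_sweedler:
  assumes V: "is_vspace V" and W: "is_vspace W" and U: "is_vspace U"
    and f: "bilinear_map V W U f"
  shows "linear_map (tensor V W) U (\<lambda>t. sweedler V W t f)"
proof -
  interpret v: vector_space "scl V" using V by (simp add: is_vspace_def)
  interpret u: vector_space "scl U" using U by (simp add: is_vspace_def)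
  have sub: "u.subspace (car U)" using U by (simp add: is_vspace_def)
  note eq = sweedler_eq[OF V W U f]
  have mem: "(\<Sum>(v, w)\<leftarrow>ps. f v w) \<in> car U" if "set ps \<subseteq> car V \<times> car W" for ps
    using that f u.subspace_0[OF sub] u.subspace_add[OF sub]
    by (induction ps) (auto simp: bilinear_map_def linear_map_def)
  have scale: "(\<Sum>(v, w)\<leftarrow>ps. f (scl V c v) w) = scl U c (\<Sum>(v, w)\<leftarrow>ps. f v w)"
    if "set ps \<subseteq> car V \<times> car W" for ps c
    using that f
    by (induction ps) (auto simp: bilinear_map_def linear_map_def u.scale_right_distrib)
  show ?thesis
    unfolding linear_map_def
  proof (intro conjI ballI allI)
    fix s assume "s \<in> car (tensor V W)"
    then obtain ps where ps: "presents V W ps s" using exists_presentation[OF V W] by blast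
    show "sweedler V W s f \<in> car U" 
      unfolding eq[OF ps] using mem ps by (simp add: presents_def)
    fix c
    show "sweedler V W (scl (tensor V W) c s) f = scl U c (sweedler V W s f)"
      unfolding eq[OF ps] eq[OF presents_scale[OF V W ps]] using scale ps
      by (simp add: presents_def o_def case_prod_beta')
  next
    fix s t assume "s \<in> car (tensor V W)" "t \<in> car (tensor V W)"
    then obtain ps qs where pq: "presents V W ps s" "presents V W qs t"
      using exists_presentation[OF V W] by blast
    then have "presents V W (ps @ qs) (s + t)" by (auto simp: presents_def)
    then show "sweedler V W (s + t) f = sweedler V W s f + sweedler V W t f"
      using pq by (simp add: eq)
  qed
qed

section \<open>Bialgebras and Hopf algebras\<close>

record ('k, 'a) coalgebra = "('k, 'a) vspace" +
  comul :: "'a \<Rightarrow> ('k, 'a, 'a) tensor"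
  counit :: "'a \<Rightarrow> 'k"

record ('k, 'a) bialgebra = "('k, 'a) coalgebra" +
  mul :: "'a \<Rightarrow> 'a \<Rightarrow> 'a"
  unit :: 'a

definition is_coalgebra :: "('k::field, 'a::ab_group_add, 'm) coalgebra_scheme \<Rightarrow> bool" where
  "is_coalgebra C \<longleftrightarrow>
     is_vspace C \<and>
     linear_map C (tensor C C) (comul C) \<and>
     linear_map C base_field (counit C) \<and>
     (\<forall>x\<in>car C.
        sweedler C C (comul C x) (\<lambda>a b. sweedler C C (comul C a)
          (\<lambda>a1 a2. a1 \<otimes>\<^bsub>C,tensor C C\<^esub> (a2 \<otimes>\<^bsub>C,C\<^esub> b))) =
        sweedler C C (comul C x) (\<lambda>a b. sweedler C C (comul C b)
          (\<lambda>b1 b2. a \<otimes>\<^bsub>C,tensor C C\<^esub> (b1 \<otimes>\<^bsub>C,C\<^esub> b2)))) \<and>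
     (\<forall>x\<in>car C. sweedler C C (comul C x) (\<lambda>a b. scl C (counit C a) b) = x) \<and>
     (\<forall>x\<in>car C. sweedler C C (comul C x) (\<lambda>a b. scl C (counit C b) a) = x)"

definition is_algebra :: "('k::field, 'a::ab_group_add, 'm) bialgebra_scheme \<Rightarrow> bool" where
  "is_algebra A \<longleftrightarrow>
     is_vspace A \<and>
     bilinear_map A A A (mul A) \<and>
     unit A \<in> car A \<and>
     (\<forall>x\<in>car A. \<forall>y\<in>car A. \<forall>z\<in>car A. mul A (mul A x y) z = mul A x (mul A y z)) \<and>
     (\<forall>x\<in>car A. mul A (unit A) x = x \<and> mul A x (unit A) = x)"

definition is_bialgebra :: "('k::field, 'a::ab_group_add, 'm) bialgebra_scheme \<Rightarrow> bool" where
  "is_bialgebra A \<longleftrightarrow>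
     is_algebra A \<and>
     is_coalgebra A \<and>
     (\<forall>x\<in>car A. \<forall>y\<in>car A.
        comul A (mul A x y) =
        sweedler A A (comul A x) (\<lambda>x1 x2. sweedler A A (comul A y)
          (\<lambda>y1 y2. mul A x1 y1 \<otimes>\<^bsub>A,A\<^esub> mul A x2 y2))) \<and>
     comul A (unit A) = unit A \<otimes>\<^bsub>A,A\<^esub> unit A \<and>
     (\<forall>x\<in>car A. \<forall>y\<in>car A. counit A (mul A x y) = counit A x * counit A y) \<and>
     counit A (unit A) = 1"

definition is_antipode ::
  "('k::field, 'a::ab_group_add, 'm) bialgebra_scheme \<Rightarrow> ('a \<Rightarrow> 'a) \<Rightarrow> bool" where
  "is_antipode A S \<longleftrightarrow>
     linear_map A A S \<and>
     (\<forall>x\<in>car A.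
        sweedler A A (comul A x) (\<lambda>x1 x2. mul A (S x1) x2) = scl A (counit A x) (unit A) \<and>
        sweedler A A (comul A x) (\<lambda>x1 x2. mul A x1 (S x2)) = scl A (counit A x) (unit A))"

definition is_hopf_algebra ::
  "('k::field, 'a::ab_group_add, 'm) bialgebra_scheme \<Rightarrow> ('a \<Rightarrow> 'a) \<Rightarrow> bool" where
  "is_hopf_algebra A S \<longleftrightarrow> is_bialgebra A \<and> is_antipode A S"

definition is_bialgebra_iso ::
  "('k::field, 'a::ab_group_add, 'm) bialgebra_scheme
    \<Rightarrow> ('k, 'b::ab_group_add, 'n) bialgebra_scheme \<Rightarrow> ('a \<Rightarrow> 'b) \<Rightarrow> bool" where
  "is_bialgebra_iso A B \<phi> \<longleftrightarrow>
     is_bialgebra A \<and> is_bialgebra B \<and>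
     linear_map A B \<phi> \<and> bij_betw \<phi> (car A) (car B) \<and>
     (\<forall>x\<in>car A. \<forall>y\<in>car A. \<phi> (mul A x y) = mul B (\<phi> x) (\<phi> y)) \<and>
     \<phi> (unit A) = unit B \<and>
     (\<forall>x\<in>car A. comul B (\<phi> x) = sweedler A A (comul A x) (\<lambda>a b. \<phi> a \<otimes>\<^bsub>B,B\<^esub> \<phi> b)) \<and>
     (\<forall>x\<in>car A. counit B (\<phi> x) = counit A x)"

definition is_hopf_algebra_iso ::
  "('k::field, 'a::ab_group_add, 'm) bialgebra_scheme \<Rightarrow> ('a \<Rightarrow> 'a)
    \<Rightarrow> ('k, 'b::ab_group_add, 'n) bialgebra_scheme \<Rightarrow> ('b \<Rightarrow> 'b) \<Rightarrow> ('a \<Rightarrow> 'b) \<Rightarrow> bool" where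
  "is_hopf_algebra_iso A S B T \<phi> \<longleftrightarrow>
     is_hopf_algebra A S \<and> is_hopf_algebra B T \<and> is_bialgebra_iso A B \<phi> \<and>
     (\<forall>x\<in>car A. \<phi> (S x) = T (\<phi> x))"


section \<open>Coradical and semisimplicity\<close>

definition subcoalgebra ::
  "('k::field, 'a::ab_group_add, 'm) coalgebra_scheme \<Rightarrow> 'a set \<Rightarrow> bool" where
  "subcoalgebra C D \<longleftrightarrow>
     D \<subseteq> car C \<and> module.subspace (scl C) D \<and>
     (\<forall>x\<in>D. comul C x \<in> car (tensor (C\<lparr>car := D\<rparr>) (C\<lparr>car := D\<rparr>)))"

definition simple_subcoalgebra ::
  "('k::field, 'a::ab_group_add, 'm) coalgebra_scheme \<Rightarrow> 'a set \<Rightarrow> bool" where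
  "simple_subcoalgebra C D \<longleftrightarrow>
     subcoalgebra C D \<and> D \<noteq> {0} \<and>
     (\<forall>E. subcoalgebra C E \<and> E \<subseteq> D \<longrightarrow> E = {0} \<or> E = D)"

definition coradical :: "('k::field, 'a::ab_group_add, 'm) coalgebra_scheme \<Rightarrow> 'a set" where
  "coradical C = module.span (scl C) (\<Union>{D. simple_subcoalgebra C D})"

definition sub_bialgebra ::
  "('k::field, 'a::ab_group_add, 'm) bialgebra_scheme \<Rightarrow> 'a set \<Rightarrow> bool" where
  "sub_bialgebra A H \<longleftrightarrow>
     subcoalgebra A H \<and> unit A \<in> H \<and> (\<forall>x\<in>H. \<forall>y\<in>H. mul A x y \<in> H)"

definition left_ideal ::
  "('k::field, 'a::ab_group_add, 'm) bialgebra_scheme \<Rightarrow> 'a set \<Rightarrow> bool" where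
  "left_ideal A I \<longleftrightarrow>
     I \<subseteq> car A \<and> module.subspace (scl A) I \<and> (\<forall>a\<in>car A. \<forall>x\<in>I. mul A a x \<in> I)"

definition minimal_left_ideal ::
  "('k::field, 'a::ab_group_add, 'm) bialgebra_scheme \<Rightarrow> 'a set \<Rightarrow> bool" where
  "minimal_left_ideal A I \<longleftrightarrow>
     left_ideal A I \<and> I \<noteq> {0} \<and>
     (\<forall>J. left_ideal A J \<and> J \<subseteq> I \<longrightarrow> J = {0} \<or> J = I)"

text \<open>The regular left module is a sum of simple submodules.\<close>

definition semisimple_algebra ::
  "('k::field, 'a::ab_group_add, 'm) bialgebra_scheme \<Rightarrow> bool" where
  "semisimple_algebra A \<longleftrightarrow>
     is_algebra A \<and> module.span (scl A) (\<Union>{I. minimal_left_ideal A I}) = car A"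


section \<open>Coalgebras in the Yetter--Drinfeld category\<close>

record ('k, 'r, 'h) yd_coalgebra = "('k, 'r) coalgebra" +
  act :: "'h \<Rightarrow> 'r \<Rightarrow> 'r"
  coact :: "'r \<Rightarrow> ('k, 'h, 'r) tensor"

definition is_left_module ::
  "('k::field, 'h::ab_group_add, 'p) bialgebra_scheme
    \<Rightarrow> ('k, 'r::ab_group_add, 'h, 'm) yd_coalgebra_scheme \<Rightarrow> bool" where
  "is_left_module H V \<longleftrightarrow>
     is_vspace V \<and>
     bilinear_map H V V (act V) \<and>
     (\<forall>v\<in>car V. act V (unit H) v = v) \<and>
     (\<forall>h\<in>car H. \<forall>k\<in>car H. \<forall>v\<in>car V. act V (mul H h k) v = act V h (act V k v))"

definition is_left_comodule ::
  "('k::field, 'h::ab_group_add, 'p) bialgebra_scheme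
    \<Rightarrow> ('k, 'r::ab_group_add, 'h, 'm) yd_coalgebra_scheme \<Rightarrow> bool" where
  "is_left_comodule H V \<longleftrightarrow>
     is_vspace V \<and>
     linear_map V (tensor H V) (coact V) \<and>
     (\<forall>v\<in>car V.
        sweedler H V (coact V v) (\<lambda>g w. sweedler H H (comul H g)
          (\<lambda>g1 g2. g1 \<otimes>\<^bsub>H,tensor H V\<^esub> (g2 \<otimes>\<^bsub>H,V\<^esub> w))) =
        sweedler H V (coact V v) (\<lambda>g w. g \<otimes>\<^bsub>H,tensor H V\<^esub> coact V w)) \<and>
     (\<forall>v\<in>car V. sweedler H V (coact V v) (\<lambda>g w. scl V (counit H g) w) = v)"

definition is_yd_module ::
  "('k::field, 'h::ab_group_add, 'p) bialgebra_scheme \<Rightarrow> ('h \<Rightarrow> 'h)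
    \<Rightarrow> ('k, 'r::ab_group_add, 'h, 'm) yd_coalgebra_scheme \<Rightarrow> bool" where
  "is_yd_module H S V \<longleftrightarrow>
     is_left_module H V \<and> is_left_comodule H V \<and>
     (\<forall>h\<in>car H. \<forall>v\<in>car V.
        coact V (act V h v) =
        sweedler H H (comul H h) (\<lambda>h1 h'. sweedler H H (comul H h') (\<lambda>h2 h3.
        sweedler H V (coact V v) (\<lambda>g w.
          mul H (mul H h1 g) (S h3) \<otimes>\<^bsub>H,V\<^esub> act V h2 w))))"

text \<open>The diagonal coaction \<open>\<rho>\<close> and, below, the comultiplication \<open>\<delta>\<close> of \<open>R \<otimes> R\<close>; the latter
  uses the braiding of the Yetter--Drinfeld category.\<close>

definition coact2 ::
  "('k::field, 'h::ab_group_add, 'p) bialgebra_scheme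
    \<Rightarrow> ('k, 'r::ab_group_add, 'h, 'm) yd_coalgebra_scheme
    \<Rightarrow> ('k, 'r, 'r) tensor \<Rightarrow> ('k, 'h, ('k, 'r, 'r) tensor) tensor" where
  "coact2 H R z =
     sweedler R R z (\<lambda>r s.
     sweedler H R (coact R r) (\<lambda>g r0. sweedler H R (coact R s) (\<lambda>k s0.
       mul H g k \<otimes>\<^bsub>H,tensor R R\<^esub> (r0 \<otimes>\<^bsub>R,R\<^esub> s0))))"

definition is_yd_coalgebra ::
  "('k::field, 'h::ab_group_add, 'p) bialgebra_scheme \<Rightarrow> ('h \<Rightarrow> 'h)
    \<Rightarrow> ('k, 'r::ab_group_add, 'h, 'm) yd_coalgebra_scheme \<Rightarrow> bool" where
  "is_yd_coalgebra H S R \<longleftrightarrow>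
     is_yd_module H S R \<and> is_coalgebra R \<and>
     (\<forall>h\<in>car H. \<forall>r\<in>car R.
        comul R (act R h r) =
        sweedler H H (comul H h) (\<lambda>h1 h2. sweedler R R (comul R r)
          (\<lambda>r1 r2. act R h1 r1 \<otimes>\<^bsub>R,R\<^esub> act R h2 r2))) \<and>
     (\<forall>h\<in>car H. \<forall>r\<in>car R. counit R (act R h r) = counit H h * counit R r) \<and>
     (\<forall>r\<in>car R.
        coact2 H R (comul R r) =
        sweedler H R (coact R r) (\<lambda>g r0. g \<otimes>\<^bsub>H,tensor R R\<^esub> comul R r0)) \<and>
     (\<forall>r\<in>car R.
        sweedler H R (coact R r) (\<lambda>g r0. scl H (counit R r0) g) =
        scl H (counit R r) (unit H))"

definition comul2 ::
  "('k::field, 'h::ab_group_add, 'p) bialgebra_scheme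
    \<Rightarrow> ('k, 'r::ab_group_add, 'h, 'm) yd_coalgebra_scheme
    \<Rightarrow> ('k, 'r, 'r) tensor \<Rightarrow> ('k, ('k, 'r, 'r) tensor, ('k, 'r, 'r) tensor) tensor" where
  "comul2 H R z =
     sweedler R R z (\<lambda>r s.
     sweedler R R (comul R r) (\<lambda>r1 r2. sweedler R R (comul R s) (\<lambda>s1 s2.
     sweedler H R (coact R r2) (\<lambda>g r20.
       (r1 \<otimes>\<^bsub>R,R\<^esub> act R g s1) \<otimes>\<^bsub>tensor R R,tensor R R\<^esub> (r20 \<otimes>\<^bsub>R,R\<^esub> s2)))))"

definition c_RH ::
  "('k::field, 'h::ab_group_add, 'p) bialgebra_scheme
    \<Rightarrow> ('k, 'r::ab_group_add, 'h, 'm) yd_coalgebra_scheme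
    \<Rightarrow> ('k, 'r, 'h) tensor \<Rightarrow> ('k, 'h, 'r) tensor" where
  "c_RH H R t =
     sweedler R H t (\<lambda>r h. sweedler H R (coact R r) (\<lambda>g r0. mul H g h \<otimes>\<^bsub>H,R\<^esub> r0))"

definition c_HR ::
  "('k::field, 'h::ab_group_add, 'p) bialgebra_scheme
    \<Rightarrow> ('k, 'r::ab_group_add, 'h, 'm) yd_coalgebra_scheme
    \<Rightarrow> ('k, 'h, 'r) tensor \<Rightarrow> ('k, 'r, 'h) tensor" where
  "c_HR H R t =
     sweedler H R t (\<lambda>h r. sweedler H H (comul H h) (\<lambda>h1 h2. act R h1 r \<otimes>\<^bsub>R,H\<^esub> h2))"


section \<open>Dual Yetter--Drinfeld quadruples and their bosonization\<close>

text \<open>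
  A composite such as \<open>(m\<^sub>H \<otimes> H)(\<xi> \<otimes> H \<otimes> \<xi>)(R \<otimes> R \<otimes> \<rho>)\<delta>\<close> is written out on generators as nested
  Sweedler sums, which makes the associativity constraints of \<open>\<otimes>\<close> disappear.
\<close>

definition dual_yd_quadruple ::
  "('k::field, 'h::ab_group_add, 'p) bialgebra_scheme \<Rightarrow> ('h \<Rightarrow> 'h)
    \<Rightarrow> ('k, 'r::ab_group_add, 'h, 'm) yd_coalgebra_scheme
    \<Rightarrow> 'r \<Rightarrow> (('k, 'r, 'r) tensor \<Rightarrow> 'r) \<Rightarrow> (('k, 'r, 'r) tensor \<Rightarrow> 'h) \<Rightarrow> bool" where
  "dual_yd_quadruple H S R u m \<xi> \<longleftrightarrow>
     is_hopf_algebra H S \<and> is_yd_coalgebra H S R \<and>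
     u \<in> car R \<and> linear_map (tensor R R) R m \<and> linear_map (tensor R R) H \<xi> \<and>
     (\<forall>h\<in>car H. act R h u = scl R (counit H h) u) \<and> coact R u = unit H \<otimes>\<^bsub>H,R\<^esub> u \<and>
     comul R u = u \<otimes>\<^bsub>R,R\<^esub> u \<and> counit R u = 1 \<and>
     (\<forall>h\<in>car H. \<forall>r\<in>car R. \<forall>s\<in>car R.
        act R h (m (r \<otimes>\<^bsub>R,R\<^esub> s)) =
        sweedler H H (comul H h) (\<lambda>h1 h2. m (act R h1 r \<otimes>\<^bsub>R,R\<^esub> act R h2 s))) \<and>
     (\<forall>h\<in>car H. \<forall>r\<in>car R. \<forall>s\<in>car R.
        sweedler H H (comul H h) (\<lambda>h1 h2. \<xi> (act R h1 r \<otimes>\<^bsub>R,R\<^esub> act R h2 s)) =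
        sweedler H H (comul H h) (\<lambda>h1 h2. mul H (mul H h1 (\<xi> (r \<otimes>\<^bsub>R,R\<^esub> s))) (S h2))) \<and>
     (\<forall>r\<in>car R. \<forall>s\<in>car R.
        comul R (m (r \<otimes>\<^bsub>R,R\<^esub> s)) =
        sweedler (tensor R R) (tensor R R) (comul2 H R (r \<otimes>\<^bsub>R,R\<^esub> s))
          (\<lambda>x y. m x \<otimes>\<^bsub>R,R\<^esub> m y)) \<and>
     (\<forall>r\<in>car R. \<forall>s\<in>car R. counit R (m (r \<otimes>\<^bsub>R,R\<^esub> s)) = counit R r * counit R s) \<and>
     (\<forall>r\<in>car R. \<forall>s\<in>car R.
        comul H (\<xi> (r \<otimes>\<^bsub>R,R\<^esub> s)) =
        sweedler (tensor R R) (tensor R R) (comul2 H R (r \<otimes>\<^bsub>R,R\<^esub> s)) (\<lambda>x y.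
        sweedler H (tensor R R) (coact2 H R y) (\<lambda>g y0. mul H (\<xi> x) g \<otimes>\<^bsub>H,H\<^esub> \<xi> y0))) \<and>
     (\<forall>r\<in>car R. \<forall>s\<in>car R. counit H (\<xi> (r \<otimes>\<^bsub>R,R\<^esub> s)) = counit R r * counit R s) \<and>
     (\<forall>r\<in>car R. \<forall>s\<in>car R.
        c_RH H R (sweedler (tensor R R) (tensor R R) (comul2 H R (r \<otimes>\<^bsub>R,R\<^esub> s))
          (\<lambda>x y. m x \<otimes>\<^bsub>R,H\<^esub> \<xi> y)) =
        sweedler (tensor R R) (tensor R R) (comul2 H R (r \<otimes>\<^bsub>R,R\<^esub> s)) (\<lambda>x y.
        sweedler H (tensor R R) (coact2 H R y) (\<lambda>g y0. mul H (\<xi> x) g \<otimes>\<^bsub>H,R\<^esub> m y0))) \<and>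
     (\<forall>r\<in>car R. \<forall>s\<in>car R. \<forall>t\<in>car R.
        m (r \<otimes>\<^bsub>R,R\<^esub> m (s \<otimes>\<^bsub>R,R\<^esub> t)) =
        sweedler (tensor R R) (tensor R R) (comul2 H R (r \<otimes>\<^bsub>R,R\<^esub> s))
          (\<lambda>x y. m (m x \<otimes>\<^bsub>R,R\<^esub> act R (\<xi> y) t))) \<and>
     (\<forall>r\<in>car R. \<forall>s\<in>car R. \<forall>t\<in>car R.
        sweedler (tensor R R) (tensor R R) (comul2 H R (s \<otimes>\<^bsub>R,R\<^esub> t))
          (\<lambda>x y. mul H (\<xi> (r \<otimes>\<^bsub>R,R\<^esub> m x)) (\<xi> y)) =
        sweedler (tensor R R) (tensor R R) (comul2 H R (r \<otimes>\<^bsub>R,R\<^esub> s)) (\<lambda>x y.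
        sweedler R H (c_HR H R (\<xi> y \<otimes>\<^bsub>H,R\<^esub> t)) (\<lambda>t' h. mul H (\<xi> (m x \<otimes>\<^bsub>R,R\<^esub> t')) h))) \<and>
     (\<forall>r\<in>car R. m (r \<otimes>\<^bsub>R,R\<^esub> u) = r \<and> m (u \<otimes>\<^bsub>R,R\<^esub> r) = r) \<and>
     (\<forall>r\<in>car R. \<xi> (r \<otimes>\<^bsub>R,R\<^esub> u) = scl H (counit R r) (unit H) \<and>
        \<xi> (u \<otimes>\<^bsub>R,R\<^esub> r) = scl H (counit R r) (unit H))"

definition bosonization ::
  "('k::field, 'h::ab_group_add, 'p) bialgebra_scheme
    \<Rightarrow> ('k, 'r::ab_group_add, 'h, 'm) yd_coalgebra_scheme
    \<Rightarrow> 'r \<Rightarrow> (('k, 'r, 'r) tensor \<Rightarrow> 'r) \<Rightarrow> (('k, 'r, 'r) tensor \<Rightarrow> 'h)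
    \<Rightarrow> ('k, ('k, 'r, 'h) tensor) bialgebra" where
  "bosonization H R u m \<xi> =
     \<lparr>car = car (tensor R H), scl = scl (tensor R H),
      comul = (\<lambda>p.
        sweedler R H p (\<lambda>r h.
        sweedler R R (comul R r) (\<lambda>r1 r2. sweedler H R (coact R r2) (\<lambda>g r20.
        sweedler H H (comul H h) (\<lambda>h1 h2.
          (r1 \<otimes>\<^bsub>R,H\<^esub> mul H g h1) \<otimes>\<^bsub>tensor R H,tensor R H\<^esub> (r20 \<otimes>\<^bsub>R,H\<^esub> h2)))))),
      counit = (\<lambda>p. sweedler R H p (\<lambda>r h. counit R r * counit H h)),
      mul = (\<lambda>p q.
        sweedler R H p (\<lambda>r h. sweedler R H q (\<lambda>s k.
        sweedler R R (comul R r) (\<lambda>r1 r2. sweedler H R (coact R r2) (\<lambda>g r20.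
        sweedler H H (comul H h) (\<lambda>h1 h'. sweedler H H (comul H h') (\<lambda>h2 h3.
        sweedler R R (comul R s) (\<lambda>s1 s2.
          m (r1 \<otimes>\<^bsub>R,R\<^esub> act R (mul H g h1) s1) \<otimes>\<^bsub>R,H\<^esub>
          mul H (mul H (\<xi> (r20 \<otimes>\<^bsub>R,R\<^esub> act R h2 s2)) h3) k)))))))),
      unit = u \<otimes>\<^bsub>R,H\<^esub> unit H\<rparr>"

end

theory Submission
  imports Defs
begin

text \<open>
  Since \<open>H\<close> is semisimple and, being the coradical, cosemisimple, it has integrals \<open>\<Lambda> \<in> H\<close> and
  \<open>\<lambda> \<in> H\<^sup>*\<close> with \<open>\<epsilon>(\<Lambda>) = \<lambda>(1) = 1\<close>.  One gets \<open>\<lambda>(xy) = \<lambda>(y S\<^sup>2(x))\<close>, so \<open>\<lambda>\<close> is invariant under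
  the adjoint action, and \<open>x \<otimes> y \<mapsto> \<lambda>(x S(y))\<close> makes \<open>H\<close> coseparable within \<open>H\<close>-bimodules.
  Averaging with the separability idempotent \<open>\<Lambda>\<^sub>1 \<otimes> S(\<Lambda>\<^sub>2)\<close> gives an \<open>H\<close>-bilinear projection
  \<open>A \<rightarrow> H\<close>, which Newton's method along the coradical filtration corrects to an \<open>H\<close>-bilinear
  coalgebra projection \<open>\<pi>\<close>.  With \<open>\<tau>(a) = a\<^sub>1 S\<pi>(a\<^sub>2)\<close> and \<open>R = \<tau>(A)\<close>, the fundamental theorem of
  Hopf modules reads \<open>a \<mapsto> \<tau>(a\<^sub>1) \<otimes> \<pi>(a\<^sub>2)\<close>, \<open>A \<cong> R \<otimes> H\<close>, and the quadruple is given by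
  \<open>m(r \<otimes> s) = \<tau>(rs)\<close>, \<open>\<xi>(r \<otimes> s) = \<pi>(rs)\<close>.  Its axioms and the formulas of the bosonization all reduce
  to \<open>(m \<otimes> id)\<delta>\<^sub>R\<^sub>\<otimes>\<^sub>R(r \<otimes> s) = \<tau>(r\<^sub>1s\<^sub>1) \<otimes> (r\<^sub>2 \<otimes> s\<^sub>2)\<close> and its analogue for \<open>\<xi>\<close>.  The antipode of
  \<open>A\<close> is a geometric series, since \<open>id * S\<pi>\<close> is the convolution unit on the coradical.
\<close>

section \<open>Globally bilinear maps\<close>

text \<open>Averaging makes a linear projection onto H bilinear, and coseparability can make a
  projection comultiplicative; the difficulty is to have both properties at once. For this the
  contracting form has to be ad-invariant: the correction then commutes with multiplication by H on
  either side. Since the correction is a closed formula, nothing is chosen on the successive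
  filtration steps, and the iterates fit together to one map.

  The resulting \<pi> is H-bilinear and comultiplicative but in general not multiplicative. A
  product of two elements of R therefore has a part in H, and \<xi> records it. Since A is given as
  a bialgebra only, \<tau> is built with the antipode of H alone.

  Record operations are meaningful on carriers only. A linear projection onto the carrier,
  precomposed everywhere, makes all maps linear on whole types; multilinearity becomes a matter of
  syntax, and equations pass through nested Sweedler sums by rewriting.\<close>

abbreviation lin ::
  "('k::field \<Rightarrow> 'a::ab_group_add \<Rightarrow> 'a) \<Rightarrow> ('k \<Rightarrow> 'b::ab_group_add \<Rightarrow> 'b) \<Rightarrow> ('a \<Rightarrow> 'b) \<Rightarrow> bool" where
  "lin \<equiv> Vector_Spaces.linear"

definition pscl :: "'k::field \<Rightarrow> ('x \<Rightarrow> 'k) \<Rightarrow> 'x \<Rightarrow> 'k" where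
  "pscl = (\<lambda>c t \<beta>. c * t \<beta>)"

definition full :: "('k::field \<Rightarrow> 'a::ab_group_add \<Rightarrow> 'a) \<Rightarrow> ('k, 'a) vspace" where
  "full s = \<lparr>car = UNIV, scl = s\<rparr>"

definition tn ::
  "('k::field \<Rightarrow> 'a::ab_group_add \<Rightarrow> 'a) \<Rightarrow> ('k \<Rightarrow> 'b::ab_group_add \<Rightarrow> 'b) \<Rightarrow> 'a \<Rightarrow> 'b \<Rightarrow> ('k, 'a, 'b) tensor"
  where "tn s1 s2 = tens (full s1) (full s2)"

definition bilin ::
  "('k::field \<Rightarrow> 'a::ab_group_add \<Rightarrow> 'a) \<Rightarrow> ('k \<Rightarrow> 'b::ab_group_add \<Rightarrow> 'b)
    \<Rightarrow> ('k \<Rightarrow> 'c::ab_group_add \<Rightarrow> 'c) \<Rightarrow> ('a \<Rightarrow> 'b \<Rightarrow> 'c) \<Rightarrow> bool" where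
  "bilin s1 s2 s3 F \<longleftrightarrow> (\<forall>y. lin s1 s3 (\<lambda>x. F x y)) \<and> (\<forall>x. lin s2 s3 (F x))"

definition swt ::
  "('k::field \<Rightarrow> 'a::ab_group_add \<Rightarrow> 'a) \<Rightarrow> ('k \<Rightarrow> 'b::ab_group_add \<Rightarrow> 'b)
    \<Rightarrow> ('k, 'a, 'b) tensor \<Rightarrow> ('a \<Rightarrow> 'b \<Rightarrow> 'c::ab_group_add) \<Rightarrow> 'c" where
  "swt s1 s2 t F = sweedler (full s1) (full s2) t F"

lemma full_simps [simp]: "car (full s) = UNIV" "scl (full s) = s"
  by (simp_all add: full_def)

lemma scl_tensor [simp]: "scl (tensor V W) = pscl"
  by (simp add: tensor_def pscl_def)

lemma vs_pscl [simp]: "vector_space pscl"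
  unfolding pscl_def by (rule vector_space_pointwise)

lemma vs_field [simp]: "vector_space ((*) :: 'k::field \<Rightarrow> 'k \<Rightarrow> 'k)"
  by unfold_locales (auto simp: algebra_simps)

text \<open>\<open>bilinear_form\<close> quantifies over the ambient types and never looks at a
  carrier. Hence tensors over different carriers are the same functionals, and computations can take
  place over the full types, with carriers returning only as membership conditions.\<close>

lemma tens_tn: "tens V W = tn (scl V) (scl W)"
  by (simp add: tn_def tens_def bilinear_form_def fun_eq_iff)

lemma is_vspace_full: "vector_space s \<Longrightarrow> is_vspace (full s)"
proof -
  assume "vector_space s"
  then interpret vector_space s .
  show ?thesis by (simp add: is_vspace_def vector_space_axioms)
qed

lemma lin_vs: assumes "lin s1 s2 f" shows "vector_space s1" "vector_space s2"
  using assms by (simp_all add: Vector_Spaces.linear_iff)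

lemma linI:
  "vector_space s1 \<Longrightarrow> vector_space s2 \<Longrightarrow> (\<And>x y. f (x + y) = f x + f y) \<Longrightarrow>
    (\<And>c x. f (s1 c x) = s2 c (f x)) \<Longrightarrow> lin s1 s2 f"
  by (simp add: Vector_Spaces.linear_iff)

lemma linD:
  assumes "lin s1 s2 f"
  shows "f (x + y) = f x + f y" "f (s1 c x) = s2 c (f x)" "f 0 = 0" "f (x - y) = f x - f y"
    "f (- x) = - f x"
proof -
  interpret Vector_Spaces.linear s1 s2 f by fact
  show "f (x + y) = f x + f y" "f (s1 c x) = s2 c (f x)" "f 0 = 0" "f (x - y) = f x - f y"
    "f (- x) = - f x" by (simp_all add: add scale diff neg)
qed

lemma bilinI:
  "(\<And>y. lin s1 s3 (\<lambda>x. F x y)) \<Longrightarrow> (\<And>x. lin s2 s3 (\<lambda>y. F x y)) \<Longrightarrow> bilin s1 s2 s3 F"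
  by (simp add: bilin_def)

lemma bilinD:
  assumes "bilin s1 s2 s3 F" shows "lin s1 s3 (\<lambda>x. F x y)" "lin s2 s3 (F x)"
  using assms by (simp_all add: bilin_def)

lemma lin_comp: "lin s2 s3 g \<Longrightarrow> lin s1 s2 f \<Longrightarrow> lin s1 s3 (\<lambda>x. g (f x))"
  by (auto simp: Vector_Spaces.linear_iff)

lemma lin_bilin1: "bilin s2 s4 s3 F \<Longrightarrow> lin s1 s2 f \<Longrightarrow> lin s1 s3 (\<lambda>x. F (f x) c)"
  by (auto simp: bilin_def Vector_Spaces.linear_iff)

lemma lin_bilin2: "bilin s4 s2 s3 F \<Longrightarrow> lin s1 s2 f \<Longrightarrow> lin s1 s3 (\<lambda>x. F c (f x))"
  by (auto simp: bilin_def Vector_Spaces.linear_iff)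

text \<open>Every use of a Sweedler identity asks for linearity in each slot of a nested expression.
  Each rule of this collection peels off one outer operation, so \<open>intro lin_rules\<close>
  follows the syntax of the expression down to the variable.\<close>

named_theorems lin_rules

lemma lin_id [lin_rules]: "vector_space s \<Longrightarrow> lin s s (\<lambda>x. x)"
  by (simp add: Vector_Spaces.linear_iff)

lemma lin_zero [lin_rules]: "vector_space s1 \<Longrightarrow> vector_space s2 \<Longrightarrow> lin s1 s2 (\<lambda>x. 0)"
proof -
  assume s: "vector_space s1" "vector_space s2"
  interpret vector_space s2 by fact
  show ?thesis by (rule linI[OF s]) auto
qed

lemma lin_add [lin_rules]: "lin s1 s2 f \<Longrightarrow> lin s1 s2 g \<Longrightarrow> lin s1 s2 (\<lambda>x. f x + g x)"
  by (auto simp: Vector_Spaces.linear_iff vector_space_def algebra_simps)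

lemma lin_diff [lin_rules]: "lin s1 s2 f \<Longrightarrow> lin s1 s2 g \<Longrightarrow> lin s1 s2 (\<lambda>x. f x - g x)"
proof -
  assume f: "lin s1 s2 f" "lin s1 s2 g"
  interpret vector_space s2 using f lin_vs by blast
  show ?thesis using f by (auto simp: Vector_Spaces.linear_iff algebra_simps scale_right_diff_distrib)
qed

lemma lin_scale1 [lin_rules]: "vector_space s2 \<Longrightarrow> lin s1 (*) f \<Longrightarrow> lin s1 s2 (\<lambda>x. s2 (f x) c)"
  by (auto simp: Vector_Spaces.linear_iff vector_space_def)

lemma lin_scale2 [lin_rules]: "lin s1 s2 f \<Longrightarrow> lin s1 s2 (\<lambda>x. s2 c (f x))"
  by (auto simp: Vector_Spaces.linear_iff vector_space_def mult.commute)

lemma lin_times1 [lin_rules]: "lin s1 (*) f \<Longrightarrow> lin s1 (*) (\<lambda>x. f x * c)"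
  by (auto simp: Vector_Spaces.linear_iff algebra_simps)

lemma lin_times2 [lin_rules]: "lin s1 (*) f \<Longrightarrow> lin s1 (*) (\<lambda>x. c * f x)"
  by (auto simp: Vector_Spaces.linear_iff algebra_simps)

lemma bilin_tn: "vector_space s1 \<Longrightarrow> vector_space s2 \<Longrightarrow> bilin s1 s2 pscl (tn s1 s2)"
  using tens_add_scale[of "full s1" "full s2"]
  by (auto simp: bilin_def tn_def intro!: linI)

lemma lin_tn1 [lin_rules]:
  "vector_space s2 \<Longrightarrow> lin s0 s1 f \<Longrightarrow> lin s0 pscl (\<lambda>x. tn s1 s2 (f x) c)"
  using lin_bilin1[OF bilin_tn] lin_vs by blast

lemma lin_tn2 [lin_rules]:
  "vector_space s1 \<Longrightarrow> lin s0 s2 f \<Longrightarrow> lin s0 pscl (\<lambda>x. tn s1 s2 c (f x))"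
  using lin_bilin2[OF bilin_tn] lin_vs by blast

lemma lin_tn0 [lin_rules]: "vector_space s1 \<Longrightarrow> vector_space s2 \<Longrightarrow> lin s2 pscl (tn s1 s2 c)"
  using bilin_tn bilinD(2) by blast

lemma lin_sum_list [lin_rules]:
  "vector_space s1 \<Longrightarrow> vector_space s2 \<Longrightarrow> (\<And>z. lin s1 s2 (\<lambda>x. f x z)) \<Longrightarrow> lin s1 s2 (\<lambda>x. \<Sum>z\<leftarrow>zs. f x z)"
  by (induction zs) (auto intro: lin_rules)

lemma bilinear_map_bilin:
  assumes "bilin (scl V) (scl W) s3 F" shows "bilinear_map V W (full s3) F"
  using assms by (auto simp: bilinear_map_def linear_map_def bilin_def Vector_Spaces.linear_iff)

lemma linear_map_lin:
  assumes "lin (scl V) (scl W) f" "\<And>x. x \<in> car V \<Longrightarrow> f x \<in> car W" shows "linear_map V W f"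
  using assms by (auto simp: linear_map_def Vector_Spaces.linear_iff)

lemma car_tensor_full:
  assumes "t \<in> car (tensor V W)"
  shows "t \<in> car (tensor (full (scl V)) (full (scl W)))"
proof -
  interpret T: vector_space pscl by simp
  have "T.span {tens V W v w | v w. v \<in> car V \<and> w \<in> car W} \<subseteq>
      T.span {tens (full (scl V)) (full (scl W)) v w | v w. True}"
    by (intro T.span_mono) (auto simp: tens_tn)
  then show ?thesis using assms by (auto simp: tensor_def pscl_def)
qed

lemma presents_full:
  "presents V W ps t \<Longrightarrow> presents (full (scl V)) (full (scl W)) ps t"
  by (simp add: presents_def tens_tn)

text \<open>Functions inside record-level Sweedler sums are bilinear on carriers only. Agreement
  with a globally bilinear G on the carriers is enough, because a presentation contains no other
  vectors.\<close>

lemma sw_list: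
  fixes F :: "'a::ab_group_add \<Rightarrow> 'b::ab_group_add \<Rightarrow> 'c::ab_group_add" and s3 :: "'k::field \<Rightarrow> _"
  assumes V: "is_vspace (V :: ('k, 'a, 'm) vspace_scheme)" and W: "is_vspace (W :: ('k, 'b, 'n) vspace_scheme)"
    and G: "bilin (scl V) (scl W) s3 G"
    and FG: "\<And>v w. v \<in> car V \<Longrightarrow> w \<in> car W \<Longrightarrow> F v w = G v w"
    and ps: "presents V W ps t"
  shows "sweedler V W t F = (\<Sum>(v, w)\<leftarrow>ps. G v w)"
proof -
  have "bilinear_map V W (full s3) F"
  proof -
    interpret v: vector_space "scl V" using V by (simp add: is_vspace_def)
    interpret w: vector_space "scl W" using W by (simp add: is_vspace_def)
    have "v.subspace (car V)" "w.subspace (car W)" using V W by (simp_all add: is_vspace_def)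
    then show ?thesis
      using bilinear_map_bilin[OF G] FG unfolding bilinear_map_def linear_map_def
      by (simp add: v.subspace_def w.subspace_def)
  qed
  moreover have "is_vspace (full s3)" using G lin_vs is_vspace_full by (metis bilinD(1))
  ultimately have "sweedler V W t F = (\<Sum>(v, w)\<leftarrow>ps. F v w)" using sweedler_eq V W ps by blast
  also have "\<dots> = (\<Sum>(v, w)\<leftarrow>ps. G v w)"
    using ps FG by (intro arg_cong[where f = sum_list] map_cong) (auto simp: presents_def)
  finally show ?thesis .
qed

lemma swt_list:
  assumes "bilin s1 s2 s3 G" "presents V W ps t" "scl V = s1" "scl W = s2"
  shows "swt s1 s2 t G = (\<Sum>(v, w)\<leftarrow>ps. G v w)"
proof -
  have "vector_space s1" "vector_space s2"
    using assms(1) lin_vs unfolding bilin_def by blast+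
  then show ?thesis
    unfolding swt_def using assms presents_full[OF assms(2)]
    by (intro sw_list) (auto intro: is_vspace_full)
qed

lemma sweedler_swt:
  assumes "is_vspace V" "is_vspace W" "bilin (scl V) (scl W) s3 G"
    and "\<And>v w. v \<in> car V \<Longrightarrow> w \<in> car W \<Longrightarrow> F v w = G v w"
    and "t \<in> car (tensor V W)"
  shows "sweedler V W t F = swt (scl V) (scl W) t G"
proof -
  obtain ps where ps: "presents V W ps t" using exists_presentation assms by blast
  show ?thesis
    using sw_list[OF assms(1-4) ps] swt_list[OF assms(3) ps] by simp
qed

definition tproj ::
  "('k::field \<Rightarrow> 'a::ab_group_add \<Rightarrow> 'a) \<Rightarrow> ('k \<Rightarrow> 'b::ab_group_add \<Rightarrow> 'b)
    \<Rightarrow> ('k, 'a, 'b) tensor \<Rightarrow> ('k, 'a, 'b) tensor" where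
  "tproj s1 s2 = (SOME q. lin pscl pscl q \<and> (\<forall>x. q x \<in> car (tensor (full s1) (full s2))) \<and>
     (\<forall>x\<in>car (tensor (full s1) (full s2)). q x = x))"

text \<open>The linear map induced by a bilinear map \<open>F\<close>, extended from the tensor product to the whole
  ambient type of functionals; this makes the universal property carrier-free.\<close>

definition tlift ::
  "('k::field \<Rightarrow> 'a::ab_group_add \<Rightarrow> 'a) \<Rightarrow> ('k \<Rightarrow> 'b::ab_group_add \<Rightarrow> 'b)
    \<Rightarrow> ('a \<Rightarrow> 'b \<Rightarrow> 'c::ab_group_add) \<Rightarrow> ('k, 'a, 'b) tensor \<Rightarrow> 'c" where
  "tlift s1 s2 F t = swt s1 s2 (tproj s1 s2 t) F"

lemma tproj:
  fixes s1 :: "'k::field \<Rightarrow> 'a::ab_group_add \<Rightarrow> 'a" and s2 :: "'k \<Rightarrow> 'b::ab_group_add \<Rightarrow> 'b"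
  shows "lin pscl pscl (tproj s1 s2)" "tproj s1 s2 t \<in> car (tensor (full s1) (full s2))"
    "t \<in> car (tensor (full s1) (full s2)) \<Longrightarrow> tproj s1 s2 t = t"
  using someI_ex[OF exists_projection[OF is_vspace_tensor[of "full s1" "full s2"], simplified]]
  unfolding tproj_def by blast+

lemma tlift:
  fixes s1 :: "'k::field \<Rightarrow> 'a::ab_group_add \<Rightarrow> 'a" and s2 :: "'k \<Rightarrow> 'b::ab_group_add \<Rightarrow> 'b"
    and s3 :: "'k \<Rightarrow> 'c::ab_group_add \<Rightarrow> 'c"
  assumes G: "bilin s1 s2 s3 G"
  shows lin_tlift: "lin pscl s3 (tlift s1 s2 G)"
    and tlift_tn: "tlift s1 s2 G (tn s1 s2 x y) = G x y"
    and tlift_swt: "t \<in> car (tensor (full s1) (full s2)) \<Longrightarrow> tlift s1 s2 G t = swt s1 s2 t G"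
proof -
  have vs: "vector_space s1" "vector_space s2" "vector_space s3"
    using G lin_vs unfolding bilin_def by blast+
  note V = is_vspace_full[OF vs(1)] is_vspace_full[OF vs(2)] is_vspace_full[OF vs(3)]
  note q = tproj[where ?s1.0 = s1 and ?s2.0 = s2]
  have B: "bilinear_map (full s1) (full s2) (full s3) G" using bilinear_map_bilin[of "full s1" "full s2"] G by simp
  have "linear_map (tensor (full s1) (full s2)) (full s3) (\<lambda>t. swt s1 s2 t G)"
    using linear_map_sweedler[OF V B] by (simp add: swt_def)
  then show "lin pscl s3 (tlift s1 s2 G)"
    using q vs unfolding tlift_def by (intro linI) (auto simp: linear_map_def linD[OF q(1)])
  show "tlift s1 s2 G (tn s1 s2 x y) = G x y" for x y
    using sweedler_tens[OF V B, of x y] q(3) tens_mem[of x "full s1" y "full s2"] by (simp add: tlift_def swt_def tn_def)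
  show "t \<in> car (tensor (full s1) (full s2)) \<Longrightarrow> tlift s1 s2 G t = swt s1 s2 t G"
    using q(3) by (auto simp: tlift_def)
qed

text \<open>The presentation chosen for t does not depend on x, so the value is a fixed finite sum
  of maps linear in x.\<close>

lemma lin_tlift_param [lin_rules]:
  assumes "vector_space s0" "vector_space s3" "\<And>y z. lin s0 s3 (\<lambda>x. F x y z)"
  shows "lin s0 s3 (\<lambda>x. tlift s1 s2 (F x) t)"
proof -
  interpret vector_space s3 by fact
  show ?thesis
    unfolding tlift_def swt_def sweedler_def case_prod_beta'
    by (intro lin_rules assms)
qed

lemma swt_tn:
  assumes "bilin s1 s2 s3 G" shows "swt s1 s2 (tn s1 s2 x y) G = G x y"
  using tlift_swt[OF assms, of "tn s1 s2 x y"] tlift_tn[OF assms, of x y] tens_mem[of x "full s1" y "full s2"]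
  by (auto simp: tn_def)

lemma tensor_sum_list:
  assumes "\<And>z. z \<in> set zs \<Longrightarrow> f z \<in> car (tensor V W)" shows "(\<Sum>z\<leftarrow>zs. f z) \<in> car (tensor V W)"
proof -
  interpret T: vector_space pscl by simp
  show ?thesis using assms 
    by (induction zs) (auto simp: tensor_def pscl_def[symmetric] T.span_zero T.span_add)
qed

section \<open>Coalgebras and Hopf algebras with total operations\<close>

text \<open>\<open>P\<close> projects the ambient type onto the carrier.  All operations are precomposed with it, so
  that they are linear on the whole type.\<close>

locale tcoalg = vector_space s for s :: "'k::field \<Rightarrow> 'a::ab_group_add \<Rightarrow> 'a" +
  fixes P :: "'a \<Rightarrow> 'a" and dl :: "'a \<Rightarrow> ('k, 'a, 'a) tensor" and ep :: "'a \<Rightarrow> 'k"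
  assumes lin_P: "lin s s P" and PP [simp]: "P (P x) = P x"
    and lin_dl: "lin s pscl dl" and lin_ep: "lin s (*) ep"
    and dl_P [simp]: "dl (P x) = dl x" and ep_P [simp]: "ep (P x) = ep x"
    and dl_car: "dl x \<in> car (tensor \<lparr>car = range P, scl = s\<rparr> \<lparr>car = range P, scl = s\<rparr>)"
    and coassoc0: "swt s s (dl x) (\<lambda>a b. swt s s (dl a) (\<lambda>a1 a2. tn s pscl a1 (tn s s a2 b))) =
      swt s s (dl x) (\<lambda>a b. swt s s (dl b) (\<lambda>b1 b2. tn s pscl a (tn s s b1 b2)))"
    and counit0: "swt s s (dl x) (\<lambda>a b. s (ep a) b) = P x" "swt s s (dl x) (\<lambda>a b. s (ep b) a) = P x"
begin

text \<open>A plain finite sum over one chosen presentation with legs in \<open>range P\<close>.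
  Therefore additivity, exchange of two sums and congruence on \<open>range P\<close> hold for
  arbitrary F; bilinearity is asked for only when \<open>dl x\<close> itself is rewritten.\<close>

definition sw :: "'a \<Rightarrow> ('a \<Rightarrow> 'a \<Rightarrow> 'c::ab_group_add) \<Rightarrow> 'c" where
  "sw x F = (\<Sum>p\<leftarrow>(SOME ps. presents \<lparr>car = range P, scl = s\<rparr> \<lparr>car = range P, scl = s\<rparr> ps (dl x)).
     F (fst p) (snd p))"

lemma is_vspace_range: "is_vspace \<lparr>car = range P, scl = s\<rparr>"
proof -
  interpret p: Vector_Spaces.linear s s P by (rule lin_P)
  show ?thesis by (simp add: is_vspace_def vector_space_axioms p.subspace_image)
qed

lemma presents_dl:
  "presents \<lparr>car = range P, scl = s\<rparr> \<lparr>car = range P, scl = s\<rparr>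
     (SOME ps. presents \<lparr>car = range P, scl = s\<rparr> \<lparr>car = range P, scl = s\<rparr> ps (dl x)) (dl x)"
  by (rule someI_ex[OF exists_presentation[OF is_vspace_range is_vspace_range dl_car]])

lemma dl_full: "dl x \<in> car (tensor (full s) (full s))"
  using car_tensor_full[OF dl_car[of x]] by simp

lemma sw_swt: "bilin s s s3 F \<Longrightarrow> swt s s (dl x) F = sw x F"
  using swt_list[OF _ presents_dl, of s s s3 F x] by (simp add: sw_def case_prod_beta')

lemma sw_cong_P:
  assumes "\<And>a b. F (P a) (P b) = G (P a) (P b)" shows "sw x F = sw x G"
  unfolding sw_def
proof (intro arg_cong[where f = sum_list] map_cong refl)
  fix p assume "p \<in> set (SOME ps. presents \<lparr>car = range P, scl = s\<rparr> \<lparr>car = range P, scl = s\<rparr> ps (dl x))"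
  then have "p \<in> range P \<times> range P" using presents_dl[of x] by (auto simp: presents_def)
  then show "F (fst p) (snd p) = G (fst p) (snd p)" using assms by auto
qed

lemma sw_P: "sw x (\<lambda>a b. F (P a) (P b)) = sw x F"
  "sw x (\<lambda>a b. F (P a) b) = sw x F" "sw x (\<lambda>a b. F a (P b)) = sw x F"
  by (rule sw_cong_P; simp)+

lemma sw_P' [simp]: "sw (P x) F = sw x F"
  by (simp add: sw_def)

lemma sw_sum: "sw x (\<lambda>a b. F a b + G a b) = sw x F + sw x G"
  "sw x (\<lambda>a b. F a b - G a b) = sw x F - sw x G"
  "sw x (\<lambda>a b. 0) = 0"
  by (simp_all add: sw_def sum_list_addf sum_list_subtractf)

lemma sw_hom: "lin s1 s2 g \<Longrightarrow> g (sw x F) = sw x (\<lambda>a b. g (F a b))"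
  by (simp add: sw_def linear_sum_list)

lemma sw_scale: "vector_space s2 \<Longrightarrow> sw x (\<lambda>a b. s2 c (F a b)) = s2 c (sw x F)"
  by (rule sw_hom[OF lin_scale2[OF lin_id], symmetric])

lemma sw_swap: "sw x (\<lambda>a b. sw y (\<lambda>c d. F a b c d)) = sw y (\<lambda>c d. sw x (\<lambda>a b. F a b c d))"
proof -
  have "(\<Sum>p\<leftarrow>xs. \<Sum>q\<leftarrow>ys. G p q) = (\<Sum>q\<leftarrow>ys. \<Sum>p\<leftarrow>xs. G p q)" for xs ys :: "('a \<times> 'a) list" and G :: "_ \<Rightarrow> _ \<Rightarrow> 'c::ab_group_add"
    by (induction xs) (auto simp: sum_list_addf)
  then show ?thesis by (simp add: sw_def)
qed

lemma vs [lin_rules, simp]: "vector_space s" by (rule vector_space_axioms)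

lemmas [lin_rules] = vs_pscl vs_field lin_P lin_ep lin_dl

lemma lin_P' [lin_rules]: "lin s0 s f \<Longrightarrow> lin s0 s (\<lambda>x. P (f x))"
  and lin_ep' [lin_rules]: "lin s0 s f \<Longrightarrow> lin s0 (*) (\<lambda>x. ep (f x))"
  and lin_dl' [lin_rules]: "lin s0 s f \<Longrightarrow> lin s0 pscl (\<lambda>x. dl (f x))"
  using lin_comp lin_P lin_ep lin_dl by blast+

lemma lin_sw_arg [lin_rules]:
  assumes "lin s0 s f" "bilin s s s2 F" shows "lin s0 s2 (\<lambda>x. sw (f x) F)"
proof -
  have "lin pscl s2 (tlift s s F)" by (rule lin_tlift[OF assms(2)])
  then have "lin s0 s2 (\<lambda>x. tlift s s F (dl (f x)))"
    by (rule lin_comp) (intro lin_rules assms)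
  then show ?thesis using assms(2) by (simp add: tlift_swt dl_full sw_swt)
qed

lemma lin_sw_fun [lin_rules]:
  assumes "vector_space s0" "vector_space s2" "\<And>a b. lin s0 s2 (\<lambda>x. F x a b)"
  shows "lin s0 s2 (\<lambda>x. sw c (F x))"
  unfolding sw_def by (intro lin_rules assms)

lemma sw_tn: "sw x (tn s s) = dl x"
  using tlift_swt[OF bilin_tn] presents_dl[of x]
  by (simp add: sw_def presents_def tens_tn case_prod_beta')

text \<open>A trilinear map may be applied to both sides of an equation in \<open>A \<otimes> (A \<otimes> A)\<close>.\<close>

lemma coassoc:
  fixes F :: "'a \<Rightarrow> 'a \<Rightarrow> 'a \<Rightarrow> 'c::ab_group_add"
  assumes F: "\<And>y z. lin s s2 (\<lambda>x. F x y z)" "\<And>x z. lin s s2 (\<lambda>y. F x y z)" "\<And>x y. lin s s2 (\<lambda>z. F x y z)"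
  shows "sw x (\<lambda>a b. sw a (\<lambda>a1 a2. F a1 a2 b)) = sw x (\<lambda>a b. sw b (\<lambda>b1 b2. F a b1 b2))"
proof -
  have vs2: "vector_space s2" using F lin_vs by blast
  define h where "h = tlift s pscl (\<lambda>x. tlift s s (F x))"
  have F2: "bilin s s s2 (F x)" for x by (rule bilinI; rule F)
  have b: "bilin s pscl s2 (\<lambda>x. tlift s s (F x))"
    by (rule bilinI) (intro lin_rules F vs2 vs lin_tlift F2 | rule lin_tlift[OF F2])+
  have h: "lin pscl s2 h" "\<And>x y z. h (tn s pscl x (tn s s y z)) = F x y z"
    unfolding h_def using lin_tlift[OF b] tlift_tn[OF b] tlift_tn[OF F2] by auto
  have c: "sw x (\<lambda>a b. sw a (\<lambda>a1 a2. tn s pscl a1 (tn s s a2 b))) =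
      sw x (\<lambda>a b. sw b (\<lambda>b1 b2. tn s pscl a (tn s s b1 b2)))"
  proof -
    have 1: "bilin s s pscl (\<lambda>a1 a2. tn s pscl a1 (tn s s a2 b))" for b by (intro bilinI lin_rules)
    have 2: "bilin s s pscl (\<lambda>b1 b2. tn s pscl a (tn s s b1 b2))" for a by (intro bilinI lin_rules)
    have 3: "bilin s s pscl (\<lambda>a b. sw a (\<lambda>a1 a2. tn s pscl a1 (tn s s a2 b)))" by (intro bilinI lin_rules)
    have 4: "bilin s s pscl (\<lambda>a b. sw b (\<lambda>b1 b2. tn s pscl a (tn s s b1 b2)))" by (intro bilinI lin_rules)
    show ?thesis using coassoc0[of x] by (simp add: sw_swt[OF 1] sw_swt[OF 2] sw_swt[OF 3] sw_swt[OF 4])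
  qed
  from arg_cong[OF c, of h] show ?thesis by (simp add: sw_hom[OF h(1)] h(2))
qed

lemma counit_l: assumes "lin s s2 f" shows "sw x (\<lambda>a b. s2 (ep a) (f b)) = f (P x)"
  and counit_r: "sw x (\<lambda>a b. s2 (ep b) (f a)) = f (P x)"
proof -
  have 1: "bilin s s s (\<lambda>a b. s (ep a) b)" "bilin s s s (\<lambda>a b. s (ep b) a)" by (intro bilinI lin_rules)+
  have "f (sw x (\<lambda>a b. s (ep a) b)) = f (P x)" "f (sw x (\<lambda>a b. s (ep b) a)) = f (P x)"
    using counit0[of x] by (simp_all add: sw_swt[OF 1(1)] sw_swt[OF 1(2)])
  then show "sw x (\<lambda>a b. s2 (ep a) (f b)) = f (P x)" "sw x (\<lambda>a b. s2 (ep b) (f a)) = f (P x)"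
    by (simp_all add: sw_hom[OF assms] linD(2)[OF assms])
qed

end

locale tbialg = tcoalg +
  fixes mu :: "'b \<Rightarrow> 'b \<Rightarrow> 'b" and one :: 'b
  assumes bilin_mu: "bilin s s s mu"
    and mu_P [simp]: "mu (P x) y = mu x y" "mu x (P y) = mu x y" "P (mu x y) = mu x y" "P one = one"
    and assoc: "mu (mu x y) z = mu x (mu y z)"
    and mu_one [simp]: "mu one x = P x" "mu x one = P x"
    and dl_mu: "dl (mu x y) = swt s s (dl x) (\<lambda>x1 x2. swt s s (dl y) (\<lambda>y1 y2. tn s s (mu x1 y1) (mu x2 y2)))"
    and dl_one: "dl one = tn s s one one"
    and ep_mu [simp]: "ep (mu x y) = ep x * ep y" and ep_one [simp]: "ep one = 1"
begin

lemma lin_mu [lin_rules]: "lin s0 s f \<Longrightarrow> lin s0 s (\<lambda>x. mu (f x) c)" "lin s0 s f \<Longrightarrow> lin s0 s (\<lambda>x. mu c (f x))"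
  using lin_bilin1[OF bilin_mu] lin_bilin2[OF bilin_mu] by blast+

lemma lin_mu0 [lin_rules]: "lin s s (mu c)" by (rule bilinD(2)[OF bilin_mu])

lemma sw_mu: assumes F: "bilin s s s2 F"
  shows "sw (mu x y) F = sw x (\<lambda>x1 x2. sw y (\<lambda>y1 y2. F (mu x1 y1) (mu x2 y2)))"
proof -
  have 1: "bilin s s pscl (\<lambda>x1 x2. sw y (\<lambda>y1 y2. tn s s (mu x1 y1) (mu x2 y2)))"
    and 2: "\<And>x1 x2. bilin s s pscl (\<lambda>y1 y2. tn s s (mu x1 y1) (mu x2 y2))"
    by (intro bilinI lin_rules)+
  have "sw (mu x y) F = tlift s s F (dl (mu x y))" by (simp add: tlift_swt[OF F] dl_full sw_swt[OF F])
  also have "\<dots> = tlift s s F (sw x (\<lambda>x1 x2. sw y (\<lambda>y1 y2. tn s s (mu x1 y1) (mu x2 y2))))"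
    unfolding dl_mu by (simp add: sw_swt[OF 1] sw_swt[OF 2])
  also have "\<dots> = sw x (\<lambda>x1 x2. sw y (\<lambda>y1 y2. F (mu x1 y1) (mu x2 y2)))"
    by (simp add: sw_hom[OF lin_tlift[OF F]] tlift_tn[OF F])
  finally show ?thesis .
qed

lemma sw_one: assumes F: "bilin s s s2 F" shows "sw one F = F one one"
  using swt_tn[OF F] by (simp add: dl_one flip: sw_swt[OF F])

end

locale thopf = tbialg +
  fixes S :: "'b \<Rightarrow> 'b"
  assumes lin_S: "lin s s S" and S_P [simp]: "S (P x) = S x" "P (S x) = S x"
    and antip0: "sw x (\<lambda>a b. mu (S a) b) = s (ep x) one" "sw x (\<lambda>a b. mu a (S b)) = s (ep x) one"
begin

lemmas [lin_rules] = lin_S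

lemma lin_S' [lin_rules]: "lin s0 s f \<Longrightarrow> lin s0 s (\<lambda>x. S (f x))"
  using lin_comp lin_S by blast

lemma antip: assumes "lin s s2 f"
  shows "sw x (\<lambda>a b. f (mu (S a) b)) = s2 (ep x) (f one)" "sw x (\<lambda>a b. f (mu a (S b))) = s2 (ep x) (f one)"
  by (simp_all add: antip0 linD(2)[OF assms] flip: sw_hom[OF assms])

end

section \<open>The antipode reverses products and coproducts\<close>

context thopf
begin

lemma ep_S [simp]: "ep (S x) = ep x"
proof -
  have "ep (sw x (\<lambda>a b. mu (S a) b)) = ep x" by (simp add: antip0 linD(2)[OF lin_ep])
  moreover have "ep (sw x (\<lambda>a b. mu (S a) b)) = sw x (\<lambda>a b. ep b * ep (S a))"
    by (simp add: sw_hom[OF lin_ep] mult.commute)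
  moreover have "\<dots> = ep (S (P x))" by (intro counit_r lin_rules)
  ultimately show ?thesis by simp
qed

lemma S_one [simp]: "S one = one"
  using antip0(1)[of one] by (subst (asm) sw_one[where ?s2.0=s]) (auto intro!: bilinI lin_rules)

text \<open>Both sides are convolution inverse to the multiplication on the coalgebra H \<otimes> H.
  \<open>?G\<close> is the triple product of S(xy), xy and S(y)S(x); cancelling its last two factors
  leaves the one side, cancelling its first two the other.\<close>

lemma S_mu: "S (mu x y) = mu (S y) (S x)"
proof -
  let ?G = "\<lambda>x1 x2 x3 y1 y2 y3. mu (S (mu x1 y1)) (mu (mu x2 y2) (mu (S y3) (S x3)))"
  have 1: "sw y' (\<lambda>y2 y3. ?G x1 x2 x3 y1 y2 y3) = s (ep y') (mu (S (mu x1 y1)) (mu x2 (S x3)))"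
    for x1 x2 x3 y1 y'
  proof -
    have "sw y' (\<lambda>y2 y3. mu (S (mu x1 y1)) (mu x2 (mu (mu y2 (S y3)) (S x3)))) =
        s (ep y') (mu (S (mu x1 y1)) (mu x2 (mu one (S x3))))"
      by (intro antip lin_rules)
    then show ?thesis by (simp add: assoc)
  qed
  have "sw x (\<lambda>x1 x'. sw x' (\<lambda>x2 x3. sw y (\<lambda>y1 y'. sw y' (\<lambda>y2 y3. ?G x1 x2 x3 y1 y2 y3)))) =
      sw x (\<lambda>x1 x'. sw x' (\<lambda>x2 x3. sw y (\<lambda>y1 y'. s (ep y') (mu (S (mu x1 y1)) (mu x2 (S x3))))))"
    by (simp add: 1)
  also have "\<dots> = sw x (\<lambda>x1 x'. sw x' (\<lambda>x2 x3. mu (S (mu x1 y)) (mu x2 (S x3))))"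
    by (subst counit_r[where ?s2.0=s]) (intro lin_rules, simp)
  also have "\<dots> = sw x (\<lambda>x1 x'. s (ep x') (mu (S (mu x1 y)) one))"
    by (subst antip[where ?s2.0=s]) (intro lin_rules, simp)
  also have "\<dots> = S (mu x y)"
    by (subst counit_r[where ?s2.0=s]) (intro lin_rules, simp)
  finally have A: "sw x (\<lambda>x1 x'. sw x' (\<lambda>x2 x3. sw y (\<lambda>y1 y'. sw y' (\<lambda>y2 y3. ?G x1 x2 x3 y1 y2 y3)))) = S (mu x y)" .
  have "sw x (\<lambda>x1 x'. sw x' (\<lambda>x2 x3. sw y (\<lambda>y1 y'. sw y' (\<lambda>y2 y3. ?G x1 x2 x3 y1 y2 y3)))) =
      sw x (\<lambda>x' x3. sw x' (\<lambda>x1 x2. sw y (\<lambda>y' y3. sw y' (\<lambda>y1 y2. ?G x1 x2 x3 y1 y2 y3))))"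
    by (subst coassoc[where ?s2.0=s], (intro lin_rules bilinI)+, subst coassoc[where ?s2.0=s], (intro lin_rules bilinI)+, simp)
  also have "\<dots> = sw x (\<lambda>x' x3. sw y (\<lambda>y' y3. sw (mu x' y') (\<lambda>u v. mu (mu (S u) v) (mu (S y3) (S x3)))))"
    by (subst sw_mu[where ?s2.0=s], intro lin_rules bilinI, subst sw_swap, simp add: assoc)
  also have "\<dots> = sw x (\<lambda>x' x3. sw y (\<lambda>y' y3. s (ep (mu x' y')) (mu (S y3) (S x3))))"
    by (subst antip[where ?s2.0=s]) (intro lin_rules, simp)
  also have "\<dots> = sw x (\<lambda>x' x3. s (ep x') (mu (S y) (S x3)))"
    by (simp add: sw_scale[OF vs] flip: scale_scale, subst counit_l, intro lin_rules, simp)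
  also have "\<dots> = mu (S y) (S x)"
    by (subst counit_l[where ?s2.0=s]) (intro lin_rules, simp)
  finally show ?thesis using A by simp
qed

text \<open>Dual to \<open>S_mu\<close>: \<Delta>(S x) and S(x_2) \<otimes> S(x_1) are both
  convolution inverse to \<Delta>. The triple product is \<Delta>(S p_1) \<Delta>(p_2) (S q_2
  \<otimes> S q_1), with F applied to its two components.\<close>

lemma sw_S:
  assumes F: "bilin s s s2 F"
  shows "sw (S x) F = sw x (\<lambda>a b. F (S b) (S a))"
proof -
  note [lin_rules] = lin_bilin1[OF F] lin_bilin2[OF F] lin_vs(2)[OF bilinD(1)[OF F]]
  let ?F = "\<lambda>a b c d q1 q2. F (mu a (mu c (S q2))) (mu b (mu d (S q1)))"
  \<comment> \<open>Cancels \<Delta>(p) against S(q_2) \<otimes> S(q_1), from the inside out: first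
    the adjacent legs d and q_1, then c and q_2.\<close>
  have inner: "sw y (\<lambda>p q. sw p (\<lambda>c d. sw q (\<lambda>q1 q2. ?F a b c d q1 q2))) = s2 (ep y) (F (P a) (P b))" for y a b
  proof -
    have "sw y (\<lambda>p q. sw p (\<lambda>c d. sw q (\<lambda>q1 q2. ?F a b c d q1 q2))) =
        sw y (\<lambda>c z. sw z (\<lambda>d q. sw q (\<lambda>q1 q2. ?F a b c d q1 q2)))"
      by (intro coassoc[where ?s2.0=s2] lin_rules bilinI)
    also have "\<dots> = sw y (\<lambda>c z. sw z (\<lambda>e q2. sw e (\<lambda>d q1. ?F a b c d q1 q2)))"
      by (subst coassoc[where ?s2.0=s2], (intro lin_rules bilinI)+, simp)
    also have "\<dots> = sw y (\<lambda>c z. sw z (\<lambda>e q2. s2 (ep e) (F (mu a (mu c (S q2))) (mu b one))))"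
      by (subst antip[where ?s2.0=s2], intro lin_rules bilinI, simp)
    also have "\<dots> = sw y (\<lambda>c z. F (mu a (mu c (S z))) (mu b one))"
      by (subst counit_l[where ?s2.0=s2], (intro lin_rules bilinI)+, simp)
    also have "\<dots> = s2 (ep y) (F (mu a one) (mu b one))"
      by (intro antip lin_rules)
    finally show ?thesis by simp
  qed
  have "sw x (\<lambda>p q. sw p (\<lambda>p1 p2. sw (mu (S p1) p2) (\<lambda>u v. sw q (\<lambda>q1 q2. F (mu u (S q2)) (mu v (S q1)))))) =
      sw x (\<lambda>p q. s2 (ep p) (sw one (\<lambda>u v. sw q (\<lambda>q1 q2. F (mu u (S q2)) (mu v (S q1))))))"
    by (subst antip[where ?s2.0=s2], intro lin_rules bilinI, simp)
  also have "\<dots> = sw one (\<lambda>u v. sw x (\<lambda>q1 q2. F (mu u (S q2)) (mu v (S q1))))"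
    by (subst counit_l[where ?s2.0=s2], intro lin_rules bilinI, simp)
  also have "\<dots> = sw x (\<lambda>a b. F (S b) (S a))"
    by (subst sw_one[where ?s2.0=s2], (intro lin_rules bilinI)+, simp)
  finally have A: "sw x (\<lambda>p q. sw p (\<lambda>p1 p2. sw (mu (S p1) p2) (\<lambda>u v. sw q (\<lambda>q1 q2. F (mu u (S q2)) (mu v (S q1)))))) =
     sw x (\<lambda>a b. F (S b) (S a))" .
  have "sw x (\<lambda>p q. sw p (\<lambda>p1 p2. sw (mu (S p1) p2) (\<lambda>u v. sw q (\<lambda>q1 q2. F (mu u (S q2)) (mu v (S q1)))))) =
      sw x (\<lambda>p q. sw p (\<lambda>p1 p2. sw (S p1) (\<lambda>a b. sw p2 (\<lambda>c d. sw q (\<lambda>q1 q2. ?F a b c d q1 q2)))))"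
    by (subst sw_mu[where ?s2.0=s2], (intro lin_rules bilinI)+, simp add: assoc)
  also have "\<dots> = sw x (\<lambda>p1 y. sw y (\<lambda>p2 q. sw (S p1) (\<lambda>a b. sw p2 (\<lambda>c d. sw q (\<lambda>q1 q2. ?F a b c d q1 q2)))))"
    by (intro coassoc[where ?s2.0=s2] lin_rules bilinI)
  also have "\<dots> = sw x (\<lambda>p1 y. sw (S p1) (\<lambda>a b. sw y (\<lambda>p q. sw p (\<lambda>c d. sw q (\<lambda>q1 q2. ?F a b c d q1 q2)))))"
    by (subst sw_swap, simp)
  also have "\<dots> = sw x (\<lambda>p1 y. s2 (ep y) (sw (S p1) F))"
    by (simp add: inner sw_P sw_scale[OF lin_vs(2)[OF bilinD(1)[OF F]]])
  also have "\<dots> = sw (S x) F"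
    by (subst counit_r[where ?s2.0=s2], (intro lin_rules F)+, simp)
  finally show ?thesis using A by simp
qed

end

section \<open>Integrals\<close>

lemma lin_sum: assumes "lin s1 s2 f" shows "f (\<Sum>c\<in>C. g c) = (\<Sum>c\<in>C. f (g c))"
proof -
  interpret Vector_Spaces.linear s1 s2 f by fact
  show ?thesis by (rule sum)
qed

context tcoalg
begin

text \<open>Take coordinates in a basis that extends a basis of E. The coordinate functional of a
  basis vector outside E vanishes on E, so \<open>dl x\<close> splits into terms with second leg in
  E and terms whose first leg is x hit by a functional killing E. This turns statements about
  functionals into statements about legs.\<close>

lemma dl_basis:
  assumes "subspace E"
  obtains C g where "finite C" "\<And>c. lin s (*) (g c)" "\<And>c e. c \<in> C \<Longrightarrow> c \<notin> E \<Longrightarrow> e \<in> E \<Longrightarrow> g c e = 0"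
    "dl x = (\<Sum>c\<in>C. tn s s (sw x (\<lambda>a b. s (g c b) a)) c)"
proof -
  obtain B0 where B0: "B0 \<subseteq> E" "independent B0" "E \<subseteq> span B0" using basis_exists[of E] by metis
  define B where "B = extend_basis B0"
  have B: "B0 \<subseteq> B" "independent B" "span B = UNIV"
    using extend_basis_superset[OF B0(2)] independent_extend_basis[OF B0(2)] span_extend_basis[OF B0(2)]
    by (auto simp: B_def)
  define g where "g = (\<lambda>c v. representation B v c)"
  define L where "L = (SOME ps. presents \<lparr>car = range P, scl = s\<rparr> \<lparr>car = range P, scl = s\<rparr> ps (dl x))"
  define C where "C = (\<Union>p\<in>set L. {c. g c (snd p) \<noteq> 0})"
  have fin: "finite C" by (auto simp: C_def g_def finite_representation)
  have g: "lin s (*) (g c)" for c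
    unfolding g_def by (intro linI) (auto simp: representation_add representation_scale B vs vs_field)
  have ad: "g c e = 0" if "c \<in> C" "c \<notin> E" "e \<in> E" for c e
  proof -
    have "representation B e = representation B0 e"
      using representation_extend[OF B(2) _ B(1)] that B0(3) by auto
    then show ?thesis using representation_ne_zero[of B0 e c] that B0(1) by (auto simp: g_def)
  qed
  have rep: "snd p = (\<Sum>c\<in>C. s (g c (snd p)) c)" if "p \<in> set L" for p
  proof -
    have "snd p = (\<Sum>c | g c (snd p) \<noteq> 0. s (g c (snd p)) c)"
      using sum_nonzero_representation_eq[OF B(2), of "snd p"] B(3) by (simp add: g_def)
    also have "\<dots> = (\<Sum>c\<in>C. s (g c (snd p)) c)"
      by (rule sum.mono_neutral_left[OF fin]) (use that in \<open>auto simp: C_def\<close>)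
    finally show ?thesis .
  qed
  have swap: "sum_list (map (\<lambda>p. \<Sum>c\<in>C. G p c) xs) = (\<Sum>c\<in>C. sum_list (map (\<lambda>p. G p c) xs))"
    for G :: "'a \<times> 'a \<Rightarrow> 'a \<Rightarrow> 'c::comm_monoid_add" and xs
    by (induction xs) (simp_all add: sum.distrib)
  note b = bilin_tn[OF vs vs]
  have "dl x = (\<Sum>p\<leftarrow>L. tn s s (fst p) (snd p))"
    using sw_tn[of x] unfolding sw_def L_def[symmetric] by simp
  also have "\<dots> = (\<Sum>p\<leftarrow>L. \<Sum>c\<in>C. tn s s (s (g c (snd p)) (fst p)) c)"
  proof (intro arg_cong[where f = sum_list] map_cong refl)
    fix p assume p: "p \<in> set L"
    have "tn s s (fst p) (snd p) = tn s s (fst p) (\<Sum>c\<in>C. s (g c (snd p)) c)" using rep[OF p] by simp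
    also have "\<dots> = (\<Sum>c\<in>C. tn s s (fst p) (s (g c (snd p)) c))"
      by (rule lin_sum[OF bilinD(2)[OF b]])
    also have "\<dots> = (\<Sum>c\<in>C. tn s s (s (g c (snd p)) (fst p)) c)"
      by (simp add: linD(2)[OF bilinD(2)[OF b]] linD(2)[OF bilinD(1)[OF b]])
    finally show "tn s s (fst p) (snd p) = (\<Sum>c\<in>C. tn s s (s (g c (snd p)) (fst p)) c)" .
  qed
  also have "\<dots> = (\<Sum>c\<in>C. tn s s (sw x (\<lambda>a b. s (g c b) a)) c)"
    by (simp add: swap sw_hom[OF bilinD(1)[OF b]]) (simp add: sw_def L_def)
  finally show ?thesis using that fin g ad by blast
qed

lemma sw_of_dl:
  assumes "dl x = (\<Sum>c\<in>C. tn s s (u c) (v c))" "bilin s s s2 F"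
  shows "sw x F = (\<Sum>c\<in>C. F (u c) (v c))"
proof -
  have "sw x F = tlift s s F (dl x)" using sw_hom[OF lin_tlift[OF assms(2)], of x "tn s s"]
    by (simp add: sw_tn tlift_tn[OF assms(2)])
  then show ?thesis
    by (simp add: assms(1) tlift_tn[OF assms(2)] lin_sum[OF lin_tlift[OF assms(2)]])
qed

end

section \<open>Integrals and the coseparability form\<close>

locale thopf_int = thopf +
  fixes lam :: "'b \<Rightarrow> 'a" and Lam :: 'b
  assumes lin_lam: "lin s (*) lam" and lam_one [simp]: "lam one = 1"
    and lam_int: "sw x (\<lambda>a b. s (lam b) a) = s (lam x) one" "sw x (\<lambda>a b. s (lam a) b) = s (lam x) one"
    and Lam_int: "mu x Lam = s (ep x) Lam" and ep_Lam [simp]: "ep Lam = 1"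
begin

lemma lin_lam' [lin_rules]: "lin s0 s f \<Longrightarrow> lin s0 (*) (\<lambda>x. lam (f x))"
  using lin_comp lin_lam by blast

lemmas [lin_rules] = lin_lam

lemma P_Lam [simp]: "P Lam = Lam"
  using Lam_int[of one] by simp

text \<open>Evaluate \<Delta>(h_1 \<Lambda>) and a trailing h_2 in two ways: h_1 \<Lambda> =
  \<epsilon>(h_1) \<Lambda> gives the right-hand side, while multiplicativity of \<Delta> produces
  S(h_2) h_3, which cancels and gives the left-hand side.\<close>

lemma separability:
  assumes F: "bilin s s s2 F"
  shows "sw Lam (\<lambda>a b. F (mu h a) (S b)) = sw Lam (\<lambda>a b. F a (mu (S b) h))"
proof -
  note [lin_rules] = lin_bilin1[OF F] lin_bilin2[OF F] lin_vs(2)[OF bilinD(1)[OF F]]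
  have G: "lin s s2 (\<lambda>x. sw x (\<lambda>a b. F a (mu (S b) h')))" for h' by (intro lin_rules bilinI)
  have "sw h (\<lambda>h1 h'. sw (mu h1 Lam) (\<lambda>a b. F a (mu (S b) h'))) =
      sw h (\<lambda>h1 h'. s2 (ep h1) (sw Lam (\<lambda>a b. F a (mu (S b) h'))))"
    by (simp add: Lam_int linD(2)[OF G])
  also have "\<dots> = sw Lam (\<lambda>a b. F a (mu (S b) h))"
    by (subst counit_l[where ?s2.0=s2], (intro lin_rules bilinI)+, simp)
  finally have A: "sw h (\<lambda>h1 h'. sw (mu h1 Lam) (\<lambda>a b. F a (mu (S b) h'))) = sw Lam (\<lambda>a b. F a (mu (S b) h))" .
  have "sw h (\<lambda>h1 h'. sw (mu h1 Lam) (\<lambda>a b. F a (mu (S b) h'))) =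
      sw h (\<lambda>h1 h'. sw h1 (\<lambda>u v. sw Lam (\<lambda>a b. F (mu u a) (mu (S b) (mu (S v) h')))))"
    by (subst sw_mu[where ?s2.0=s2], (intro lin_rules bilinI)+, simp add: assoc S_mu)
  also have "\<dots> = sw h (\<lambda>u h'. sw h' (\<lambda>v w. sw Lam (\<lambda>a b. F (mu u a) (mu (S b) (mu (S v) w)))))"
    by (intro coassoc[where ?s2.0=s2] lin_rules bilinI)
  also have "\<dots> = sw h (\<lambda>u h'. s2 (ep h') (sw Lam (\<lambda>a b. F (mu u a) (mu (S b) one))))"
    by (subst antip[where ?s2.0=s2], intro lin_rules bilinI, simp)
  also have "\<dots> = sw Lam (\<lambda>a b. F (mu h a) (S b))"
    by (subst counit_r[where ?s2.0=s2], (intro lin_rules bilinI)+, simp)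
  finally show ?thesis using A by simp
qed

text \<open>Applying \<epsilon> to the first leg of \<open>separability\<close> shows that S
  \<Lambda> is a right integral. The product of S \<Lambda> and \<Lambda> can then be evaluated by
  either integral property, whence S \<Lambda> = \<Lambda>.\<close>

lemma Lam_right: "mu Lam x = s (ep x) Lam"
proof -
  have "sw Lam (\<lambda>a b. s (ep (mu y a)) (S b)) = sw Lam (\<lambda>a b. s (ep a) (mu (S b) y))" for y
    by (intro separability[where ?s2.0=s] lin_rules bilinI)
  moreover have "sw Lam (\<lambda>a b. s (ep (mu y a)) (S b)) = s (ep y) (S Lam)" for y
    by (simp add: sw_scale[OF vs] flip: scale_scale) (subst counit_l, intro lin_rules, simp)
  moreover have "sw Lam (\<lambda>a b. s (ep a) (mu (S b) y)) = mu (S Lam) y" for y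
    by (subst counit_l, intro lin_rules, simp)
  ultimately have r: "mu (S Lam) y = s (ep y) (S Lam)" for y by simp
  have "S Lam = Lam" using r[of Lam] Lam_int[of "S Lam"] by simp
  with r show ?thesis by simp
qed

text \<open>Use \<lambda>(u) 1 = \<lambda>(u_1) u_2 for u = x y_1 and multiply by S(y_2) on the
  right: the last legs of y cancel. \<open>lam_exchange2\<close> is the mirror image.\<close>

lemma lam_exchange1:
  "sw x (\<lambda>a b. s (lam (mu a y)) b) = sw y (\<lambda>a b. s (lam (mu x a)) (S b))"
proof -
  have 1: "s (lam (mu x a)) (S b) = sw x (\<lambda>x1 x2. sw a (\<lambda>a1 a2. s (lam (mu x1 a1)) (mu x2 (mu a2 (S b)))))" for a b
  proof -
    have "s (lam (mu x a)) (S b) = mu (s (lam (mu x a)) one) (S b)" by (simp add: linD(2)[OF lin_mu(1)[OF lin_id[OF vs]]])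
    also have "\<dots> = sw (mu x a) (\<lambda>u v. s (lam u) (mu v (S b)))"
      by (simp add: linD(2)[OF lin_mu(1)[OF lin_id[OF vs]]] sw_hom[OF lin_mu(1)[OF lin_id[OF vs]]] flip: lam_int(2))
    also have "\<dots> = sw x (\<lambda>x1 x2. sw a (\<lambda>a1 a2. s (lam (mu x1 a1)) (mu x2 (mu a2 (S b)))))"
      by (subst sw_mu[where ?s2.0=s], intro lin_rules bilinI, simp add: assoc)
    finally show ?thesis .
  qed
  have "sw y (\<lambda>a b. s (lam (mu x a)) (S b)) =
      sw x (\<lambda>x1 x2. sw y (\<lambda>a b. sw a (\<lambda>a1 a2. s (lam (mu x1 a1)) (mu x2 (mu a2 (S b))))))"
    unfolding 1 by (rule sw_swap)
  also have "\<dots> = sw x (\<lambda>x1 x2. sw y (\<lambda>a1 z. sw z (\<lambda>a2 b. s (lam (mu x1 a1)) (mu x2 (mu a2 (S b))))))"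
    by (subst coassoc[where ?s2.0=s], (intro lin_rules)+, simp)
  also have "\<dots> = sw x (\<lambda>x1 x2. sw y (\<lambda>a1 z. s (ep z) (s (lam (mu x1 a1)) (mu x2 one))))"
    by (subst antip[where ?s2.0=s], intro lin_rules, simp)
  also have "\<dots> = sw x (\<lambda>x1 x2. s (lam (mu x1 y)) (P x2))"
    by (subst counit_r[where ?s2.0=s], intro lin_rules, simp)
  also have "\<dots> = sw x (\<lambda>a b. s (lam (mu a y)) b)" by (rule sw_cong_P) simp
  finally show ?thesis by simp
qed

lemma lam_exchange2:
  "sw y (\<lambda>a b. s (lam (mu x b)) a) = sw x (\<lambda>a b. s (lam (mu b y)) (S a))"
proof -
  have 1: "s (lam (mu b y)) (S a) = sw y (\<lambda>y1 y2. sw b (\<lambda>b1 b2. s (lam (mu b2 y2)) (mu (mu (S a) b1) y1)))" for a b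
  proof -
    have "s (lam (mu b y)) (S a) = mu (S a) (s (lam (mu b y)) one)" by (simp add: linD(2)[OF lin_mu(2)[OF lin_id[OF vs]]])
    also have "\<dots> = sw (mu b y) (\<lambda>u v. s (lam v) (mu (S a) u))"
      by (simp add: linD(2)[OF lin_mu(2)[OF lin_id[OF vs]]] sw_hom[OF lin_mu(2)[OF lin_id[OF vs]]] flip: lam_int(1))
    also have "\<dots> = sw b (\<lambda>b1 b2. sw y (\<lambda>y1 y2. s (lam (mu b2 y2)) (mu (S a) (mu b1 y1))))"
      by (subst sw_mu[where ?s2.0=s], intro lin_rules bilinI, simp)
    finally show ?thesis by (simp add: assoc sw_swap[of b])
  qed
  have "sw x (\<lambda>a b. s (lam (mu b y)) (S a)) =
      sw y (\<lambda>y1 y2. sw x (\<lambda>a b. sw b (\<lambda>b1 b2. s (lam (mu b2 y2)) (mu (mu (S a) b1) y1))))"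
    unfolding 1 by (rule sw_swap)
  also have "\<dots> = sw y (\<lambda>y1 y2. sw x (\<lambda>z b2. sw z (\<lambda>a b1. s (lam (mu b2 y2)) (mu (mu (S a) b1) y1))))"
    by (subst coassoc[where ?s2.0=s], (intro lin_rules)+, simp)
  also have "\<dots> = sw y (\<lambda>y1 y2. sw x (\<lambda>z b2. s (ep z) (s (lam (mu b2 y2)) (mu one y1))))"
    by (subst antip[where ?s2.0=s], intro lin_rules, simp)
  also have "\<dots> = sw y (\<lambda>y1 y2. s (lam (mu x y2)) (P y1))"
    by (subst counit_l[where ?s2.0=s], intro lin_rules, simp)
  also have "\<dots> = sw y (\<lambda>a b. s (lam (mu x b)) a)" by (rule sw_cong_P) simp
  finally show ?thesis by simp
qed

text \<open>By \<open>theta_comul\<close> and \<open>theta_colinear\<close>, x \<otimes> y \<mapsto>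
  x_1 \<theta>(x_2, y) is a bicolinear retraction of \<Delta>; this is the coseparability of
  H.\<close>

definition theta :: "'b \<Rightarrow> 'b \<Rightarrow> 'a" where "theta x y = lam (mu x (S y))"

lemma lin_theta [lin_rules]: "lin s0 s f \<Longrightarrow> lin s0 (*) (\<lambda>x. theta (f x) c)"
  "lin s0 s f \<Longrightarrow> lin s0 (*) (\<lambda>x. theta c (f x))" "lin s (*) (theta c)"
  unfolding theta_def[abs_def] by (intro lin_rules; assumption)+

lemma theta_P [simp]: "theta (P x) y = theta x y" "theta x (P y) = theta x y"
  by (simp_all add: theta_def)

lemma theta_comul: "sw x theta = ep x"
  unfolding theta_def[abs_def] using antip(2)[OF lin_lam, of x] by simp

text \<open>The integral property \<lambda>(u) 1 = \<lambda>(u_2) u_1 for u = x S(y_1), multiplied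
  by y_2: the coproduct of S(y_1) brings S(y_2) next to y_3, and the two cancel.\<close>

lemma theta_colinear: "sw x (\<lambda>a b. s (theta b y) a) = sw y (\<lambda>a b. s (theta x a) b)"
proof -
  have 1: "s (theta x a) (P b) = sw x (\<lambda>x1 x2. sw a (\<lambda>a1 a2. s (theta x2 a1) (mu x1 (mu (S a2) b))))" for a b
  proof -
    have "s (theta x a) (P b) = mu (s (lam (mu x (S a))) one) b" by (simp add: theta_def linD(2)[OF lin_mu(1)[OF lin_id[OF vs]]])
    also have "\<dots> = sw (mu x (S a)) (\<lambda>u v. s (lam v) (mu u b))"
      by (simp add: linD(2)[OF lin_mu(1)[OF lin_id[OF vs]]] sw_hom[OF lin_mu(1)[OF lin_id[OF vs]]] flip: lam_int(1))
    also have "\<dots> = sw x (\<lambda>x1 x2. sw a (\<lambda>a1 a2. s (theta x2 a1) (mu x1 (mu (S a2) b))))"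
      by (subst sw_mu[where ?s2.0=s], intro lin_rules bilinI, subst sw_S[where ?s2.0=s], intro lin_rules bilinI, simp add: assoc theta_def)
    finally show ?thesis .
  qed
  have "sw y (\<lambda>a b. s (theta x a) b) = sw y (\<lambda>a b. s (theta x a) (P b))" by (rule sw_cong_P) simp
  also have "\<dots> = sw x (\<lambda>x1 x2. sw y (\<lambda>a b. sw a (\<lambda>a1 a2. s (theta x2 a1) (mu x1 (mu (S a2) b)))))"
    unfolding 1 by (rule sw_swap)
  also have "\<dots> = sw x (\<lambda>x1 x2. sw y (\<lambda>a1 z. sw z (\<lambda>a2 b. s (theta x2 a1) (mu x1 (mu (S a2) b)))))"
    by (subst coassoc[where ?s2.0=s], (intro lin_rules)+, simp)
  also have "\<dots> = sw x (\<lambda>x1 x2. sw y (\<lambda>a1 z. s (ep z) (s (theta x2 a1) (mu x1 one))))"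
    by (subst antip[where ?s2.0=s], intro lin_rules, simp)
  also have "\<dots> = sw x (\<lambda>x1 x2. s (theta x2 y) (P x1))"
    by (subst counit_r[where ?s2.0=s], intro lin_rules, simp)
  also have "\<dots> = sw x (\<lambda>a b. s (theta b y) a)" by (rule sw_cong_P) simp
  finally show ?thesis by simp
qed

text \<open>Left and right normalised integrals coincide. At x = 1, \<open>theta_colinear\<close>
  says \<lambda>(S y) 1 = \<lambda>(S y_1) y_2; applying \<lambda> gives the product of \<lambda>(S
  y_1) and \<lambda>(y_2), which the integral property of \<lambda> at y evaluates to
  \<lambda>(y).\<close>

lemma lam_S: "lam (S y) = lam y"
proof -
  have "s (lam (S y)) one = sw y (\<lambda>a b. s (lam (S a)) b)"
    using theta_colinear[of one y] by (subst (asm) sw_one[where ?s2.0=s], intro lin_rules bilinI) (simp add: theta_def)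
  then have "lam (s (lam (S y)) one) = lam (sw y (\<lambda>a b. s (lam (S a)) b))" by simp
  also have "\<dots> = lam (S (sw y (\<lambda>a b. s (lam b) a)))"
    by (simp add: sw_hom[OF lin_lam] sw_hom[OF lin_S] linD(2)[OF lin_lam] linD(2)[OF lin_S] mult.commute)
  also have "\<dots> = lam y" by (simp add: lam_int linD(2)[OF lin_lam] linD(2)[OF lin_S])
  finally show ?thesis by (simp add: linD(2)[OF lin_lam])
qed

text \<open>The exchange identities with \<Lambda> in place of one variable. Up to S and the scalar
  \<lambda>(\<Lambda>), the legs of \<Lambda> are dual bases for the Frobenius form (x, y) \<mapsto>
  \<lambda>(xy).\<close>

lemma dual_bases:
  "sw Lam (\<lambda>a b. s (lam (mu a y)) b) = s (lam Lam) (S y)"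
  "sw Lam (\<lambda>a b. s (lam (mu x b)) a) = s (lam Lam) (S x)"
proof -
  have "sw y (\<lambda>a b. s (ep a) (s (lam Lam) (S b))) = s (lam Lam) (S y)"
    by (subst counit_l[where ?s2.0=s], intro lin_rules, simp)
  then show "sw Lam (\<lambda>a b. s (lam (mu a y)) b) = s (lam Lam) (S y)"
    by (simp add: lam_exchange1 Lam_right linD(2)[OF lin_lam])
  have "sw x (\<lambda>a b. s (ep b) (s (lam Lam) (S a))) = s (lam Lam) (S x)"
    by (subst counit_r[where ?s2.0=s], intro lin_rules, simp)
  then show "sw Lam (\<lambda>a b. s (lam (mu x b)) a) = s (lam Lam) (S x)"
    by (simp add: lam_exchange2 Lam_int linD(2)[OF lin_lam])
qed

text \<open>If the scalar were 0, then \<lambda>(\<Lambda>_1 y) \<Lambda>_2 = 0 for all y by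
  \<open>dual_bases\<close>. But 1 = \<epsilon>(\<Lambda>) = \<lambda>(\<Lambda>_1 S(\<Lambda>_2)),
  and writing \<Delta>(\<Lambda>) in coordinates makes each term of this sum a coordinate of such a
  vanishing expression.\<close>

lemma lam_Lam: "lam Lam \<noteq> 0"
proof
  assume 0: "lam Lam = 0"
  obtain C g where C: "finite C" "\<And>c. lin s (*) (g c)" 
      "dl Lam = (\<Sum>c\<in>C. tn s s (sw Lam (\<lambda>a b. s (g c b) a)) c)"
    by (rule dl_basis[OF subspace_UNIV, of Lam]) (rule that)
  have "1 = sw Lam (\<lambda>a b. lam (mu a (S b)))"
    using antip(2)[OF lin_lam, of Lam] by simp
  also have "\<dots> = (\<Sum>c\<in>C. lam (mu (sw Lam (\<lambda>a b. s (g c b) a)) (S c)))"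
    by (rule sw_of_dl[OF C(3), where ?s2.0="(*)"]) (intro bilinI lin_rules)
  also have "\<dots> = 0"
  proof (rule sum.neutral, rule ballI)
    fix c
    have "lam (mu (sw Lam (\<lambda>a b. s (g c b) a)) y) = g c (sw Lam (\<lambda>a b. s (lam (mu a y)) b))" for y
      by (simp add: sw_hom[OF lin_lam] sw_hom[OF lin_mu(1)[OF lin_id[OF vs]]] sw_hom[OF C(2)] linD(2)[OF C(2)]
          linD(2)[OF lin_lam] linD(2)[OF lin_mu(1)[OF lin_id[OF vs]]] mult.commute)
    then show "lam (mu (sw Lam (\<lambda>a b. s (g c b) a)) (S c)) = 0"
      by (simp add: dual_bases 0 linD(3)[OF C(2)])
  qed
  finally show False by simp
qed

text \<open>The dual bases of \<open>dual_bases\<close> express both \<open>S (S x)\<close> and \<open>S y\<close>, and \<open>lam\<close> is invariant under \<open>S\<close>.\<close>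

lemma lam_trace: "lam (mu x y) = lam (mu y (S (S x)))"
proof -
  have "lam Lam * lam (mu y (S (S x))) = lam (mu y (s (lam Lam) (S (S x))))"
    by (simp add: linD(2)[OF lin_lam] linD(2)[OF lin_mu0])
  also have "\<dots> = lam (mu (sw Lam (\<lambda>a b. s (lam (mu y b)) a)) (S x))"
    unfolding dual_bases(1)[symmetric]
    by (simp add: sw_hom[OF lin_lam] sw_hom[OF lin_mu0] sw_hom[OF lin_mu(1)[OF lin_id[OF vs]]]
          linD(2)[OF lin_lam] linD(2)[OF lin_mu0] linD(2)[OF lin_mu(1)[OF lin_id[OF vs]]] mult.commute)
  also have "\<dots> = lam Lam * lam (S (mu x y))"
    by (simp add: dual_bases S_mu linD(2)[OF lin_lam] linD(2)[OF lin_mu(1)[OF lin_id[OF vs]]])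
  finally show ?thesis using lam_Lam by (simp add: lam_S)
qed

text \<open>This is the ad-invariance. By \<open>lam_trace\<close>, the leading h_1 in \<lambda>(h_1
  x S(y) S(h_2)) moves to the end as S(S(h_1)), and S(h_2) S(S(h_1)) = S(S(h_1) h_2) collapses. On
  the other side h_1 S(h_2) is adjacent from the start.\<close>

lemma theta_mul:
  "sw h (\<lambda>h1 h2. theta (mu h1 x) (mu h2 y)) = ep h * theta x y"
  "sw h (\<lambda>h1 h2. theta (mu x h1) (mu y h2)) = ep h * theta x y"
proof -
  have "theta (mu h1 x) (mu h2 y) = lam (mu (mu x (S y)) (S (mu (S h1) h2)))" for h1 h2
    using lam_trace[of h1 "mu x (mu (S y) (S h2))"] by (simp add: theta_def S_mu assoc)
  then have "sw h (\<lambda>h1 h2. theta (mu h1 x) (mu h2 y)) = sw h (\<lambda>h1 h2. lam (mu (mu x (S y)) (S (mu (S h1) h2))))"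
    by simp
  also have "\<dots> = ep h * lam (mu (mu x (S y)) (S one))" by (intro antip lin_rules)
  finally show "sw h (\<lambda>h1 h2. theta (mu h1 x) (mu h2 y)) = ep h * theta x y" by (simp add: theta_def)
  have "sw h (\<lambda>h1 h2. theta (mu x h1) (mu y h2)) = sw h (\<lambda>h1 h2. lam (mu x (mu (mu h1 (S h2)) (S y))))"
    by (simp add: theta_def S_mu assoc)
  also have "\<dots> = ep h * lam (mu x (mu one (S y)))" by (intro antip lin_rules)
  finally show "sw h (\<lambda>h1 h2. theta (mu x h1) (mu y h2)) = ep h * theta x y" by (simp add: theta_def)
qed

end

section \<open>The coradical filtration\<close>

context tcoalg
begin

abbreviation lfun :: "('a \<Rightarrow> 'k) \<Rightarrow> bool" where "lfun f \<equiv> lin s (*) f"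

lemma separate:
  assumes "subspace W" "v \<notin> W"
  obtains f where "lfun f" "f v = 1" "\<And>w. w \<in> W \<Longrightarrow> f w = 0"
proof -
  interpret k: vector_space_pair s "(*) :: 'k \<Rightarrow> 'k \<Rightarrow> 'k"
    by (simp add: vector_space_pair_def vector_space_axioms)
  obtain B where B: "B \<subseteq> W" "independent B" "W \<subseteq> span B" using basis_exists[of W] by metis
  have sp: "span B = W" using B assms(1) by (metis span_subspace)
  have "independent (insert v B)" using B sp assms(2) by (simp add: independent_insert)
  from k.linear_independent_extend[OF this, of "\<lambda>x. if x = v then 1 else 0"]
  obtain f where f: "lfun f" "\<And>x. x \<in> insert v B \<Longrightarrow> f x = (if x = v then 1 else 0)" by blast
  have "f b = 0" if "b \<in> B" for b using f(2)[of b] that B(1) assms(2) by auto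
  then have "f w = 0" if "w \<in> span B" for w
    using k.linear_eq_0_on_span[OF f(1), of B w] that by blast
  then show ?thesis using that f sp by auto
qed

lemma functionals_separate: "(\<And>f. lfun f \<Longrightarrow> f v = 0) \<Longrightarrow> v = 0"
  using separate[OF subspace_single_0, of v] by (metis singletonD zero_neq_one singletonI)

definition fd :: "'a set \<Rightarrow> bool" where "fd V \<longleftrightarrow> (\<exists>B. finite B \<and> V \<subseteq> span B)"

lemma fd_subset: "fd V \<Longrightarrow> U \<subseteq> V \<Longrightarrow> fd U"
  unfolding fd_def by blast

lemma fd_basis:
  assumes "fd V" "subspace V"
  obtains B where "finite B" "independent B" "span B = V" "card B = dim V"
proof -
  obtain B where B: "B \<subseteq> V" "independent B" "V \<subseteq> span B" "card B = dim V" using basis_exists[of V] by metis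
  obtain T where "finite T" "V \<subseteq> span T" using assms by (auto simp: fd_def)
  then have "finite B" using independent_span_bound[of T B] B by auto
  then show ?thesis using that B assms(2) by (metis span_subspace)
qed

lemma fd_dim_less:
  assumes "fd V" "subspace V" "subspace U" "U \<subseteq> V" "U \<noteq> V" shows "dim U < dim V"
proof -
  obtain B where B: "finite B" "independent B" "span B = V" "card B = dim V" using fd_basis assms by metis
  obtain D where D: "finite D" "independent D" "span D = U" "card D = dim U"
    using fd_basis assms fd_subset by metis
  obtain x where x: "x \<in> V" "x \<notin> U" using assms by blast
  have "x \<notin> D" using x D span_superset by blast
  moreover have "independent (insert x D)" using x D by (simp add: independent_insert)
  moreover have "insert x D \<subseteq> span B" using x B D assms(4) span_superset by blast
  ultimately show ?thesis using independent_span_bound[OF B(1)] B(4) D by fastforce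
qed


text \<open>\<open>hit\<close> and \<open>hitr\<close> are the two actions of the dual algebra,
  whose product is \<open>conv\<close>, on the coalgebra. They commute, and they let coideals be
  treated as submodules.\<close>

definition hit :: "('a \<Rightarrow> 'k) \<Rightarrow> 'a \<Rightarrow> 'a" where "hit f x = sw x (\<lambda>a b. s (f b) a)"

definition hitr :: "('a \<Rightarrow> 'k) \<Rightarrow> 'a \<Rightarrow> 'a" where "hitr f x = sw x (\<lambda>a b. s (f a) b)"

definition conv :: "('a \<Rightarrow> 'k) \<Rightarrow> ('a \<Rightarrow> 'k) \<Rightarrow> 'a \<Rightarrow> 'k" where "conv f g x = sw x (\<lambda>a b. f a * g b)"

lemma lin_hit: assumes "lfun f" shows "lin s s (hit f)" "lin s s (hitr f)"
  unfolding hit_def[abs_def] hitr_def[abs_def]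
  by (intro lin_rules bilinI assms lin_comp[OF assms])+

lemma lin_conv: assumes "lfun f" "lfun g" shows "lfun (conv f g)"
  unfolding conv_def[abs_def] by (intro lin_rules bilinI assms lin_comp[OF assms(1)] lin_comp[OF assms(2)])

lemma P_sw: "(\<And>a b. P (F (P a) (P b)) = F (P a) (P b)) \<Longrightarrow> P (sw x F) = sw x F"
  unfolding sw_hom[OF lin_P] by (rule sw_cong_P)

lemma P_hit [simp]: "P (hit f x) = hit f x" "P (hitr f x) = hitr f x"
  unfolding hit_def hitr_def by (rule P_sw; simp add: linD(2)[OF lin_P])+

lemma hit_add:
  "hit (\<lambda>x. f x + g x) x = hit f x + hit g x" "hit (\<lambda>x. f x - g x) x = hit f x - hit g x"
  "hitr (\<lambda>x. f x + g x) x = hitr f x + hitr g x"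
  "hit (\<lambda>x. c * f x) x = s c (hit f x)" "hitr (\<lambda>x. c * f x) x = s c (hitr f x)"
  by (simp_all add: hit_def hitr_def scale_left_distrib scale_left_diff_distrib sw_sum sw_scale[OF vs] flip: scale_scale)

lemma hit_ep [simp]: "hit ep x = P x" "hitr ep x = P x"
  unfolding hit_def hitr_def by (rule counit_r[OF lin_id[OF vs]], rule counit_l[OF lin_id[OF vs]])

lemma ep_hit: assumes "lfun f" shows "ep (hit f x) = f (P x)"
  unfolding hit_def by (simp add: sw_hom[OF lin_ep] linD(2)[OF lin_ep])
    (subst mult.commute, rule counit_l[OF assms])

lemma functional_hit: assumes "lfun f" "lfun g" shows "f (hitr g x) = g (hit f x)"
  unfolding hit_def hitr_def by (simp add: sw_hom[OF assms(1)] sw_hom[OF assms(2)]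
      linD(2)[OF assms(1)] linD(2)[OF assms(2)] mult.commute)

lemma conv_hit: assumes "lfun f" "lfun g"
  shows "conv f g x = f (hit g x)" "conv f g x = g (hitr f x)"
  unfolding hit_def hitr_def conv_def by (simp_all add: sw_hom[OF assms(1)] sw_hom[OF assms(2)]
      linD(2)[OF assms(1)] linD(2)[OF assms(2)] mult.commute)

lemma hit_conv: assumes f: "lfun f" and g: "lfun g"
  shows "hit f (hit g x) = hit (conv f g) x"
proof -
  have "hit f (hit g x) = sw x (\<lambda>a b. sw a (\<lambda>a1 a2. s (f a2 * g b) a1))"
    unfolding hit_def[of g] sw_hom[OF lin_hit(1)[OF f]]
    by (simp add: linD(2)[OF lin_hit(1)[OF f]]) (simp add: hit_def mult.commute flip: sw_scale[OF vs])
  also have "\<dots> = sw x (\<lambda>a b. sw b (\<lambda>b1 b2. s (f b1 * g b2) a))"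
    by (intro coassoc[where ?s2.0=s] lin_rules lin_comp[OF f] lin_comp[OF g])
  also have "\<dots> = hit (conv f g) x"
    using sw_hom[OF lin_scale1[OF vs lin_id[OF vs_field]]] by (simp add: hit_def conv_def)
  finally show ?thesis .
qed

lemma hitr_conv: assumes f: "lfun f" and g: "lfun g"
  shows "hitr f (hitr g x) = hitr (conv g f) x"
proof -
  have "hitr f (hitr g x) = sw x (\<lambda>a b. sw b (\<lambda>b1 b2. s (g a * f b1) b2))"
    unfolding hitr_def[of g] sw_hom[OF lin_hit(2)[OF f]]
    by (simp add: linD(2)[OF lin_hit(2)[OF f]]) (simp add: hitr_def flip: sw_scale[OF vs])
  also have "\<dots> = sw x (\<lambda>a b. sw a (\<lambda>a1 a2. s (g a1 * f a2) b))"
    by (rule sym, intro coassoc[where ?s2.0=s] lin_rules lin_comp[OF f] lin_comp[OF g])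
  also have "\<dots> = hitr (conv g f) x"
    using sw_hom[OF lin_scale1[OF vs lin_id[OF vs_field]]] by (simp add: hitr_def conv_def)
  finally show ?thesis .
qed

lemma hit_hitr: assumes f: "lfun f" and g: "lfun g"
  shows "hit f (hitr g x) = hitr g (hit f x)"
proof -
  have "hit f (hitr g x) = sw x (\<lambda>a b. sw b (\<lambda>b1 b2. s (g a * f b2) b1))"
    unfolding hitr_def[of g] sw_hom[OF lin_hit(1)[OF f]]
    by (simp add: linD(2)[OF lin_hit(1)[OF f]]) (simp add: hit_def flip: sw_scale[OF vs])
  also have "\<dots> = sw x (\<lambda>a b. sw a (\<lambda>a1 a2. s (g a1 * f b) a2))"
    by (rule sym, intro coassoc[where ?s2.0=s] lin_rules lin_comp[OF f] lin_comp[OF g])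
  also have "\<dots> = hitr g (hit f x)"
    unfolding hit_def[of f] sw_hom[OF lin_hit(2)[OF g]]
    by (simp add: linD(2)[OF lin_hit(2)[OF g]]) (simp add: hitr_def mult.commute flip: sw_scale[OF vs])
  finally show ?thesis .
qed

text \<open>The finiteness theorem for comodules: each orbit under the dual algebra lies in the span
  of the finitely many legs of one presentation of \<open>dl x\<close>.\<close>

lemma fd_hits: "fd {hit f x | f. lfun f}" "fd {hitr f x | f. lfun f}"
proof -
  define L where "L = (SOME ps. presents \<lparr>car = range P, scl = s\<rparr> \<lparr>car = range P, scl = s\<rparr> ps (dl x))"
  have sp: "(\<Sum>p\<leftarrow>xs. s (f p) (u p)) \<in> span (u ` set xs)"
    for f :: "'a \<times> 'a \<Rightarrow> 'k" and u :: "'a \<times> 'a \<Rightarrow> 'a" and xs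
  proof (induction xs)
    case (Cons p xs)
    have "(\<Sum>p\<leftarrow>xs. s (f p) (u p)) \<in> span (u ` set (p # xs))"
      by (rule subsetD[OF span_mono Cons]) auto
    then show ?case by (auto intro!: span_add span_scale intro: span_base)
  qed (simp add: span_zero)
  then have "hit f x \<in> span (fst ` set L)" "hitr f x \<in> span (snd ` set L)" for f
    unfolding hit_def hitr_def sw_def L_def[symmetric]
    using sp[of "\<lambda>p. f (snd p)" fst L] sp[of "\<lambda>p. f (fst p)" snd L] by simp_all
  then show "fd {hit f x | f. lfun f}" "fd {hitr f x | f. lfun f}"
    unfolding fd_def by (blast intro: finite_imageI)+
qed

text \<open>Stability under \<open>hit\<close> describes right coideals, since the functionals are
  evaluated on the second leg. Stability under \<open>hitr\<close> as well describes subcoalgebras;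
  see \<open>bistable_iff\<close>.\<close>

definition hstable :: "'a set \<Rightarrow> bool" where
  "hstable V \<longleftrightarrow> subspace V \<and> V \<subseteq> range P \<and> (\<forall>f v. lfun f \<longrightarrow> v \<in> V \<longrightarrow> hit f v \<in> V)"

definition bistable :: "'a set \<Rightarrow> bool" where
  "bistable V \<longleftrightarrow> hstable V \<and> (\<forall>f v. lfun f \<longrightarrow> v \<in> V \<longrightarrow> hitr f v \<in> V)"

definition simple :: "'a set \<Rightarrow> bool" where
  "simple V \<longleftrightarrow> bistable V \<and> V \<noteq> {0} \<and> (\<forall>E. bistable E \<and> E \<subseteq> V \<longrightarrow> E = {0} \<or> E = V)"

lemma range_P: "x \<in> range P \<longleftrightarrow> P x = x"
  by (metis PP rangeI rangeE)

lemma subspace_hits: "subspace {hit f x | f. lfun f}"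
proof (rule subspaceI)
  show "0 \<in> {hit f x | f. lfun f}"
    by (rule CollectI, rule exI[of _ "\<lambda>_. 0"]) (auto simp: hit_def sw_sum intro: lin_rules)
next
  fix y z assume "y \<in> {hit f x | f. lfun f}" "z \<in> {hit f x | f. lfun f}"
  then obtain f g where "lfun f" "lfun g" "y = hit f x" "z = hit g x" by auto
  then show "y + z \<in> {hit f x | f. lfun f}"
    by (intro CollectI exI[of _ "\<lambda>x. f x + g x"]) (auto simp: hit_add intro: lin_rules)
next
  fix c y assume "y \<in> {hit f x | f. lfun f}"
  then obtain f where "lfun f" "y = hit f x" by auto
  then show "s c y \<in> {hit f x | f. lfun f}"
    by (intro CollectI exI[of _ "\<lambda>x. c * f x"]) (auto simp: hit_add intro: lin_rules)
qed

lemma hstable_hits: "hstable {hit f x | f. lfun f}"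
  unfolding hstable_def using subspace_hits hit_conv lin_conv by (auto simp: range_P)

lemma exists_simple:
  assumes "bistable C" "fd C" "C \<noteq> {0}" obtains E where "simple E" "E \<subseteq> C"
proof -
  obtain E where E: "bistable E" "E \<noteq> {0}" "E \<subseteq> C" "\<And>D. bistable D \<Longrightarrow> D \<noteq> {0} \<Longrightarrow> D \<subseteq> C \<Longrightarrow> dim E \<le> dim D"
    using ex_has_least_nat[of "\<lambda>E. bistable E \<and> E \<noteq> {0} \<and> E \<subseteq> C" C dim] assms by blast
  have "D = {0} \<or> D = E" if "bistable D" "D \<subseteq> E" for D
  proof (rule ccontr)
    assume n: "\<not> ?thesis"
    have "fd E" "subspace E" "subspace D"
      using that E(1,3) fd_subset[OF assms(2)] by (auto simp: bistable_def hstable_def)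
    then show False using fd_dim_less[of E D] E(4)[of D] n that E(3) by auto
  qed
  then have "simple E" unfolding simple_def using E by blast
  then show ?thesis using that E by blast
qed

end

context tcoalg
begin

lemma bistableD:
  assumes "bistable E"
  shows "subspace E" "E \<subseteq> range P" "hstable E" "lfun f \<Longrightarrow> v \<in> E \<Longrightarrow> hit f v \<in> E"
    "lfun f \<Longrightarrow> v \<in> E \<Longrightarrow> hitr f v \<in> E" "v \<in> E \<Longrightarrow> P v = v"
  using assms by (auto simp: bistable_def hstable_def range_P)

lemma hstableD:
  assumes "hstable E"
  shows "subspace E" "E \<subseteq> range P" "lfun f \<Longrightarrow> v \<in> E \<Longrightarrow> hit f v \<in> E" "v \<in> E \<Longrightarrow> P v = v"
  using assms by (auto simp: hstable_def range_P)

lemma bistable_span: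
  assumes "X \<subseteq> range P" "\<And>f v. lfun f \<Longrightarrow> v \<in> X \<Longrightarrow> hit f v \<in> span X"
    "\<And>f v. lfun f \<Longrightarrow> v \<in> X \<Longrightarrow> hitr f v \<in> span X"
  shows "bistable (span X)"
proof -
  interpret p: Vector_Spaces.linear s s P by (rule lin_P)
  have 1: "g v \<in> span X" if g: "lin s s g" "\<And>v. v \<in> X \<Longrightarrow> g v \<in> span X" and "v \<in> span X" for g v
    using that(3)
  proof (induction rule: span_induct_alt)
    case (step c x y)
    then show ?case by (simp add: linD[OF g(1)] span_add span_scale g(2))
  qed (simp add: linD[OF g(1)] span_zero)
  have "span X \<subseteq> range P" by (rule span_minimal[OF assms(1)]) (simp add: p.subspace_image)
  then show ?thesis using 1[OF lin_hit(1)] 1[OF lin_hit(2)] assms(2,3)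
    by (auto simp: bistable_def hstable_def)
qed

text \<open>\<open>M\<close> is a simple right coideal and \<open>E\<close> a simple subcoalgebra of its coefficient space \<open>C\<close>.  Let \<open>I\<close>
  be the ideal of functionals vanishing on \<open>E\<close>.  If \<open>I\<close> kills \<open>M\<close>, then \<open>M \<subseteq> E\<close>.  Otherwise \<open>I M = M\<close>,
  and successive approximation gives some \<open>p \<in> I\<close> fixing any finite subset of \<open>M\<close>; such a \<open>p\<close>
  fixes a nonzero element of \<open>E\<close>, although it kills \<open>E\<close>.\<close>

lemma simple_in_coradical:
  assumes H: "\<And>E. simple E \<Longrightarrow> E \<subseteq> H" "0 \<in> H"
    and M: "hstable M" "fd M"
    and cyc: "\<And>m. m \<in> M \<Longrightarrow> m \<noteq> 0 \<Longrightarrow> M \<subseteq> {hit f m | f. lfun f}"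
  shows "M \<subseteq> H"
proof (cases "M = {0}")
  case False
  note MD = hstableD[OF M(1)]
  define X where "X = {hitr g m | g m. lfun g \<and> m \<in> M}"
  define C where "C = span X"
  have MX: "M \<subseteq> X"
  proof
    fix m assume m: "m \<in> M"
    then have "m = hitr ep m" using MD(4) by simp
    then show "m \<in> X" unfolding X_def using m lin_ep by blast
  qed
  have C: "bistable C"
    unfolding C_def
  proof (rule bistable_span)
    show "X \<subseteq> range P" by (auto simp: X_def range_P)
    show "hit f v \<in> span X" if f: "lfun f" and v: "v \<in> X" for f v
    proof -
      obtain g m where g: "lfun g" "m \<in> M" "v = hitr g m" using v by (auto simp: X_def)
      then have "hit f v = hitr g (hit f m)" by (simp add: hit_hitr f)
      then show ?thesis using g MD(3)[OF f] by (auto simp: X_def intro!: span_base)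
    qed
    show "hitr f v \<in> span X" if f: "lfun f" and v: "v \<in> X" for f v
    proof -
      obtain g m where g: "lfun g" "m \<in> M" "v = hitr g m" using v by (auto simp: X_def)
      then have "hitr f v = hitr (conv g f) m" by (simp add: hitr_conv f)
      then show ?thesis using g lin_conv[OF g(1) f] by (auto simp: X_def intro!: span_base)
    qed
  qed
  have "fd C"
  proof -
    obtain B where B: "finite B" "span B = M" using fd_basis[OF M(2) MD(1)] by metis
    have "\<forall>b. \<exists>T. finite T \<and> {hitr f b | f. lfun f} \<subseteq> span T" using fd_hits(2) by (auto simp: fd_def)
    from choice[OF this] obtain T where "\<forall>b. finite (T b) \<and> {hitr f b | f. lfun f} \<subseteq> span (T b)" ..
    then have T: "\<And>b. finite (T b)" "\<And>b. {hitr f b | f. lfun f} \<subseteq> span (T b)" by blast+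
    have "hitr g m \<in> span (\<Union>b\<in>B. T b)" if g: "lfun g" and "m \<in> span B" for g m
      using that(2)
    proof (induction rule: span_induct_alt)
      case (step c x y)
      have "hitr g x \<in> span (T x)" using T(2)[of x] g by auto
      also have "span (T x) \<subseteq> span (\<Union>b\<in>B. T b)" by (rule span_mono) (use step in auto)
      finally show ?case using step by (simp add: linD[OF lin_hit(2)[OF g]] span_add span_scale)
    qed (simp add: linD[OF lin_hit(2)[OF g]] span_zero)
    then have "C \<subseteq> span (\<Union>b\<in>B. T b)" unfolding C_def using B by (intro span_minimal) (auto simp: X_def)
    then show ?thesis unfolding fd_def using B T by blast
  qed
  moreover have "C \<noteq> {0}" using MX False MD(1) subspace_0 span_superset[of X] unfolding C_def by blast
  ultimately obtain E where E: "simple E" "E \<subseteq> C" using exists_simple[OF C] by metis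
  have bE: "bistable E" and E0: "E \<noteq> {0}" using E by (auto simp: simple_def)
  note ED = bistableD[OF bE]
  define I where "I = {p. lfun p \<and> (\<forall>e\<in>E. p e = 0)}"
  have I1: "conv p f \<in> I" "conv f p \<in> I" if "p \<in> I" "lfun f" for p f
    using that ED(4,5)[OF that(2)] lin_conv conv_hit(1)[of p f] conv_hit(2)[of f p] by (auto simp: I_def)
  show ?thesis
  proof (cases "\<forall>p\<in>I. \<forall>m\<in>M. hit p m = 0")
    case True
    have "m \<in> E" if m: "m \<in> M" for m
    proof (rule ccontr)
      assume "m \<notin> E"
      then obtain p where p: "lfun p" "p m = 1" "\<And>e. e \<in> E \<Longrightarrow> p e = 0" using separate ED(1) by metis
      then have "hit p m = 0" using True m by (auto simp: I_def)
      then have "p (P m) = 0" using ep_hit[OF p(1), of m] by (simp add: linD[OF lin_ep])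
      then show False using p(2) MD(4)[OF m] by simp
    qed
    then show ?thesis using H(1)[OF E(1)] by auto
  next
    case False
    then obtain p0 m0 where p0: "p0 \<in> I" "m0 \<in> M" "hit p0 m0 \<noteq> 0" by auto
    have fix1: "\<exists>p\<in>I. hit p m = m" if m: "m \<in> M" for m
    proof (cases "m = 0")
      case True then show ?thesis using p0(1) linD(3)[OF lin_hit(1)] by (auto simp: I_def)
    next
      case False
      obtain f where f: "lfun f" "m0 = hit f m" using cyc[OF m False] p0(2) by auto
      \<comment> \<open>f carries m to the vector m0 on which p0 acts nontrivially; simplicity of M
        then leads from the nonzero vector \<open>hit p1 m\<close> back to m. Since I is an ideal,
        the composite stays in I.\<close>
      define p1 where "p1 = conv p0 f"
      have p1: "p1 \<in> I" "lfun p1" using I1 p0 f by (auto simp: p1_def I_def)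
      have n: "hit p1 m \<noteq> 0" using p0 f by (simp add: p1_def I_def flip: hit_conv)
      have "hit p1 m \<in> M" using MD(3) p1 m by auto
      then obtain f' where f': "lfun f'" "m = hit f' (hit p1 m)" using cyc[OF _ n] m by auto
      then have "m = hit (conv f' p1) m" using p1 by (simp add: hit_conv)
      then show ?thesis using I1(2)[OF p1(1) f'(1)] by metis
    qed
    have fixn: "\<exists>p\<in>I. \<forall>x\<in>Y. hit p x = x" if "finite Y" "Y \<subseteq> M" for Y
      using that
    proof (induction Y rule: finite_induct)
      case empty then show ?case using p0 by auto
    next
      case (insert m Y)
      then obtain p where p: "p \<in> I" "\<And>x. x \<in> Y \<Longrightarrow> hit p x = x" by auto
      have lp: "lfun p" using p by (simp add: I_def)
      have "m - hit p m \<in> M" using insert MD(3)[OF lp] subspace_diff[OF MD(1)] by auto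
      then obtain q where q: "q \<in> I" "hit q (m - hit p m) = m - hit p m" using fix1 by blast
      have lq: "lfun q" using q by (simp add: I_def)
      \<comment> \<open>In the dual algebra 1 - r = (1 - q)(1 - p): whatever p fixes stays fixed,
        and q removes the defect that p leaves at m.\<close>
      define r where "r = (\<lambda>x. (p x + q x) - conv q p x)"
      have lr: "lfun r" unfolding r_def by (intro lin_diff lin_add lp lq lin_conv)
      have r: "r \<in> I" using lr p(1) q(1) I1(1)[OF q(1) lp] by (auto simp: I_def r_def)
      have hr: "hit r x = hit p x + hit q (x - hit p x)" for x
        unfolding r_def by (simp add: hit_add hit_conv[OF lq lp] linD[OF lin_hit(1)[OF lq]])
      have "hit r x = x" if "x \<in> insert m Y" for x
        using that p(2) q(2) by (auto simp: hr linD(3)[OF lin_hit(1)[OF lq]] simp del: add_diff_cancel_left')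
      then show ?case using r by blast
    qed
    \<comment> \<open>The two actions commute, so an element fixing m also fixes every
      \<open>hitr g m\<close>; hence fixing finitely many vectors of M suffices to fix a given c in
      C.\<close>
    have supp: "\<exists>Y. finite Y \<and> Y \<subseteq> M \<and> (\<forall>p. lfun p \<longrightarrow> (\<forall>x\<in>Y. hit p x = x) \<longrightarrow> hit p c = c)" if "c \<in> C" for c
      using that unfolding C_def
    proof (induction rule: span_induct_alt)
      case base show ?case by (rule exI[of _ "{}"]) (auto simp: linD[OF lin_hit(1)])
    next
      case (step a x y)
      obtain g m where g: "lfun g" "m \<in> M" "x = hitr g m" using step by (auto simp: X_def)
      obtain Y where Y: "finite Y" "Y \<subseteq> M" "\<And>p. lfun p \<Longrightarrow> (\<forall>x\<in>Y. hit p x = x) \<Longrightarrow> hit p y = y"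
        using step by blast
      show ?case
        by (rule exI[of _ "insert m Y"]) (use g Y in \<open>auto simp: linD[OF lin_hit(1)] hit_hitr\<close>)
    qed
    obtain e where e: "e \<in> E" "e \<noteq> 0" using E0 subspace_0[OF ED(1)] by auto
    from supp[OF subsetD[OF E(2) e(1)]] obtain Y
      where "finite Y \<and> Y \<subseteq> M \<and> (\<forall>p. lfun p \<longrightarrow> (\<forall>x\<in>Y. hit p x = x) \<longrightarrow> hit p e = e)" ..
    then have Y: "finite Y" "Y \<subseteq> M" "\<And>p. lfun p \<Longrightarrow> (\<forall>x\<in>Y. hit p x = x) \<Longrightarrow> hit p e = e" by simp_all
    from fixn[OF Y(1,2)] obtain p where p: "p \<in> I" "\<forall>x\<in>Y. hit p x = x" ..
    have "f e = 0" if f: "lfun f" for f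
    proof -
      have lp: "lfun p" using p by (simp add: I_def)
      have "f e = f (hit p e)" using Y(3)[OF lp p(2)] by simp
      also have "\<dots> = p (hitr f e)" using functional_hit[OF lp f] by simp
      also have "\<dots> = 0" using p(1) ED(5)[OF f e(1)] by (auto simp: I_def)
      finally show ?thesis .
    qed
    then show ?thesis using functionals_separate[of e] e(2) by simp
  qed
qed (use H in auto)

end

section \<open>The filtration and its exhaustion\<close>

locale tcoalg_corad = tcoalg +
  fixes H :: "'b set"
  assumes H: "bistable H" and simple_H: "\<And>E. simple E \<Longrightarrow> E \<subseteq> H"
begin

lemmas HD = bistableD[OF H]

text \<open>The index is shifted by one: \<open>filt 0\<close> is zero and \<open>filt 1\<close> is
  the coradical. The successor step is the wedge with H, that is, \<Delta>(x) lies in the sum of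
  \<open>filt n\<close> \<otimes> C and C \<otimes> H, expressed by functionals that kill H.\<close>

fun filt :: "nat \<Rightarrow> 'b set" where
  "filt 0 = {0}"
| "filt (Suc n) = {x \<in> range P. \<forall>f. lfun f \<longrightarrow> (\<forall>h\<in>H. f h = 0) \<longrightarrow> hit f x \<in> filt n}"

lemma filt_hstable: "hstable (filt n)"
proof (induction n)
  case 0 show ?case using linD(3)[OF lin_P] by (auto simp: hstable_def range_P linD(3)[OF lin_hit(1)])
next
  case (Suc n)
  note IH = hstableD[OF Suc]
  interpret p: Vector_Spaces.linear s s P by (rule lin_P)
  have "subspace (filt (Suc n))"
    by (rule subspaceI) (auto simp: range_P p.zero p.add p.scale linD[OF lin_hit(1)]
      intro: subspace_0[OF IH(1)] subspace_add[OF IH(1)] subspace_scale[OF IH(1)])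
  moreover have "hit f x \<in> filt (Suc n)" if f: "lfun f" and x: "x \<in> filt (Suc n)" for f x
  proof -
    have "hit g (hit f x) \<in> filt n" if g: "lfun g" "\<forall>h\<in>H. g h = 0" for g
      using x f g lin_conv[OF g(1) f] HD(4)[OF f] by (auto simp: hit_conv conv_hit)
    then show ?thesis by (auto simp: range_P)
  qed
  ultimately show ?case by (auto simp: hstable_def)
qed

lemmas filtD = hstableD[OF filt_hstable]

lemma filt_Suc: "filt n \<subseteq> filt (Suc n)"
  using filtD(2)[of n] filtD(3)[of _ _ n] by auto

lemma filt_mono: "m \<le> n \<Longrightarrow> filt m \<subseteq> filt n"
  by (rule lift_Suc_mono_le[of filt]) (rule filt_Suc)

text \<open>The counit recovers f(x) from \<open>hit f x\<close>, so an x in the first step is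
  killed by every functional that kills H. The converse uses the stability of H under
  \<open>hitr\<close>.\<close>

lemma filt_1: "filt 1 = H"
proof -
  have "x \<in> filt 1 \<longleftrightarrow> x \<in> H" for x
  proof
    assume x: "x \<in> filt 1"
    show "x \<in> H"
    proof (rule ccontr)
      assume "x \<notin> H"
      then obtain f where f: "lfun f" "f x = 1" "\<And>h. h \<in> H \<Longrightarrow> f h = 0" using separate HD(1) by metis
      then have "hit f x = 0" using x by auto
      then show False using ep_hit[OF f(1), of x] f(2) x by (auto simp: range_P linD[OF lin_ep])
    qed
  next
    assume x: "x \<in> H"
    have "hit f x = 0" if f: "lfun f" "\<forall>h\<in>H. f h = 0" for f
    proof (rule functionals_separate)
      fix g assume g: "lfun g"
      then have "g (hit f x) = f (hitr g x)" using functional_hit[OF f(1) g] by simp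
      then show "g (hit f x) = 0" using f HD(5)[OF g x] by auto
    qed
    then show "x \<in> filt 1" using x HD(2) by auto
  qed
  then show ?thesis by blast
qed

lemma filt_legs:
  assumes "x \<in> filt n" "bilin s s s2 B" "\<And>u v. u \<in> filt n \<Longrightarrow> B u v = 0"
  shows "sw x B = 0"
proof -
  obtain C g where C: "\<And>c. lfun (g c)" "dl x = (\<Sum>c\<in>C. tn s s (hit (g c) x) c)"
    by (rule dl_basis[OF subspace_UNIV, of x]) (auto simp: hit_def that)
  have "sw x B = (\<Sum>c\<in>C. B (hit (g c) x) c)" by (rule sw_of_dl[OF C(2) assms(2)])
  then show ?thesis using assms(1,3) filtD(3)[OF C(1)] by simp
qed

text \<open>In a basis adapted to H every term of \<Delta>(x) has its second leg in H or its first
  leg in \<open>filt n\<close>. In this form the filtration drives both convergence arguments: a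
  bilinear error term vanishes on the next step as soon as it vanishes on the previous step and on
  H.\<close>

lemma filt_Suc_legs:
  assumes "x \<in> filt (Suc n)" "bilin s s s2 B" "\<And>u v. u \<in> filt n \<Longrightarrow> B u v = 0" "\<And>u v. v \<in> H \<Longrightarrow> B u v = 0"
  shows "sw x B = 0"
proof -
  obtain C g where C: "\<And>c. lfun (g c)" "\<And>c e. c \<in> C \<Longrightarrow> c \<notin> H \<Longrightarrow> e \<in> H \<Longrightarrow> g c e = 0"
      "dl x = (\<Sum>c\<in>C. tn s s (hit (g c) x) c)"
    by (rule dl_basis[OF HD(1), of x]) (auto simp: hit_def that)
  have "sw x B = (\<Sum>c\<in>C. B (hit (g c) x) c)" by (rule sw_of_dl[OF C(3) assms(2)])
  moreover have "B (hit (g c) x) c = 0" if c: "c \<in> C" for c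
  proof (cases "c \<in> H")
    case False
    then have "hit (g c) x \<in> filt n" using assms(1) C(1)[of c] C(2)[OF c] by auto
    then show ?thesis using assms(3) by simp
  qed (use assms(4) in simp)
  ultimately show ?thesis by simp
qed

text \<open>Let W be the part of V reached by the filtration. If W is proper, induction puts all
  proper subcomodules of V into W, so V/W is simple. Simple right coideals lie in H, hence
  functionals killing H map V into W, and V is reached one step after W.\<close>

lemma hstable_exhausted: "hstable V \<Longrightarrow> fd V \<Longrightarrow> \<exists>n. V \<subseteq> filt n"
proof (induction "dim V" arbitrary: V rule: less_induct)
  case less
  note VD = hstableD[OF less.prems(1)]
  define W where "W = V \<inter> (\<Union>n. filt n)"
  have sup: "\<exists>k. x \<in> filt k \<and> y \<in> filt k" if "x \<in> filt m" "y \<in> filt n" for x y m n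
    using filt_mono[of m "max m n"] filt_mono[of n "max m n"] that by auto
  have W: "hstable W"
    unfolding hstable_def W_def
  proof (intro conjI allI impI)
    show "subspace (V \<inter> (\<Union>n. filt n))"
    proof (intro subspace_inter VD subspaceI)
      show "0 \<in> (\<Union>n. filt n)" using filt.simps(1) by blast
      show "x + y \<in> (\<Union>n. filt n)" if "x \<in> (\<Union>n. filt n)" "y \<in> (\<Union>n. filt n)" for x y
        using that sup filtD(1) subspace_add by (metis UN_E UN_I UNIV_I)
      show "s c x \<in> (\<Union>n. filt n)" if "x \<in> (\<Union>n. filt n)" for x c
        using that filtD(1) subspace_scale by (metis UN_E UN_I UNIV_I)
    qed
    show "V \<inter> (\<Union>n. filt n) \<subseteq> range P" using VD(2) by blast
    fix f v assume f: "lfun f" and v: "v \<in> V \<inter> (\<Union>n. filt n)"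
    then obtain n where "v \<in> filt n" by blast
    then have "hit f v \<in> filt n" by (rule filtD(3)[OF f])
    then show "hit f v \<in> V \<inter> (\<Union>n. filt n)" using VD(3)[OF f] v by blast
  qed
  show ?case
  proof (cases "W = V")
    case True
    obtain B where B: "finite B" "span B = V" using fd_basis[OF less.prems(2) VD(1)] by metis
    have "\<exists>n. Y \<subseteq> filt n" if "finite Y" "Y \<subseteq> V" for Y
      using that
    proof (induction Y)
      case (insert y Y)
      then obtain n where "Y \<subseteq> filt n" by blast
      moreover have "y \<in> (\<Union>n. filt n)" using insert.prems True unfolding W_def by blast
      then obtain m where "y \<in> filt m" by blast
      ultimately show ?case using filt_mono[of m "max m n"] filt_mono[of n "max m n"] by (intro exI[of _ "max m n"]) auto
    qed auto
    then obtain n where "B \<subseteq> filt n" using B span_superset by metis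
    then show ?thesis using B filtD(1) span_minimal by metis
  next
    case False
    have dW: "dim U < dim V" if "subspace U" "U \<subseteq> V" "U \<noteq> V" for U
      using fd_dim_less[OF less.prems(2) VD(1)] that by auto
    have WV: "W \<subseteq> V" by (simp add: W_def)
    obtain n where n: "W \<subseteq> filt n"
      using less.hyps[OF dW W] hstableD(1)[OF W] WV False fd_subset[OF less.prems(2)] by blast
    have max: "U \<subseteq> W" if U: "hstable U" "U \<subseteq> V" "U \<noteq> V" for U
      using less.hyps[OF dW U(1)] hstableD(1)[OF U(1)] U fd_subset[OF less.prems(2)] by (force simp: W_def)
    have "hit f v \<in> W" if v: "v \<in> V" and f: "lfun f" "\<forall>h\<in>H. f h = 0" for f v
    proof (rule ccontr)
      assume "hit f v \<notin> W"
      then obtain g where g: "lfun g" "g (hit f v) = 1" "\<And>w. w \<in> W \<Longrightarrow> g w = 0"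
        using separate hstableD(1)[OF W] by metis
      interpret hg: Vector_Spaces.linear s s "hitr g" by (rule lin_hit(2)[OF g(1)])
      have gW: "hitr g w = 0" if "w \<in> W" for w
      proof (rule functionals_separate)
        fix f assume f: "lfun f"
        show "f (hitr g w) = 0" using functional_hit[OF f g(1)] g(3) hstableD(3)[OF W f that] by simp
      qed
      \<comment> \<open>\<open>hitr g\<close> commutes with all \<open>hit f\<close> and kills W, so
        its image is a right coideal and a quotient of the simple comodule V/W;
        \<open>simple_in_coradical\<close> applies to it.\<close>
      have "hitr g ` V \<subseteq> H"
      proof (rule simple_in_coradical[OF simple_H subspace_0[OF HD(1)]])
        show "hstable (hitr g ` V)"
          unfolding hstable_def using VD g(1) by (auto simp: hg.subspace_image range_P hit_hitr)
        obtain B where B: "finite B" "span B = V" using fd_basis[OF less.prems(2) VD(1)] by metis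
        show "fd (hitr g ` V)"
          unfolding fd_def B(2)[symmetric] hg.span_image[symmetric] using B(1) by blast
        fix m assume m: "m \<in> hitr g ` V" "m \<noteq> 0"
        then obtain u where u: "u \<in> V" "m = hitr g u" by auto
        have "u \<notin> W" using gW u m by auto
        moreover have "u \<in> {hit f u | f. lfun f}" using VD(4)[OF u(1)] lin_ep by (metis (mono_tags, lifting) hit_ep(1) mem_Collect_eq)
        moreover have "{hit f u | f. lfun f} \<subseteq> V" using VD(3) u by auto
        ultimately have "{hit f u | f. lfun f} = V" using max[OF hstable_hits[of u]] by blast
        moreover have "hitr g (hit f u) = hit f m" if "lfun f" for f using hit_hitr[OF that g(1)] u(2) by simp
        ultimately show "hitr g ` V \<subseteq> {hit f m | f. lfun f}" by auto
      qed
      then have "f (hitr g v) = 0" using f v by auto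
      then show False using functional_hit[OF f(1) g(1)] g(2) by auto
    qed
    then have "V \<subseteq> filt (Suc n)" using VD(2) n by auto
    then show ?thesis by blast
  qed
qed

lemma filt_exhausts: assumes "P x = x" obtains n where "x \<in> filt n"
proof -
  have "x \<in> {hit f x | f. lfun f}" using assms lin_ep by (metis (mono_tags, lifting) hit_ep(1) mem_Collect_eq)
  then show ?thesis using hstable_exhausted[OF hstable_hits fd_hits(1), of x] that by blast
qed

end

section \<open>From the records to total operations\<close>

lemma tensor_cong:
  "car V = car V' \<Longrightarrow> scl V = scl V' \<Longrightarrow> car W = car W' \<Longrightarrow> scl W = scl W' \<Longrightarrow> tensor V W = tensor V' W'"
  by (simp add: tensor_def tens_tn)

lemma linear_map_comp_lin:
  assumes "linear_map V W f" "lin s (scl V) p" "\<And>x. p x \<in> car V" "vector_space (scl W)"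
  shows "lin s (scl W) (\<lambda>x. f (p x))"
  using assms by (auto simp: linear_map_def Vector_Spaces.linear_iff)

lemma tcoalg_of:
  assumes C: "is_coalgebra C" and p: "lin (scl C) (scl C) p" "\<And>x. p x \<in> car C" "\<And>x. x \<in> car C \<Longrightarrow> p x = x"
  shows "tcoalg (scl C) p (\<lambda>x. comul C (p x)) (\<lambda>x. counit C (p x))"
proof -
  let ?s = "scl C" let ?d = "\<lambda>x. comul C (p x)" let ?e = "\<lambda>x. counit C (p x)"
  have V: "is_vspace C" and cm: "linear_map C (tensor C C) (comul C)" and cu: "linear_map C base_field (counit C)"
    using C by (simp_all add: is_coalgebra_def)
  have vs: "vector_space ?s" using V by (simp add: is_vspace_def)
  interpret vector_space ?s by (rule vs)
  have ran: "range p = car C" using p by (metis rangeI subsetI subset_antisym image_subset_iff)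
  have ld: "lin ?s pscl ?d" using linear_map_comp_lin[OF cm p(1,2)] by simp
  have le: "lin ?s (*) ?e" using linear_map_comp_lin[OF cu p(1,2)] by (simp add: base_field_def)
  have mem: "comul C x \<in> car (tensor C C)" if "x \<in> car C" for x
    using cm that by (simp add: linear_map_def)
  have memf: "?d x \<in> car (tensor (full ?s) (full ?s))" for x
    using car_tensor_full[OF mem[OF p(2)]] .
  have sl: "lin s0 s2 (\<lambda>x. swt ?s ?s (?d (f x)) F)" if "bilin ?s ?s s2 F" "lin s0 ?s f" for f F and s0 :: "_ \<Rightarrow> 'z::ab_group_add \<Rightarrow> 'z" and s2 :: "_ \<Rightarrow> 'y::ab_group_add \<Rightarrow> 'y"
  proof -
    have "lin s0 s2 (\<lambda>x. tlift ?s ?s F (?d (f x)))"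
      using lin_comp[OF lin_tlift[OF that(1)] lin_comp[OF ld that(2)]] .
    then show ?thesis by (simp add: tlift_swt[OF that(1)] memf)
  qed
  note [lin_rules] = vs vs_pscl vs_field p(1) le lin_comp[OF le] lin_comp[OF p(1)] sl
  have vsp: "vector_space (pscl :: _ \<Rightarrow> ('a, 'b, ('a, 'b, 'b) tensor) tensor \<Rightarrow> _)" by simp
  have conv: "sweedler C C (comul C x) F = swt ?s ?s (comul C x) G"
    if "x \<in> car C" "bilin ?s ?s s3 G" "\<And>v w. v \<in> car C \<Longrightarrow> w \<in> car C \<Longrightarrow> F v w = G v w"
    for x F G and s3 :: "'a \<Rightarrow> 'z::ab_group_add \<Rightarrow> 'z"
    by (rule sweedler_swt[OF V V that(2,3) mem[OF that(1)]])
  have tl: "lin ?s pscl (\<lambda>a. swt ?s ?s t (F a))" if "t \<in> car (tensor (full ?s) (full ?s))" "\<And>y z. lin ?s pscl (\<lambda>x. F x y z)" "\<And>x. bilin ?s ?s pscl (F x)" for t and F :: "'b \<Rightarrow> 'b \<Rightarrow> 'b \<Rightarrow> ('a, 'b, ('a, 'b, 'b) tensor) tensor"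
  proof -
    have "lin ?s pscl (\<lambda>a. tlift ?s ?s (F a) t)" by (rule lin_tlift_param[OF vs vs_pscl]) (rule that(2))
    then show ?thesis using tlift_swt[OF that(3) that(1)] by simp
  qed
  show ?thesis
  proof (rule tcoalg.intro[OF vs], rule tcoalg_axioms.intro, goal_cases)
    case 1 show ?case by (rule p)
  next
    case 2 show ?case using p by simp
  next
    case 3 show ?case by (rule ld)
  next
    case 4 show ?case by (rule le)
  next
    case 5 show ?case using p by simp
  next
    case 6 show ?case using p by simp
  next
    case (7 x)
    have "tensor \<lparr>car = range p, scl = ?s\<rparr> \<lparr>car = range p, scl = ?s\<rparr> = tensor C C"
      by (rule tensor_cong) (simp_all add: ran)
    then show ?case using mem[OF p(2)[of x]] by simp
  next
    case (8 x)
    have b1: "bilin ?s ?s pscl (\<lambda>a1 a2. tn ?s pscl a1 (tn ?s ?s a2 b))"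
      and b2: "bilin ?s ?s pscl (\<lambda>a1 a2. tn ?s pscl b (tn ?s ?s a1 a2))" for b
      by (intro bilinI lin_rules)+
    have B1: "bilin ?s ?s pscl (\<lambda>a b. swt ?s ?s (?d a) (\<lambda>a1 a2. tn ?s pscl a1 (tn ?s ?s a2 b)))"
      by (rule bilinI, (intro lin_rules bilinI)[1], rule tl[OF memf _ b1], intro lin_rules)
    have B2: "bilin ?s ?s pscl (\<lambda>a b. swt ?s ?s (?d b) (\<lambda>b1 b2. tn ?s pscl a (tn ?s ?s b1 b2)))"
      by (rule bilinI, rule tl[OF memf _ b2], intro lin_rules, (intro lin_rules bilinI)[1])
    have "sweedler C C (comul C (p x)) (\<lambda>a b. sweedler C C (comul C a) (\<lambda>a1 a2. tens C (tensor C C) a1 (tens C C a2 b))) =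
        swt ?s ?s (?d x) (\<lambda>a b. swt ?s ?s (?d a) (\<lambda>a1 a2. tn ?s pscl a1 (tn ?s ?s a2 b)))"
      by (rule conv[OF p(2) B1], subst conv[OF _ b1]) (simp_all add: p(3) tens_tn)
    moreover have "sweedler C C (comul C (p x)) (\<lambda>a b. sweedler C C (comul C b) (\<lambda>b1 b2. tens C (tensor C C) a (tens C C b1 b2))) =
        swt ?s ?s (?d x) (\<lambda>a b. swt ?s ?s (?d b) (\<lambda>b1 b2. tn ?s pscl a (tn ?s ?s b1 b2)))"
      by (rule conv[OF p(2) B2], subst conv[OF _ b2]) (simp_all add: p(3) tens_tn)
    ultimately show ?case using C p(2)[of x] unfolding is_coalgebra_def by auto
  next
    case (9 x)
    have B: "bilin ?s ?s ?s (\<lambda>a b. ?s (?e a) b)" by (intro bilinI lin_rules)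
    have "sweedler C C (comul C (p x)) (\<lambda>a b. ?s (counit C a) b) = swt ?s ?s (?d x) (\<lambda>a b. ?s (?e a) b)"
      by (rule conv[OF p(2) B]) (simp add: p(3))
    then show ?case using C p(2)[of x] by (simp add: is_coalgebra_def)
  next
    case (10 x)
    have B: "bilin ?s ?s ?s (\<lambda>a b. ?s (?e b) a)" by (intro bilinI lin_rules)
    have "sweedler C C (comul C (p x)) (\<lambda>a b. ?s (counit C b) a) = swt ?s ?s (?d x) (\<lambda>a b. ?s (?e b) a)"
      by (rule conv[OF p(2) B]) (simp add: p(3))
    then show ?case using C p(2)[of x] by (simp add: is_coalgebra_def)
  qed
qed

lemma bilin_total:
  assumes "bilinear_map V V V f" "lin (scl V) (scl V) p" "\<And>x. p x \<in> car V" "vector_space (scl V)"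
  shows "bilin (scl V) (scl V) (scl V) (\<lambda>x y. f (p x) (p y))"
  using assms by (auto simp: bilin_def bilinear_map_def linear_map_def Vector_Spaces.linear_iff)

lemma tbialg_of:
  assumes A: "is_bialgebra A" and p: "lin (scl A) (scl A) p" "\<And>x. p x \<in> car A" "\<And>x. x \<in> car A \<Longrightarrow> p x = x"
  shows "tbialg (scl A) p (\<lambda>x. comul A (p x)) (\<lambda>x. counit A (p x)) (\<lambda>x y. mul A (p x) (p y)) (unit A)"
proof -
  let ?s = "scl A"
  have alg: "is_algebra A" and C: "is_coalgebra A" using A by (simp_all add: is_bialgebra_def)
  have V: "is_vspace A" using C by (simp add: is_coalgebra_def)
  interpret tcoalg ?s p "\<lambda>x. comul A (p x)" "\<lambda>x. counit A (p x)" by (rule tcoalg_of[OF C p])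
  have bm: "bilin ?s ?s ?s (\<lambda>x y. mul A (p x) (p y))"
    using alg p by (intro bilin_total) (auto simp: is_algebra_def is_vspace_def)
  note [lin_rules] = lin_bilin1[OF bm] lin_bilin2[OF bm] bilinD(2)[OF bm]
  have mulmem: "mul A x y \<in> car A" if "x \<in> car A" "y \<in> car A" for x y
    using alg that by (auto simp: is_algebra_def bilinear_map_def linear_map_def)
  have mem: "comul A (p x) \<in> car (tensor A A)" for x
    using C p(2) by (auto simp: is_coalgebra_def linear_map_def)
  have B: "bilin ?s ?s pscl (\<lambda>y1 y2. tn ?s ?s (mul A (p x1) (p y1)) (mul A (p x2) (p y2)))" for x1 x2
    by (intro bilinI lin_rules)
  have B2: "bilin ?s ?s pscl (\<lambda>x1 x2. sw y (\<lambda>y1 y2. tn ?s ?s (mul A (p x1) (p y1)) (mul A (p x2) (p y2))))" for y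
    by (intro bilinI lin_rules)
  have inner: "sweedler A A (comul A (p y)) (\<lambda>y1 y2. tens A A (mul A v y1) (mul A w y2)) =
      sw y (\<lambda>y1 y2. tn ?s ?s (mul A (p v) (p y1)) (mul A (p w) (p y2)))" if "v \<in> car A" "w \<in> car A" for v w y
    by (rule trans[OF sweedler_swt[OF V V B[of v w] _ mem] sw_swt[OF B]]) (use that p(3) in \<open>simp add: tens_tn\<close>)
  have cmul: "comul A (mul A (p x) (p y)) = swt ?s ?s (comul A (p x)) (\<lambda>x1 x2. sw y (\<lambda>y1 y2. tn ?s ?s (mul A (p x1) (p y1)) (mul A (p x2) (p y2))))" for x y
  proof -
    have "comul A (mul A (p x) (p y)) = sweedler A A (comul A (p x)) (\<lambda>x1 x2. sweedler A A (comul A (p y))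
          (\<lambda>y1 y2. tens A A (mul A x1 y1) (mul A x2 y2)))"
      using A p(2) by (simp add: is_bialgebra_def)
    also have "\<dots> = swt ?s ?s (comul A (p x)) (\<lambda>x1 x2. sw y (\<lambda>y1 y2. tn ?s ?s (mul A (p x1) (p y1)) (mul A (p x2) (p y2))))"
      by (rule sweedler_swt[OF V V B2 _ mem]) (simp add: inner p(3))
    finally show ?thesis .
  qed
  show ?thesis
    by (rule tbialg.intro[OF tcoalg_axioms], rule tbialg_axioms.intro) (use A alg p mulmem bm cmul sw_swt[OF B] in \<open>auto simp: is_algebra_def is_bialgebra_def tens_tn\<close>)
qed

lemma thopf_of:
  assumes A: "is_bialgebra A" and S: "is_antipode A S"
    and p: "lin (scl A) (scl A) p" "\<And>x. p x \<in> car A" "\<And>x. x \<in> car A \<Longrightarrow> p x = x"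
  shows "thopf (scl A) p (\<lambda>x. comul A (p x)) (\<lambda>x. counit A (p x)) (\<lambda>x y. mul A (p x) (p y)) (unit A) (\<lambda>x. S (p x))"
proof -
  let ?s = "scl A"
  interpret tbialg ?s p "\<lambda>x. comul A (p x)" "\<lambda>x. counit A (p x)" "\<lambda>x y. mul A (p x) (p y)" "unit A"
    by (rule tbialg_of[OF A p])
  have C: "is_coalgebra A" using A by (simp_all add: is_bialgebra_def)
  have V: "is_vspace A" using C by (simp add: is_coalgebra_def)
  have mem: "comul A (p x) \<in> car (tensor A A)" for x
    using C p(2) by (auto simp: is_coalgebra_def linear_map_def)
  have lS: "linear_map A A S" using S by (simp add: is_antipode_def)
  have ls: "lin ?s ?s (\<lambda>x. S (p x))" by (rule linear_map_comp_lin[OF lS p(1,2) vs])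
  have Sm: "S x \<in> car A" if "x \<in> car A" for x using lS that by (simp add: linear_map_def)
  note [lin_rules] = lin_comp[OF ls]
  have B: "bilin ?s ?s ?s (\<lambda>a b. mul A (p (S (p a))) (p b))" "bilin ?s ?s ?s (\<lambda>a b. mul A (p a) (p (S (p b))))"
    by (intro bilinI lin_rules)+
  have 1: "sweedler A A (comul A (p x)) (\<lambda>x1 x2. mul A (S x1) x2) = sw x (\<lambda>a b. mul A (p (S (p a))) (p b))" for x
    by (subst sweedler_swt[OF V V B(1) _ mem]) (simp_all add: p(3) Sm sw_swt[OF B(1)])
  have 2: "sweedler A A (comul A (p x)) (\<lambda>x1 x2. mul A x1 (S x2)) = sw x (\<lambda>a b. mul A (p a) (p (S (p b))))" for x
    by (subst sweedler_swt[OF V V B(2) _ mem]) (simp_all add: p(3) Sm sw_swt[OF B(2)])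
  show ?thesis
  proof (rule thopf.intro[OF tbialg_axioms], rule thopf_axioms.intro, goal_cases)
    case (4 x) show ?case using S p(2)[of x] 1[of x] by (simp add: is_antipode_def)
  next
    case (5 x) show ?case using S p(2)[of x] 2[of x] by (simp add: is_antipode_def)
  qed (simp_all add: ls p(2,3) Sm)
qed

section \<open>Subcoalgebras as stable subspaces\<close>

context tcoalg
begin

lemma tensor_span: "t \<in> car (tensor \<lparr>car = E, scl = s\<rparr> \<lparr>car = E, scl = s\<rparr>) \<longleftrightarrow>
    t \<in> module.span pscl {tn s s v w | v w. v \<in> E \<and> w \<in> E}"
  by (simp add: tensor_def tens_tn pscl_def)

text \<open>For the forward direction expand \<open>dl x\<close> in a basis adapted to E. First legs
  are values of \<open>hit\<close> and lie in E; if c is not in E, its coordinate functional kills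
  E, and duality with \<open>hitr\<close> makes the corresponding first leg zero.\<close>

lemma bistable_iff:
  "bistable E \<longleftrightarrow> subspace E \<and> E \<subseteq> range P \<and>
     (\<forall>x\<in>E. dl x \<in> car (tensor \<lparr>car = E, scl = s\<rparr> \<lparr>car = E, scl = s\<rparr>))"
proof (intro iffI conjI ballI)
  assume E: "bistable E"
  note ED = bistableD[OF E]
  show "subspace E" "E \<subseteq> range P" by (rule ED)+
  interpret T: vector_space "pscl :: 'k \<Rightarrow> ('k, 'a, 'a) tensor \<Rightarrow> _" by simp
  fix x assume x: "x \<in> E"
  obtain C g where C: "\<And>c. lfun (g c)" "\<And>c e. c \<in> C \<Longrightarrow> c \<notin> E \<Longrightarrow> e \<in> E \<Longrightarrow> g c e = 0"
      "dl x = (\<Sum>c\<in>C. tn s s (hit (g c) x) c)"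
    by (rule dl_basis[OF ED(1), of x]) (auto simp: hit_def that)
  have "tn s s (hit (g c) x) c \<in> T.span {tn s s v w | v w. v \<in> E \<and> w \<in> E}" if c: "c \<in> C" for c
  proof (cases "c \<in> E")
    case True
    then show ?thesis using ED(4)[OF C(1) x] by (auto intro!: T.span_base)
  next
    case False
    have "hit (g c) x = 0"
    proof (rule functionals_separate)
      fix f assume f: "lfun f"
      show "f (hit (g c) x) = 0" using functional_hit[OF C(1) f, of c x] C(2)[OF c False] ED(5)[OF f x] by simp
    qed
    then show ?thesis using linD(3)[OF bilinD(1)[OF bilin_tn[OF vs vs]]] by (simp add: T.span_zero)
  qed
  then show "dl x \<in> car (tensor \<lparr>car = E, scl = s\<rparr> \<lparr>car = E, scl = s\<rparr>)"
    unfolding tensor_span C(3) by (rule T.span_sum)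
next
  assume E: "subspace E \<and> E \<subseteq> range P \<and> (\<forall>x\<in>E. dl x \<in> car (tensor \<lparr>car = E, scl = s\<rparr> \<lparr>car = E, scl = s\<rparr>))"
  have V: "is_vspace \<lparr>car = E, scl = s\<rparr>" using E by (simp add: is_vspace_def)
  have "hit f x \<in> E" "hitr f x \<in> E" if x: "x \<in> E" and f: "lfun f" for f x
  proof -
    obtain ps where ps: "presents \<lparr>car = E, scl = s\<rparr> \<lparr>car = E, scl = s\<rparr> ps (dl x)"
      using exists_presentation[OF V V] E x by blast
    have b: "bilin s s s (\<lambda>a b. s (f b) a)" "bilin s s s (\<lambda>a b. s (f a) b)"
      by (intro bilinI lin_rules lin_comp[OF f])+
    have sub: "set ps \<subseteq> E \<times> E" using ps by (simp add: presents_def)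
    have "(\<Sum>(v, w)\<leftarrow>ps. s (f w) v) \<in> E \<and> (\<Sum>(v, w)\<leftarrow>ps. s (f v) w) \<in> E"
      using sub E by (induction ps) (auto simp: subspace_0 subspace_add subspace_scale)
    then show "hit f x \<in> E" "hitr f x \<in> E"
      using swt_list[OF b(1) ps] swt_list[OF b(2) ps] by (simp_all add: hit_def hitr_def sw_swt[OF b(1)] sw_swt[OF b(2)])
  qed
  then show "bistable E" using E by (auto simp: bistable_def hstable_def)
qed

text \<open>Shows that the unit is not in the sum of the simple subcoalgebras that avoid it: a functional
  with \<open>f 1 = 1\<close> cannot kill the subcomodule generated by \<open>1\<close>.\<close>

lemma exists_killer:
  assumes one: "\<And>f. lfun f \<Longrightarrow> hit f one = s (f one) one" "one \<in> range P" "one \<noteq> 0"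
    and X: "\<And>c. c \<in> X \<Longrightarrow> \<exists>E. bistable E \<and> c \<in> E \<and> one \<notin> E"
    and x: "x \<in> span X"
  shows "\<exists>f. lfun f \<and> f one = 1 \<and> (\<forall>g. lfun g \<longrightarrow> hit f (hit g x) = 0)"
  using x
proof (induction rule: span_induct_alt)
  case base
  show ?case
  proof -
    obtain f where "lfun f" "f one = 1" using separate[OF subspace_single_0, of one] one(3) by blast
    then show ?thesis by (intro exI[of _ f]) (auto simp: linD(3)[OF lin_hit(1)])
  qed
next
  case (step a c y)
  then obtain f where f: "lfun f" "f one = 1" "\<And>g. lfun g \<Longrightarrow> hit f (hit g y) = 0" by blast
  obtain E where E: "bistable E" "c \<in> E" "one \<notin> E" using X step by blast
  obtain h where h: "lfun h" "h one = 1" "\<And>e. e \<in> E \<Longrightarrow> h e = 0"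
    using separate[OF bistableD(1)[OF E(1)] E(3)] by metis
  have hE: "hit h e = 0" if "e \<in> E" for e
  proof (rule functionals_separate)
    fix g assume g: "lfun g"
    show "g (hit h e) = 0" using functional_hit[OF h(1) g, of e, symmetric] h(3)[OF bistableD(5)[OF E(1) g that]] by simp
  qed
  have "conv f h one = 1" using one(1)[OF h(1)] f h by (simp add: conv_hit linD(2)[OF f(1)])
  moreover have "hit (conv f h) (hit g (s a c + y)) = 0" if g: "lfun g" for g
  proof -
    have "hit h (hit g c) = 0" using hE bistableD(4)[OF E(1) g E(2)] by blast
    moreover have "hit f (hit h (hit g y)) = 0" using f(3)[OF lin_conv[OF h(1) g]] by (simp add: hit_conv[OF h(1) g])
    ultimately show ?thesis
      by (simp add: hit_conv[OF f(1) h(1), symmetric] linD[OF lin_hit(1)[OF g]] linD[OF lin_hit(1)[OF h(1)]] linD[OF lin_hit(1)[OF f(1)]])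
  qed
  ultimately show ?case using lin_conv[OF f(1) h(1)] by blast
qed

end

section \<open>Integrals on and in the coradical\<close>

context tcoalg
begin

text \<open>Any functional with value 1 at the unit that kills all simple subcoalgebras avoiding the
  unit will do. On such a subcoalgebra both translates of the functional vanish, because a test
  functional can be moved to the other leg without leaving the subcoalgebra.\<close>

lemma exists_integral:
  assumes one: "\<And>f. lfun f \<Longrightarrow> hit f one = s (f one) one" "\<And>f. lfun f \<Longrightarrow> hitr f one = s (f one) one"
      "one \<in> range P" "one \<noteq> 0"
  obtains lam where "lfun lam" "lam one = 1"
    "\<And>h. h \<in> span (\<Union>{E. simple E}) \<Longrightarrow> hit lam h = s (lam h) one"
    "\<And>h. h \<in> span (\<Union>{E. simple E}) \<Longrightarrow> hitr lam h = s (lam h) one"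
proof -
  interpret p: Vector_Spaces.linear s s P by (rule lin_P)
  define D where "D = span (\<Union>{E. simple E \<and> one \<notin> E})"
  have "one \<notin> D"
  proof
    assume D: "one \<in> D"
    have "\<exists>f. lfun f \<and> f one = 1 \<and> (\<forall>g. lfun g \<longrightarrow> hit f (hit g one) = 0)"
      by (rule exists_killer[OF one(1,3,4) _ D[unfolded D_def]]) (auto simp: simple_def)
    then obtain f where f: "lfun f" "f one = 1" "hit f (hit ep one) = 0" using lin_ep by blast
    then show False using one by (simp add: range_P)
  qed
  then obtain lam where lam: "lfun lam" "lam one = 1" "\<And>d. d \<in> D \<Longrightarrow> lam d = 0"
    using separate[of D one] unfolding D_def by (metis subspace_span)
  have sone: "bistable (span {one})"
    by (rule bistable_span) (use one(3) in \<open>simp_all add: one(1,2) span_scale span_base\<close>)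
  have *: "hit lam h = s (lam h) one \<and> hitr lam h = s (lam h) one" if E: "simple E" and h: "h \<in> E" for E h
  proof (cases "one \<in> E")
    case True
    \<comment> \<open>The line spanned by the grouplike unit is a subcoalgebra, so a simple
      subcoalgebra containing the unit equals that line.\<close>
    have "span {one} \<subseteq> E" using E True bistableD(1) by (intro span_minimal) (auto simp: simple_def)
    moreover have "span {one} \<noteq> {0}" using one(4) span_base[of one "{one}"] by auto
    ultimately have "E = span {one}" using E sone unfolding simple_def by blast
    then obtain c where "h = s c one" using h by (auto simp: span_singleton)
    then show ?thesis using lam(1,2) one by (simp add: linD[OF lin_hit(1)] linD[OF lin_hit(2)] linD[OF lam(1)])
  next
    case False
    have ED: "E \<subseteq> D" unfolding D_def using E False by (intro order_trans[OF _ span_superset]) auto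
    have bE: "bistable E" using E by (simp add: simple_def)
    have "hit lam h = 0"
    proof (rule functionals_separate)
      fix g assume g: "lfun g"
      show "g (hit lam h) = 0"
        using functional_hit[OF lam(1) g, of h, symmetric] lam(3) bistableD(5)[OF bE g h] ED by auto
    qed
    moreover have "hitr lam h = 0"
    proof (rule functionals_separate)
      fix g assume g: "lfun g"
      show "g (hitr lam h) = 0"
        using functional_hit[OF g lam(1), of h] lam(3) bistableD(4)[OF bE g h] ED by auto
    qed
    ultimately show ?thesis using lam(3) h ED by auto
  qed
  have "hit lam h = s (lam h) one \<and> hitr lam h = s (lam h) one" if "h \<in> span (\<Union>{E. simple E})" for h
    using that
  proof (induction rule: span_induct_alt)
    case base
    show ?case by (simp add: linD[OF lin_hit(1)[OF lam(1)]] linD[OF lin_hit(2)[OF lam(1)]] linD[OF lam(1)])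
  next
    case (step c x y)
    then show ?case using *[of _ x]
      by (auto simp: linD[OF lin_hit(1)[OF lam(1)]] linD[OF lin_hit(2)[OF lam(1)]] linD[OF lam(1)] scale_left_distrib)
  qed
  then show ?thesis using that lam by blast
qed

end

text \<open>The minimal left ideals span H, so one of them is not contained in the kernel of
  \<epsilon>. By minimality it meets this kernel in zero; hence \<epsilon> is injective on it, H
  acts on it through \<epsilon>, and its element of counit 1 is the integral.\<close>

lemma exists_algebra_integral:
  assumes H: "is_bialgebra H" "semisimple_algebra H"
  obtains L where "L \<in> car H" "counit H L = 1" "\<And>x. x \<in> car H \<Longrightarrow> mul H x L = scl H (counit H x) L"
proof -
  have V: "is_vspace H" and alg: "is_algebra H" and cl: "linear_map H base_field (counit H)"
    using H by (simp_all add: is_bialgebra_def is_coalgebra_def)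
  interpret vector_space "scl H" using V by (simp add: is_vspace_def)
  have sub: "subspace (car H)" using V by (simp add: is_vspace_def)
  have e: "counit H (x + y) = counit H x + counit H y" "counit H (scl H c x) = c * counit H x"
    if "x \<in> car H" "y \<in> car H" for x y c
    using cl that by (simp_all add: linear_map_def base_field_def)
  have e0: "counit H 0 = 0" using e(2)[OF subspace_0[OF sub] subspace_0[OF sub], of 0] by simp
  have em: "counit H (mul H x y) = counit H x * counit H y" if "x \<in> car H" "y \<in> car H" for x y
    using H(1) that by (simp add: is_bialgebra_def)
  define K where "K = {x \<in> car H. counit H x = 0}"
  have K: "subspace K"
    by (rule subspaceI) (auto simp: K_def e e0 subspace_0[OF sub] subspace_add[OF sub] subspace_scale[OF sub])
  have "unit H \<in> car H" "unit H \<notin> K" using H by (auto simp: K_def is_bialgebra_def is_algebra_def)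
  then have "\<not> \<Union>{I. minimal_left_ideal H I} \<subseteq> K"
    using span_minimal[OF _ K] H(2) unfolding semisimple_algebra_def by blast
  then obtain I x where I: "minimal_left_ideal H I" "x \<in> I" "x \<notin> K" by blast
  have lI: "left_ideal H I" "I \<subseteq> car H" "subspace I" using I by (auto simp: minimal_left_ideal_def left_ideal_def)
  have "left_ideal H (I \<inter> K)"
    unfolding left_ideal_def
  proof (intro conjI ballI)
    show "subspace (I \<inter> K)" using lI K by (intro subspace_inter)
    fix a y assume "a \<in> car H" "y \<in> I \<inter> K"
    then show "mul H a y \<in> I \<inter> K" using lI em by (auto simp: left_ideal_def K_def)
  qed (use lI in auto)
  then have IK: "I \<inter> K = {0}" using I unfolding minimal_left_ideal_def by blast
  have x: "x \<in> car H" "counit H x \<noteq> 0" using I lI by (auto simp: K_def)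
  define L where "L = scl H (1 / counit H x) x"
  have L: "L \<in> I" "L \<in> car H" "counit H L = 1"
    using x I lI subspace_scale[OF lI(3)] subspace_scale[OF sub] e(2)[OF x(1) x(1)] by (auto simp: L_def)
  have "mul H y L = scl H (counit H y) L" if y: "y \<in> car H" for y
  proof -
    have m: "mul H y L \<in> I" "scl H (counit H y) L \<in> I"
      using lI L y subspace_scale[OF lI(3)] by (auto simp: left_ideal_def)
    then have d: "mul H y L - scl H (counit H y) L \<in> I" using subspace_diff[OF lI(3)] by blast
    have "counit H (mul H y L) = counit H (mul H y L - scl H (counit H y) L) + counit H (scl H (counit H y) L)"
      using e(1)[of "mul H y L - scl H (counit H y) L" "scl H (counit H y) L"] d m lI by auto
    then have "mul H y L - scl H (counit H y) L \<in> I \<inter> K"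
      using d lI em[OF y L(2)] L e(2)[OF L(2) L(2)] by (auto simp: K_def)
    then show ?thesis using IK by auto
  qed
  then show ?thesis using that L by blast
qed

lemma (in tcoalg) sw_coeff: "vector_space s2 \<Longrightarrow> sw x (\<lambda>a b. s2 (F a b) c) = s2 (sw x F) c"
  by (rule sw_hom[OF lin_scale1[OF _ lin_id[OF vs_field]], symmetric])

section \<open>A bilinear coalgebra projection\<close>

text \<open>A bilinear map \<open>p\<close> onto \<open>H = range Q\<close> fails to be a coalgebra map by
  \<open>D p a = \<Delta>(p a) - p a\<^sub>1 \<otimes> p a\<^sub>2\<close>, which is a Hochschild 2-cocycle.  The form \<open>theta\<close> comes from an ad-invariant integral and
  contracts \<open>D p\<close> to a correction \<open>corr p\<close>, such that the defect of \<open>p + corr p\<close> is quadratic in \<open>D p\<close>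
  (Newton's method).  Hence the iterates stabilise on each step of the coradical filtration.\<close>

locale newton = tbialg s P dl ep mu one + tcoalg_corad s P dl ep "range Q"
  for s :: "'k::field \<Rightarrow> 'a::ab_group_add \<Rightarrow> 'a" and P dl ep mu one and Q :: "'a \<Rightarrow> 'a" +
  fixes theta :: "'a \<Rightarrow> 'a \<Rightarrow> 'k"
  assumes lin_Q: "lin s s Q" and Q_P [simp]: "Q (P x) = Q x" "P (Q x) = Q x" "Q (Q x) = Q x"
    and sw_Q0: "dl (Q x) = sw (Q x) (\<lambda>a b. tn s s (Q a) (Q b))"
    and Q_mu [simp]: "Q (mu (Q x) (Q y)) = mu (Q x) (Q y)" and Q_one [simp]: "Q one = one"
    and bilin_theta: "bilin s s (*) theta"
    and theta_col: "sw (Q x) (\<lambda>a b. s (theta b (Q y)) a) = sw (Q y) (\<lambda>a b. s (theta (Q x) a) b)"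
    and theta_com: "sw (Q x) theta = ep (Q x)"
    and theta_mul: "sw (Q h) (\<lambda>h1 h2. theta (mu h1 (Q x)) (mu h2 (Q y))) = ep (Q h) * theta (Q x) (Q y)"
      "sw (Q h) (\<lambda>h1 h2. theta (mu (Q x) h1) (mu (Q y) h2)) = ep (Q h) * theta (Q x) (Q y)"
begin

declare filt.simps(2) [simp del]

lemma lin_theta [lin_rules]: "lin s0 s f \<Longrightarrow> lin s0 (*) (\<lambda>x. theta (f x) c)"
  "lin s0 s f \<Longrightarrow> lin s0 (*) (\<lambda>x. theta c (f x))" "lin s (*) (theta c)"
  using lin_bilin1[OF bilin_theta] lin_bilin2[OF bilin_theta] bilinD(2)[OF bilin_theta] by blast+

lemma lin_Q' [lin_rules]: "lin s0 s f \<Longrightarrow> lin s0 s (\<lambda>x. Q (f x))"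
  using lin_comp lin_Q by blast

lemmas [lin_rules] = lin_Q

text \<open>The coproduct of an element of H has legs in H, but the presentation fixed in
  \<open>sw\<close> need only have legs in \<open>range P\<close>. Passing to legs in H changes the
  presentation, whence the bilinearity of F and G.\<close>

lemma sw_Q_cong:
  assumes "bilin s s s2 F" "bilin s s s2 G" "\<And>a b. F (Q a) (Q b) = G (Q a) (Q b)"
  shows "sw (Q h) F = sw (Q h) G"
proof -
  have *: "sw (Q h) K = sw (Q h) (\<lambda>a b. K (Q a) (Q b))" if K: "bilin s s s2 K" for K
  proof -
    have "sw (Q h) K = tlift s s K (dl (Q h))"
      using sw_hom[OF lin_tlift[OF K], of "Q h" "tn s s"] by (simp add: sw_tn tlift_tn[OF K])
    then show ?thesis unfolding sw_Q0 by (simp add: sw_hom[OF lin_tlift[OF K]] tlift_tn[OF K])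
  qed
  show ?thesis using *[OF assms(1)] *[OF assms(2)] assms(3) by simp
qed

text \<open>The defect tensor paired with a bilinear F. Keeping F as an argument lets defects be
  nested in each other and in Sweedler sums like ordinary coproducts.\<close>

definition D :: "('a \<Rightarrow> 'a) \<Rightarrow> 'a \<Rightarrow> ('a \<Rightarrow> 'a \<Rightarrow> 'c::ab_group_add) \<Rightarrow> 'c" where
  "D p a F = sw (p a) F - sw a (\<lambda>x y. F (p x) (p y))"

text \<open>The contracting homotopy of a coseparable coalgebra, applied to the cocycle: for legs u,
  v of the defect at a_1, the second leg v is contracted by \<theta> against p(a_2).\<close>

definition corr :: "('a \<Rightarrow> 'a) \<Rightarrow> 'a \<Rightarrow> 'a" where
  "corr p a = sw a (\<lambda>x y. D p x (\<lambda>u v. s (theta v (p y)) u))"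

text \<open>The invariants of the iteration: H-bilinear projections onto H that preserve the counit.
  Comultiplicativity is what the iteration adds to them.\<close>

definition good :: "('a \<Rightarrow> 'a) \<Rightarrow> bool" where
  "good p \<longleftrightarrow> lin s s p \<and> (\<forall>a. Q (p a) = p a) \<and> (\<forall>a. ep (p a) = ep a) \<and> (\<forall>a. p (P a) = p a) \<and>
     (\<forall>h a. p (mu (Q h) a) = mu (Q h) (p a)) \<and> (\<forall>h a. p (mu a (Q h)) = mu (p a) (Q h)) \<and> (\<forall>a. p (Q a) = Q a)"

context
  fixes p assumes good: "good p"
begin

lemma p: "lin s s p" "Q (p a) = p a" "ep (p a) = ep a" "p (P a) = p a"
  "p (mu (Q h) a) = mu (Q h) (p a)" "p (mu a (Q h)) = mu (p a) (Q h)" "p (Q a) = Q a"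
  using good by (auto simp: good_def)

lemma lin_p: "lin s0 s f \<Longrightarrow> lin s0 s (\<lambda>x. p (f x))" using lin_comp p(1) by blast

lemma D_hom: "lin s1 s2 g \<Longrightarrow> g (D p a F) = D p a (\<lambda>u v. g (F u v))"
  by (simp add: D_def linD sw_hom)

lemma D_sw: "D p a (\<lambda>u v. sw b (\<lambda>x y. F u v x y)) = sw b (\<lambda>x y. D p a (\<lambda>u v. F u v x y))"
  by (simp add: D_def sw_sum sw_swap[of _ b])

lemma D_sum: "D p a (\<lambda>u v. F u v + G u v) = D p a F + D p a G" "D p a (\<lambda>u v. F u v - G u v) = D p a F - D p a G"
  by (simp_all add: D_def sw_sum)

lemma D_scale: "vector_space s2 \<Longrightarrow> D p a (\<lambda>u v. s2 c (F u v)) = s2 c (D p a F)"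
  by (rule D_hom[OF lin_scale2[OF lin_id], symmetric])

lemma lin_D_arg: assumes "bilin s s s2 F" "lin s0 s f" shows "lin s0 s2 (\<lambda>a. D p (f a) F)"
  unfolding D_def by (intro lin_rules bilinI assms lin_p lin_bilin1[OF assms(1)] lin_bilin2[OF assms(1)])

lemma lin_D_fun: "vector_space s0 \<Longrightarrow> vector_space s2 \<Longrightarrow> (\<And>y z. lin s0 s2 (\<lambda>x. F x y z)) \<Longrightarrow> lin s0 s2 (\<lambda>x. D p c (F x))"
  unfolding D_def by (intro lin_rules)

lemma D_P: "D p (P a) F = D p a F"
  by (simp add: D_def p)

lemma D_Q_cong:
  assumes "bilin s s s2 F" "bilin s s s2 G" "\<And>u v. F (Q u) (Q v) = G (Q u) (Q v)"
  shows "D p a F = D p a G"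
  using sw_Q_cong[OF assms, of "p a"] assms(3)[of "p _" "p _"] by (simp add: D_def p)

lemma D_tn: "bilin s s s2 F \<Longrightarrow> D p a F = tlift s s F (D p a (tn s s))"
  by (simp add: D_hom[OF lin_tlift] tlift_tn)

lemma D_zero: "D p a (\<lambda>u v. 0) = 0"
  by (simp add: D_def sw_sum)

lemmas Drules = lin_rules lin_p lin_D_arg lin_D_fun bilinI p(1)

lemma lin_corr: "lin s s (corr p)"
  unfolding corr_def[abs_def] by (intro Drules)

text \<open>Coassociativity at p(a) and at a, subtracted from each other. The identity is exact even
  though p is not comultiplicative, so error terms enter only through \<theta> in
  \<open>newton_step\<close>.\<close>

lemma D_cocycle:
  assumes G: "\<And>y z. lin s s2 (\<lambda>x. G x y z)" "\<And>x z. lin s s2 (\<lambda>y. G x y z)" "\<And>x y. lin s s2 (\<lambda>z. G x y z)"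
  shows "D p a (\<lambda>u v. sw u (\<lambda>u1 u2. G u1 u2 v)) = D p a (\<lambda>u v. sw v (\<lambda>v1 v2. G u v1 v2)) +
    sw a (\<lambda>x y. D p y (\<lambda>u v. G (p x) u v)) - sw a (\<lambda>x y. D p x (\<lambda>u v. G u v (p y)))"
proof -
  have 1: "sw (p a) (\<lambda>u v. sw u (\<lambda>u1 u2. G u1 u2 v)) = sw (p a) (\<lambda>u v. sw v (\<lambda>v1 v2. G u v1 v2))"
    by (rule coassoc[where ?s2.0=s2]; rule G)
  have 2: "sw a (\<lambda>x y. sw x (\<lambda>x1 x2. G (p x1) (p x2) (p y))) = sw a (\<lambda>x y. sw y (\<lambda>y1 y2. G (p x) (p y1) (p y2)))"
    by (rule coassoc[where ?s2.0=s2]; intro lin_comp[OF G(1) p(1)] lin_comp[OF G(2) p(1)] lin_comp[OF G(3) p(1)])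
  show ?thesis by (simp add: D_def sw_sum 1 2)
qed

lemma theta_p: "sw z (\<lambda>x y. theta (p x) (p y)) = ep z - D p z theta"
  using theta_com[of "p z"] by (simp add: D_def p)

text \<open>Expand the coproduct of the correction by \<open>D_cocycle\<close>. The terms linear in
  the defect are those expected from the linearised equation: they cancel \<open>D p a\<close> and
  account for the products of p with its correction. The last two sums contain the defect
  twice.\<close>

lemma newton_step:
  fixes F :: "'a \<Rightarrow> 'a \<Rightarrow> 'c::ab_group_add"
  assumes F: "bilin s s s2 F"
  shows "sw (corr p a) F = sw a (\<lambda>x y. F (p x) (corr p y)) + sw a (\<lambda>x y. F (corr p x) (p y)) - D p a F
    + sw a (\<lambda>x y. D p x (\<lambda>u v. s2 (D p y theta) (F u v)))
    + sw a (\<lambda>x y. D p x (\<lambda>u v. D p y (\<lambda>c d. s2 (theta v c) (F u d))))"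
proof -
  have vs2: "vector_space s2" using F lin_vs bilinD by blast
  note R = Drules vs2 lin_bilin1[OF F] lin_bilin2[OF F]
  have 0: "sw (corr p a) F = sw a (\<lambda>x y. D p x (\<lambda>u v. sw u (\<lambda>u1 u2. s2 (theta v (p y)) (F u1 u2))))"
  proof -
    have g: "lin s s2 (\<lambda>z. sw z F)" by (intro R F)
    show ?thesis unfolding corr_def sw_hom[OF g] D_hom[OF g] by (simp add: linD(2)[OF g] sw_scale[OF vs2])
  qed
  \<comment> \<open>On H, colinearity of \<theta> moves the coproduct from v to p(y). Splitting
    \<Delta>(p y) into p(y_1) \<otimes> p(y_2) and the defect at y gives a linear and a quadratic
    term.\<close>
  have t1: "D p x (\<lambda>u v. sw v (\<lambda>v1 v2. s2 (theta v2 (p y)) (F u v1))) =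
      D p x (\<lambda>u v. D p y (\<lambda>c d. s2 (theta v c) (F u d))) +
      sw y (\<lambda>y1 y2. D p x (\<lambda>u v. s2 (theta v (p y1)) (F u (p y2))))" for x y
  proof -
    have "D p x (\<lambda>u v. sw v (\<lambda>v1 v2. s2 (theta v2 (p y)) (F u v1))) =
        D p x (\<lambda>u v. sw (p y) (\<lambda>c d. s2 (theta v c) (F u d)))"
    proof (rule D_Q_cong[where ?s2.0=s2])
      fix u v
      have "F (Q u) (sw (Q v) (\<lambda>v1 v2. s (theta v2 (Q (p y))) v1)) = F (Q u) (sw (Q (p y)) (\<lambda>c d. s (theta (Q v) c) d))"
        by (simp only: theta_col)
      then show "sw (Q v) (\<lambda>v1 v2. s2 (theta v2 (p y)) (F (Q u) v1)) = sw (p y) (\<lambda>c d. s2 (theta (Q v) c) (F (Q u) d))"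
        by (simp add: sw_hom[OF bilinD(2)[OF F]] linD(2)[OF bilinD(2)[OF F]] p)
    qed (intro R)+
    also have "\<dots> = D p x (\<lambda>u v. D p y (\<lambda>c d. s2 (theta v c) (F u d)) + sw y (\<lambda>y1 y2. s2 (theta v (p y1)) (F u (p y2))))"
      by (simp add: D_def[of p y])
    finally show ?thesis by (simp add: D_sum D_sw)
  qed
  have t2: "sw a (\<lambda>x y. sw x (\<lambda>x1 x2. D p x2 (\<lambda>u v. s2 (theta v (p y)) (F (p x1) u)))) =
      sw a (\<lambda>x y. F (p x) (corr p y))"
  proof -
    have "sw a (\<lambda>x y. sw x (\<lambda>x1 x2. D p x2 (\<lambda>u v. s2 (theta v (p y)) (F (p x1) u)))) =
        sw a (\<lambda>x z. sw z (\<lambda>x2 y. D p x2 (\<lambda>u v. s2 (theta v (p y)) (F (p x) u))))"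
      by (intro coassoc[where ?s2.0=s2] R)
    then show ?thesis
      unfolding corr_def sw_hom[OF bilinD(2)[OF F]] D_hom[OF bilinD(2)[OF F]] by (simp add: linD(2)[OF bilinD(2)[OF F]])
  qed
  \<comment> \<open>After regrouping, \<theta> meets p(a_2) and p(a_3). By \<open>theta_p\<close>
    this is \<epsilon> minus a defect: the \<epsilon> part gives back \<open>D p a F\<close>, the
    rest is quadratic.\<close>
  have t3: "sw a (\<lambda>x y. sw x (\<lambda>x1 x2. D p x1 (\<lambda>u v. s2 (theta (p x2) (p y)) (F u v)))) =
      D p a F - sw a (\<lambda>x y. D p x (\<lambda>u v. s2 (D p y theta) (F u v)))"
  proof -
    have "sw a (\<lambda>x y. sw x (\<lambda>x1 x2. D p x1 (\<lambda>u v. s2 (theta (p x2) (p y)) (F u v)))) =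
        sw a (\<lambda>x z. sw z (\<lambda>x2 y. D p x (\<lambda>u v. s2 (theta (p x2) (p y)) (F u v))))"
      by (intro coassoc[where ?s2.0=s2] R)
    also have "\<dots> = sw a (\<lambda>x z. D p x (\<lambda>u v. s2 (ep z - D p z theta) (F u v)))"
      unfolding theta_p[symmetric] sw_coeff[OF vs2, symmetric] D_sw ..
    also have "\<dots> = sw a (\<lambda>x z. s2 (ep z) (D p x F)) - sw a (\<lambda>x y. D p x (\<lambda>u v. s2 (D p y theta) (F u v)))"
      by (simp add: linD(4)[OF lin_scale1[OF vs2 lin_id[OF vs_field]]] D_sum D_scale[OF vs2] sw_sum)
    also have "sw a (\<lambda>x z. s2 (ep z) (D p x F)) = D p a F"
      by (subst counit_r[where ?s2.0=s2]) (intro R F, simp add: D_P)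
    finally show ?thesis .
  qed
  have t4: "sw a (\<lambda>x y. sw y (\<lambda>y1 y2. D p x (\<lambda>u v. s2 (theta v (p y1)) (F u (p y2))))) = sw a (\<lambda>x y. F (corr p x) (p y))"
  proof -
    have "sw a (\<lambda>z y. sw z (\<lambda>x y1. D p x (\<lambda>u v. s2 (theta v (p y1)) (F u (p y))))) =
      sw a (\<lambda>x y. sw y (\<lambda>y1 y2. D p x (\<lambda>u v. s2 (theta v (p y1)) (F u (p y2)))))"
      by (intro coassoc[where ?s2.0=s2] R)
    then show ?thesis
      unfolding corr_def sw_hom[OF bilinD(1)[OF F]] D_hom[OF bilinD(1)[OF F]] by (simp add: linD(2)[OF bilinD(1)[OF F]])
  qed
  have "sw (corr p a) F = sw a (\<lambda>x y. D p x (\<lambda>u v. sw v (\<lambda>v1 v2. s2 (theta v2 (p y)) (F u v1))) +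
      sw x (\<lambda>x1 x2. D p x2 (\<lambda>u v. s2 (theta v (p y)) (F (p x1) u))) -
      sw x (\<lambda>x1 x2. D p x1 (\<lambda>u v. s2 (theta (p x2) (p y)) (F u v))))"
    unfolding 0 by (subst D_cocycle[where ?s2.0=s2]) (intro R, simp)+
  also have "\<dots> = sw a (\<lambda>x y. D p x (\<lambda>u v. D p y (\<lambda>c d. s2 (theta v c) (F u d)))) + sw a (\<lambda>x y. F (corr p x) (p y))
      + sw a (\<lambda>x y. F (p x) (corr p y)) - (D p a F - sw a (\<lambda>x y. D p x (\<lambda>u v. s2 (D p y theta) (F u v))))"
    by (simp add: sw_sum t1 t2 t3 t4)
  finally show ?thesis by (simp add: algebra_simps)
qed

lemma D_mul_left:
  assumes F: "bilin s s s2 F"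
  shows "D p (mu (Q h) a) F = sw (Q h) (\<lambda>h1 h2. D p a (\<lambda>u v. F (mu h1 u) (mu h2 v)))"
proof -
  have vs2: "vector_space s2" using F lin_vs bilinD by blast
  note R = Drules vs2 lin_bilin1[OF F] lin_bilin2[OF F]
  have "sw (Q h) (\<lambda>h1 h2. sw a (\<lambda>x y. F (p (mu h1 x)) (p (mu h2 y)))) =
      sw (Q h) (\<lambda>h1 h2. sw a (\<lambda>x y. F (mu h1 (p x)) (mu h2 (p y))))"
    by (rule sw_Q_cong[where ?s2.0=s2]; (intro R | simp add: p))
  moreover have "sw (mu (Q h) a) (\<lambda>x y. F (p x) (p y)) = sw (Q h) (\<lambda>h1 h2. sw a (\<lambda>x y. F (p (mu h1 x)) (p (mu h2 y))))"
    by (intro sw_mu[where ?s2.0=s2] R)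
  ultimately show ?thesis by (simp add: D_def p sw_mu[OF F] sw_sum)
qed

lemma D_mul_right:
  assumes F: "bilin s s s2 F"
  shows "D p (mu a (Q h)) F = sw (Q h) (\<lambda>h1 h2. D p a (\<lambda>u v. F (mu u h1) (mu v h2)))"
proof -
  have vs2: "vector_space s2" using F lin_vs bilinD by blast
  note R = Drules vs2 lin_bilin1[OF F] lin_bilin2[OF F]
  have "sw (Q h) (\<lambda>h1 h2. sw a (\<lambda>x y. F (p (mu x h1)) (p (mu y h2)))) =
      sw (Q h) (\<lambda>h1 h2. sw a (\<lambda>x y. F (mu (p x) h1) (mu (p y) h2)))"
    by (rule sw_Q_cong[where ?s2.0=s2]; (intro R | simp add: p))
  moreover have "sw (mu a (Q h)) (\<lambda>x y. F (p x) (p y)) = sw (Q h) (\<lambda>h1 h2. sw a (\<lambda>x y. F (p (mu x h1)) (p (mu y h2))))"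
    by (subst sw_swap, intro sw_mu[where ?s2.0=s2] R)
  ultimately show ?thesis by (simp add: D_def p sw_mu[OF F] sw_sum sw_swap[of "p a"])
qed

text \<open>The factor h spreads as h_1 u, h_2 v and h_3 p(y). Ad-invariance of \<theta> removes h_2
  and h_3, and h_1 remains in front.\<close>

lemma corr_left: "corr p (mu (Q h) a) = mu (Q h) (corr p a)"
proof -
  have "sw (Q h) (\<lambda>h1 h2. sw a (\<lambda>x y. D p (mu h1 x) (\<lambda>u v. s (theta v (p (mu h2 y))) u))) =
     sw (Q h) (\<lambda>h1 h2. sw h1 (\<lambda>k l. sw a (\<lambda>x y. D p x (\<lambda>u v. s (theta (mu l v) (mu h2 (p y))) (mu k u)))))"
  proof (rule sw_Q_cong[where ?s2.0=s])
    fix b c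
    have "D p (mu (Q b) x) (\<lambda>u v. s (theta v (p (mu (Q c) y))) u) =
        sw (Q b) (\<lambda>k l. D p x (\<lambda>u v. s (theta (mu l v) (mu (Q c) (p y))) (mu k u)))" for x y
      by (subst D_mul_left[where ?s2.0=s]) (intro Drules, simp add: p)
    then show "sw a (\<lambda>x y. D p (mu (Q b) x) (\<lambda>u v. s (theta v (p (mu (Q c) y))) u)) =
        sw (Q b) (\<lambda>k l. sw a (\<lambda>x y. D p x (\<lambda>u v. s (theta (mu l v) (mu (Q c) (p y))) (mu k u))))"
      by (simp add: sw_swap[of a])
  qed (intro Drules)+
  also have "\<dots> = sw (Q h) (\<lambda>k h'. sw h' (\<lambda>l h2. sw a (\<lambda>x y. D p x (\<lambda>u v. s (theta (mu l v) (mu h2 (p y))) (mu k u)))))"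
    by (intro coassoc[where ?s2.0=s] Drules)
  also have "\<dots> = sw (Q h) (\<lambda>k h'. s (ep h') (mu k (corr p a)))"
  proof (rule sw_Q_cong[where ?s2.0=s])
    fix b c
    have 1: "D p x (\<lambda>u v. sw (Q c) (\<lambda>l h2. s (theta (mu l v) (mu h2 (p y))) (mu (Q b) u))) =
        D p x (\<lambda>u v. s (ep (Q c) * theta v (p y)) (mu (Q b) u))" for x y
    proof (rule D_Q_cong[where ?s2.0=s])
      fix u v
      show "sw (Q c) (\<lambda>l h2. s (theta (mu l (Q v)) (mu h2 (p y))) (mu (Q b) (Q u))) =
          s (ep (Q c) * theta (Q v) (p y)) (mu (Q b) (Q u))"
        using theta_mul(1)[of c v "p y"] by (simp add: p sw_coeff[OF vs])
    qed (intro Drules)+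
    have "sw (Q c) (\<lambda>l h2. sw a (\<lambda>x y. D p x (\<lambda>u v. s (theta (mu l v) (mu h2 (p y))) (mu (Q b) u)))) =
        sw a (\<lambda>x y. D p x (\<lambda>u v. s (ep (Q c) * theta v (p y)) (mu (Q b) u)))"
      by (simp only: sw_swap[of "Q c"] D_sw[symmetric] 1)
    then show "sw (Q c) (\<lambda>l h2. sw a (\<lambda>x y. D p x (\<lambda>u v. s (theta (mu l v) (mu h2 (p y))) (mu (Q b) u)))) =
        s (ep (Q c)) (mu (Q b) (corr p a))"
      by (simp add: corr_def sw_hom[OF lin_mu0] D_hom[OF lin_mu0] linD(2)[OF lin_mu0] sw_scale[OF vs] D_scale[OF vs] flip: scale_scale)
  qed (intro Drules)+
  also have "\<dots> = mu (Q h) (corr p a)"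
    by (subst counit_r[where ?s2.0=s]) (intro Drules, simp)
  finally show ?thesis unfolding corr_def by (subst sw_mu[where ?s2.0=s]) (intro Drules, simp)
qed

lemma corr_right: "corr p (mu a (Q h)) = mu (corr p a) (Q h)"
proof -
  have lmu: "lin s s (\<lambda>x. mu x c)" for c by (intro Drules)
  have "sw (Q h) (\<lambda>h1 h2. sw a (\<lambda>x y. D p (mu x h1) (\<lambda>u v. s (theta v (p (mu y h2))) u))) =
     sw (Q h) (\<lambda>h1 h2. sw h1 (\<lambda>k l. sw a (\<lambda>x y. D p x (\<lambda>u v. s (theta (mu v l) (mu (p y) h2)) (mu u k)))))"
  proof (rule sw_Q_cong[where ?s2.0=s])
    fix b c
    have "D p (mu x (Q b)) (\<lambda>u v. s (theta v (p (mu y (Q c)))) u) =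
        sw (Q b) (\<lambda>k l. D p x (\<lambda>u v. s (theta (mu v l) (mu (p y) (Q c))) (mu u k)))" for x y
      by (subst D_mul_right[where ?s2.0=s]) (intro Drules, simp add: p)
    then show "sw a (\<lambda>x y. D p (mu x (Q b)) (\<lambda>u v. s (theta v (p (mu y (Q c)))) u)) =
        sw (Q b) (\<lambda>k l. sw a (\<lambda>x y. D p x (\<lambda>u v. s (theta (mu v l) (mu (p y) (Q c))) (mu u k))))"
      by (simp add: sw_swap[of a])
  qed (intro Drules)+
  also have "\<dots> = sw (Q h) (\<lambda>k h'. sw h' (\<lambda>l h2. sw a (\<lambda>x y. D p x (\<lambda>u v. s (theta (mu v l) (mu (p y) h2)) (mu u k)))))"
    by (intro coassoc[where ?s2.0=s] Drules)
  also have "\<dots> = sw (Q h) (\<lambda>k h'. s (ep h') (mu (corr p a) k))"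
  proof (rule sw_Q_cong[where ?s2.0=s])
    fix b c
    have 1: "D p x (\<lambda>u v. sw (Q c) (\<lambda>l h2. s (theta (mu v l) (mu (p y) h2)) (mu u (Q b)))) =
        D p x (\<lambda>u v. s (ep (Q c) * theta v (p y)) (mu u (Q b)))" for x y
    proof (rule D_Q_cong[where ?s2.0=s])
      fix u v
      show "sw (Q c) (\<lambda>l h2. s (theta (mu (Q v) l) (mu (p y) h2)) (mu (Q u) (Q b))) =
          s (ep (Q c) * theta (Q v) (p y)) (mu (Q u) (Q b))"
        using theta_mul(2)[of c v "p y"] by (simp add: p sw_coeff[OF vs])
    qed (intro Drules)+
    have "sw (Q c) (\<lambda>l h2. sw a (\<lambda>x y. D p x (\<lambda>u v. s (theta (mu v l) (mu (p y) h2)) (mu u (Q b))))) =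
        sw a (\<lambda>x y. D p x (\<lambda>u v. s (ep (Q c) * theta v (p y)) (mu u (Q b))))"
      by (simp only: sw_swap[of "Q c"] D_sw[symmetric] 1)
    then show "sw (Q c) (\<lambda>l h2. sw a (\<lambda>x y. D p x (\<lambda>u v. s (theta (mu v l) (mu (p y) h2)) (mu u (Q b))))) =
        s (ep (Q c)) (mu (corr p a) (Q b))"
      by (simp add: corr_def sw_hom[OF lmu] D_hom[OF lmu] linD(2)[OF lmu] sw_scale[OF vs] D_scale[OF vs] flip: scale_scale)
  qed (intro Drules)+
  also have "\<dots> = mu (corr p a) (Q h)"
    by (subst counit_r[where ?s2.0=s]) (intro Drules, simp)
  finally show ?thesis unfolding corr_def
    by (subst sw_mu[where ?s2.0=s], intro Drules, subst sw_swap, simp)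
qed

lemma D_Q: assumes F: "bilin s s s2 F" shows "D p (Q a) F = 0"
proof -
  have "sw (Q a) F = sw (Q a) (\<lambda>x y. F (p x) (p y))"
    by (rule sw_Q_cong[OF F]) (intro Drules lin_bilin1[OF F] lin_bilin2[OF F], simp add: p)
  then show ?thesis by (simp add: D_def p)
qed

text \<open>Contracting the first leg by \<epsilon> turns both summands of the defect into p(a).
  Hence the correction has counit 0.\<close>

lemma ep_D: "D p a (\<lambda>u v. s (ep u * c) v) = 0"
proof -
  have 1: "sw (p a) (\<lambda>u v. s (ep u) (s c v)) = s c (P (p a))"
    by (rule counit_l) (intro Drules)
  have 2: "sw a (\<lambda>x y. s (ep x) (s c (p y))) = s c (p (P a))"
    by (rule counit_l) (intro Drules)
  have "P (p a) = p a" using Q_P(2)[of "p a"] by (simp add: p)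
  then show ?thesis using 1 2 by (simp add: D_def p)
qed

lemma ep_corr: "ep (corr p a) = 0"
proof -
  have "D p x (\<lambda>u v. theta v (p y) * ep u) = theta (D p x (\<lambda>u v. s (ep u * 1) v)) (p y)" for x y
  proof -
    have g: "lin s (*) (\<lambda>z. theta z (p y))" by (intro Drules)
    show ?thesis unfolding D_hom[OF g] by (simp add: linD(2)[OF g] mult.commute)
  qed
  then have "D p x (\<lambda>u v. theta v (p y) * ep u) = 0" for x y
    unfolding ep_D by (simp add: linD(3)[OF bilinD(1)[OF bilin_theta]])
  then show ?thesis unfolding corr_def by (simp add: sw_hom[OF lin_ep] D_hom[OF lin_ep] linD(2)[OF lin_ep] sw_sum)
qed

lemma good_step: "good (\<lambda>a. p a + corr p a)"
proof -
  have "Q (corr p a) = corr p a" for a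
    unfolding corr_def sw_hom[OF lin_Q] D_hom[OF lin_Q] linD(2)[OF lin_Q]
    by (intro arg_cong[where f = "sw a"] ext D_Q_cong[where ?s2.0=s]) (intro Drules, simp)+
  moreover have "corr p (P a) = corr p a" for a by (simp add: corr_def)
  moreover have "corr p (Q a) = 0" for a
  proof -
    have "corr p (Q a) = sw (Q a) (\<lambda>x y. 0)"
      unfolding corr_def by (rule sw_Q_cong[where ?s2.0=s]) (intro Drules, intro Drules, rule D_Q[where ?s2.0=s], intro Drules)
    then show ?thesis by (simp add: sw_sum)
  qed
  ultimately show ?thesis unfolding good_def
    using lin_add[OF p(1) lin_corr] by (simp add: p linD(1)[OF lin_Q] linD(1)[OF lin_ep] ep_corr corr_left corr_right
      linD(1)[OF lin_mu0] linD(1)[OF bilinD(1)[OF bilin_mu]])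
qed

lemma filt_Q: "v \<in> range Q \<Longrightarrow> v \<in> filt (Suc n)"
  using filt_1 filt_mono[of 1 "Suc n"] by auto

lemma D_vanish: "D p a (tn s s) = 0 \<Longrightarrow> bilin s s s2 F \<Longrightarrow> D p a F = 0"
  by (simp add: D_tn linD(3)[OF lin_tlift])

text \<open>A quadratic error is a bilinear expression in the two legs of a that vanishes if the
  first leg lies in \<open>filt (Suc n)\<close>, and also if the second lies in H, since H is part
  of that step. By \<open>filt_Suc_legs\<close> it vanishes one step higher.\<close>

lemma quadratic_convergence:
  assumes van: "\<And>a. a \<in> filt (Suc n) \<Longrightarrow> D p a (tn s s) = 0"
  shows "a \<in> filt (Suc n) \<Longrightarrow> corr p a = 0"
    "a \<in> filt (Suc (Suc n)) \<Longrightarrow> D (\<lambda>a. p a + corr p a) a (tn s s) = 0"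
proof -
  note v = D_vanish[OF van]
  have c0: "corr p a = 0" if "a \<in> filt (Suc n)" for a
    unfolding corr_def by (rule filt_legs[OF that, where ?s2.0=s]) (intro Drules, rule v[where ?s2.0=s], assumption, intro Drules)
  then show "a \<in> filt (Suc n) \<Longrightarrow> corr p a = 0" .
  assume a: "a \<in> filt (Suc (Suc n))"
  note T = bilin_tn[OF vs vs] lin_corr lin_comp[OF lin_corr]
  have q1: "sw a (\<lambda>x y. D p x (\<lambda>u v. pscl (D p y theta) (tn s s u v))) = 0"
  proof (rule filt_Suc_legs[OF a, where ?s2.0=pscl])
    fix x y assume "y \<in> range Q"
    then have "D p y theta = 0" by (intro v[where ?s2.0="(*)"] filt_Q bilin_theta)
    moreover have "pscl 0 z = (0 :: ('k, 'a, 'a) tensor)" for z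
      by (simp add: pscl_def zero_fun_def)
    ultimately show "D p x (\<lambda>u v. pscl (D p y theta) (tn s s u v)) = 0" by (simp add: D_zero)
  qed (intro Drules bilin_theta, rule v[where ?s2.0=pscl], assumption, intro Drules)
  have q2: "sw a (\<lambda>x y. D p x (\<lambda>u v. D p y (\<lambda>c d. pscl (theta v c) (tn s s u d)))) = 0"
  proof (rule filt_Suc_legs[OF a, where ?s2.0=pscl])
    fix x y assume "y \<in> range Q"
    then have "D p y (\<lambda>c d. pscl (theta v c) (tn s s u d)) = 0" for u v by (intro v[where ?s2.0=pscl] filt_Q Drules)
    then show "D p x (\<lambda>u v. D p y (\<lambda>c d. pscl (theta v c) (tn s s u d))) = 0" by (simp add: D_zero)
  qed (intro Drules, rule v[where ?s2.0=pscl], assumption, intro Drules)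
  have q3: "sw a (\<lambda>x y. tn s s (corr p x) (corr p y)) = 0"
    by (rule filt_Suc_legs[OF a, where ?s2.0=pscl], intro Drules T)
      (simp_all add: c0 c0[OF filt_Q] linD(3)[OF bilinD(1)[OF bilin_tn[OF vs vs]]] linD(3)[OF bilinD(2)[OF bilin_tn[OF vs vs]]])
  have l: "sw (x + y) (tn s s) = sw x (tn s s) + sw y (tn s s)" for x y
    by (rule linD(1)[OF lin_sw_arg[OF lin_id[OF vs] bilin_tn[OF vs vs]]])
  have st: "sw (corr p a) (tn s s) = sw a (\<lambda>x y. tn s s (p x) (corr p y)) + sw a (\<lambda>x y. tn s s (corr p x) (p y)) - D p a (tn s s)"
    using newton_step[OF bilin_tn[OF vs vs], of a] by (simp only: q1 q2 add_0_right)
  \<comment> \<open>With c the correction, the new defect is \<open>D p a\<close> plus \<Delta>(c)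
    minus the three mixed products; \<open>st\<close> cancels everything but c \<otimes> c, which is
    zero by \<open>q3\<close>.\<close>
  show "D (\<lambda>a. p a + corr p a) a (tn s s) = 0"
    unfolding D_def[of "\<lambda>a. p a + corr p a"] l st D_def[of p a "tn s s"]
    by (simp add: linD(1)[OF bilinD(1)[OF bilin_tn[OF vs vs]]] linD(1)[OF bilinD(2)[OF bilin_tn[OF vs vs]]] sw_sum q3)
qed

end

section \<open>The Newton iteration and its limit\<close>

context
  fixes p0 :: "'a \<Rightarrow> 'a" assumes good_p0: "good p0"
begin

definition approx :: "nat \<Rightarrow> 'a \<Rightarrow> 'a" where
  "approx n = ((\<lambda>p a. p a + corr p a) ^^ n) p0"

lemma approx_simps [simp]: "approx 0 = p0" "approx (Suc n) = (\<lambda>a. approx n a + corr (approx n) a)"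
  by (simp_all add: approx_def)

lemma good_approx: "good (approx n)"
  by (induction n) (simp_all add: good_p0 good_step)

lemma D_approx: "a \<in> filt (Suc n) \<Longrightarrow> D (approx n) a (tn s s) = 0"
proof (induction n arbitrary: a)
  case 0
  then have "a \<in> range Q" using filt_1 by (simp add: One_nat_def[symmetric] del: One_nat_def)
  then show ?case using D_Q[OF good_p0 bilin_tn[OF vs vs]] by auto
next
  case (Suc n)
  then show ?case using quadratic_convergence(2)[OF good_approx Suc.IH] by simp
qed

lemma approx_stable: "a \<in> filt (Suc n) \<Longrightarrow> n \<le> m \<Longrightarrow> approx m a = approx n a"
proof (induction m)
  case (Suc m)
  show ?case
  proof (cases "n = Suc m")
    case False
    then have "n \<le> m" using Suc by simp
    then have "a \<in> filt (Suc m)" using Suc.prems(1) filt_mono[of "Suc n" "Suc m"] by blast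
    then have "corr (approx m) a = 0" using quadratic_convergence(1)[OF good_approx D_approx] by blast
    then show ?thesis using Suc \<open>n \<le> m\<close> by simp
  qed simp
qed simp

text \<open>The test is on \<open>P a\<close> because only elements of the carrier occur in the
  filtration. The successor reflects that \<open>filt 1\<close> is H, where already the initial map
  has no defect.\<close>

definition limit :: "'a \<Rightarrow> 'a" where
  "limit a = approx (LEAST n. P a \<in> filt (Suc n)) a"

lemma limit: "P a \<in> filt (Suc n) \<Longrightarrow> limit a = approx n a"
proof -
  assume a: "P a \<in> filt (Suc n)"
  define k where "k = (LEAST n. P a \<in> filt (Suc n))"
  have "P a \<in> filt (Suc k)" "k \<le> n" unfolding k_def using a by (rule LeastI, rule Least_le)
  then have "approx n (P a) = approx k (P a)" by (rule approx_stable)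
  then show ?thesis using good_approx by (simp add: limit_def k_def good_def)
qed

lemma common_stage:
  assumes "finite X" obtains n where "\<And>x. x \<in> X \<Longrightarrow> limit x = approx n x" "\<And>x. x \<in> X \<Longrightarrow> P x \<in> filt (Suc n)"
proof -
  have "\<exists>n. \<forall>x\<in>X. P x \<in> filt (Suc n)"
    using assms
  proof (induction X)
    case (insert x X)
    then obtain n where n: "\<forall>x\<in>X. P x \<in> filt (Suc n)" by blast
    obtain m where m: "P x \<in> filt m" using filt_exhausts[of "P x"] by auto
    have "P y \<in> filt (Suc (max n m))" if "y \<in> insert x X" for y
    proof -
      have "filt (Suc n) \<subseteq> filt (Suc (max n m))" "filt m \<subseteq> filt (Suc (max n m))"
        by (rule filt_mono; linarith)+
      then show ?thesis using that n m by blast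
    qed
    then show ?case by blast
  qed simp
  then show ?thesis using that limit by blast
qed

lemma good_limit: "good limit"
proof -
  have g: "Q (approx n a) = approx n a" "ep (approx n a) = ep a" "approx n (P a) = approx n a"
    "approx n (mu (Q h) a) = mu (Q h) (approx n a)" "approx n (mu a (Q h)) = mu (approx n a) (Q h)"
    "approx n (Q a) = Q a" "lin s s (approx n)" for n a h
    using good_approx[of n] by (auto simp: good_def)
  have one: "\<exists>n. limit a = approx n a" for a by (simp add: limit_def) blast
  have two: "\<exists>n. limit a = approx n a \<and> limit b = approx n b" for a b
    using common_stage[of "{a, b}"] by (metis finite.emptyI finite.insertI insertCI)
  show ?thesis
    unfolding good_def
  proof (intro conjI allI)
    show "lin s s limit"
    proof (rule linI)
      fix x y
      obtain n where "\<And>z. z \<in> {x, y, x + y} \<Longrightarrow> limit z = approx n z" using common_stage[of "{x, y, x + y}"] by blast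
      then show "limit (x + y) = limit x + limit y" by (simp add: linD(1)[OF g(7)])
    next
      fix c x
      obtain n where "limit x = approx n x" "limit (s c x) = approx n (s c x)" using two by blast
      then show "limit (s c x) = s c (limit x)" by (simp add: linD(2)[OF g(7)])
    qed simp_all
    fix a h
    show "Q (limit a) = limit a" "ep (limit a) = ep a" "limit (Q a) = Q a" using one g by metis+
    show "limit (P a) = limit a" by (simp add: limit_def g)
    show "limit (mu (Q h) a) = mu (Q h) (limit a)" using two[of a "mu (Q h) a"] g by auto
    show "limit (mu a (Q h)) = mu (limit a) (Q h)" using two[of a "mu a (Q h)"] g by auto
  qed
qed

lemma D_limit: "D limit a (tn s s) = 0"
proof -
  obtain C g where C: "finite C" "dl a = (\<Sum>c\<in>C. tn s s (hit (g c) a) c)"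
    by (rule dl_basis[OF subspace_UNIV, of a]) (auto simp: hit_def that)
  \<comment> \<open>The defect of the limit at a involves only its values at a and at the legs of
    one finite expansion of \<Delta>(a), so one stage of the iteration serves for all of
    them.\<close>
  define X where "X = insert a (C \<union> (\<lambda>c. hit (g c) a) ` C)"
  have "finite X" using C by (simp add: X_def)
  then obtain n where n: "\<And>x. x \<in> X \<Longrightarrow> limit x = approx n x" "\<And>x. x \<in> X \<Longrightarrow> P x \<in> filt (Suc n)"
    using common_stage by blast
  have lim: "bilin s s pscl (\<lambda>x y. tn s s (q x) (q y))" if "lin s s q" for q
    by (intro bilinI lin_rules lin_comp[OF that])
  have "D limit a (tn s s) = D (approx n) a (tn s s)"
    using n(1) lim good_limit good_approx[of n]
    by (simp add: D_def sw_of_dl[OF C(2), where ?s2.0=pscl] good_def X_def)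
  also have "\<dots> = D (approx n) (P a) (tn s s)" by (simp add: D_P[OF good_approx])
  also have "\<dots> = 0" using n(2)[of a] by (intro D_approx) (simp add: X_def del: filt.simps)
  finally show ?thesis .
qed

end

end

section \<open>The coradical as a Hopf algebra and the projection onto it\<close>

locale corad_hopf =
  fixes A :: "('k::field, 'a::ab_group_add) bialgebra" and Hc :: "'a set" and S :: "'a \<Rightarrow> 'a"
  assumes A: "is_bialgebra A" and sub: "sub_bialgebra A Hc" and Hc: "Hc = coradical A"
    and ss: "semisimple_algebra (A\<lparr>car := Hc\<rparr>)" and S: "is_antipode (A\<lparr>car := Hc\<rparr>) S"
begin

abbreviation "s \<equiv> scl A"
abbreviation "H \<equiv> A\<lparr>car := Hc\<rparr>"

definition P :: "'a \<Rightarrow> 'a" where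
  "P = (SOME p. lin s s p \<and> (\<forall>x. p x \<in> car A) \<and> (\<forall>x\<in>car A. p x = x))"

definition "dl = (\<lambda>x. comul A (P x))"
definition "ep = (\<lambda>x. counit A (P x))"
definition "mu = (\<lambda>x y. mul A (P x) (P y))"
definition "one = unit A"

lemma V: "is_vspace A"
  using A by (simp add: is_bialgebra_def is_algebra_def)

lemma P: "lin s s P" "P x \<in> car A" "x \<in> car A \<Longrightarrow> P x = x"
  using someI_ex[OF exists_projection[OF V]] unfolding P_def by blast+

sublocale tbialg s P dl ep mu one
  unfolding dl_def ep_def mu_def one_def by (rule tbialg_of[OF A P])

lemma carA: "x \<in> car A \<longleftrightarrow> P x = x"
  using P by metis

lemma range_P_car: "range P = car A"
  using P by (metis rangeI subsetI subset_antisym image_subset_iff)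

lemma Hc_sub: "Hc \<subseteq> car A" "subspace Hc" "one \<in> Hc" "x \<in> Hc \<Longrightarrow> y \<in> Hc \<Longrightarrow> mul A x y \<in> Hc"
  using sub by (auto simp: sub_bialgebra_def subcoalgebra_def one_def)

lemma VH: "is_vspace H"
  using Hc_sub V by (simp add: is_vspace_def)

lemma subcoalgebra_bistable: "subcoalgebra A E \<longleftrightarrow> bistable E"
proof -
  have t: "tensor (A\<lparr>car := E\<rparr>) (A\<lparr>car := E\<rparr>) = tensor \<lparr>car = E, scl = s\<rparr> \<lparr>car = E, scl = s\<rparr>"
    by (rule tensor_cong) simp_all
  have "dl x = comul A x" if "x \<in> E" "E \<subseteq> car A" for x
    using that P(3) by (auto simp: dl_def)
  then show ?thesis unfolding subcoalgebra_def bistable_iff t range_P_car by auto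
qed

lemma simple_subcoalgebra_simple: "simple_subcoalgebra A E \<longleftrightarrow> simple E"
  by (auto simp: simple_subcoalgebra_def simple_def subcoalgebra_bistable)

lemma Hc_span: "Hc = span (\<Union>{E. simple E})"
  unfolding Hc coradical_def simple_subcoalgebra_simple ..

lemma bistable_Hc: "bistable Hc"
  using sub by (simp add: sub_bialgebra_def subcoalgebra_bistable)

lemma corad: "tcoalg_corad s P dl ep Hc"
proof
  show "bistable Hc" by (rule bistable_Hc)
  show "E \<subseteq> Hc" if "simple E" for E
    unfolding Hc_span using that by (intro order_trans[OF _ span_superset]) auto
qed

lemma H_mem: "x \<in> Hc \<Longrightarrow> comul A x \<in> car (tensor H H)"
  using sub by (simp add: sub_bialgebra_def subcoalgebra_def)

lemma H_total: "x \<in> Hc \<Longrightarrow> P x = x" "x \<in> Hc \<Longrightarrow> comul A x = dl x" "x \<in> Hc \<Longrightarrow> counit A x = ep x"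
  "x \<in> Hc \<Longrightarrow> y \<in> Hc \<Longrightarrow> mul A x y = mu x y"
proof -
  have *: "P x = x" if "x \<in> Hc" for x using Hc_sub(1) P(3) that by auto
  then show "x \<in> Hc \<Longrightarrow> P x = x" "x \<in> Hc \<Longrightarrow> comul A x = dl x" "x \<in> Hc \<Longrightarrow> counit A x = ep x"
    "x \<in> Hc \<Longrightarrow> y \<in> Hc \<Longrightarrow> mul A x y = mu x y" by (simp_all add: dl_def ep_def mu_def)
qed

text \<open>The Sweedler sum over the record H chooses a presentation with legs in
  \<open>Hc\<close>, the sum in A one with legs in the larger carrier. Both present the same tensor,
  so a bilinear map has the same value on them.\<close>

lemma H_sweedler:
  assumes "x \<in> Hc" "bilin s s s2 G" "\<And>v w. v \<in> Hc \<Longrightarrow> w \<in> Hc \<Longrightarrow> F v w = G v w"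
  shows "sweedler H H (comul A x) F = sw x G"
proof -
  have "sweedler H H (comul A x) F = swt s s (comul A x) G"
    using sweedler_swt[OF VH VH, of s2 G F "comul A x"] assms H_mem[OF assms(1)] by simp
  then show ?thesis using H_total(2)[OF assms(1)] sw_swt[OF assms(2)] by simp
qed

lemma H_bialgebra: "is_bialgebra H"
  unfolding is_bialgebra_def
proof (intro conjI ballI)
  have cA: "is_coalgebra A" "is_algebra A" using A by (simp_all add: is_bialgebra_def)
  show "is_algebra H" using ss by (simp add: semisimple_algebra_def)
  show "is_coalgebra H"
    unfolding is_coalgebra_def
  proof (intro conjI ballI)
    show "is_vspace H" by (rule VH)
    show "linear_map H (tensor H H) (comul H)"
      using cA(1) Hc_sub(1) H_mem by (auto simp: is_coalgebra_def linear_map_def subset_iff)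
    show "linear_map H base_field (counit H)"
      using cA(1) Hc_sub(1) by (auto simp: is_coalgebra_def linear_map_def subset_iff base_field_def)
    fix x assume "x \<in> car H"
    then have x: "x \<in> Hc" by simp
    have "sweedler H H (comul A x) (\<lambda>a b. sweedler H H (comul A a) (\<lambda>a1 a2. tens H (tensor H H) a1 (tens H H a2 b))) =
        sw x (\<lambda>a b. sw a (\<lambda>a1 a2. tn s pscl a1 (tn s s a2 b)))"
      by (rule H_sweedler[OF x, where ?s2.0=pscl], intro bilinI lin_rules,
          rule H_sweedler[where ?s2.0=pscl], assumption, intro bilinI lin_rules) (simp add: tens_tn)
    moreover have "sweedler H H (comul A x) (\<lambda>a b. sweedler H H (comul A b) (\<lambda>b1 b2. tens H (tensor H H) a (tens H H b1 b2))) =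
        sw x (\<lambda>a b. sw b (\<lambda>b1 b2. tn s pscl a (tn s s b1 b2)))"
      by (rule H_sweedler[OF x, where ?s2.0=pscl], intro bilinI lin_rules,
          rule H_sweedler[where ?s2.0=pscl], assumption, intro bilinI lin_rules) (simp add: tens_tn)
    moreover have "sw x (\<lambda>a b. sw a (\<lambda>a1 a2. tn s pscl a1 (tn s s a2 b))) = sw x (\<lambda>a b. sw b (\<lambda>b1 b2. tn s pscl a (tn s s b1 b2)))"
      by (intro coassoc[where ?s2.0=pscl] lin_rules)
    ultimately show "sweedler H H (comul H x) (\<lambda>a b. sweedler H H (comul H a) (\<lambda>a1 a2. tens H (tensor H H) a1 (tens H H a2 b))) =
        sweedler H H (comul H x) (\<lambda>a b. sweedler H H (comul H b) (\<lambda>b1 b2. tens H (tensor H H) a (tens H H b1 b2)))" by simp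
    have "sweedler H H (comul A x) (\<lambda>a b. s (counit A a) b) = sw x (\<lambda>a b. s (ep a) b)"
      by (rule H_sweedler[OF x, where ?s2.0=s], intro bilinI lin_rules) (simp add: H_total)
    moreover have "sw x (\<lambda>a b. s (ep a) b) = P x" by (rule counit_l) (intro lin_rules)
    ultimately show "sweedler H H (comul H x) (\<lambda>a b. scl H (counit H a) b) = x" using H_total(1)[OF x] by simp
    have "sweedler H H (comul A x) (\<lambda>a b. s (counit A b) a) = sw x (\<lambda>a b. s (ep b) a)"
      by (rule H_sweedler[OF x, where ?s2.0=s], intro bilinI lin_rules) (simp add: H_total)
    moreover have "sw x (\<lambda>a b. s (ep b) a) = P x" by (rule counit_r) (intro lin_rules)
    ultimately show "sweedler H H (comul H x) (\<lambda>a b. scl H (counit H b) a) = x" using H_total(1)[OF x] by simp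
  qed
  show "comul H (unit H) = tens H H (unit H) (unit H)" using A by (simp add: is_bialgebra_def tens_tn)
  show "counit H (unit H) = 1" using A by (simp add: is_bialgebra_def)
  fix x y assume "x \<in> car H" "y \<in> car H"
  then have x: "x \<in> Hc" and y: "y \<in> Hc" by simp_all
  show "counit H (mul H x y) = counit H x * counit H y"
    using A subsetD[OF Hc_sub(1) x] subsetD[OF Hc_sub(1) y] by (simp add: is_bialgebra_def)
  have "comul A (mul A x y) = sw (mu x y) (tn s s)"
    using H_total(2)[OF Hc_sub(4)[OF x y]] by (simp add: sw_tn H_total x y)
  also have "\<dots> = sw x (\<lambda>x1 x2. sw y (\<lambda>y1 y2. tn s s (mu x1 y1) (mu x2 y2)))"
    by (intro sw_mu[where ?s2.0=pscl] bilinI lin_rules)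
  also have "\<dots> = sweedler H H (comul A x) (\<lambda>x1 x2. sweedler H H (comul A y) (\<lambda>y1 y2. tens H H (mul A x1 y1) (mul A x2 y2)))"
    by (rule sym, rule H_sweedler[OF x, where ?s2.0=pscl], intro bilinI lin_rules,
        rule H_sweedler[OF y, where ?s2.0=pscl], intro bilinI lin_rules) (simp add: tens_tn H_total)
  finally show "comul H (mul H x y) = sweedler H H (comul H x) (\<lambda>x1 x2. sweedler H H (comul H y)
          (\<lambda>y1 y2. tens H H (mul H x1 y1) (mul H x2 y2)))" by simp
qed

lemma one_hits: "lfun f \<Longrightarrow> hit f one = s (f one) one" "lfun f \<Longrightarrow> hitr f one = s (f one) one"
proof -
  assume f: "lfun f"
  show "hit f one = s (f one) one" "hitr f one = s (f one) one"
    unfolding hit_def hitr_def by (intro sw_one[where ?s2.0=s] bilinI lin_rules f lin_comp[OF f])+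
qed

lemma one_props: "one \<in> range P" "one \<noteq> 0"
proof -
  show "one \<in> range P" by (simp add: range_P)
  show "one \<noteq> 0" using linD(3)[OF lin_ep] ep_one by force
qed

lemma H_thopf:
  assumes "lin s s q" "\<And>x. q x \<in> Hc" "\<And>x. x \<in> Hc \<Longrightarrow> q x = x"
  shows "thopf s q (\<lambda>x. dl (q x)) (\<lambda>x. ep (q x)) (\<lambda>x y. mu (q x) (q y)) one (\<lambda>x. S (q x))"
  using thopf_of[OF H_bialgebra S, of q] assms by (simp add: H_total one_def)

lemma H_sw:
  assumes "thopf s q (\<lambda>x. dl (q x)) e m one S'" "bilin s s s2 F"
  shows "tcoalg.sw s q (\<lambda>x. dl (q x)) x F = sw (q x) F"
proof -
  interpret h: thopf s q "\<lambda>x. dl (q x)" e m one S' by fact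
  show ?thesis using h.sw_swt[OF assms(2)] sw_swt[OF assms(2)] by metis
qed

definition Q :: "'a \<Rightarrow> 'a" where
  "Q = (\<lambda>x. (SOME p. lin s s p \<and> (\<forall>x. p x \<in> Hc) \<and> (\<forall>x\<in>Hc. p x = x)) (P x))"

lemma Q: "lin s s Q" "Q x \<in> Hc" "x \<in> Hc \<Longrightarrow> Q x = x" "Q (P x) = Q x"
proof -
  have q: "lin s s (SOME p. lin s s p \<and> (\<forall>x. p x \<in> Hc) \<and> (\<forall>x\<in>Hc. p x = x)) \<and>
      (\<forall>x. (SOME p. lin s s p \<and> (\<forall>x. p x \<in> Hc) \<and> (\<forall>x\<in>Hc. p x = x)) x \<in> Hc) \<and>
      (\<forall>x\<in>Hc. (SOME p. lin s s p \<and> (\<forall>x. p x \<in> Hc) \<and> (\<forall>x\<in>Hc. p x = x)) x = x)"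
    using someI_ex[OF exists_projection[OF VH]] by simp
  show "lin s s Q" unfolding Q_def by (rule lin_comp[OF _ lin_P]) (use q in blast)
  show "Q x \<in> Hc" "x \<in> Hc \<Longrightarrow> Q x = x" "Q (P x) = Q x" using q by (simp_all add: Q_def H_total)
qed

sublocale h: thopf s Q "\<lambda>x. dl (Q x)" "\<lambda>x. ep (Q x)" "\<lambda>x y. mu (Q x) (Q y)" one "\<lambda>x. S (Q x)"
  by (rule H_thopf[OF Q(1-3)])

lemma exists_bilinear_projection:
  "\<exists>pi. lin s s pi \<and> (\<forall>x. pi x \<in> Hc) \<and> (\<forall>x\<in>Hc. pi x = x) \<and> (\<forall>x. ep (pi x) = ep x) \<and> (\<forall>x. pi (P x) = pi x) \<and>
     (\<forall>h\<in>Hc. \<forall>a. pi (mu h a) = mu h (pi a) \<and> pi (mu a h) = mu (pi a) h) \<and>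
     (\<forall>a. dl (pi a) = sw a (\<lambda>x y. tn s s (pi x) (pi y)))"
proof -
  obtain lam where lam: "lfun lam" "lam one = 1" "\<And>x. x \<in> Hc \<Longrightarrow> hit lam x = s (lam x) one"
      "\<And>x. x \<in> Hc \<Longrightarrow> hitr lam x = s (lam x) one"
    using exists_integral[OF one_hits one_props] Hc_span by metis
  obtain L where L: "L \<in> Hc" "ep L = 1" "\<And>x. x \<in> Hc \<Longrightarrow> mu x L = s (ep x) L"
    using exists_algebra_integral[OF H_bialgebra ss] by (auto simp: H_total)
  note HS = H_sw[OF h.thopf_axioms]
  interpret hi: thopf_int s Q "\<lambda>x. dl (Q x)" "\<lambda>x. ep (Q x)" "\<lambda>x y. mu (Q x) (Q y)" one "\<lambda>x. S (Q x)" "\<lambda>x. lam (Q x)" L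
  proof (rule thopf_int.intro[OF h.thopf_axioms], rule thopf_int_axioms.intro)
    show l: "lfun (\<lambda>x. lam (Q x))" by (rule lin_comp[OF lam(1) Q(1)])
    fix x
    have "h.sw x (\<lambda>a b. s (lam (Q b)) a) = h.sw x (\<lambda>a b. s (lam b) a)" by (rule h.sw_cong_P) simp
    also have "\<dots> = hit lam (Q x)" unfolding hit_def by (intro HS[where ?s2.0=s] bilinI lin_rules lin_comp[OF lam(1)])
    finally show "h.sw x (\<lambda>a b. s (lam (Q b)) a) = s (lam (Q x)) one" using lam(3) Q(2) by simp
    have "h.sw x (\<lambda>a b. s (lam (Q a)) b) = h.sw x (\<lambda>a b. s (lam a) b)" by (rule h.sw_cong_P) simp
    also have "\<dots> = hitr lam (Q x)" unfolding hitr_def by (intro HS[where ?s2.0=s] bilinI lin_rules lin_comp[OF lam(1)])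
    finally show "h.sw x (\<lambda>a b. s (lam (Q a)) b) = s (lam (Q x)) one" using lam(4) Q(2) by simp
    show "lam (Q one) = 1" "mu (Q x) (Q L) = s (ep (Q x)) L" "ep (Q L) = 1" using L Q lam Hc_sub by simp_all
  qed
  have PQ: "P (Q x) = Q x" for x using Q(2) by (rule H_total)
  have Qmem: "range Q = Hc" using Q by (metis rangeI subsetI subset_antisym image_subset_iff)
  interpret newton s P dl ep mu one Q hi.theta
  proof (intro newton.intro newton_axioms.intro)
    show "tbialg s P dl ep mu one" by (rule tbialg_axioms)
    show "tcoalg_corad s P dl ep (range Q)" unfolding Qmem by (rule corad)
    show "lin s s Q" "\<And>x. Q (P x) = Q x" "\<And>x. P (Q x) = Q x" "\<And>x. Q (Q x) = Q x" using Q PQ by simp_all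
    show "Q one = one" using Q Hc_sub by simp
    show "Q (mu (Q x) (Q y)) = mu (Q x) (Q y)" for x y using Q Hc_sub H_total(4) by metis
    have "h.sw x (\<lambda>a b. tn s s (Q a) (Q b)) = h.sw x (tn s s)" for x by (rule h.sw_cong_P) simp
    then show "dl (Q x) = sw (Q x) (\<lambda>a b. tn s s (Q a) (Q b))" for x
      using HS[of pscl "\<lambda>a b. tn s s (Q a) (Q b)" x] h.sw_tn[of x] by (simp add: bilinI lin_rules)
    note R = bilinI lin_rules
    show bt: "bilin s s (*) hi.theta" by (intro R)
    fix x y z
    have "sw (Q x) (\<lambda>a b. s (hi.theta b y) a) = h.sw x (\<lambda>a b. s (hi.theta b y) a)" by (rule sym, intro HS[where ?s2.0=s] R)
    moreover have "sw (Q y) (\<lambda>a b. s (hi.theta x a) b) = h.sw y (\<lambda>a b. s (hi.theta x a) b)" by (rule sym, intro HS[where ?s2.0=s] R)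
    ultimately show "sw (Q x) (\<lambda>a b. s (hi.theta b (Q y)) a) = sw (Q y) (\<lambda>a b. s (hi.theta (Q x) a) b)"
      using hi.theta_colinear[of x y] by simp
    show "sw (Q x) hi.theta = ep (Q x)" using hi.theta_comul[of x] HS[OF bt, of x] by simp
    have "sw (Q z) (\<lambda>h1 h2. hi.theta (mu h1 (Q x)) (mu h2 (Q y))) = h.sw z (\<lambda>h1 h2. hi.theta (mu h1 (Q x)) (mu h2 (Q y)))"
      by (rule sym, intro HS[where ?s2.0="(*)"] R lin_rules)
    also have "\<dots> = h.sw z (\<lambda>h1 h2. hi.theta (mu (Q h1) (Q x)) (mu (Q h2) (Q y)))" by (rule h.sw_cong_P) simp
    finally show "sw (Q z) (\<lambda>h1 h2. hi.theta (mu h1 (Q x)) (mu h2 (Q y))) = ep (Q z) * hi.theta (Q x) (Q y)"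
      using hi.theta_mul(1)[of z x y] by simp
    have "sw (Q z) (\<lambda>h1 h2. hi.theta (mu (Q x) h1) (mu (Q y) h2)) = h.sw z (\<lambda>h1 h2. hi.theta (mu (Q x) h1) (mu (Q y) h2))"
      by (rule sym, intro HS[where ?s2.0="(*)"] R lin_rules)
    also have "\<dots> = h.sw z (\<lambda>h1 h2. hi.theta (mu (Q x) (Q h1)) (mu (Q y) (Q h2)))" by (rule h.sw_cong_P) simp
    finally show "sw (Q z) (\<lambda>h1 h2. hi.theta (mu (Q x) h1) (mu (Q y) h2)) = ep (Q z) * hi.theta (Q x) (Q y)"
      using hi.theta_mul(2)[of z x y] by simp
  qed
  \<comment> \<open>The added multiple of the unit makes f preserve the counit; on H it is zero, so
    f remains a projection.\<close>
  define f where "f = (\<lambda>a. Q a + s (ep a - ep (Q a)) one)"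
  have lf: "lin s s f" unfolding f_def by (intro lin_rules)
  have Qlin: "Q (x + y) = Q x + Q y" "Q (s c x) = s c (Q x)" for x y c by (simp_all add: linD[OF Q(1)])
  have elin: "ep (x + y) = ep x + ep y" "ep (s c x) = c * ep x" for x y c by (simp_all add: linD[OF lin_ep])
  have Qone: "Q one = one" using Q Hc_sub by simp
  have f: "f (Q x) = Q x" "ep (f x) = ep x" "Q (f x) = f x" "f (P x) = f x" for x
    using Q PQ by (simp_all add: f_def Qlin elin Qone)
  let ?S = "\<lambda>x. S (Q x)"
  have QS: "Q (S (Q x)) = S (Q x)" for x by (rule h.S_P(2))
  have QL: "Q L = L" using L Q by simp
  note SR = h.lin_S h.lin_S' lf lin_comp[OF lf]
  \<comment> \<open>One copy of the separability idempotent averages on each side, which makes p0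
    bilinear. On H, where f is the identity, both copies cancel by the antipode and
    \<epsilon>(\<Lambda>) = 1.\<close>
  define p0 where "p0 = (\<lambda>a. h.sw L (\<lambda>e1 e2. h.sw L (\<lambda>g1 g2. mu e1 (mu (f (mu (?S e2) (mu a g1))) (?S g2)))))"
  have R: "lin s s (\<lambda>a. f (mu (?S c) (mu a d)))" for c d by (intro lin_comp[OF lf] lin_rules)
  have lin_p0: "lin s s p0" unfolding p0_def by (intro h.lin_sw_fun lin_rules SR)
  have left: "p0 (mu (Q h) a) = mu (Q h) (p0 a)" for h a
  proof -
    define G where "G = (\<lambda>z. h.sw L (\<lambda>g1 g2. mu (f (mu z (mu a g1))) (?S g2)))"
    have lG: "lin s s G" unfolding G_def by (intro h.lin_sw_fun lin_rules SR)
    have b: "bilin s s s (\<lambda>x y. mu x (G y))" by (intro bilinI lin_rules lin_comp[OF lG])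
    have p: "p0 a = h.sw L (\<lambda>e1 e2. mu e1 (G (?S e2)))" "p0 (mu (Q h) a) = h.sw L (\<lambda>e1 e2. mu e1 (G (mu (?S e2) (Q h))))"
      unfolding p0_def G_def by (simp_all add: assoc h.sw_hom[OF lin_mu0])
    have "mu (Q h) (p0 a) = h.sw L (\<lambda>e1 e2. mu (mu (Q h) e1) (G (?S e2)))"
      unfolding p(1) h.sw_hom[OF lin_mu0] by (simp add: assoc)
    also have "\<dots> = h.sw L (\<lambda>e1 e2. mu (mu (Q h) (Q e1)) (G (?S e2)))" by (rule h.sw_cong_P) simp
    also have "\<dots> = h.sw L (\<lambda>e1 e2. mu e1 (G (mu (Q (?S e2)) (Q h))))" by (rule hi.separability[OF b])
    finally show ?thesis unfolding p(2) QS ..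
  qed
  have right: "p0 (mu a (Q h)) = mu (p0 a) (Q h)" for h a
  proof -
    have lm: "lin s s (\<lambda>x. mu x c)" for c by (intro lin_rules)
    have 1: "h.sw L (\<lambda>g1 g2. mu c (mu (f (mu d (mu (mu a (Q h)) g1))) (?S g2))) =
        h.sw L (\<lambda>g1 g2. mu c (mu (f (mu d (mu a g1))) (mu (?S g2) (Q h))))" for c d
    proof -
      have b: "bilin s s s (\<lambda>x y. mu c (mu (f (mu d (mu a x))) y))" by (intro bilinI lin_rules SR)
      have "h.sw L (\<lambda>g1 g2. mu c (mu (f (mu d (mu (mu a (Q h)) g1))) (?S g2))) =
          h.sw L (\<lambda>g1 g2. mu c (mu (f (mu d (mu a (mu (Q h) (Q g1))))) (?S g2)))"
        by (rule h.sw_cong_P) (simp add: assoc)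
      also have "\<dots> = h.sw L (\<lambda>g1 g2. mu c (mu (f (mu d (mu a g1))) (mu (Q (?S g2)) (Q h))))"
        by (rule hi.separability[OF b])
      finally show ?thesis unfolding QS .
    qed
    show ?thesis unfolding p0_def h.sw_hom[OF lm] 1 by (simp add: assoc)
  qed
  have QQ: "Q (mu (Q x) (Q y)) = mu (Q x) (Q y)" for x y by (rule Q_mu)
  have p0Q: "p0 (Q a) = Q a" for a
  proof -
    have in1: "h.sw L (\<lambda>g1 g2. mu e1 (mu (f (mu (?S e2) (mu (Q a) g1))) (?S g2))) = mu (mu e1 (?S e2)) (Q a)" for e1 e2
    proof -
      have "h.sw L (\<lambda>g1 g2. mu e1 (mu (f (mu (?S e2) (mu (Q a) g1))) (?S g2))) =
          h.sw L (\<lambda>g1 g2. mu (mu e1 (mu (?S e2) (Q a))) (mu (Q g1) (?S g2)))"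
      proof (rule h.sw_cong_P)
        fix x y
        have "mu (?S e2) (mu (Q a) (Q x)) = Q (mu (?S e2) (mu (Q a) (Q x)))" by (metis QQ QS)
        then have "f (mu (?S e2) (mu (Q a) (Q x))) = mu (?S e2) (mu (Q a) (Q x))" by (metis f(1))
        then show "mu e1 (mu (f (mu (?S e2) (mu (Q a) (Q x)))) (?S (Q y))) =
          mu (mu e1 (mu (?S e2) (Q a))) (mu (Q (Q x)) (?S (Q y)))" by (simp add: assoc)
      qed
      also have "\<dots> = s (ep L) (mu (mu e1 (mu (?S e2) (Q a))) one)"
        using h.antip(2)[OF lin_mu0[of "mu e1 (mu (?S e2) (Q a))"], of L] by (simp add: QS QL)
      finally show ?thesis using L by (simp add: assoc)
    qed
    have "p0 (Q a) = h.sw L (\<lambda>e1 e2. mu (mu e1 (?S e2)) (Q a))" unfolding p0_def in1 ..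
    also have "\<dots> = h.sw L (\<lambda>e1 e2. mu (mu (Q e1) (?S e2)) (Q a))" by (rule h.sw_cong_P) simp
    also have "\<dots> = s (ep L) (mu one (Q a))"
      using h.antip(2)[of s "\<lambda>x. mu x (Q a)" L] by (simp add: QS QL lin_rules)
    finally show ?thesis using L PQ by simp
  qed
  have ep0: "ep (p0 a) = ep a" for a
  proof -
    have eS: "ep (?S x) = ep (Q x)" for x using h.ep_S[of x] by (simp add: QS)
    have c: "h.sw L (\<lambda>x y. ep x * (c * ep (Q y))) = c" for c
    proof -
      have "h.sw L (\<lambda>x y. ep x * (c * ep (Q y))) = h.sw L (\<lambda>x y. ep (Q x) * (c * ep (Q y)))" by (rule h.sw_cong_P) simp
      also have "\<dots> = c * ep (Q (Q L))" by (rule h.counit_l[where ?s2.0="(*)"]) (intro lin_rules Q(1) lin_comp[OF lin_ep])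
      finally show ?thesis using L QL by simp
    qed
    have c': "h.sw L (\<lambda>x y. ep (Q y) * (ep a * ep x) * ep z) = ep a * ep z" for z
      using c[of "ep a * ep z"] by (simp add: mult_ac)
    have "ep (p0 a) = h.sw L (\<lambda>e1 e2. h.sw L (\<lambda>g1 g2. ep e1 * (ep (Q e2) * (ep a * ep g1) * ep (Q g2))))"
      unfolding p0_def h.sw_hom[OF lin_ep] by (simp add: f eS)
    also have "\<dots> = h.sw L (\<lambda>e1 e2. h.sw L (\<lambda>g1 g2. ep g1 * ((ep e1 * ep (Q e2) * ep a) * ep (Q g2))))"
      by (simp add: mult_ac)
    also have "\<dots> = h.sw L (\<lambda>e1 e2. ep e1 * ep (Q e2) * ep a)" by (simp only: c)
    also have "\<dots> = h.sw L (\<lambda>e1 e2. ep e1 * (ep a * ep (Q e2)))" by (simp add: mult_ac)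
    also have "\<dots> = ep a" by (rule c)
    finally show ?thesis .
  qed
  have Qp0: "Q (p0 a) = p0 a" for a
    unfolding p0_def h.sw_hom[OF Q(1)]
  proof (intro h.sw_cong_P)
    fix x y u v
    have "mu (f z) (?S v) = Q (mu (f z) (?S v))" for z v using QQ[of "f z" "?S v"] by (simp add: f QS)
    then show "Q (mu (Q x) (mu (f (mu (?S (Q y)) (mu a (Q u)))) (?S (Q v)))) = mu (Q x) (mu (f (mu (?S (Q y)) (mu a (Q u)))) (?S (Q v)))"
      using QQ by metis
  qed
  have "good p0"
    unfolding good_def using lin_p0 Qp0 ep0 left right p0Q by (simp add: p0_def)
  from good_limit[OF this] D_limit[OF this] obtain pi where g: "good pi" and D: "\<And>a. D pi a (tn s s) = 0" by blast
  have "dl (pi a) = sw a (\<lambda>x y. tn s s (pi x) (pi y))" for a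
    using D[of a] by (simp add: D_def sw_tn)
  moreover have "pi x = x" if "x \<in> Hc" for x using g Q(3)[OF that] by (metis good_def)
  moreover have "pi x \<in> Hc" for x using g Q(2)[of "pi x"] by (simp add: good_def)
  moreover have "pi (mu h a) = mu h (pi a)" "pi (mu a h) = mu (pi a) h" if "h \<in> Hc" for h a
    using g Q(3)[OF that] by (metis good_def)+
  ultimately show ?thesis using g by (intro exI[of _ pi]) (simp add: good_def)
qed

end

section \<open>The antipode of the whole bialgebra\<close>

context tbialg
begin

definition cv :: "('b \<Rightarrow> 'b) \<Rightarrow> ('b \<Rightarrow> 'b) \<Rightarrow> 'b \<Rightarrow> 'b" where
  "cv f g x = sw x (\<lambda>a b. mu (f a) (g b))"

lemma lin_cv: assumes "lin s s f" "lin s s g" shows "lin s s (cv f g)"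
  unfolding cv_def[abs_def] by (intro lin_rules bilinI lin_comp[OF assms(1)] lin_comp[OF assms(2)])

lemma cv_assoc:
  assumes f: "lin s s f" and g: "lin s s g" and h: "lin s s h"
  shows "cv (cv f g) h x = cv f (cv g h) x"
proof -
  have r: "lin s s (\<lambda>x. mu x c)" for c by (intro lin_rules)
  have "cv (cv f g) h x = sw x (\<lambda>a b. sw a (\<lambda>a1 a2. mu (f a1) (mu (g a2) (h b))))"
    unfolding cv_def sw_hom[OF r] by (simp add: assoc)
  also have "\<dots> = sw x (\<lambda>a b. sw b (\<lambda>b1 b2. mu (f a) (mu (g b1) (h b2))))"
    by (intro coassoc[where ?s2.0=s] lin_rules lin_comp[OF f] lin_comp[OF g] lin_comp[OF h])
  also have "\<dots> = cv f (cv g h) x"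
    unfolding cv_def sw_hom[OF lin_mu0] ..
  finally show ?thesis .
qed

lemma cv_unit: assumes "lin s s f"
  shows "cv (\<lambda>x. s (ep x) one) f x = P (f (P x))" "cv f (\<lambda>x. s (ep x) one) x = P (f (P x))"
proof -
  have 1: "mu (s c one) y = s c (P y)" "mu y (s c one) = s c (P y)" for c y
    by (simp_all add: linD(2)[OF bilinD(1)[OF bilin_mu]] linD(2)[OF bilinD(2)[OF bilin_mu]])
  show "cv (\<lambda>x. s (ep x) one) f x = P (f (P x))" "cv f (\<lambda>x. s (ep x) one) x = P (f (P x))"
    unfolding cv_def 1 by (rule counit_l[OF lin_comp[OF lin_P assms]], rule counit_r[OF lin_comp[OF lin_P assms]])
qed

end

locale tbialg_corad = tbialg s P dl ep mu one + tcoalg_corad s P dl ep H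
  for s :: "'k::field \<Rightarrow> 'a::ab_group_add \<Rightarrow> 'a" and P dl ep mu one H
begin

declare filt.simps(2) [simp del]

text \<open>If \<open>f * g = 1\<close> on the coradical, then \<open>1 - f * g\<close> is locally nilpotent for convolution, and the
  geometric series inverts \<open>f * g\<close>.\<close>

lemma left_inverse:
  assumes f: "lin s s f" and g: "lin s s g" and fg: "\<And>x. x \<in> H \<Longrightarrow> cv f g x = s (ep x) one"
  obtains G where "lin s s G" "\<And>x. cv G g x = s (ep x) one"
proof -
  define nu where "nu = (\<lambda>x. s (ep x) one - cv f g x)"
  have lfg: "lin s s (cv f g)" by (rule lin_cv[OF f g])
  have lnu: "lin s s nu" unfolding nu_def by (intro lin_rules lfg)
  \<comment> \<open>\<open>N k\<close> is the k-th convolution power of \<open>nu\<close>; the index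
    shift in \<open>filt\<close> makes it vanish on \<open>filt k\<close>.\<close>
  define N where "N k = rec_nat (\<lambda>x. s (ep x) one) (\<lambda>k n. cv n nu) k" for k
  have N: "N 0 = (\<lambda>x. s (ep x) one)" "N (Suc k) = cv (N k) nu" for k by (simp_all add: N_def)
  have lN: "lin s s (N k)" for k
    by (induction k) (simp_all add: N lin_cv lnu, intro lin_rules)
  have N0: "N k x = 0" if "x \<in> filt k" for k x
    using that
  proof (induction k arbitrary: x)
    case 0 then show ?case by (simp add: N linD(3)[OF lin_ep])
  next
    case (Suc k)
    have z: "mu 0 y = 0" "mu y 0 = 0" for y
      by (rule linD(3)[OF bilinD(1)[OF bilin_mu]], rule linD(3)[OF bilinD(2)[OF bilin_mu]])
    show ?case
      unfolding N cv_def
    proof (rule filt_Suc_legs[OF Suc.prems, where ?s2.0=s])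
      show "bilin s s s (\<lambda>a b. mu (N k a) (nu b))" by (intro bilinI lin_rules lin_comp[OF lN] lin_comp[OF lnu])
      show "mu (N k u) (nu v) = 0" if "u \<in> filt k" for u v using Suc.IH[OF that] z by simp
      show "mu (N k u) (nu v) = 0" if "v \<in> H" for u v using fg[OF that] z by (simp add: nu_def)
    qed
  qed
  \<comment> \<open>The geometric series. At x all terms from the first stage containing
    \<open>P x\<close> on are zero, so it may be cut off at any later stage as well.\<close>
  define T where "T x = (\<Sum>k<(LEAST n. P x \<in> filt n). N k x)" for x
  have NP: "N k (P x) = N k x" for k x by (cases k) (simp_all add: N cv_def)
  have T: "T x = (\<Sum>k<n. N k x)" if "P x \<in> filt n" for n x
  proof -
    define m where "m = (LEAST n. P x \<in> filt n)"
    have m: "P x \<in> filt m" "m \<le> n" unfolding m_def using that by (rule LeastI, rule Least_le)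
    have "N k x = 0" if "k \<in> {..<n} - {..<m}" for k
      using N0[of "P x" k] filt_mono[of m k] m that NP by auto
    then show ?thesis unfolding T_def m_def[symmetric] using m(2) by (intro sum.mono_neutral_left) auto
  qed
  have stage: "\<exists>n. P x \<in> filt n" for x using filt_exhausts[of "P x"] by auto
  have lT: "lin s s T"
  proof (rule linI)
    fix x y
    obtain n m where nm: "P x \<in> filt n" "P y \<in> filt m" using stage by blast
    then have 1: "P x \<in> filt (max n m)" "P y \<in> filt (max n m)"
      using filt_mono[of n "max n m"] filt_mono[of m "max n m"] by auto
    then have "P (x + y) \<in> filt (max n m)" using subspace_add[OF filtD(1)] by (simp add: linD(1)[OF lin_P])
    then show "T (x + y) = T x + T y" using T[OF 1(1)] T[OF 1(2)] T[of "x + y"] by (simp add: linD(1)[OF lN] sum.distrib)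
  next
    fix c x
    obtain n where n: "P x \<in> filt n" using stage by blast
    then have "P (s c x) \<in> filt n" using subspace_scale[OF filtD(1)] by (simp add: linD(2)[OF lin_P])
    then show "T (s c x) = s c (T x)" using T[OF n] T[of "s c x"] by (simp add: linD(2)[OF lN] scale_sum_right)
  qed simp_all
  have inv: "cv T (cv f g) x = s (ep x) one" for x
  proof -
    obtain n where n: "P x \<in> filt n" using stage by blast
    define U where "U y = (\<Sum>k<n. N k y)" for y
    have lU: "lin s s U" unfolding U_def[abs_def]
      by (induction n) (simp_all add: lin_zero lin_add lN)
    \<comment> \<open>The first legs of an element of \<open>filt n\<close> stay in
      \<open>filt n\<close>; one common cut-off n therefore replaces T by the finite sum U.\<close>
    have "sw (P x) (\<lambda>a b. mu (T a - U a) (cv f g b)) = 0"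
    proof (rule filt_legs[OF n, where ?s2.0=s])
      show "bilin s s s (\<lambda>a b. mu (T a - U a) (cv f g b))"
        by (intro bilinI lin_rules lin_comp[OF lT] lin_comp[OF lU] lin_comp[OF lfg] lT lU)
      fix u v assume u: "u \<in> filt n"
      then have "T u = U u" using T[of u n] filtD(4)[OF u] by (simp add: U_def)
      then show "mu (T u - U u) (cv f g v) = 0" by (simp add: linD(3)[OF bilinD(1)[OF bilin_mu]])
    qed
    then have "cv T (cv f g) x = cv U (cv f g) x"
      by (simp add: cv_def linD(4)[OF bilinD(1)[OF bilin_mu]] sw_sum)
    also have "\<dots> = (\<Sum>k<n. cv (N k) (cv f g) x)"
      unfolding U_def[abs_def] cv_def lin_sum[OF bilinD(1)[OF bilin_mu]]
      by (induction n) (simp_all add: sw_sum)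
    \<comment> \<open>Since f * g is 1 - \<open>nu\<close>, each term is a difference of consecutive
      powers, and the sum telescopes.\<close>
    also have "\<dots> = (\<Sum>k<n. N k x - N (Suc k) x)"
    proof (rule sum.cong[OF refl])
      fix k
      have "N (Suc k) x = cv (N k) (\<lambda>x. s (ep x) one) x - cv (N k) (cv f g) x"
        unfolding N cv_def nu_def linD(4)[OF bilinD(2)[OF bilin_mu]] sw_sum ..
      moreover have "P (N k (P x)) = N k x"
        by (cases k) (simp_all add: N cv_def linD(2)[OF lin_P] sw_hom[OF lin_P])
      ultimately show "cv (N k) (cv f g) x = N k x - N (Suc k) x" by (simp add: cv_unit[OF lN])
    qed
    also have "\<dots> = N 0 x - N n x" by (induction n) simp_all
    also have "\<dots> = s (ep x) one" using N0[OF n] NP[of n x] by (simp add: N)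
    finally show ?thesis .
  qed
  show ?thesis
    by (rule that[OF lin_cv[OF lT f]]) (simp add: cv_assoc[OF lT f g] inv)
qed

lemma H_legs:
  assumes "x \<in> H" "bilin s s s2 B" "\<And>u v. v \<in> H \<Longrightarrow> B u v = 0" shows "sw x B = 0"
proof (rule filt_Suc_legs[OF _ assms(2) _ assms(3)])
  show "x \<in> filt (Suc 0)" using assms(1) filt_1 by simp
  show "B u v = 0" if "u \<in> filt 0" for u v using that linD(3)[OF bilinD(1)[OF assms(2)]] by simp
qed

text \<open>\<open>left_inverse\<close> gives G with G * P = 1. On the coradical G agrees with S, so
  P * G = 1 there, and a second use of \<open>left_inverse\<close> gives a G' with G' * G = 1.
  Associativity identifies G' with P up to projection, so G is a two-sided inverse.\<close>

lemma exists_antipode: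
  assumes S: "lin s s S" and HS: "\<And>x. x \<in> H \<Longrightarrow> cv S P x = s (ep x) one" "\<And>x. x \<in> H \<Longrightarrow> cv P S x = s (ep x) one"
  obtains G where "lin s s G" "\<And>x. P (G x) = G x" "\<And>x. cv G P x = s (ep x) one" "\<And>x. cv P G x = s (ep x) one"
proof -
  obtain G0 where G0: "lin s s G0" "\<And>x. cv G0 P x = s (ep x) one" by (rule left_inverse[OF S lin_P HS(1)]) (assumption, rule that)
  define G where "G = (\<lambda>x. P (G0 x))"
  have lG: "lin s s G" unfolding G_def by (intro lin_rules G0)
  have G: "cv G P x = s (ep x) one" for x using G0(2)[of x] by (simp add: cv_def G_def)
  have "cv P G x = s (ep x) one" if "x \<in> H" for x
  proof -
    have GS: "G y = P (S y)" if y: "y \<in> H" for y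
    proof -
      have Py: "P y = y" using HD(6)[OF y] .
      have lPS: "lin s s (cv P S)" by (rule lin_cv[OF lin_P S])
      have "sw y (\<lambda>a b. mu (G a) (cv P S b - s (ep b) one)) = 0"
      proof (rule H_legs[OF y, where ?s2.0=s])
        show "bilin s s s (\<lambda>a b. mu (G a) (cv P S b - s (ep b) one))"
          by (intro bilinI lin_rules lin_comp[OF lG] lin_comp[OF lPS] lPS lG)
      qed (simp add: HS linD(3)[OF bilinD(2)[OF bilin_mu]])
      then have "cv G (cv P S) y = cv G (\<lambda>b. s (ep b) one) y"
        by (simp add: cv_def linD(4)[OF bilinD(2)[OF bilin_mu]] sw_sum)
      moreover have "cv G (cv P S) y = cv (\<lambda>b. s (ep b) one) S y"
        using cv_assoc[OF lG lin_P S, of y] by (simp add: G cv_def[of "cv G P"] cv_def[of "\<lambda>b. s (ep b) one"])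
      ultimately show ?thesis using cv_unit(1)[OF S, of y] cv_unit(2)[OF lG, of y] Py by (simp add: G_def)
    qed
    have res: "cv F G x = cv F S x" if F: "lin s s F" for F
    proof -
      have "sw x (\<lambda>a b. mu (F a) (G b - P (S b))) = 0"
      proof (rule H_legs[OF \<open>x \<in> H\<close>, where ?s2.0=s])
        show "bilin s s s (\<lambda>a b. mu (F a) (G b - P (S b)))"
          by (intro bilinI lin_rules lin_comp[OF lG] lin_comp[OF S] lin_comp[OF F] S lG F)
      qed (simp add: GS linD(3)[OF bilinD(2)[OF bilin_mu]])
      then show ?thesis by (simp add: cv_def linD(4)[OF bilinD(2)[OF bilin_mu]] sw_sum)
    qed
    show ?thesis using res[OF lin_P] HS(2)[OF that] by simp
  qed
  then obtain G' where G': "lin s s G'" "\<And>x. cv G' G x = s (ep x) one" by (rule left_inverse[OF lin_P lG]) (assumption, rule that)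
  have "cv P G x = s (ep x) one" for x
  proof -
    have GP: "cv G P = (\<lambda>x. s (ep x) one)" "cv G' G = (\<lambda>x. s (ep x) one)" using G G' by auto
    have "P = (\<lambda>x. P (G' (P x)))"
    proof
      fix y
      show "P y = P (G' (P y))"
        using cv_unit(2)[OF G'(1), of y] cv_unit(1)[OF lin_P, of y] cv_assoc[OF G'(1) lG lin_P, of y] by (simp add: GP)
    qed
    then have "cv P G x = cv (\<lambda>x. P (G' (P x))) G x" by (rule arg_cong)
    also have "\<dots> = cv G' G x" unfolding cv_def by (rule sw_cong_P) simp
    finally show ?thesis by (simp add: G')
  qed
  then show ?thesis using that lG G by (simp add: G_def)
qed

end

section \<open>The splitting\<close>

text \<open>Here \<open>S\<close> is the antipode of H composed with \<open>pi\<close>, hence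
  defined on all of A. The map \<open>pi\<close> is assumed multiplicative only if one of the two
  factors lies in H.\<close>

locale split = tbialg s P dl ep mu one
  for s :: "'k::field \<Rightarrow> 'a::ab_group_add \<Rightarrow> 'a" and P dl ep mu one +
  fixes pi S :: "'a \<Rightarrow> 'a"
  assumes lin_pi: "lin s s pi" and pi_P [simp]: "pi (P x) = pi x" "P (pi x) = pi x" "pi (pi x) = pi x"
    and ep_pi [simp]: "ep (pi x) = ep x" and pi_one [simp]: "pi one = one"
    and pi_mu [simp]: "pi (mu (pi x) y) = mu (pi x) (pi y)" "pi (mu x (pi y)) = mu (pi x) (pi y)"
    and dl_pi: "dl (pi a) = sw a (\<lambda>x y. tn s s (pi x) (pi y))"
    and lin_S: "lin s s S" and S_pi [simp]: "S (pi x) = S x" "pi (S x) = S x"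
    and S_antip: "sw a (\<lambda>x y. mu (S x) (pi y)) = s (ep a) one" "sw a (\<lambda>x y. mu (pi x) (S y)) = s (ep a) one"
    and S_mu0: "S (mu (pi x) (pi y)) = mu (S y) (S x)" and dl_S: "dl (S a) = sw a (\<lambda>x y. tn s s (S y) (S x))"
    and ep_S [simp]: "ep (S x) = ep x" and S_one [simp]: "S one = one"
begin

lemma P_S [simp]: "S (P x) = S x" "P (S x) = S x"
  by (metis S_pi(1) pi_P(1), metis S_pi(2) pi_P(2))

lemma lin_pi' [lin_rules]: "lin s0 s f \<Longrightarrow> lin s0 s (\<lambda>x. pi (f x))"
  and lin_S' [lin_rules]: "lin s0 s f \<Longrightarrow> lin s0 s (\<lambda>x. S (f x))"
  using lin_comp lin_pi lin_S by blast+

lemmas [lin_rules] = lin_pi lin_S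

lemma S_mu [simp]: "S (mu (pi x) y) = mu (S y) (S x)" "S (mu x (pi y)) = mu (S y) (S x)"
  using S_mu0[of x y] S_pi(1)[of "mu (pi x) y"] S_pi(1)[of "mu x (pi y)"] by simp_all

lemma S_mu_S [simp]: "S (mu (S x) y) = mu (S y) (S (S x))" "S (mu x (S y)) = mu (S (S y)) (S x)"
  "pi (mu (S x) y) = mu (S x) (pi y)" "pi (mu x (S y)) = mu (pi x) (S y)"
  using S_mu[of "S x" y] S_mu[of x "S y"] pi_mu[of "S x" y] pi_mu[of x "S y"] by simp_all

lemma sw_pi: assumes F: "bilin s s s2 F" shows "sw (pi a) F = sw a (\<lambda>x y. F (pi x) (pi y))"
  and sw_S: "sw (S a) F = sw a (\<lambda>x y. F (S y) (S x))"
proof -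
  have 1: "sw z F = tlift s s F (dl z)" for z using sw_hom[OF lin_tlift[OF F], of z "tn s s"] by (simp add: sw_tn tlift_tn[OF F])
  show "sw (pi a) F = sw a (\<lambda>x y. F (pi x) (pi y))" "sw (S a) F = sw a (\<lambda>x y. F (S y) (S x))"
    unfolding 1 dl_pi dl_S by (simp_all add: sw_hom[OF lin_tlift[OF F]] tlift_tn[OF F])
qed

lemma antip: assumes "lin s s2 f"
  shows "sw x (\<lambda>a b. f (mu (S a) (pi b))) = s2 (ep x) (f one)" "sw x (\<lambda>a b. f (mu (pi a) (S b))) = s2 (ep x) (f one)"
  by (simp_all add: S_antip linD(2)[OF assms] flip: sw_hom[OF assms])

text \<open>The projection onto the right coinvariants, the elements a with a_1 \<otimes> \<pi>(a_2)
  = a \<otimes> 1. The map is idempotent but not multiplicative in general.\<close>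

definition tau :: "'a \<Rightarrow> 'a" where "tau a = sw a (\<lambda>x y. mu x (S y))"

lemma lin_tau: "lin s s tau" unfolding tau_def[abs_def] by (intro lin_rules bilinI)

lemma lin_tau' [lin_rules]: "lin s0 s f \<Longrightarrow> lin s0 s (\<lambda>x. tau (f x))"
  using lin_comp lin_tau by blast

lemmas [lin_rules] = lin_tau

lemma tau_P [simp]: "tau (P x) = tau x" "P (tau x) = tau x"
  by (simp_all add: tau_def sw_hom[OF lin_P])

lemma tau_mu_pi [simp]: "tau (mu a (pi h)) = s (ep h) (tau a)"
proof -
  have "tau (mu a (pi h)) = sw a (\<lambda>x y. sw h (\<lambda>k l. mu x (mu (mu (pi k) (S l)) (S y))))"
    unfolding tau_def by (subst sw_mu[where ?s2.0=s], intro lin_rules bilinI, subst sw_pi[where ?s2.0=s], intro lin_rules bilinI) (simp add: assoc)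
  also have "\<dots> = sw a (\<lambda>x y. s (ep h) (mu x (mu one (S y))))"
    by (subst antip[where ?s2.0=s], intro lin_rules, simp)
  finally show ?thesis by (simp add: tau_def sw_scale[OF vs])
qed

lemma tau_mu_S [simp]: "tau (mu a (S h)) = s (ep h) (tau a)"
  using tau_mu_pi[of a "S h"] by simp

lemma tau_one [simp]: "tau one = one"
  unfolding tau_def by (subst sw_one[where ?s2.0=s]) (intro lin_rules bilinI, simp)

lemma pi_tau [simp]: "pi (tau a) = s (ep a) one"
  by (simp add: tau_def sw_hom[OF lin_pi] S_antip)

lemma ep_tau [simp]: "ep (tau a) = ep a"
  using ep_pi[of "tau a"] by (simp add: linD(2)[OF lin_ep] del: ep_pi)

lemma S_tau [simp]: "S (tau a) = s (ep a) one"
  using S_pi(1)[of "tau a"] by (simp add: linD(2)[OF lin_S] del: S_pi)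

text \<open>S reverses coproducts, so \<Delta>(a_1 S(a_2)) = a_1 S(a_4) \<otimes> a_2 S(a_3): the
  inner pair is again a value of \<tau>. All coproduct formulas on R come from this one.\<close>

lemma sw_tau: assumes F: "bilin s s s2 F"
  shows "sw (tau a) F = sw a (\<lambda>x z. sw z (\<lambda>y w. F (mu x (S w)) (tau y)))"
proof -
  note R = lin_rules bilinI lin_bilin1[OF F] lin_bilin2[OF F] lin_vs(2)[OF bilinD(1)[OF F]]
  have g: "lin s s2 (\<lambda>z. sw z F)" by (intro R F)
  have "sw (tau a) F = sw a (\<lambda>x z. sw (mu x (S z)) F)"
    unfolding tau_def by (rule sw_hom[OF g])
  also have "\<dots> = sw a (\<lambda>p z. sw p (\<lambda>x y. sw z (\<lambda>u v. F (mu x (S v)) (mu y (S u)))))"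
    by (subst sw_mu[OF F], subst sw_S[where ?s2.0=s2], intro R, simp)
  also have "\<dots> = sw a (\<lambda>x z. sw z (\<lambda>y q. sw q (\<lambda>u v. F (mu x (S v)) (mu y (S u)))))"
    by (intro coassoc[where ?s2.0=s2] R)
  also have "\<dots> = sw a (\<lambda>x z. sw z (\<lambda>q v. sw q (\<lambda>y u. F (mu x (S v)) (mu y (S u)))))"
    by (subst coassoc[where ?s2.0=s2], (intro R)+, simp)
  finally show ?thesis by (simp add: tau_def sw_hom[OF bilinD(2)[OF F]])
qed

lemma tau_tau [simp]: "tau (tau a) = tau a"
proof -
  have "tau (tau a) = sw a (\<lambda>x z. sw z (\<lambda>y w. s (ep y) (mu x (S w))))"
    unfolding tau_def[of "tau a"] 
    by (subst sw_tau[where ?s2.0=s], intro lin_rules bilinI) (simp add: linD(2)[OF lin_mu0])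
  also have "\<dots> = tau a"
    unfolding tau_def[of a] by (subst counit_l[where ?s2.0=s], intro lin_rules, simp)
  finally show ?thesis .
qed

text \<open>In \<open>sw_tau\<close> the trailing S-factor of the first leg is absorbed by \<tau>.
  Thus \<tau> is a coalgebra map onto R, with comultiplication \<tau> \<otimes> \<tau> after
  \<Delta>.\<close>

lemma sw_tau_tau: assumes F: "bilin s s s2 F"
  shows "sw (tau a) (\<lambda>x y. F (tau x) (tau y)) = sw a (\<lambda>x y. F (tau x) (tau y))"
proof -
  note R = lin_rules bilinI lin_bilin1[OF F] lin_bilin2[OF F] lin_vs(2)[OF bilinD(1)[OF F]]
  have "sw (tau a) (\<lambda>x y. F (tau x) (tau y)) = sw a (\<lambda>x z. sw z (\<lambda>y w. s2 (ep w) (F (tau x) (tau y))))"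
    by (subst sw_tau[where ?s2.0=s2], intro R) (simp add: linD(2)[OF bilinD(1)[OF F]])
  also have "\<dots> = sw a (\<lambda>x y. F (tau x) (tau y))"
    by (subst counit_r[where ?s2.0=s2], intro R, simp)
  finally show ?thesis .
qed

lemma sw_pi_tau: assumes F: "bilin s s s2 F"
  shows "sw (tau a) (\<lambda>x y. F (pi x) (tau y)) = sw a (\<lambda>x z. sw z (\<lambda>y w. F (mu (pi x) (S w)) (tau y)))"
proof -
  note R = lin_rules bilinI lin_bilin1[OF F] lin_bilin2[OF F] lin_vs(2)[OF bilinD(1)[OF F]]
  show ?thesis by (subst sw_tau[where ?s2.0=s2], intro R) simp
qed

text \<open>R is a left coideal: by \<open>sw_tau\<close> the second leg already lies in R. This
  allows \<tau> to be inserted in or removed from second legs.\<close>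

lemma sw_R: assumes F: "bilin s s s2 F" and r: "tau r = r"
  shows "sw r (\<lambda>x y. F x (tau y)) = sw r F"
proof -
  note R = lin_rules bilinI lin_bilin1[OF F] lin_bilin2[OF F] lin_vs(2)[OF bilinD(1)[OF F]]
  have "sw (tau r) (\<lambda>x y. F x (tau y)) = sw (tau r) F"
    by (subst sw_tau[where ?s2.0=s2], intro R, subst sw_tau[OF F], simp)
  then show ?thesis by (simp add: r)
qed

text \<open>This is the Hopf module decomposition \<open>A = R \<otimes> H\<close>.\<close>

lemma decompose: assumes "lin s s2 f" shows "sw a (\<lambda>x y. f (mu (tau x) (pi y))) = f (P a)"
proof -
  have "sw a (\<lambda>x y. mu (tau x) (pi y)) = sw a (\<lambda>q y. sw q (\<lambda>x z. mu x (mu (S z) (pi y))))"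
    using sw_hom[OF lin_mu(1)[OF lin_id[OF vs]]] by (simp add: tau_def assoc)
  also have "\<dots> = sw a (\<lambda>x q. sw q (\<lambda>z y. mu x (mu (S z) (pi y))))"
    by (intro coassoc[where ?s2.0=s] lin_rules)
  also have "\<dots> = sw a (\<lambda>x q. s (ep q) (mu x one))"
    by (subst antip[where ?s2.0=s], intro lin_rules, simp)
  also have "\<dots> = P (P a)" unfolding mu_one by (rule counit_r) (intro lin_rules)
  finally show ?thesis by (simp flip: sw_hom[OF assms])
qed

text \<open>\<tau>(b) arises from b by right factors in H, and \<tau> turns such factors into
  counits.\<close>

lemma tau_mu_tau [simp]: "tau (mu a (tau b)) = tau (mu a b)"
proof -
  have "tau (mu a (tau b)) = sw b (\<lambda>x y. s (ep y) (tau (mu a x)))"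
    using tau_mu_S[of "mu a _"] by (simp add: tau_def[of b] sw_hom[OF lin_mu0] sw_hom[OF lin_tau] assoc[symmetric])
  also have "\<dots> = tau (mu a (P b))" by (intro counit_r lin_rules)
  finally show ?thesis by simp
qed

lemma pi_mu_tau: "pi (mu a (tau b)) = sw b (\<lambda>x y. mu (pi (mu a x)) (S y))"
  by (simp add: tau_def sw_hom[OF lin_mu0] sw_hom[OF lin_pi] assoc[symmetric])

text \<open>Identifies \<tau>(hb) as the adjoint action of h on \<tau>(b), the Yetter-Drinfeld
  action on R.\<close>

lemma tau_pi_mu: "tau (mu (pi h) b) = sw (pi h) (\<lambda>k l. mu (mu k (tau b)) (S l))"
proof -
  have "tau (mu (pi h) b) = sw h (\<lambda>k l. sw b (\<lambda>x y. mu (mu (pi k) (mu x (S y))) (S l)))"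
    unfolding tau_def
    by (subst sw_mu[where ?s2.0=s], intro lin_rules bilinI, subst sw_pi[where ?s2.0=s], intro lin_rules bilinI) (simp add: assoc)
  also have "\<dots> = sw h (\<lambda>k l. mu (mu (pi k) (tau b)) (S l))"
    using sw_hom[OF lin_mu(1)[OF lin_id[OF vs]]] by (simp add: tau_def sw_hom[OF lin_mu0])
  also have "\<dots> = sw (pi h) (\<lambda>k l. mu (mu k (tau b)) (S l))"
    by (subst sw_pi[where ?s2.0=s]) (intro lin_rules bilinI, simp)
  finally show ?thesis .
qed

end

lemma sweedler_tlift:
  assumes "is_vspace V" "is_vspace W" "bilin (scl V) (scl W) s3 G"
    and "\<And>v w. v \<in> car V \<Longrightarrow> w \<in> car W \<Longrightarrow> F v w = G v w" and "t \<in> car (tensor V W)"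
  shows "sweedler V W t F = tlift (scl V) (scl W) G t"
  using sweedler_swt[OF assms] tlift_swt[OF assms(3)] car_tensor_full[OF assms(5)] by simp

lemma tlift_hom: "lin s3 s4 g \<Longrightarrow> g (tlift s1 s2 F t) = tlift s1 s2 (\<lambda>x y. g (F x y)) t"
  by (simp add: tlift_def swt_def sweedler_def linear_sum_list case_prod_beta')

lemma tlift_mem: "(\<And>x y. F x y \<in> car (tensor V W)) \<Longrightarrow> tlift s1 s2 F t \<in> car (tensor V W)"
  by (auto simp: tlift_def swt_def sweedler_def intro!: tensor_sum_list)

lemma lin_tlift_arg [lin_rules]: "bilin s1 s2 s3 F \<Longrightarrow> lin s0 pscl f \<Longrightarrow> lin s0 s3 (\<lambda>x. tlift s1 s2 F (f x))"
  by (rule lin_comp[OF lin_tlift])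

lemma (in tcoalg) sw_mem: "(\<And>x y. T x y \<in> car (tensor V W)) \<Longrightarrow> sw a T \<in> car (tensor V W)"
  unfolding sw_def by (rule tensor_sum_list)

lemma tn_mem: "x \<in> car V \<Longrightarrow> y \<in> car W \<Longrightarrow> s1 = scl V \<Longrightarrow> s2 = scl W \<Longrightarrow> tn s1 s2 x y \<in> car (tensor V W)"
  using tens_mem[of x V y W] by (simp add: tens_tn)

section \<open>The dual Yetter--Drinfeld quadruple\<close>

locale split_raw = split s P dl ep mu one pi S
  for s :: "'k::field \<Rightarrow> 'a::ab_group_add \<Rightarrow> 'a" and P dl ep mu one pi S +
  fixes Hr :: "('k, 'a) bialgebra" and Sr :: "'a \<Rightarrow> 'a"
  assumes car_Hr [simp]: "car Hr = range pi" and scl_Hr [simp]: "scl Hr = s"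
    and hopf: "is_hopf_algebra Hr Sr"
    and Hr_ops: "pi x = x \<Longrightarrow> comul Hr x = dl x" "pi x = x \<Longrightarrow> counit Hr x = ep x"
      "pi x = x \<Longrightarrow> pi y = y \<Longrightarrow> mul Hr x y = mu x y" "pi x = x \<Longrightarrow> Sr x = S x" 
    and unit_Hr [simp]: "unit Hr = one"
begin

lemmas [simp] = Hr_ops(2-4)

text \<open>The action is the adjoint one (\<open>tau_pi_mu\<close>), the coaction is \<Delta> with
  first leg sent to H. The \<tau> in the second leg of the coaction changes nothing on R but keeps
  the values inside the tensor product for every argument.\<close>

definition R :: "('k, 'a, 'a) yd_coalgebra" where
  "R = \<lparr>car = range tau, scl = s, comul = (\<lambda>r. sw r (\<lambda>x y. tn s s (tau x) (tau y))), counit = ep,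
     act = (\<lambda>h r. tau (mu (pi h) r)), coact = (\<lambda>r. sw r (\<lambda>x y. tn s s (pi x) (tau y)))\<rparr>"

lemma R_simps [simp]: "car R = range tau" "scl R = s" "comul R r = sw r (\<lambda>x y. tn s s (tau x) (tau y))"
  "counit R = ep" "act R h r = tau (mu (pi h) r)" "coact R r = sw r (\<lambda>x y. tn s s (pi x) (tau y))"
  by (simp_all add: R_def)

abbreviation "TT \<equiv> tensor R R"

definition m :: "('k, 'a, 'a) tensor \<Rightarrow> 'a" where "m = tlift s s (\<lambda>x y. tau (mu x y))"
definition xi :: "('k, 'a, 'a) tensor \<Rightarrow> 'a" where "xi = tlift s s (\<lambda>x y. pi (mu x y))"

lemma bilin_mxi: "bilin s s s (\<lambda>x y. tau (mu x y))" "bilin s s s (\<lambda>x y. pi (mu x y))"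
  by (intro lin_rules bilinI)+

lemma lin_m [lin_rules]: "lin s0 pscl f \<Longrightarrow> lin s0 s (\<lambda>x. m (f x))"
  and lin_xi [lin_rules]: "lin s0 pscl f \<Longrightarrow> lin s0 s (\<lambda>x. xi (f x))"
  unfolding m_def xi_def using lin_comp lin_tlift[OF bilin_mxi(1)] lin_tlift[OF bilin_mxi(2)] by blast+

lemma m_tn [simp]: "m (tn s s x y) = tau (mu x y)" and xi_tn [simp]: "xi (tn s s x y) = pi (mu x y)"
  by (simp_all add: m_def xi_def tlift_tn[OF bilin_mxi(1)] tlift_tn[OF bilin_mxi(2)])

lemma tau_m [simp]: "tau (m t) = m t" and pi_xi [simp]: "pi (xi t) = xi t" and P_m [simp]: "P (m t) = m t"
proof -
  show 1: "tau (m t) = m t" by (simp add: m_def tlift_hom[OF lin_tau])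
  show "pi (xi t) = xi t" by (simp add: xi_def tlift_hom[OF lin_pi])
  show "P (m t) = m t" using tau_P(2)[of "m t"] by (simp add: 1)
qed

lemma vspaces [simp]: "is_vspace R" "is_vspace Hr" "is_vspace (tensor V W)"
proof -
  interpret t: Vector_Spaces.linear s s tau by (rule lin_tau)
  interpret p: Vector_Spaces.linear s s pi by (rule lin_pi)
  show "is_vspace R" "is_vspace Hr" by (simp_all add: is_vspace_def t.subspace_image p.subspace_image)
qed (rule is_vspace_tensor)

lemma in_tau: "r \<in> range tau \<longleftrightarrow> tau r = r" by (metis tau_tau rangeI rangeE)
lemma in_pi: "r \<in> range pi \<longleftrightarrow> pi r = r" by (metis pi_P(3) rangeI rangeE)

lemma comul_R_mem: "comul R r \<in> car TT" and coact_mem: "coact R r \<in> car (tensor Hr R)"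
  by (simp_all) (rule sw_mem, rule tn_mem; simp)+

lemma conv_R:
  assumes "bilin s s s3 G" "\<And>x y. F (tau x) (tau y) = G (tau x) (tau y)"
  shows "sweedler R R (comul R r) F = sw r (\<lambda>x y. G (tau x) (tau y))"
proof -
  have "sweedler R R (comul R r) F = tlift s s G (comul R r)"
    using sweedler_tlift[of R R s3 G F "comul R r"] assms comul_R_mem by (auto simp del: R_simps(3))
  then show ?thesis by (simp add: sw_hom[OF lin_tlift[OF assms(1)]] tlift_tn[OF assms(1)])
qed

lemma conv_coact:
  assumes "bilin s s s3 G" "\<And>x y. F (pi x) (tau y) = G (pi x) (tau y)"
  shows "sweedler Hr R (coact R r) F = sw r (\<lambda>x y. G (pi x) (tau y))"
proof -
  have "sweedler Hr R (coact R r) F = tlift s s G (coact R r)"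
    using sweedler_tlift[of Hr R s3 G F "coact R r"] assms coact_mem by (auto simp del: R_simps(6))
  then show ?thesis by (simp add: sw_hom[OF lin_tlift[OF assms(1)]] tlift_tn[OF assms(1)])
qed

lemma conv_H:
  assumes "pi h = h" "bilin s s s3 G" "\<And>x y. F (pi x) (pi y) = G (pi x) (pi y)"
  shows "sweedler Hr Hr (comul Hr h) F = sw h G"
proof -
  have "comul Hr h \<in> car (tensor Hr Hr)"
  proof -
    have "linear_map Hr (tensor Hr Hr) (comul Hr)"
      using hopf by (simp add: is_hopf_algebra_def is_bialgebra_def is_coalgebra_def)
    moreover have "h \<in> car Hr" using assms(1) by (simp add: in_pi)
    ultimately show ?thesis unfolding linear_map_def by blast
  qed
  then have "sweedler Hr Hr (comul Hr h) F = tlift s s G (dl h)"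
    using sweedler_tlift[of Hr Hr s3 G F "comul Hr h"] assms by (auto simp: Hr_ops(1))
  then show ?thesis by (simp add: tlift_tn[OF assms(2)] sw_hom[OF lin_tlift[OF assms(2)]] flip: sw_tn)
qed

lemma sw_H: "pi h = h \<Longrightarrow> bilin s s s2 G \<Longrightarrow> sw h (\<lambda>x y. G (pi x) (pi y)) = sw h G"
  by (metis sw_pi)

lemma conv_tn: assumes "bilin s s s3 G" "tau r = r" "tau t = t" "\<And>x y. F (tau x) (tau y) = G (tau x) (tau y)"
  shows "sweedler R R (tn s s r t) F = G r t"
proof -
  have "F v w = G v w" if "tau v = v" "tau w = w" for v w using assms(4)[of v w] that by simp
  then have "sweedler R R (tn s s r t) F = tlift s s G (tn s s r t)"
    using sweedler_tlift[of R R s3 G F "tn s s r t"] assms tn_mem[of r R t R s s] by (auto simp: in_tau)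
  then show ?thesis by (simp add: tlift_tn[OF assms(1)])
qed

lemma comul2_eq:
  assumes r: "tau r = r" and t: "tau t = t"
  shows "comul2 Hr R (tn s s r t) = sw r (\<lambda>r1 r2. sw t (\<lambda>t1 t2. sw r2 (\<lambda>g r0.
    tn pscl pscl (tn s s (tau r1) (tau (mu (pi g) t1))) (tn s s (tau r0) (tau t2)))))"
proof -
  let ?K = "\<lambda>r1 r2 t1 t2. sw r2 (\<lambda>g r0. tn pscl pscl (tn s s r1 (tau (mu (pi g) t1))) (tn s s (tau r0) t2))"
  note R = lin_rules bilinI
  have 1: "sweedler Hr R (coact R (tau r2)) (\<lambda>g r0. tens TT TT (tens R R (tau r1) (act R g (tau t1))) (tens R R r0 (tau t2))) = ?K (tau r1) (tau r2) (tau t1) (tau t2)" for r1 r2 t1 t2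
    by (subst conv_coact[where ?s3.0=pscl and G = "\<lambda>g r0. tn pscl pscl (tn s s (tau r1) (tau (mu (pi g) t1))) (tn s s r0 (tau t2))"],
        intro R) (simp_all add: tens_tn)
  have 2: "sweedler R R (comul R t) (\<lambda>t1 t2. sweedler Hr R (coact R (tau r2)) (\<lambda>g r0. tens TT TT (tens R R (tau r1) (act R g t1)) (tens R R r0 t2))) =
      sw t (\<lambda>t1 t2. ?K (tau r1) (tau r2) (tau t1) (tau t2))" for r1 r2 t
    by (rule conv_R[where ?s3.0=pscl and G = "\<lambda>t1 t2. ?K (tau r1) (tau r2) t1 t2"]) (intro R, rule 1)
  have 3: "sweedler R R (comul R r) (\<lambda>r1 r2. sweedler R R (comul R t) (\<lambda>t1 t2. sweedler Hr R (coact R r2) (\<lambda>g r0. tens TT TT (tens R R r1 (act R g t1)) (tens R R r0 t2)))) =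
      sw r (\<lambda>r1 r2. sw t (\<lambda>t1 t2. ?K (tau r1) (tau r2) (tau t1) (tau t2)))" for r t
    by (rule conv_R[where ?s3.0=pscl and G = "\<lambda>r1 r2. sw t (\<lambda>t1 t2. ?K r1 r2 (tau t1) (tau t2))"]) (intro R, rule 2)
  have "comul2 Hr R (tn s s r t) = sw r (\<lambda>r1 r2. sw t (\<lambda>t1 t2. ?K (tau r1) (tau r2) (tau t1) (tau t2)))"
    unfolding comul2_def
    by (rule conv_tn[where ?s3.0=pscl and G = "\<lambda>r t. sw r (\<lambda>r1 r2. sw t (\<lambda>t1 t2. ?K (tau r1) (tau r2) (tau t1) (tau t2)))"])
      (intro R, rule r, rule t, rule 3)
  also have "\<dots> = sw r (\<lambda>r1 r2. sw t (\<lambda>t1 t2. ?K (tau r1) r2 (tau t1) (tau t2)))"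
    by (rule sw_R[OF _ r, where ?s2.0=pscl and F = "\<lambda>r1 r2. sw t (\<lambda>t1 t2. ?K (tau r1) r2 (tau t1) (tau t2))"]) (intro R)
  finally show ?thesis by simp
qed

lemma comul2_mem: "tau r = r \<Longrightarrow> tau t = t \<Longrightarrow> comul2 Hr R (tn s s r t) \<in> car (tensor TT TT)"
  unfolding comul2_eq by (intro sw_mem tn_mem) auto

lemma conv_comul2:
  assumes r: "tau r = r" and t: "tau t = t" and G: "bilin pscl pscl s3 G"
    and FG: "\<And>x y. x \<in> car TT \<Longrightarrow> y \<in> car TT \<Longrightarrow> F x y = G x y"
  shows "sweedler TT TT (comul2 Hr R (tn s s r t)) F = sw r (\<lambda>r1 r2. sw t (\<lambda>t1 t2. sw r2 (\<lambda>g r0.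
    G (tn s s (tau r1) (tau (mu (pi g) t1))) (tn s s (tau r0) (tau t2)))))"
  using sweedler_tlift[of TT TT s3 G F "comul2 Hr R (tn s s r t)"] comul2_mem[OF r t] G FG
  by (simp add: comul2_eq[OF r t] sw_hom[OF lin_tlift[OF G]] tlift_tn[OF G])

text \<open>The coaction leg produced by the braiding sits next to \<tau>(r_1), and \<tau>(r_1)
  \<pi>(r_2) reassembles to one leg by \<open>decompose\<close>.\<close>

lemma merge:
  assumes F: "\<And>z. lin s s3 (\<lambda>x. F x z)" "\<And>x. lin s s3 (F x)"
  shows "sw r (\<lambda>r1 r2. sw r2 (\<lambda>g r0. F (mu (tau r1) (pi g)) r0)) = sw r F"
proof -
  have "sw r (\<lambda>r1 r2. sw r2 (\<lambda>g r0. F (mu (tau r1) (pi g)) r0)) = sw r (\<lambda>q r0. sw q (\<lambda>r1 g. F (mu (tau r1) (pi g)) r0))"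
    by (rule sym, rule coassoc[where ?s2.0=s3]) (intro lin_comp[OF F(1)] lin_rules F(2))+
  also have "\<dots> = sw r (\<lambda>q r0. F (P q) r0)" by (simp add: decompose[OF F(1)])
  finally show ?thesis by (simp add: sw_P)
qed

text \<open>Inside the outer \<tau> the action on t_1 may be replaced by plain multiplication
  (\<open>tau_mu_tau\<close>). Then \<tau>(r_1) \<pi>(g) is reassembled by \<open>merge\<close>, and
  the braiding disappears.\<close>

lemma m_comul2:
  assumes r: "tau r = r" and t: "tau t = t" and N: "bilin s pscl s3 N"
  shows "sweedler TT TT (comul2 Hr R (tn s s r t)) (\<lambda>x y. N (m x) y) =
    sw r (\<lambda>r1 r2. sw t (\<lambda>t1 t2. N (tau (mu r1 t1)) (tn s s (tau r2) (tau t2))))"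
proof -
  note R = lin_rules bilinI lin_bilin1[OF N] lin_bilin2[OF N] lin_vs(2)[OF bilinD(1)[OF N]]
  have "sweedler TT TT (comul2 Hr R (tn s s r t)) (\<lambda>x y. N (m x) y) =
      sw r (\<lambda>r1 r2. sw t (\<lambda>t1 t2. sw r2 (\<lambda>g r0. N (tau (mu (mu (tau r1) (pi g)) t1)) (tn s s (tau r0) (tau t2)))))"
    by (subst conv_comul2[OF r t, where ?s3.0=s3 and G = "\<lambda>x y. N (m x) y"], intro R) (simp_all add: assoc)
  also have "\<dots> = sw t (\<lambda>t1 t2. sw r (\<lambda>r1 r2. sw r2 (\<lambda>g r0. N (tau (mu (mu (tau r1) (pi g)) t1)) (tn s s (tau r0) (tau t2)))))"
    by (simp add: sw_swap[of t])
  also have "\<dots> = sw t (\<lambda>t1 t2. sw r (\<lambda>r1 r2. N (tau (mu r1 t1)) (tn s s (tau r2) (tau t2))))"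
    by (subst merge[where ?s3.0=s3], (intro R)+, simp)
  finally show ?thesis by (simp add: sw_swap[of t])
qed

definition C2 :: "'a \<Rightarrow> 'a \<Rightarrow> ('k, 'a, ('k, 'a, 'a) tensor) tensor" where
  "C2 r t = sw r (\<lambda>g r0. sw t (\<lambda>k t0. tn s pscl (mu (pi g) (pi k)) (tn s s (tau r0) (tau t0))))"

lemma bilin_C2: "bilin s s pscl C2"
  unfolding C2_def[abs_def] by (intro bilinI lin_rules)

lemma coact2_eq: assumes "y \<in> car TT" shows "coact2 Hr R y = tlift s s C2 y"
proof -
  have 1: "sweedler Hr R (coact R t) (\<lambda>k t0. tens Hr TT (mul Hr (pi g) k) (tens R R (tau r0) t0)) =
      sw t (\<lambda>k t0. tn s pscl (mu (pi g) (pi k)) (tn s s (tau r0) (tau t0)))" for g r0 t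
    by (rule conv_coact[where ?s3.0=pscl and G = "\<lambda>k t0. tn s pscl (mu (pi g) k) (tn s s (tau r0) t0)"])
      (intro lin_rules bilinI, simp add: tens_tn)
  have "sweedler Hr R (coact R r) (\<lambda>g r0. sweedler Hr R (coact R t) (\<lambda>k t0. tens Hr TT (mul Hr g k) (tens R R r0 t0))) = C2 r t" for r t
    unfolding C2_def
    by (rule conv_coact[where ?s3.0=pscl and G = "\<lambda>g r0. sw t (\<lambda>k t0. tn s pscl (mu g (pi k)) (tn s s r0 (tau t0)))"])
      (intro lin_rules bilinI, rule 1)
  then show ?thesis unfolding coact2_def using sweedler_tlift[of R R pscl C2 C2 y] assms bilin_C2 by simp
qed

lemma C2_mem: "C2 r t \<in> car (tensor Hr TT)"
  unfolding C2_def by (intro sw_mem tn_mem) (auto simp: in_pi)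

lemma cancel:
  assumes G: "bilin s s s3 G"
  shows "sw w (\<lambda>b y. sw y (\<lambda>k z. G (mu (S b) (pi k)) z)) = G one (P w)"
proof -
  note R = lin_rules bilinI lin_bilin1[OF G] lin_bilin2[OF G] lin_vs(2)[OF bilinD(1)[OF G]]
  have "sw w (\<lambda>b y. sw y (\<lambda>k z. G (mu (S b) (pi k)) z)) = sw w (\<lambda>e z. sw e (\<lambda>b k. G (mu (S b) (pi k)) z))"
    by (rule sym, rule coassoc[where ?s2.0=s3]) (intro R)+
  also have "\<dots> = sw w (\<lambda>e z. s3 (ep e) (G one z))" by (simp add: antip[OF bilinD(1)[OF G]])
  also have "\<dots> = G one (P w)" by (rule counit_l) (rule bilinD(2)[OF G])
  finally show ?thesis .
qed

text \<open>The second slot receives S(g_2) \<pi>(g') from consecutive legs, which cancel;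
  afterwards \<open>merge\<close> applies to the first slot.\<close>

lemma merge2:
  assumes F: "\<And>y z. lin s s3 (\<lambda>x. F x y z)" "\<And>x z. lin s s3 (\<lambda>y. F x y z)" "\<And>x y. lin s s3 (\<lambda>z. F x y z)"
  shows "sw r (\<lambda>r1 r2. sw r2 (\<lambda>g r0. sw r0 (\<lambda>g' z. sw g (\<lambda>g1 g2. F (mu (tau r1) (pi g1)) (mu (S g2) (pi g')) z)))) =
    sw r (\<lambda>q z. F q one z)"
proof -
  note R = lin_rules bilinI lin_comp[OF F(1)] lin_comp[OF F(2)] lin_comp[OF F(3)] F(2,3) lin_vs(2)[OF F(1)]
  have "sw r2 (\<lambda>g r0. sw r0 (\<lambda>g' z. sw g (\<lambda>g1 g2. F (mu (tau r1) (pi g1)) (mu (S g2) (pi g')) z))) =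
     sw r2 (\<lambda>g1 w. F (mu (tau r1) (pi g1)) one w)" for r1 r2
  proof -
    have "sw r2 (\<lambda>g r0. sw r0 (\<lambda>g' z. sw g (\<lambda>g1 g2. F (mu (tau r1) (pi g1)) (mu (S g2) (pi g')) z))) =
        sw r2 (\<lambda>g r0. sw g (\<lambda>g1 g2. sw r0 (\<lambda>g' z. F (mu (tau r1) (pi g1)) (mu (S g2) (pi g')) z)))"
      by (subst sw_swap) simp
    also have "\<dots> = sw r2 (\<lambda>g1 w. sw w (\<lambda>g2 r0. sw r0 (\<lambda>g' z. F (mu (tau r1) (pi g1)) (mu (S g2) (pi g')) z)))"
      by (rule coassoc[where ?s2.0=s3]) (intro R)+
    also have "\<dots> = sw r2 (\<lambda>g1 w. F (mu (tau r1) (pi g1)) one (P w))"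
      by (subst cancel[where ?s3.0=s3], (intro R)+, simp)
    also have "\<dots> = sw r2 (\<lambda>g1 w. F (mu (tau r1) (pi g1)) one w)" by (rule sw_cong_P) simp
    finally show ?thesis .
  qed
  then show ?thesis
    by (simp add: merge[where F = "\<lambda>q z. F q one z" and ?s3.0=s3, OF F(1,3)])
qed

lemma merge3:
  assumes F: "\<And>y z. lin s s3 (\<lambda>x. F x y z)" "\<And>x z. lin s s3 (\<lambda>y. F x y z)" "\<And>x y. lin s s3 (\<lambda>z. F x y z)"
  shows "sw t (\<lambda>t1 t2. sw t2 (\<lambda>k z. sw t1 (\<lambda>a b. F a (mu (S b) (pi k)) z))) = sw t (\<lambda>a z. F a one z)"
proof -
  note R = lin_rules bilinI lin_comp[OF F(1)] lin_comp[OF F(2)] lin_comp[OF F(3)] F(1,2,3) lin_vs(2)[OF F(1)]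
  have "sw t (\<lambda>t1 t2. sw t2 (\<lambda>k z. sw t1 (\<lambda>a b. F a (mu (S b) (pi k)) z))) =
     sw t (\<lambda>t1 t2. sw t1 (\<lambda>a b. sw t2 (\<lambda>k z. F a (mu (S b) (pi k)) z)))"
    by (subst sw_swap) simp
  also have "\<dots> = sw t (\<lambda>a w. sw w (\<lambda>b t2. sw t2 (\<lambda>k z. F a (mu (S b) (pi k)) z)))"
    by (rule coassoc[where ?s2.0=s3]) (intro R)+
  also have "\<dots> = sw t (\<lambda>a w. F a one (P w))"
    by (subst cancel[where ?s3.0=s3], (intro R)+, simp)
  also have "\<dots> = sw t (\<lambda>a z. F a one z)" by (rule sw_cong_P) simp
  finally show ?thesis .
qed

lemma sw_R2:
  assumes F: "\<And>y z. lin s s3 (\<lambda>x. F x y z)" "\<And>x z. lin s s3 (\<lambda>y. F x y z)" "\<And>x y. lin s s3 (\<lambda>z. F x y z)"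
    and r: "tau r = r"
  shows "sw r (\<lambda>x y. sw y (\<lambda>u v. F x u (tau v))) = sw r (\<lambda>x y. sw y (\<lambda>u v. F x u v))"
proof -
  note R = lin_rules bilinI lin_comp[OF F(1)] lin_comp[OF F(2)] lin_comp[OF F(3)] F(1,2,3) lin_vs(2)[OF F(1)]
  have "sw r (\<lambda>x y. sw y (\<lambda>u v. F x u (tau v))) = sw r (\<lambda>q v. sw q (\<lambda>x u. F x u (tau v)))"
    by (rule sym, rule coassoc[where ?s2.0=s3]) (intro R)+
  also have "\<dots> = sw r (\<lambda>q v. sw q (\<lambda>x u. F x u v))"
    by (rule sw_R[OF _ r, where ?s2.0=s3 and F = "\<lambda>q v. sw q (\<lambda>x u. F x u v)"]) (intro R)
  also have "\<dots> = sw r (\<lambda>x y. sw y (\<lambda>u v. F x u v))"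
    by (rule coassoc[where ?s2.0=s3]) (intro R)+
  finally show ?thesis .
qed

text \<open>Under \<pi> the action on t_1 cannot be dropped as under \<tau>: by
  \<open>pi_mu_tau\<close> it leaves the factors S(b) S(g_2). The diagonal coaction of the other leg
  contributes \<pi>(g') \<pi>(k) directly behind them. First S(g_2) \<pi>(g') cancels by
  \<open>merge2\<close>, then S(b) \<pi>(k) by \<open>merge3\<close>.\<close>

lemma xi_comul2:
  assumes r: "tau r = r" and t: "tau t = t" and N: "bilin s pscl s3 N"
  shows "sweedler TT TT (comul2 Hr R (tn s s r t)) (\<lambda>x y. sweedler Hr TT (coact2 Hr R y) (\<lambda>g y0. N (mul Hr (xi x) g) y0)) =
    sw r (\<lambda>r1 r2. sw t (\<lambda>t1 t2. N (pi (mu r1 t1)) (tn s s (tau r2) (tau t2))))"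
proof -
  note R = lin_rules bilinI lin_bilin1[OF N] lin_bilin2[OF N] bilinD(2)[OF N] lin_vs(2)[OF bilinD(1)[OF N]] lin_tlift[OF bilin_C2] lin_bilin1[OF bilin_C2] lin_bilin2[OF bilin_C2] bilin_C2
  have bN: "bilin s pscl s3 (\<lambda>g y0. N (mu h g) y0)" for h by (intro R)
  define G where "G X Y = tlift s pscl (\<lambda>g y0. N (mu (xi X) g) y0) (tlift s s C2 Y)" for X Y
  have bG: "bilin pscl pscl s3 G" unfolding G_def[abs_def] by (intro R)
  have FG: "sweedler Hr TT (coact2 Hr R y) (\<lambda>g y0. N (mul Hr (xi x) g) y0) = G x y" if "y \<in> car TT" for x y
    unfolding G_def coact2_eq[OF that]
    using sweedler_tlift[of Hr TT s3 "\<lambda>g y0. N (mu (xi x) g) y0" "\<lambda>g y0. N (mul Hr (xi x) g) y0", OF _ _ _ _ tlift_mem[OF C2_mem]] bN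
    by (simp add: in_pi)
  have G: "G (tn s s x1 x2) (tn s s y1 y2) =
      sw y1 (\<lambda>g r0. sw y2 (\<lambda>k t0. N (mu (pi (mu x1 x2)) (mu (pi g) (pi k))) (tn s s (tau r0) (tau t0))))" for x1 x2 y1 y2
    by (simp add: G_def tlift_tn[OF bilin_C2]) (simp add: C2_def sw_hom[OF lin_tlift[OF bN]] tlift_tn[OF bN])
  define \<Phi> where "\<Phi> q a b e k z t0 = N (mu (pi (mu q a)) (mu (S b) (mu e (pi k)))) (tn s s (tau z) (tau t0))" for q a b e k z t0
  have lN: "sw u (\<lambda>x y. N (mu (f x y) c) d) = N (mu (sw u f) c) d" for u c d and f :: "'a \<Rightarrow> 'a \<Rightarrow> 'a"
    by (rule sw_hom[symmetric, of s s3 "\<lambda>z. N (mu z c) d"]) (intro R)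
  have exp: "N (mu (pi (mu r1 (tau (mu (pi g) t1)))) (mu (pi g') (pi k))) (tn s s (tau z) (tau t0)) =
      sw g (\<lambda>g1 g2. sw t1 (\<lambda>a b. \<Phi> (mu r1 (pi g1)) a b (mu (S g2) (pi g')) k z t0))" for r1 g t1 g' k z t0
  proof -
    have "pi (mu r1 (tau (mu (pi g) t1))) = sw g (\<lambda>g1 g2. sw t1 (\<lambda>a b. mu (pi (mu (mu r1 (pi g1)) a)) (mu (S b) (S g2))))"
      unfolding pi_mu_tau
      by (subst sw_mu[where ?s2.0=s], intro R, subst sw_pi[where ?s2.0=s], intro R) (simp add: assoc)
    then show ?thesis
      by (simp add: \<Phi>_def flip: lN) (simp add: assoc)
  qed
  have "sweedler TT TT (comul2 Hr R (tn s s r t)) (\<lambda>x y. sweedler Hr TT (coact2 Hr R y) (\<lambda>g y0. N (mul Hr (xi x) g) y0)) =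
    sw r (\<lambda>r1 r2. sw t (\<lambda>t1 t2. sw r2 (\<lambda>g r0. G (tn s s (tau r1) (tau (mu (pi g) t1))) (tn s s (tau r0) (tau t2)))))"
    by (rule conv_comul2[OF r t bG FG])
  also have "\<dots> = sw t (\<lambda>t1 t2. sw r (\<lambda>r1 r2. sw r2 (\<lambda>g r0. G (tn s s (tau r1) (tau (mu (pi g) t1))) (tn s s (tau r0) (tau t2)))))"
    by (simp add: sw_swap[of t])
  \<comment> \<open>The projections in the second tensor are removed so that the coaction in G
    expands plain coproducts of r0 and t2 rather than those of their images under \<tau>.\<close>
  also have "\<dots> = sw t (\<lambda>t1 t2. sw r (\<lambda>r1 r2. sw r2 (\<lambda>g r0. G (tn s s (tau r1) (tau (mu (pi g) t1))) (tn s s r0 t2))))"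
  proof -
    note RG = R lin_bilin1[OF bG] lin_bilin2[OF bG]
    have "sw t (\<lambda>t1 t2. sw r (\<lambda>r1 r2. sw r2 (\<lambda>g r0. G (tn s s (tau r1) (tau (mu (pi g) t1))) (tn s s (tau r0) (tau t2))))) =
        sw t (\<lambda>t1 t2. sw r (\<lambda>r1 r2. sw r2 (\<lambda>g r0. G (tn s s (tau r1) (tau (mu (pi g) t1))) (tn s s (tau r0) t2))))"
      by (rule sw_R[OF _ t, where ?s2.0=s3 and F = "\<lambda>t1 t2. sw r (\<lambda>r1 r2. sw r2 (\<lambda>g r0. G (tn s s (tau r1) (tau (mu (pi g) t1))) (tn s s (tau r0) t2)))"]) (intro RG)
    moreover have "sw r (\<lambda>r1 r2. sw r2 (\<lambda>g r0. G (tn s s (tau r1) (tau (mu (pi g) t1))) (tn s s (tau r0) t2))) =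
        sw r (\<lambda>r1 r2. sw r2 (\<lambda>g r0. G (tn s s (tau r1) (tau (mu (pi g) t1))) (tn s s r0 t2)))" for t1 t2
      by (rule sw_R2[OF _ _ _ r, where ?s3.0=s3 and F = "\<lambda>r1 g r0. G (tn s s (tau r1) (tau (mu (pi g) t1))) (tn s s r0 t2)"]) (intro RG)+
    ultimately show ?thesis by simp
  qed
  also have "\<dots> = sw t (\<lambda>t1 t2. sw r (\<lambda>r1 r2. sw r2 (\<lambda>g r0. sw r0 (\<lambda>g' z. sw t2 (\<lambda>k t0. sw g (\<lambda>g1 g2. sw t1 (\<lambda>a b.
      \<Phi> (mu (tau r1) (pi g1)) a b (mu (S g2) (pi g')) k z t0)))))))"
    unfolding G exp ..
  also have "\<dots> = sw t (\<lambda>t1 t2. sw t2 (\<lambda>k t0. sw t1 (\<lambda>a b. sw r (\<lambda>r1 r2. sw r2 (\<lambda>g r0. sw r0 (\<lambda>g' z. sw g (\<lambda>g1 g2.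
      \<Phi> (mu (tau r1) (pi g1)) a b (mu (S g2) (pi g')) k z t0)))))))"
  proof -
    have "sw r (\<lambda>r1 r2. sw r2 (\<lambda>g r0. sw r0 (\<lambda>g' z. sw t2 (\<lambda>k t0. sw g (\<lambda>g1 g2. sw t1 (\<lambda>a b.
      \<Phi> (mu (tau r1) (pi g1)) a b (mu (S g2) (pi g')) k z t0)))))) =
      sw t2 (\<lambda>k t0. sw t1 (\<lambda>a b. sw r (\<lambda>r1 r2. sw r2 (\<lambda>g r0. sw r0 (\<lambda>g' z. sw g (\<lambda>g1 g2.
      \<Phi> (mu (tau r1) (pi g1)) a b (mu (S g2) (pi g')) k z t0))))))" for t1 t2
      by (simp only: sw_swap[of t1], simp only: sw_swap[of t2])
    then show ?thesis by simp
  qed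
  also have "\<dots> = sw t (\<lambda>t1 t2. sw t2 (\<lambda>k t0. sw t1 (\<lambda>a b. sw r (\<lambda>q z. \<Phi> q a b one k z t0))))"
    unfolding \<Phi>_def by (subst merge2[where ?s3.0=s3], (intro R)+, simp)
  also have "\<dots> = sw t (\<lambda>t1 t2. sw t2 (\<lambda>k t0. sw t1 (\<lambda>a b. sw r (\<lambda>q z. N (mu (pi (mu q a)) (mu (S b) (pi k))) (tn s s (tau z) (tau t0))))))"
    by (simp add: \<Phi>_def)
  also have "\<dots> = sw t (\<lambda>t1 t2. sw r (\<lambda>r1 r2. N (mu (pi (mu r1 t1)) one) (tn s s (tau r2) (tau t2))))"
    by (rule merge3[where ?s3.0=s3 and F = "\<lambda>a e t0. sw r (\<lambda>q z. N (mu (pi (mu q a)) e) (tn s s (tau z) (tau t0)))"]) (intro R)+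
  finally show ?thesis by (simp add: sw_swap[of t])
qed

end

lemma bilinear_mapI:
  "bilin (scl V) (scl W) (scl U) f \<Longrightarrow> (\<And>x y. f x y \<in> car U) \<Longrightarrow> bilinear_map V W U f"
  by (auto simp: bilinear_map_def bilin_def linear_map_def Vector_Spaces.linear_iff)

context split_raw
begin

lemma tau_mem [simp]: "tau x \<in> range tau" "pi x \<in> range pi" by auto

lemma left_module: "is_left_module Hr R"
  unfolding is_left_module_def
proof (intro conjI ballI)
  have a: "act R = (\<lambda>h r. tau (mu (pi h) r))" by (simp add: R_def)
  show "bilinear_map Hr R R (act R)" unfolding a by (rule bilinear_mapI) (auto intro!: bilinI lin_rules)
next
  fix v assume "v \<in> car R"
  then show "act R (unit Hr) v = v" by (simp add: in_tau)
next
  fix h k v assume "h \<in> car Hr" "k \<in> car Hr" "v \<in> car R"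
  then have "pi h = h" "pi k = k" by (simp_all add: in_pi)
  moreover from this have "pi (mu h k) = mu h k" by (metis pi_mu(1))
  ultimately show "act R (mul Hr h k) v = act R h (act R k v)" by (simp add: assoc)
qed simp

lemma left_comodule: "is_left_comodule Hr R"
  unfolding is_left_comodule_def
proof (intro conjI ballI)
  have a: "coact R = (\<lambda>r. sw r (\<lambda>x y. tn s s (pi x) (tau y)))" by (simp add: R_def)
  show "linear_map R (tensor Hr R) (coact R)" 
    unfolding a by (rule linear_map_lin) (use coact_mem in \<open>auto intro!: bilinI lin_rules\<close>)
next
  fix v assume "v \<in> car R"
  then have v: "tau v = v" by (simp add: in_tau)
  have "sweedler Hr Hr (comul Hr (pi x)) (\<lambda>g1 g2. tens Hr (tensor Hr R) g1 (tens Hr R g2 w)) = sw (pi x) (\<lambda>g1 g2. tn s pscl g1 (tn s s g2 w))" for x w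
    by (rule conv_H[where ?s3.0=pscl]) (simp, intro bilinI lin_rules, simp add: tens_tn)
  then have "sweedler Hr R (coact R v) (\<lambda>g w. sweedler Hr Hr (comul Hr g) (\<lambda>g1 g2. tens Hr (tensor Hr R) g1 (tens Hr R g2 w))) =
      sw v (\<lambda>x y. sw (pi x) (\<lambda>g1 g2. tn s pscl g1 (tn s s g2 (tau y))))"
    by (intro conv_coact[where ?s3.0=pscl and G = "\<lambda>g w. sw g (\<lambda>g1 g2. tn s pscl g1 (tn s s g2 w))"] bilinI lin_rules)
  also have "\<dots> = sw v (\<lambda>x y. sw x (\<lambda>x1 x2. tn s pscl (pi x1) (tn s s (pi x2) (tau y))))"
    by (subst sw_pi[where ?s2.0=pscl], intro bilinI lin_rules, simp)
  also have "\<dots> = sw v (\<lambda>x y. sw y (\<lambda>y1 y2. tn s pscl (pi x) (tn s s (pi y1) (tau y2))))"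
    by (intro coassoc[where ?s2.0=pscl] lin_rules)
  also have "\<dots> = sw v (\<lambda>x y. sw (tau y) (\<lambda>y1 y2. tn s pscl (pi x) (tn s s (pi y1) (tau y2))))"
    by (rule sym, rule sw_R[OF _ v, where ?s2.0=pscl and F = "\<lambda>x y. sw y (\<lambda>y1 y2. tn s pscl (pi x) (tn s s (pi y1) (tau y2)))"])
      (intro bilinI lin_rules)
  also have "\<dots> = sw v (\<lambda>x y. tn s pscl (pi x) (sw (tau y) (\<lambda>x y. tn s s (pi x) (tau y))))"
    by (simp add: sw_hom[OF lin_tn0[OF vs vs_pscl]])
  also have "\<dots> = sweedler Hr R (coact R v) (\<lambda>g w. tens Hr (tensor Hr R) g (coact R w))"
    by (rule sym, rule conv_coact[where ?s3.0=pscl and G = "\<lambda>g w. tn s pscl g (sw w (\<lambda>x y. tn s s (pi x) (tau y)))"])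
      (intro bilinI lin_rules, simp add: tens_tn)
  finally show "sweedler Hr R (coact R v) (\<lambda>g w. sweedler Hr Hr (comul Hr g) (\<lambda>g1 g2. tens Hr (tensor Hr R) g1 (tens Hr R g2 w))) =
     sweedler Hr R (coact R v) (\<lambda>g w. tens Hr (tensor Hr R) g (coact R w))" .
  have "sweedler Hr R (coact R v) (\<lambda>g w. scl R (counit Hr g) w) = sw v (\<lambda>x y. s (ep (pi x)) (tau y))"
    by (rule conv_coact[where ?s3.0=s and G = "\<lambda>g w. s (ep g) w"]) (intro bilinI lin_rules, simp)
  also have "\<dots> = tau (P v)" unfolding ep_pi by (intro counit_l lin_rules)
  finally show "sweedler Hr R (coact R v) (\<lambda>g w. scl R (counit Hr g) w) = v" by (simp add: v)
qed simp

text \<open>By \<open>sw_pi_tau\<close> the coaction of \<tau>(hv) is \<pi>(h_1 v_1) S(h_3 v_3)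
  \<otimes> \<tau>(h_2 v_2). For h in H the outer factors h_1 and S(h_3) come out, and \<pi>(v_1)
  S(v_3) \<otimes> \<tau>(v_2) is the coaction of v.\<close>

lemma yd_module: "is_yd_module Hr Sr R"
  unfolding is_yd_module_def
proof (intro conjI ballI left_module left_comodule)
  fix h v assume "h \<in> car Hr" "v \<in> car R"
  then have h: "pi h = h" and v: "tau v = v" by (simp_all add: in_tau in_pi)
  let ?K = "\<lambda>h1 h2 h3 g w. tn s s (mu (mu h1 g) (S h3)) (tau (mu h2 w))"
  have 1: "sweedler Hr R (coact R v) (\<lambda>g w. tens Hr R (mul Hr (mul Hr (pi h1) g) (Sr (pi h3))) (act R (pi h2) w)) =
      sw v (\<lambda>g w. ?K (pi h1) (pi h2) (pi h3) (pi g) (tau w))" for h1 h2 h3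
    by (rule conv_coact[where ?s3.0=pscl and G = "\<lambda>g w. ?K (pi h1) (pi h2) (pi h3) g w"]) (intro bilinI lin_rules, simp add: tens_tn)
  have 2: "sweedler Hr Hr (comul Hr (pi h')) (\<lambda>h2 h3. sweedler Hr R (coact R v) (\<lambda>g w. tens Hr R (mul Hr (mul Hr (pi h1) g) (Sr h3)) (act R h2 w))) =
      sw (pi h') (\<lambda>h2 h3. sw v (\<lambda>g w. ?K (pi h1) h2 h3 (pi g) (tau w)))" for h1 h'
    by (rule conv_H[where ?s3.0=pscl]) (simp, intro bilinI lin_rules, rule 1)
  have 3: "sweedler Hr Hr (comul Hr h) (\<lambda>h1 h'. sweedler Hr Hr (comul Hr h') (\<lambda>h2 h3. sweedler Hr R (coact R v) (\<lambda>g w. tens Hr R (mul Hr (mul Hr h1 g) (Sr h3)) (act R h2 w)))) =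
      sw h (\<lambda>h1 h'. sw h' (\<lambda>h2 h3. sw v (\<lambda>g w. ?K h1 h2 h3 (pi g) (tau w))))"
    by (rule conv_H[where ?s3.0=pscl]) (rule h, intro bilinI lin_rules, rule 2)
  have "coact R (act R h v) = sw (mu h v) (\<lambda>x z. sw z (\<lambda>y w. tn s s (mu (pi x) (S w)) (tau y)))"
    using sw_pi_tau[OF bilin_tn[OF vs vs], of "mu h v"] by (simp add: h)
  also have "\<dots> = sw h (\<lambda>h1 h'. sw v (\<lambda>v1 v'. sw h' (\<lambda>h2 h3. sw v' (\<lambda>v2 v3. tn s s (mu (pi (mu h1 v1)) (S (mu h3 v3))) (tau (mu h2 v2))))))"
    by (subst sw_mu[where ?s2.0=pscl], intro bilinI lin_rules, subst sw_mu[where ?s2.0=pscl], intro bilinI lin_rules, simp)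
  also have "\<dots> = sw h (\<lambda>h1 h'. sw h' (\<lambda>h2 h3. sw v (\<lambda>v1 v'. sw v' (\<lambda>v2 v3. tn s s (mu (pi (mu h1 v1)) (S (mu h3 v3))) (tau (mu h2 v2))))))"
    by (subst sw_swap, simp)
  also have "\<dots> = sw h (\<lambda>h1 h'. sw h' (\<lambda>h2 h3. sw v (\<lambda>v1 v'. sw v' (\<lambda>v2 v3. ?K h1 h2 h3 (mu (pi v1) (S v3)) (tau v2)))))"
  proof -
    \<comment> \<open>H-linearity of \<pi> can be used only when the legs of h are visibly in H.
      They are therefore wrapped in \<open>pi\<close>, rewritten, and unwrapped again.\<close>
    let ?X = "\<lambda>h1 h2 h3. sw v (\<lambda>v1 v'. sw v' (\<lambda>v2 v3. tn s s (mu (pi (mu h1 v1)) (S (mu h3 v3))) (tau (mu h2 v2))))"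
    let ?Y = "\<lambda>h1 h2 h3. sw v (\<lambda>v1 v'. sw v' (\<lambda>v2 v3. ?K h1 h2 h3 (mu (pi v1) (S v3)) (tau v2)))"
    have XY: "?X (pi h1) (pi h2) (pi h3) = ?Y (pi h1) (pi h2) (pi h3)" for h1 h2 h3 by (simp add: assoc)
    have "sw h (\<lambda>h1 h'. sw h' (\<lambda>h2 h3. ?X h1 h2 h3)) = sw h (\<lambda>h1 h'. sw (pi h') (\<lambda>h2 h3. ?X (pi h1) h2 h3))"
      by (rule sw_H[OF h, symmetric, where ?s2.0=pscl]) (intro bilinI lin_rules)
    also have "\<dots> = sw h (\<lambda>h1 h'. sw (pi h') (\<lambda>h2 h3. ?X (pi h1) (pi h2) (pi h3)))"
      by (subst sw_H[where ?s2.0=pscl], simp, intro bilinI lin_rules, simp)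
    also have "\<dots> = sw h (\<lambda>h1 h'. sw (pi h') (\<lambda>h2 h3. ?Y (pi h1) (pi h2) (pi h3)))"
      by (simp only: XY)
    also have "\<dots> = sw h (\<lambda>h1 h'. sw (pi h') (\<lambda>h2 h3. ?Y (pi h1) h2 h3))"
      by (subst sw_H[where ?s2.0=pscl and G = "\<lambda>h2 h3. ?Y (pi _) h2 h3"], simp, intro bilinI lin_rules, simp)
    also have "\<dots> = sw h (\<lambda>h1 h'. sw h' (\<lambda>h2 h3. ?Y h1 h2 h3))"
      by (rule sw_H[OF h, where ?s2.0=pscl]) (intro bilinI lin_rules)
    finally show ?thesis .
  qed
  also have "\<dots> = sw h (\<lambda>h1 h'. sw h' (\<lambda>h2 h3. sw v (\<lambda>g w. ?K h1 h2 h3 (pi g) (tau w))))"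
  proof -
    have "sw (tau v) (\<lambda>g w. ?K h1 h2 h3 (pi g) (tau w)) = sw v (\<lambda>v1 v'. sw v' (\<lambda>v2 v3. ?K h1 h2 h3 (mu (pi v1) (S v3)) (tau v2)))" for h1 h2 h3
      by (rule sw_pi_tau[where F = "\<lambda>g w. ?K h1 h2 h3 g w" and ?s2.0=pscl]) (intro bilinI lin_rules)
    then show ?thesis by (simp only: v)
  qed
  finally show "coact R (act R h v) = sweedler Hr Hr (comul Hr h) (\<lambda>h1 h'. sweedler Hr Hr (comul Hr h') (\<lambda>h2 h3.
        sweedler Hr R (coact R v) (\<lambda>g w. tens Hr R (mul Hr (mul Hr h1 g) (Sr h3)) (act R h2 w))))" using 3 by simp
qed

lemma coalgebra_R: "is_coalgebra R"
  unfolding is_coalgebra_def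
proof (intro conjI ballI)
  have a: "comul R = (\<lambda>r. sw r (\<lambda>x y. tn s s (tau x) (tau y)))" by (simp add: R_def)
  show "linear_map R TT (comul R)"
    unfolding a by (rule linear_map_lin) (use comul_R_mem in \<open>auto intro!: bilinI lin_rules\<close>)
  show "linear_map R base_field (counit R)"
    by (rule linear_map_lin) (auto simp: base_field_def intro: lin_ep)
next
  fix r assume "r \<in> car R"
  then have r: "tau r = r" by (simp add: in_tau)
  have 1: "sweedler R R (comul R (tau a)) (\<lambda>a1 a2. tens R TT a1 (tens R R a2 b)) = sw a (\<lambda>a1 a2. tn s pscl (tau a1) (tn s s (tau a2) b))" for a b
  proof -
    have "sweedler R R (comul R (tau a)) (\<lambda>a1 a2. tens R TT a1 (tens R R a2 b)) = sw (tau a) (\<lambda>a1 a2. tn s pscl (tau a1) (tn s s (tau a2) b))"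
      by (rule conv_R[where ?s3.0=pscl and G = "\<lambda>a1 a2. tn s pscl a1 (tn s s a2 b)"]) (intro bilinI lin_rules, simp add: tens_tn)
    also have "\<dots> = sw a (\<lambda>a1 a2. tn s pscl (tau a1) (tn s s (tau a2) b))"
      by (rule sw_tau_tau[where F = "\<lambda>a1 a2. tn s pscl a1 (tn s s a2 b)" and ?s2.0=pscl]) (intro bilinI lin_rules)
    finally show ?thesis .
  qed
  have 2: "sweedler R R (comul R (tau b)) (\<lambda>b1 b2. tens R TT a (tens R R b1 b2)) = sw b (\<lambda>b1 b2. tn s pscl a (tn s s (tau b1) (tau b2)))" for a b
  proof -
    have "sweedler R R (comul R (tau b)) (\<lambda>b1 b2. tens R TT a (tens R R b1 b2)) = sw (tau b) (\<lambda>b1 b2. tn s pscl a (tn s s (tau b1) (tau b2)))"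
      by (rule conv_R[where ?s3.0=pscl and G = "\<lambda>b1 b2. tn s pscl a (tn s s b1 b2)"]) (intro bilinI lin_rules, simp add: tens_tn)
    also have "\<dots> = sw b (\<lambda>b1 b2. tn s pscl a (tn s s (tau b1) (tau b2)))"
      by (rule sw_tau_tau[where F = "\<lambda>b1 b2. tn s pscl a (tn s s b1 b2)" and ?s2.0=pscl]) (intro bilinI lin_rules)
    finally show ?thesis .
  qed
  have "sweedler R R (comul R r) (\<lambda>a b. sweedler R R (comul R a) (\<lambda>a1 a2. tens R TT a1 (tens R R a2 b))) =
      sw r (\<lambda>a b. sw (tau a) (\<lambda>a1 a2. tn s pscl (tau a1) (tn s s (tau a2) (tau b))))"
  proof (rule conv_R[where ?s3.0=pscl and G = "\<lambda>a b. sw a (\<lambda>a1 a2. tn s pscl (tau a1) (tn s s (tau a2) b))"])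
    fix x y
    show "sweedler R R (comul R (tau x)) (\<lambda>a1 a2. tens R TT a1 (tens R R a2 (tau y))) = sw (tau x) (\<lambda>a1 a2. tn s pscl (tau a1) (tn s s (tau a2) (tau y)))"
      unfolding 1 by (rule sym, rule sw_tau_tau[where F = "\<lambda>a1 a2. tn s pscl a1 (tn s s a2 (tau y))" and ?s2.0=pscl]) (intro bilinI lin_rules)
  qed (intro bilinI lin_rules)
  also have "\<dots> = sw r (\<lambda>a b. sw a (\<lambda>a1 a2. tn s pscl (tau a1) (tn s s (tau a2) (tau b))))"
    by (subst sw_tau_tau[where F = "\<lambda>a1 a2. tn s pscl a1 (tn s s a2 (tau _))" and ?s2.0=pscl], intro bilinI lin_rules, simp)
  also have "\<dots> = sw r (\<lambda>a b. sw b (\<lambda>b1 b2. tn s pscl (tau a) (tn s s (tau b1) (tau b2))))"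
    by (intro coassoc[where ?s2.0=pscl] lin_rules)
  also have "\<dots> = sw r (\<lambda>a b. sw (tau b) (\<lambda>b1 b2. tn s pscl (tau a) (tn s s (tau b1) (tau b2))))"
    by (subst sw_tau_tau[where F = "\<lambda>b1 b2. tn s pscl (tau _) (tn s s b1 b2)" and ?s2.0=pscl], intro bilinI lin_rules, simp)
  also have "\<dots> = sweedler R R (comul R r) (\<lambda>a b. sweedler R R (comul R b) (\<lambda>b1 b2. tens R TT a (tens R R b1 b2)))"
  proof (rule sym, rule conv_R[where ?s3.0=pscl and G = "\<lambda>a b. sw b (\<lambda>b1 b2. tn s pscl a (tn s s (tau b1) (tau b2)))"])
    fix x y
    show "sweedler R R (comul R (tau y)) (\<lambda>b1 b2. tens R TT (tau x) (tens R R b1 b2)) = sw (tau y) (\<lambda>b1 b2. tn s pscl (tau x) (tn s s (tau b1) (tau b2)))"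
      unfolding 2 by (rule sym, rule sw_tau_tau[where F = "\<lambda>b1 b2. tn s pscl (tau x) (tn s s b1 b2)" and ?s2.0=pscl]) (intro bilinI lin_rules)
  qed (intro bilinI lin_rules)
  finally show "sweedler R R (comul R r) (\<lambda>a b. sweedler R R (comul R a) (\<lambda>a1 a2. tens R TT a1 (tens R R a2 b))) =
    sweedler R R (comul R r) (\<lambda>a b. sweedler R R (comul R b) (\<lambda>b1 b2. tens R TT a (tens R R b1 b2)))" .
  have "sweedler R R (comul R r) (\<lambda>a b. scl R (counit R a) b) = sw r (\<lambda>a b. s (ep (tau a)) (tau b))"
    by (rule conv_R[where ?s3.0=s and G = "\<lambda>a b. s (ep a) b"]) (intro bilinI lin_rules, simp)
  also have "\<dots> = tau (P r)" unfolding ep_tau by (intro counit_l lin_rules)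
  finally show "sweedler R R (comul R r) (\<lambda>a b. scl R (counit R a) b) = r" by (simp add: r)
  have "sweedler R R (comul R r) (\<lambda>a b. scl R (counit R b) a) = sw r (\<lambda>a b. s (ep (tau b)) (tau a))"
    by (rule conv_R[where ?s3.0=s and G = "\<lambda>a b. s (ep b) a"]) (intro bilinI lin_rules, simp)
  also have "\<dots> = tau (P r)" unfolding ep_tau by (intro counit_r lin_rules)
  finally show "sweedler R R (comul R r) (\<lambda>a b. scl R (counit R b) a) = r" by (simp add: r)
qed simp

end

section \<open>Compatibilities and axioms of the quadruple\<close>

context split_raw
begin

text \<open>Colinearity of the comultiplication: in the product of the coactions of \<tau>(r_1) and
  r_2 the trailing S-factor of the first meets the leading \<pi>-factor of the second, and
  \<open>cancel\<close> removes both.\<close>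

lemma coact2_comul:
  assumes r: "tau r = r"
  shows "coact2 Hr R (comul R r) = sweedler Hr R (coact R r) (\<lambda>g r0. tens Hr TT g (comul R r0))"
proof -
  note R = lin_rules bilinI lin_bilin1[OF bilin_C2] lin_bilin2[OF bilin_C2]
  have "coact2 Hr R (comul R r) = tlift s s C2 (comul R r)" by (rule coact2_eq[OF comul_R_mem])
  also have "\<dots> = sw r (\<lambda>x y. C2 (tau x) (tau y))"
    by (simp add: sw_hom[OF lin_tlift[OF bilin_C2]] tlift_tn[OF bilin_C2])
  also have "\<dots> = sw r (\<lambda>x y. C2 (tau x) y)"
    by (rule sw_R[OF _ r, where ?s2.0=pscl and F = "\<lambda>x y. C2 (tau x) y"]) (intro R)
  also have "\<dots> = sw r (\<lambda>x y. sw x (\<lambda>u z. sw z (\<lambda>v w. sw y (\<lambda>k t0. tn s pscl (mu (pi u) (mu (S w) (pi k))) (tn s s (tau v) (tau t0))))))"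
    unfolding C2_def
    by (subst sw_pi_tau[where ?s2.0=pscl and F = "\<lambda>g r0. sw _ (\<lambda>k t0. tn s pscl (mu g (pi k)) (tn s s r0 (tau t0)))"], intro R) (simp add: assoc)
  also have "\<dots> = sw r (\<lambda>u y. sw y (\<lambda>z x. sw z (\<lambda>v w. sw x (\<lambda>k t0. tn s pscl (mu (pi u) (mu (S w) (pi k))) (tn s s (tau v) (tau t0))))))"
    by (rule coassoc[where ?s2.0=pscl]) (intro R)+
  also have "\<dots> = sw r (\<lambda>u y. sw y (\<lambda>v x. sw x (\<lambda>w q. sw q (\<lambda>k t0. tn s pscl (mu (pi u) (mu (S w) (pi k))) (tn s s (tau v) (tau t0))))))"
    by (subst coassoc[where ?s2.0=pscl], (intro R)+, simp)
  also have "\<dots> = sw r (\<lambda>u y. sw y (\<lambda>v x. tn s pscl (mu (pi u) one) (tn s s (tau v) (tau (P x)))))"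
    by (subst cancel[where ?s3.0=pscl and G = "\<lambda>e z. tn s pscl (mu (pi _) e) (tn s s (tau _) (tau z))"], intro R, simp)
  also have "\<dots> = sw r (\<lambda>u y. tn s pscl (pi u) (sw (tau y) (\<lambda>v x. tn s s (tau v) (tau x))))"
    by (subst sw_tau_tau[OF bilin_tn[OF vs vs]]) (simp add: sw_hom[OF lin_tn0[OF vs vs_pscl]])
  also have "\<dots> = sweedler Hr R (coact R r) (\<lambda>g r0. tens Hr TT g (comul R r0))"
    by (rule sym, rule conv_coact[where ?s3.0=pscl and G = "\<lambda>g y. tn s pscl g (sw y (\<lambda>v x. tn s s (tau v) (tau x)))"])
      (intro R, simp add: tens_tn)
  finally show ?thesis .
qed

lemma yd_coalgebra: "is_yd_coalgebra Hr Sr R"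
  unfolding is_yd_coalgebra_def
proof (intro conjI ballI yd_module coalgebra_R)
  fix h r assume "h \<in> car Hr" "r \<in> car R"
  then have h: "pi h = h" and r: "tau r = r" by (simp_all add: in_tau in_pi)
  have 1: "sweedler R R (comul R r) (\<lambda>r1 r2. tens R R (act R (pi h1) r1) (act R (pi h2) r2)) =
      sw r (\<lambda>x y. tn s s (tau (mu (pi h1) (tau x))) (tau (mu (pi h2) (tau y))))" for h1 h2
    by (rule conv_R[where ?s3.0=pscl and G = "\<lambda>x y. tn s s (tau (mu (pi h1) x)) (tau (mu (pi h2) y))"])
      (intro bilinI lin_rules, simp add: tens_tn)
  have "comul R (act R h r) = sw (mu h r) (\<lambda>x y. tn s s (tau x) (tau y))"
    by (simp add: h sw_tau_tau[OF bilin_tn[OF vs vs]])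
  also have "\<dots> = sw h (\<lambda>h1 h2. sw r (\<lambda>x y. tn s s (tau (mu h1 x)) (tau (mu h2 y))))"
    by (rule sw_mu[where ?s2.0=pscl]) (intro bilinI lin_rules)
  also have "\<dots> = sweedler Hr Hr (comul Hr h) (\<lambda>h1 h2. sweedler R R (comul R r) (\<lambda>r1 r2. tens R R (act R h1 r1) (act R h2 r2)))"
    by (rule sym, rule conv_H[OF h, where ?s3.0=pscl]) (intro bilinI lin_rules, simp add: 1 del: R_simps)
  finally show "comul R (act R h r) = sweedler Hr Hr (comul Hr h) (\<lambda>h1 h2. sweedler R R (comul R r) (\<lambda>r1 r2. tens R R (act R h1 r1) (act R h2 r2)))" .
  show "counit R (act R h r) = counit Hr h * counit R r" by (simp add: h)
next
  fix r assume "r \<in> car R"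
  then have r: "tau r = r" by (simp add: in_tau)
  then show "coact2 Hr R (comul R r) = sweedler Hr R (coact R r) (\<lambda>g r0. tens Hr TT g (comul R r0))"
    by (rule coact2_comul)
  have "sweedler Hr R (coact R r) (\<lambda>g r0. scl Hr (counit R r0) g) = sw r (\<lambda>x y. s (ep (tau y)) (pi x))"
    by (rule conv_coact[where ?s3.0=s and G = "\<lambda>x y. s (ep y) x"]) (intro bilinI lin_rules, simp)
  also have "\<dots> = pi (P r)" unfolding ep_tau by (intro counit_r lin_rules)
  finally show "sweedler Hr R (coact R r) (\<lambda>g r0. scl Hr (counit R r0) g) = scl Hr (counit R r) (unit Hr)"
    using pi_tau[of r] by (simp add: r)
qed

lemma pi_R: "tau r = r \<Longrightarrow> pi r = s (ep r) one" by (metis pi_tau)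
text \<open>The adjoint action is compatible with products in A, as S(l) and the next leg cancel
  between the two factors. Applying \<tau> to the resulting h_1 (rt) S(h_2) absorbs S(h_2), while
  \<pi> keeps it.\<close>

lemma act_m: assumes h: "pi h = h" and r: "tau r = r" and t: "tau t = t"
  shows "sweedler Hr Hr (comul Hr h) (\<lambda>h1 h2. m (tens R R (act R h1 r) (act R h2 t))) = tau (mu h (mu r t))"
    "sweedler Hr Hr (comul Hr h) (\<lambda>h1 h2. xi (tens R R (act R h1 r) (act R h2 t))) = sw h (\<lambda>h1 h2. mu (mu h1 (pi (mu r t))) (S h2))"
proof -
  have prod: "sw h (\<lambda>h1 h2. mu (tau (mu (pi h1) r)) (tau (mu (pi h2) t))) = sw h (\<lambda>h1 h2. mu (mu h1 (mu r t)) (S h2))"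
  proof -
    have a: "tau (mu (pi x) r) = sw (pi x) (\<lambda>k l. mu (mu k r) (S l))" "tau (mu (pi x) t) = sw (pi x) (\<lambda>k l. mu (mu k t) (S l))" for x
      by (simp_all add: tau_pi_mu r t)
    note L = lin_rules bilinI
    have lr: "lin s s (\<lambda>z. mu z c)" for c by (intro L)
    have "sw h (\<lambda>h1 h2. mu (tau (mu (pi h1) r)) (tau (mu (pi h2) t))) =
        sw h (\<lambda>h1 h2. sw (pi h1) (\<lambda>k l. sw (pi h2) (\<lambda>u v. mu (mu k r) (mu (S l) (mu (mu u t) (S v))))))"
      unfolding a by (simp add: sw_hom[OF lr] sw_hom[OF lin_mu0] assoc, subst sw_swap, simp)
    also have "\<dots> = sw h (\<lambda>h1 h2. sw h1 (\<lambda>k l. sw h2 (\<lambda>u v. mu (mu (pi k) r) (mu (S l) (mu (mu (pi u) t) (S v))))))"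
      by (subst (1 2) sw_pi[where ?s2.0=s], (intro L)+, simp)
    also have "\<dots> = sw h (\<lambda>k h2. sw h2 (\<lambda>l q. sw q (\<lambda>u v. mu (mu (pi k) r) (mu (S l) (mu (mu (pi u) t) (S v))))))"
      by (rule coassoc[where ?s2.0=s]) (intro L)+
    also have "\<dots> = sw h (\<lambda>k h2. sw h2 (\<lambda>l q. sw q (\<lambda>u v. mu (mu (pi k) r) (mu (mu (S l) (pi u)) (mu t (S v))))))"
      by (simp add: assoc)
    also have "\<dots> = sw h (\<lambda>k h2. mu (mu (pi k) r) (mu one (mu t (S (P h2)))))"
      by (subst cancel[where ?s3.0=s and G = "\<lambda>e v. mu (mu (pi _) r) (mu e (mu t (S v)))"], intro L, simp)
    also have "\<dots> = sw h (\<lambda>k h2. mu (mu (pi k) (mu r t)) (S (pi h2)))" by (simp add: assoc)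
    also have "\<dots> = sw h (\<lambda>h1 h2. mu (mu h1 (mu r t)) (S h2))"
      by (rule sw_H[OF h, where ?s2.0=s]) (intro L)
    finally show ?thesis .
  qed
  have "sweedler Hr Hr (comul Hr h) (\<lambda>h1 h2. m (tens R R (act R h1 r) (act R h2 t))) = sw h (\<lambda>h1 h2. tau (mu (tau (mu (pi h1) r)) (tau (mu (pi h2) t))))"
    by (rule conv_H[OF h, where ?s3.0=s]) (intro bilinI lin_rules, simp add: tens_tn)
  also have "\<dots> = tau (sw h (\<lambda>h1 h2. mu (tau (mu (pi h1) r)) (tau (mu (pi h2) t))))"
    by (rule sw_hom[OF lin_tau, symmetric])
  also have "\<dots> = sw h (\<lambda>h1 h2. s (ep h2) (tau (mu h1 (mu r t))))"
    unfolding prod by (simp add: sw_hom[OF lin_tau])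
  also have "\<dots> = tau (mu (P h) (mu r t))" by (intro counit_r lin_rules)
  finally show "sweedler Hr Hr (comul Hr h) (\<lambda>h1 h2. m (tens R R (act R h1 r) (act R h2 t))) = tau (mu h (mu r t))" by simp
  have "sweedler Hr Hr (comul Hr h) (\<lambda>h1 h2. xi (tens R R (act R h1 r) (act R h2 t))) = sw h (\<lambda>h1 h2. pi (mu (tau (mu (pi h1) r)) (tau (mu (pi h2) t))))"
    by (rule conv_H[OF h, where ?s3.0=s]) (intro bilinI lin_rules, simp add: tens_tn)
  also have "\<dots> = pi (sw h (\<lambda>h1 h2. mu (tau (mu (pi h1) r)) (tau (mu (pi h2) t))))"
    by (rule sw_hom[OF lin_pi, symmetric])
  also have "\<dots> = sw h (\<lambda>h1 h2. pi (mu (mu h1 (mu r t)) (S h2)))"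
    unfolding prod by (rule sw_hom[OF lin_pi])
  also have "\<dots> = sw h (\<lambda>h1 h2. pi (mu (mu (pi h1) (mu r t)) (S (pi h2))))"
    by (rule sym, rule sw_H[OF h, where ?s2.0=s]) (intro bilinI lin_rules)
  also have "\<dots> = sw h (\<lambda>h1 h2. mu (mu (pi h1) (pi (mu r t))) (S (pi h2)))" by simp
  also have "\<dots> = sw h (\<lambda>h1 h2. mu (mu h1 (pi (mu r t))) (S h2))"
    by (rule sw_H[OF h, where ?s2.0=s]) (intro bilinI lin_rules)
  finally show "sweedler Hr Hr (comul Hr h) (\<lambda>h1 h2. xi (tens R R (act R h1 r) (act R h2 t))) = sw h (\<lambda>h1 h2. mu (mu h1 (pi (mu r t))) (S h2))" .
qed

text \<open>The commutation rule of a smash product: the S-leg of the adjoint action cancels against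
  the following h_2.\<close>

lemma act_absorb:
  assumes v: "tau v = v" shows "sw (pi h) (\<lambda>h1 h2. mu (tau (mu (pi h1) v)) h2) = mu (pi h) v"
proof -
  note L = lin_rules bilinI
  have "sw (pi h) (\<lambda>h1 h2. mu (tau (mu (pi h1) v)) h2) = sw h (\<lambda>h1 h2. sw h1 (\<lambda>k l. mu (mu (pi k) v) (mu (S l) (pi h2))))"
  proof -
    have lr: "lin s s (\<lambda>z. mu z c)" for c by (intro L)
    have "sw (pi h) (\<lambda>h1 h2. mu (tau (mu (pi h1) v)) h2) = sw h (\<lambda>h1 h2. mu (tau (mu (pi h1) v)) (pi h2))"
      by (subst sw_pi[where ?s2.0=s], intro L, simp)
    also have "\<dots> = sw h (\<lambda>h1 h2. sw (pi h1) (\<lambda>k l. mu (mu k v) (mu (S l) (pi h2))))"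
      by (simp add: tau_pi_mu v sw_hom[OF lr] assoc)
    finally show ?thesis by (subst (asm) (2) sw_pi[where ?s2.0=s], intro L, simp)
  qed
  also have "\<dots> = sw h (\<lambda>k h'. sw h' (\<lambda>l h2. mu (mu (pi k) v) (mu (S l) (pi h2))))"
    by (rule coassoc[where ?s2.0=s]) (intro L)+
  also have "\<dots> = sw h (\<lambda>k h'. s (ep h') (mu (mu (pi k) v) one))"
    by (subst antip[where ?s2.0=s], intro L, simp)
  also have "\<dots> = mu (pi h) v" by (subst counit_r[where ?s2.0=s]) (intro L, simp)
  finally show ?thesis .
qed

lemma pi_act_absorb:
  assumes v: "tau v = v"
  shows "sw (pi h) (\<lambda>h1 h2. mu (pi (mu x (tau (mu (pi h1) v)))) h2) = pi (mu x (mu (pi h) v))"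
proof -
  note L = lin_rules bilinI
  have "sw (pi h) (\<lambda>h1 h2. mu (pi (mu x (tau (mu (pi h1) v)))) h2) = sw (pi h) (\<lambda>h1 h2. mu (pi (mu x (tau (mu (pi h1) v)))) (pi h2))"
    using sw_H[of "pi h" s "\<lambda>h1 h2. mu (pi (mu x (tau (mu (pi h1) v)))) h2"] by (simp add: L)
  also have "\<dots> = sw (pi h) (\<lambda>h1 h2. pi (mu x (mu (tau (mu (pi h1) v)) (pi h2))))"
    by (simp add: assoc[symmetric])
  also have "\<dots> = sw (pi h) (\<lambda>h1 h2. pi (mu x (mu (tau (mu (pi h1) v)) h2)))"
    using sw_H[of "pi h" s "\<lambda>h1 h2. pi (mu x (mu (tau (mu (pi h1) v)) h2))"] by (simp add: L)
  also have "\<dots> = pi (mu x (sw (pi h) (\<lambda>h1 h2. mu (tau (mu (pi h1) v)) h2)))"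
    by (simp add: sw_hom[OF lin_mu0] sw_hom[OF lin_pi])
  finally show ?thesis unfolding act_absorb[OF v] .
qed

text \<open>The coproduct axioms are multiplicativity of \<Delta> on a product rt in A, viewed
  through \<tau> and \<pi>. The two associativity axioms are r(tv) = (rt)v viewed through \<tau> and
  through \<pi>, after \<open>decompose\<close> has reassembled \<tau>(x_1) \<pi>(x_2).\<close>

lemma quadruple: "dual_yd_quadruple Hr Sr R one m xi"
  unfolding dual_yd_quadruple_def
proof (intro conjI ballI hopf yd_coalgebra)
  show "one \<in> car R" by (simp add: in_tau)
  show "linear_map TT R m" by (rule linear_map_lin) (auto simp: in_tau intro: lin_m[OF lin_id[OF vs_pscl]])
  show "linear_map TT Hr xi" by (rule linear_map_lin) (auto simp: in_pi intro: lin_xi[OF lin_id[OF vs_pscl]])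
  show "coact R one = tens Hr R (unit Hr) one"
    unfolding R_simps by (subst sw_one[where ?s2.0=pscl]) (intro bilinI lin_rules, simp add: tens_tn)
  show "comul R one = tens R R one one"
    unfolding R_simps by (subst sw_one[where ?s2.0=pscl]) (intro bilinI lin_rules, simp add: tens_tn)
  show "counit R one = 1" by simp
next
  fix h assume "h \<in> car Hr"
  then have h: "pi h = h" by (simp add: in_pi)
  then have "tau (mu one h) = s (ep h) one" using tau_mu_pi[of one h] by simp
  then have "tau h = s (ep h) one" by simp
  then show "act R h one = scl R (counit Hr h) one" by (simp add: h)
next
  fix h r t assume "h \<in> car Hr" "r \<in> car R" "t \<in> car R"
  then have h: "pi h = h" and r: "tau r = r" and t: "tau t = t" by (simp_all add: in_pi in_tau)
  show "act R h (m (tens R R r t)) = sweedler Hr Hr (comul Hr h) (\<lambda>h1 h2. m (tens R R (act R h1 r) (act R h2 t)))"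
    unfolding act_m[OF h r t] by (simp add: tens_tn h)
  have "sweedler Hr Hr (comul Hr h) (\<lambda>h1 h2. mul Hr (mul Hr h1 (xi (tens R R r t))) (Sr h2)) =
      sw h (\<lambda>h1 h2. mu (mu h1 (pi (mu r t))) (S h2))"
    by (rule conv_H[OF h, where ?s3.0=s]) (intro bilinI lin_rules, simp add: tens_tn)
  then show "sweedler Hr Hr (comul Hr h) (\<lambda>h1 h2. xi (tens R R (act R h1 r) (act R h2 t))) =
      sweedler Hr Hr (comul Hr h) (\<lambda>h1 h2. mul Hr (mul Hr h1 (xi (tens R R r t))) (Sr h2))"
    unfolding act_m[OF h r t] by simp
next
  fix r t assume "r \<in> car R" "t \<in> car R"
  then have r: "tau r = r" and t: "tau t = t" by (simp_all add: in_tau)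
  note L = lin_rules bilinI
  have T: "tens R R r t = tn s s r t" by (simp add: tens_tn)
  show "counit R (m (tens R R r t)) = counit R r * counit R t" by (simp add: tens_tn)
  show "counit Hr (xi (tens R R r t)) = counit R r * counit R t" by (simp add: tens_tn)
  have mm: "sweedler TT TT (comul2 Hr R (tens R R r t)) (\<lambda>x y. tens R R (m x) (m y)) = 
      sw r (\<lambda>r1 r2. sw t (\<lambda>t1 t2. tn s s (tau (mu r1 t1)) (tau (mu (tau r2) (tau t2)))))"
    using m_comul2[OF r t, of pscl "\<lambda>x y. tn s s x (m y)"] by (simp add: T tens_tn L)
  \<comment> \<open>The formulas for m and \<xi> have second legs projected to R. As r and t lie in
    R, the projections may be removed, which exposes the coproduct of rt.\<close>
  have dropm: "sw r (\<lambda>r1 r2. sw t (\<lambda>t1 t2. tn s1 s (f (mu r1 t1)) (g (mu (tau r2) (tau t2))))) =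
      sw r (\<lambda>r1 r2. sw t (\<lambda>t1 t2. tn s1 s (f (mu r1 t1)) (g (mu r2 t2))))"
    if f: "lin s s1 f" and g: "lin s s g" for f g and s1 :: "'k \<Rightarrow> 'a \<Rightarrow> 'a"
  proof -
    note L' = L lin_comp[OF f] lin_comp[OF g] lin_vs[OF f]
    have "sw r (\<lambda>r1 r2. sw t (\<lambda>t1 t2. tn s1 s (f (mu r1 t1)) (g (mu (tau r2) (tau t2))))) =
        sw r (\<lambda>r1 r2. sw t (\<lambda>t1 t2. tn s1 s (f (mu r1 t1)) (g (mu r2 (tau t2)))))"
      by (rule sw_R[OF _ r, where ?s2.0=pscl and F = "\<lambda>r1 r2. sw t (\<lambda>t1 t2. tn s1 s (f (mu r1 t1)) (g (mu r2 (tau t2))))"]) (intro L')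
    moreover have "sw t (\<lambda>t1 t2. tn s1 s (f (mu r1 t1)) (g (mu r2 (tau t2)))) = sw t (\<lambda>t1 t2. tn s1 s (f (mu r1 t1)) (g (mu r2 t2)))" for r1 r2
      by (rule sw_R[OF _ t, where ?s2.0=pscl and F = "\<lambda>t1 t2. tn s1 s (f (mu r1 t1)) (g (mu r2 t2))"]) (intro L')
    ultimately show ?thesis by simp
  qed
  have "comul R (m (tens R R r t)) = sw (mu r t) (\<lambda>x y. tn s s (tau x) (tau y))"
    by (simp add: T sw_tau_tau[OF bilin_tn[OF vs vs]])
  also have "\<dots> = sw r (\<lambda>r1 r2. sw t (\<lambda>t1 t2. tn s s (tau (mu r1 t1)) (tau (mu r2 t2))))"
    by (rule sw_mu[where ?s2.0=pscl]) (intro L)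
  finally show "comul R (m (tens R R r t)) = sweedler TT TT (comul2 Hr R (tens R R r t)) (\<lambda>x y. tens R R (m x) (m y))"
    unfolding mm dropm[OF lin_tau lin_tau] .
  have xx: "sweedler TT TT (comul2 Hr R (tens R R r t)) (\<lambda>x y. sweedler Hr TT (coact2 Hr R y) (\<lambda>g y0. tens Hr Hr (mul Hr (xi x) g) (xi y0))) =
      sw r (\<lambda>r1 r2. sw t (\<lambda>t1 t2. tn s s (pi (mu r1 t1)) (pi (mu (tau r2) (tau t2)))))"
    using xi_comul2[OF r t, of pscl "\<lambda>x y. tn s s x (xi y)"] by (simp add: T tens_tn L)
  have "comul Hr (xi (tens R R r t)) = sw (pi (mu r t)) (tn s s)"
    by (simp add: T Hr_ops(1) sw_tn)
  also have "\<dots> = sw (mu r t) (\<lambda>x y. tn s s (pi x) (pi y))"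
    by (rule sw_pi[OF bilin_tn[OF vs vs]])
  also have "\<dots> = sw r (\<lambda>r1 r2. sw t (\<lambda>t1 t2. tn s s (pi (mu r1 t1)) (pi (mu r2 t2))))"
    by (rule sw_mu[where ?s2.0=pscl]) (intro L)
  finally show "comul Hr (xi (tens R R r t)) = sweedler TT TT (comul2 Hr R (tens R R r t)) (\<lambda>x y.
        sweedler Hr TT (coact2 Hr R y) (\<lambda>g y0. tens Hr Hr (mul Hr (xi x) g) (xi y0)))"
    unfolding xx dropm[OF lin_pi lin_pi] .
  have xm: "sweedler TT TT (comul2 Hr R (tens R R r t)) (\<lambda>x y. sweedler Hr TT (coact2 Hr R y) (\<lambda>g y0. tens Hr R (mul Hr (xi x) g) (m y0))) =
      sw r (\<lambda>r1 r2. sw t (\<lambda>t1 t2. tn s s (pi (mu r1 t1)) (tau (mu (tau r2) (tau t2)))))"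
    using xi_comul2[OF r t, of pscl "\<lambda>x y. tn s s x (m y)"] by (simp add: T tens_tn L)
  have mx: "sweedler TT TT (comul2 Hr R (tens R R r t)) (\<lambda>x y. tens R Hr (m x) (xi y)) = 
      sw r (\<lambda>r1 r2. sw t (\<lambda>t1 t2. tn s s (tau (mu r1 t1)) (pi (mu (tau r2) (tau t2)))))"
    using m_comul2[OF r t, of pscl "\<lambda>x y. tn s s x (xi y)"] by (simp add: T tens_tn L)
  \<comment> \<open>The braiding axiom depends on the product a only: it relates \<tau>(a_1)
    \<otimes> \<pi>(a_2) to \<pi>(a_1) \<otimes> \<tau>(a_2). The braiding maps the former to
    \<pi>(a_1) S(a_3) \<pi>(a_4) \<otimes> \<tau>(a_2), where S(a_3) \<pi>(a_4) cancels.\<close>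
  define a where "a = mu r t"
  have a1: "sw r (\<lambda>r1 r2. sw t (\<lambda>t1 t2. tn s s (tau (mu r1 t1)) (pi (mu r2 t2)))) = sw a (\<lambda>x y. tn s s (tau x) (pi y))"
    unfolding a_def by (rule sym, rule sw_mu[where ?s2.0=pscl]) (intro L)
  have a2: "sw r (\<lambda>r1 r2. sw t (\<lambda>t1 t2. tn s s (pi (mu r1 t1)) (tau (mu r2 t2)))) = sw a (\<lambda>x y. tn s s (pi x) (tau y))"
    unfolding a_def by (rule sym, rule sw_mu[where ?s2.0=pscl]) (intro L)
  have mem: "sw a (\<lambda>x y. tn s s (tau x) (pi y)) \<in> car (tensor R Hr)" by (intro sw_mem tn_mem) auto
  let ?G = "\<lambda>r h. sw r (\<lambda>g r0. tn s s (mu (pi g) h) (tau r0))"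
  have bG: "bilin s s pscl ?G" by (intro L)
  have "sweedler Hr R (coact R v) (\<lambda>g r0. tens Hr R (mul Hr g (pi h)) r0) = ?G v (pi h)" for v h
    by (rule conv_coact[where ?s3.0=pscl and G = "\<lambda>g r0. tn s s (mu g (pi h)) r0"]) (intro L, simp add: tens_tn)
  then have "sweedler Hr R (coact R v) (\<lambda>g r0. tens Hr R (mul Hr g h) r0) = ?G v h" if "h \<in> car Hr" for v h
    using that by auto
  then have "c_RH Hr R (sw a (\<lambda>x y. tn s s (tau x) (pi y))) = tlift (scl R) (scl Hr) ?G (sw a (\<lambda>x y. tn s s (tau x) (pi y)))"
    unfolding c_RH_def by (intro sweedler_tlift[where ?s3.0=pscl] vspaces mem) (simp_all only: R_simps(2) scl_Hr bG)
  also have "\<dots> = sw a (\<lambda>x y. sw (tau x) (\<lambda>g r0. tn s s (mu (pi g) (pi y)) (tau r0)))"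
    by (simp add: sw_hom[OF lin_tlift[OF bG]] tlift_tn[OF bG] del: R_simps(6))
  also have "\<dots> = sw a (\<lambda>x y. sw x (\<lambda>u z. sw z (\<lambda>v w. tn s s (mu (pi u) (mu (S w) (pi y))) (tau v))))"
    by (subst sw_pi_tau[where ?s2.0=pscl and F = "\<lambda>g r0. tn s s (mu g (pi _)) r0"], intro L) (simp add: assoc)
  also have "\<dots> = sw a (\<lambda>u y. sw y (\<lambda>z x. sw z (\<lambda>v w. tn s s (mu (pi u) (mu (S w) (pi x))) (tau v))))"
    by (rule coassoc[where ?s2.0=pscl]) (intro L)+
  also have "\<dots> = sw a (\<lambda>u y. sw y (\<lambda>v x. sw x (\<lambda>w k. tn s s (mu (pi u) (mu (S w) (pi k))) (tau v))))"
    by (subst coassoc[where ?s2.0=pscl], (intro L)+, simp)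
  also have "\<dots> = sw a (\<lambda>u y. sw y (\<lambda>v x. pscl (ep x) (tn s s (mu (pi u) one) (tau v))))"
    by (subst antip[where ?s2.0=pscl and f = "\<lambda>e. tn s s (mu (pi _) e) (tau _)"], intro L, simp)
  also have "\<dots> = sw a (\<lambda>x y. tn s s (pi x) (tau y))"
    by (subst counit_r[where ?s2.0=pscl], intro L, simp)
  finally show "c_RH Hr R (sweedler TT TT (comul2 Hr R (tens R R r t)) (\<lambda>x y. tens R Hr (m x) (xi y))) =
     sweedler TT TT (comul2 Hr R (tens R R r t)) (\<lambda>x y. sweedler Hr TT (coact2 Hr R y) (\<lambda>g y0. tens Hr R (mul Hr (xi x) g) (m y0)))"
    unfolding mx xm dropm[OF lin_tau lin_pi] dropm[OF lin_pi lin_tau] a1 a2 .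
next
  fix r t v assume "r \<in> car R" "t \<in> car R" "v \<in> car R"
  then have r: "tau r = r" and t: "tau t = t" and v: "tau v = v" by (simp_all add: in_tau)
  note L = lin_rules bilinI
  have T: "tens R R x y = tn s s x y" for x y by (simp add: tens_tn)
  have drop: "sw r (\<lambda>r1 r2. sw t (\<lambda>t1 t2. F (mu r1 t1) (mu (tau r2) (tau t2)))) = sw (mu r t) F"
    if F: "bilin s s s F" and r: "tau r = r" and t: "tau t = t" for F r t
  proof -
    note L' = L lin_bilin1[OF F] lin_bilin2[OF F]
    have "sw r (\<lambda>r1 r2. sw t (\<lambda>t1 t2. F (mu r1 t1) (mu (tau r2) (tau t2)))) = sw r (\<lambda>r1 r2. sw t (\<lambda>t1 t2. F (mu r1 t1) (mu r2 (tau t2))))"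
      by (rule sw_R[OF _ r, where ?s2.0=s and F = "\<lambda>r1 r2. sw t (\<lambda>t1 t2. F (mu r1 t1) (mu r2 (tau t2)))"]) (intro L')
    also have "\<dots> = sw r (\<lambda>r1 r2. sw t (\<lambda>t1 t2. F (mu r1 t1) (mu r2 t2)))"
      by (subst sw_R[OF _ t, where ?s2.0=s and F = "\<lambda>t1 t2. F (mu _ t1) (mu _ t2)"], intro L', simp)
    also have "\<dots> = sw (mu r t) F" by (rule sym, rule sw_mu[OF F])
    finally show ?thesis .
  qed
  have "sweedler TT TT (comul2 Hr R (tens R R r t)) (\<lambda>x y. m (tens R R (m x) (act R (xi y) v))) =
      sw r (\<lambda>r1 r2. sw t (\<lambda>t1 t2. tau (mu (mu (tau (mu r1 t1)) (pi (mu (tau r2) (tau t2)))) v)))"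
    using m_comul2[OF r t, of s "\<lambda>x y. m (tn s s x (tau (mu (xi y) v)))"] by (simp add: T L assoc)
  also have "\<dots> = sw (mu r t) (\<lambda>x y. tau (mu (mu (tau x) (pi y)) v))"
    by (rule drop[OF _ r t]) (intro L)
  also have "\<dots> = tau (mu (P (mu r t)) v)" by (rule decompose[where ?s2.0=s]) (intro L)
  finally show "m (tens R R r (m (tens R R t v))) = sweedler TT TT (comul2 Hr R (tens R R r t)) (\<lambda>x y. m (tens R R (m x) (act R (xi y) v)))"
    by (simp add: T assoc)
  have "sweedler TT TT (comul2 Hr R (tens R R t v)) (\<lambda>x y. mul Hr (xi (tens R R r (m x))) (xi y)) =
      sw t (\<lambda>r1 r2. sw v (\<lambda>t1 t2. mu (pi (mu r (tau (mu r1 t1)))) (pi (mu (tau r2) (tau t2)))))"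
    using m_comul2[OF t v, of s "\<lambda>x y. mu (pi (mu r x)) (xi y)"] by (simp add: T L)
  also have "\<dots> = sw (mu t v) (\<lambda>x y. mu (pi (mu r (tau x))) (pi y))"
    by (rule drop[OF _ t v]) (intro L)
  also have "\<dots> = sw (mu t v) (\<lambda>x y. pi (mu r (mu (tau x) (pi y))))" by (simp add: assoc[symmetric])
  also have "\<dots> = pi (mu r (P (mu t v)))" by (rule decompose[where ?s2.0=s]) (intro L)
  finally have lhs: "sweedler TT TT (comul2 Hr R (tens R R t v)) (\<lambda>x y. mul Hr (xi (tens R R r (m x))) (xi y)) = pi (mu r (mu t v))" by simp
  \<comment> \<open>The other braiding sends h \<otimes> v to h_1 acting on v, tensored with h_2;
    multiplied out this is hv by \<open>act_absorb\<close>, so no trace of the braiding remains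
    inside \<pi>.\<close>
  have inner: "sweedler R Hr (c_HR Hr R (tens Hr R (xi y) v)) (\<lambda>t' h. mul Hr (xi (tens R R (m x) t')) h) = pi (mu (m x) (mu (xi y) v))" for x y
  proof -
    have "sweedler Hr Hr (comul Hr (xi y)) (\<lambda>h1 h2. tens R Hr (act R h1 v) h2) = sw (xi y) (\<lambda>h1 h2. tn s s (tau (mu (pi h1) v)) h2)"
      by (rule conv_H[where ?s3.0=pscl]) (simp, intro L, simp add: tens_tn)
    moreover have "c_HR Hr R (tens Hr R (xi y) v) = sweedler Hr Hr (comul Hr (xi y)) (\<lambda>h1 h2. tens R Hr (act R h1 v) h2)"
    proof -
      let ?G = "\<lambda>h r. sw (pi h) (\<lambda>h1 h2. tn s s (tau (mu (pi h1) r)) h2)"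
      have bG: "bilin s s pscl ?G" by (intro L)
      have e: "sweedler Hr Hr (comul Hr h) (\<lambda>h1 h2. tens R Hr (act R h1 r) h2) = ?G h r" if "pi h = h" for h r
        unfolding that by (rule conv_H[OF that, where ?s3.0=pscl]) (intro L, simp add: tens_tn)
      have "xi y \<in> car Hr" "v \<in> car R" by (simp_all add: in_pi in_tau v)
      then have mem: "tn s s (xi y) v \<in> car (tensor Hr R)" by (rule tn_mem) simp_all
      have "c_HR Hr R (tn s s (xi y) v) = tlift (scl Hr) (scl R) ?G (tn s s (xi y) v)"
        unfolding c_HR_def
        by (intro sweedler_tlift[where ?s3.0=pscl] vspaces mem e) (simp_all only: R_simps(2) scl_Hr bG car_Hr in_pi)
      then show ?thesis using e[of "xi y" v] by (simp add: tlift_tn[OF bG] tens_tn del: R_simps(5))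
    qed
    moreover have "sweedler R Hr (sw (xi y) (\<lambda>h1 h2. tn s s (tau (mu (pi h1) v)) h2)) (\<lambda>t' h. mul Hr (xi (tens R R (m x) t')) h) =
        sw (xi y) (\<lambda>h1 h2. mu (pi (mu (m x) (tau (mu (pi h1) v)))) h2)"
    proof -
      let ?G = "\<lambda>t' h. mu (pi (mu (m x) t')) h"
      have bG: "bilin s s s ?G" by (intro L)
      have "sw (xi y) (\<lambda>h1 h2. tn s s (tau (mu (pi h1) v)) (pi h2)) = sw (xi y) (\<lambda>h1 h2. tn s s (tau (mu (pi h1) v)) h2)"
        using sw_H[of "xi y" pscl "\<lambda>h1 h2. tn s s (tau (mu (pi h1) v)) h2"] by (simp add: L)
      moreover have "sw (xi y) (\<lambda>h1 h2. tn s s (tau (mu (pi h1) v)) (pi h2)) \<in> car (tensor R Hr)"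
        by (intro sw_mem tn_mem) auto
      ultimately have mem: "sw (xi y) (\<lambda>h1 h2. tn s s (tau (mu (pi h1) v)) h2) \<in> car (tensor R Hr)" by simp
      have "sweedler R Hr (sw (xi y) (\<lambda>h1 h2. tn s s (tau (mu (pi h1) v)) h2)) (\<lambda>t' h. mul Hr (xi (tens R R (m x) t')) h) =
          tlift (scl R) (scl Hr) ?G (sw (xi y) (\<lambda>h1 h2. tn s s (tau (mu (pi h1) v)) h2))"
        by (intro sweedler_tlift[where ?s3.0=s] vspaces mem) (simp_all add: bG in_pi T)
      then show ?thesis by (simp add: sw_hom[OF lin_tlift[OF bG]] tlift_tn[OF bG])
    qed
    moreover have "sw (xi y) (\<lambda>h1 h2. mu (pi (mu (m x) (tau (mu (pi h1) v)))) h2) = pi (mu (m x) (mu (xi y) v))"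
      using pi_act_absorb[OF v, of "xi y" "m x"] by simp
    ultimately show ?thesis by simp
  qed
  have "sweedler TT TT (comul2 Hr R (tens R R r t)) (\<lambda>x y. sweedler R Hr (c_HR Hr R (tens Hr R (xi y) v)) (\<lambda>t' h. mul Hr (xi (tens R R (m x) t')) h)) =
      sw r (\<lambda>r1 r2. sw t (\<lambda>t1 t2. pi (mu (mu (tau (mu r1 t1)) (pi (mu (tau r2) (tau t2)))) v)))"
    unfolding inner using m_comul2[OF r t, of s "\<lambda>x y. pi (mu x (mu (xi y) v))"] by (simp add: T L assoc)
  also have "\<dots> = sw (mu r t) (\<lambda>x y. pi (mu (mu (tau x) (pi y)) v))"
    by (rule drop[OF _ r t]) (intro L)
  also have "\<dots> = pi (mu (P (mu r t)) v)" by (rule decompose[where ?s2.0=s]) (intro L)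
  finally show "sweedler TT TT (comul2 Hr R (tens R R t v)) (\<lambda>x y. mul Hr (xi (tens R R r (m x))) (xi y)) =
      sweedler TT TT (comul2 Hr R (tens R R r t)) (\<lambda>x y. sweedler R Hr (c_HR Hr R (tens Hr R (xi y) v)) (\<lambda>t' h. mul Hr (xi (tens R R (m x) t')) h))"
    unfolding lhs by (simp add: assoc)
next
  fix r assume "r \<in> car R"
  then have r: "tau r = r" by (simp add: in_tau)
  show "m (tens R R r one) = r" "m (tens R R one r) = r"
    "xi (tens R R r one) = scl Hr (counit R r) (unit Hr)" "xi (tens R R one r) = scl Hr (counit R r) (unit Hr)"
    by (simp_all add: tens_tn r pi_R)
qed

end

section \<open>The bosonization\<close>

text \<open>The operations of B are only assumed to match those of A along a linear bijection of
  carriers; that B is a bialgebra is then a conclusion. In this way the axioms for the bosonization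
  follow from those of A, without computing with its formulas again.\<close>

locale transport = tbialg s P dl ep mu one
  for s :: "'k::field \<Rightarrow> 'a::ab_group_add \<Rightarrow> 'a" and P dl ep mu one +
  fixes B :: "('k, 'b::ab_group_add) bialgebra" and phi :: "'a \<Rightarrow> 'b" and psi :: "'b \<Rightarrow> 'a"
  assumes B: "is_vspace B" and lin_phi: "lin s (scl B) phi" and lin_psi: "lin (scl B) s psi"
    and phi_mem: "phi x \<in> car B" and phi_psi: "t \<in> car B \<Longrightarrow> phi (psi t) = t"
    and psi_phi: "psi (phi x) = P x"
    and mulB: "mul B (phi x) (phi y) = phi (mu x y)"
    and comulB: "comul B (phi x) = sw x (\<lambda>a b. tn (scl B) (scl B) (phi a) (phi b))"
    and counitB: "counit B (phi x) = ep x" and unitB: "unit B = phi one"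
begin

lemma phi_P: "phi (P x) = phi x"
  using phi_psi[OF phi_mem, of x] by (simp add: psi_phi)

lemma vsB [lin_rules]: "vector_space (scl B)" using B by (simp add: is_vspace_def)

lemma lin_phi' [lin_rules]: "lin s0 s f \<Longrightarrow> lin s0 (scl B) (\<lambda>x. phi (f x))"
  and lin_psi' [lin_rules]: "lin s0 (scl B) g \<Longrightarrow> lin s0 s (\<lambda>x. psi (g x))"
  using lin_comp lin_phi lin_psi by blast+

lemmas [lin_rules] = lin_phi lin_psi

lemma conv_B:
  assumes G: "bilin (scl B) (scl B) s3 G" and FG: "\<And>a b. F (phi a) (phi b) = G (phi a) (phi b)"
  shows "sweedler B B (comul B (phi x)) F = sw x (\<lambda>a b. G (phi a) (phi b))"
proof -
  have "F v w = G v w" if "v \<in> car B" "w \<in> car B" for v w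
    using FG[of "psi v" "psi w"] that by (simp add: phi_psi)
  moreover have "comul B (phi x) \<in> car (tensor B B)" unfolding comulB by (intro sw_mem tn_mem phi_mem refl)
  ultimately have "sweedler B B (comul B (phi x)) F = tlift (scl B) (scl B) G (comul B (phi x))"
    using sweedler_tlift[OF B B G] by blast
  then show ?thesis by (simp add: comulB sw_hom[OF lin_tlift[OF G]] tlift_tn[OF G])
qed

lemma transport_bialgebra: "is_bialgebra B"
proof -
  interpret b: vector_space "scl B" by (rule vsB)
  have subB: "b.subspace (car B)" using B by (simp add: is_vspace_def)
  have ex: "\<exists>a. y = phi a" if "y \<in> car B" for y using phi_psi[OF that] by metis
  have alg: "is_algebra B"
    unfolding is_algebra_def
  proof (intro conjI ballI B)
    have "mul B x y = phi (mu (psi x) (psi y))" if "x \<in> car B" "y \<in> car B" for x y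
      using mulB[of "psi x" "psi y"] that by (simp add: phi_psi)
    moreover have "bilinear_map B B B (\<lambda>x y. phi (mu (psi x) (psi y)))"
      by (rule bilinear_mapI) (intro bilinI lin_rules, rule phi_mem)
    ultimately show "bilinear_map B B B (mul B)"
      unfolding bilinear_map_def linear_map_def by (simp add: b.subspace_add[OF subB] b.subspace_scale[OF subB])
    show "unit B \<in> car B" by (simp add: unitB phi_mem)
  next
    fix x y z assume "x \<in> car B" "y \<in> car B" "z \<in> car B"
    then obtain a b c where "x = phi a" "y = phi b" "z = phi c" using ex by blast
    then show "mul B (mul B x y) z = mul B x (mul B y z)" by (simp add: mulB assoc)
  next
    fix x assume "x \<in> car B"
    then obtain a where "x = phi a" using ex by blast
    then show "mul B (unit B) x = x" "mul B x (unit B) = x" by (simp_all add: unitB mulB phi_P)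
  qed
  have coalg: "is_coalgebra B"
    unfolding is_coalgebra_def
  proof (intro conjI ballI B)
    have "comul B y = sw (psi y) (\<lambda>a b. tn (scl B) (scl B) (phi a) (phi b))" if "y \<in> car B" for y
      using comulB[of "psi y"] that by (simp add: phi_psi)
    moreover have "linear_map B (tensor B B) (\<lambda>y. sw (psi y) (\<lambda>a b. tn (scl B) (scl B) (phi a) (phi b)))"
      by (rule linear_map_lin) (simp, intro bilinI lin_rules, intro sw_mem tn_mem phi_mem refl)
    ultimately show "linear_map B (tensor B B) (comul B)"
      unfolding linear_map_def by (simp add: b.subspace_add[OF subB] b.subspace_scale[OF subB])
    have "counit B y = ep (psi y)" if "y \<in> car B" for y
      using counitB[of "psi y"] that by (simp add: phi_psi)
    moreover have "linear_map B base_field (\<lambda>y. ep (psi y))"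
      by (rule linear_map_lin) (simp_all add: base_field_def, intro lin_rules)
    ultimately show "linear_map B base_field (counit B)"
      unfolding linear_map_def by (simp add: b.subspace_add[OF subB] b.subspace_scale[OF subB])
  next
    fix y assume "y \<in> car B"
    then obtain x where y: "y = phi x" using ex by blast
    let ?t = "tn (scl B) (scl B)" and ?t3 = "tn (scl B) (pscl :: 'k \<Rightarrow> ('k, 'b, 'b) tensor \<Rightarrow> _)"
    have 1: "sweedler B B (comul B (phi a)) (\<lambda>a1 a2. tens B (tensor B B) a1 (tens B B a2 v)) = sw a (\<lambda>a1 a2. ?t3 (phi a1) (?t (phi a2) v))" for a v
      by (rule conv_B[where ?s3.0=pscl and G = "\<lambda>a1 a2. ?t3 a1 (?t a2 v)"]) (intro bilinI lin_rules, simp add: tens_tn)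
    have 2: "sweedler B B (comul B (phi a)) (\<lambda>b1 b2. tens B (tensor B B) v (tens B B b1 b2)) = sw a (\<lambda>b1 b2. ?t3 v (?t (phi b1) (phi b2)))" for a v
      by (rule conv_B[where ?s3.0=pscl and G = "\<lambda>b1 b2. ?t3 v (?t b1 b2)"]) (intro bilinI lin_rules, simp add: tens_tn)
    have "sweedler B B (comul B (phi x)) (\<lambda>a b. sweedler B B (comul B a) (\<lambda>a1 a2. tens B (tensor B B) a1 (tens B B a2 b))) =
        sw x (\<lambda>a b. sw (psi (phi a)) (\<lambda>a1 a2. ?t3 (phi a1) (?t (phi a2) (phi b))))"
      by (rule conv_B[where ?s3.0=pscl and G = "\<lambda>u v. sw (psi u) (\<lambda>a1 a2. ?t3 (phi a1) (?t (phi a2) v))"])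
        (intro bilinI lin_rules, simp add: 1 psi_phi)
    also have "\<dots> = sw x (\<lambda>a b. sw b (\<lambda>b1 b2. ?t3 (phi a) (?t (phi b1) (phi b2))))"
      unfolding psi_phi sw_P' by (intro coassoc[where ?s2.0=pscl] lin_rules)
    also have "\<dots> = sw x (\<lambda>a b. sw (psi (phi b)) (\<lambda>b1 b2. ?t3 (phi a) (?t (phi b1) (phi b2))))"
      by (simp add: psi_phi)
    also have "\<dots> = sweedler B B (comul B (phi x)) (\<lambda>a b. sweedler B B (comul B b) (\<lambda>b1 b2. tens B (tensor B B) a (tens B B b1 b2)))"
      by (rule sym, rule conv_B[where ?s3.0=pscl and G = "\<lambda>u v. sw (psi v) (\<lambda>b1 b2. ?t3 u (?t (phi b1) (phi b2)))"])
        (intro bilinI lin_rules, simp add: 2 psi_phi)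
    finally show "sweedler B B (comul B y) (\<lambda>a b. sweedler B B (comul B a) (\<lambda>a1 a2. tens B (tensor B B) a1 (tens B B a2 b))) =
      sweedler B B (comul B y) (\<lambda>a b. sweedler B B (comul B b) (\<lambda>b1 b2. tens B (tensor B B) a (tens B B b1 b2)))"
      unfolding y .
    have "sweedler B B (comul B (phi x)) (\<lambda>a b. scl B (counit B a) b) = sw x (\<lambda>a b. scl B (ep (psi (phi a))) (phi b))"
      by (rule conv_B[where ?s3.0="scl B" and G = "\<lambda>u v. scl B (ep (psi u)) v"]) (intro bilinI lin_rules, simp add: counitB psi_phi)
    also have "\<dots> = phi (P x)" unfolding psi_phi ep_P by (intro counit_l lin_phi)
    finally show "sweedler B B (comul B y) (\<lambda>a b. scl B (counit B a) b) = y" by (simp add: y phi_P)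
    have "sweedler B B (comul B (phi x)) (\<lambda>a b. scl B (counit B b) a) = sw x (\<lambda>a b. scl B (ep (psi (phi b))) (phi a))"
      by (rule conv_B[where ?s3.0="scl B" and G = "\<lambda>u v. scl B (ep (psi v)) u"]) (intro bilinI lin_rules, simp add: counitB psi_phi)
    also have "\<dots> = phi (P x)" unfolding psi_phi ep_P by (intro counit_r lin_phi)
    finally show "sweedler B B (comul B y) (\<lambda>a b. scl B (counit B b) a) = y" by (simp add: y phi_P)
  qed
  show ?thesis
    unfolding is_bialgebra_def
  proof (intro conjI ballI alg coalg)
    fix u v assume "u \<in> car B" "v \<in> car B"
    then obtain x y where u: "u = phi x" and v: "v = phi y" using ex by blast
    let ?t = "tn (scl B) (scl B)"
    have 1: "sweedler B B (comul B (phi y)) (\<lambda>y1 y2. tens B B (mul B (phi a) y1) (mul B (phi b) y2)) = sw y (\<lambda>y1 y2. ?t (phi (mu a y1)) (phi (mu b y2)))" for a b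
    proof -
      have "sweedler B B (comul B (phi y)) (\<lambda>y1 y2. tens B B (mul B (phi a) y1) (mul B (phi b) y2)) =
         sw y (\<lambda>y1 y2. ?t (phi (mu a (psi (phi y1)))) (phi (mu b (psi (phi y2)))))"
        by (rule conv_B[where ?s3.0=pscl and G = "\<lambda>y1 y2. ?t (phi (mu a (psi y1))) (phi (mu b (psi y2)))"])
          (intro bilinI lin_rules, simp add: tens_tn mulB psi_phi)
      then show ?thesis by (simp add: psi_phi)
    qed
    have "comul B (mul B u v) = sw x (\<lambda>x1 x2. sw y (\<lambda>y1 y2. ?t (phi (mu x1 y1)) (phi (mu x2 y2))))"
      unfolding u v mulB comulB by (rule sw_mu[where ?s2.0=pscl]) (intro bilinI lin_rules)
    also have "\<dots> = sw x (\<lambda>x1 x2. sw y (\<lambda>y1 y2. ?t (phi (mu (psi (phi x1)) y1)) (phi (mu (psi (phi x2)) y2))))"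
      by (simp add: psi_phi)
    also have "\<dots> = sweedler B B (comul B u) (\<lambda>x1 x2. sweedler B B (comul B v) (\<lambda>y1 y2. tens B B (mul B x1 y1) (mul B x2 y2)))"
      unfolding u v
      by (rule sym, rule conv_B[where ?s3.0=pscl and G = "\<lambda>x1 x2. sw y (\<lambda>y1 y2. ?t (phi (mu (psi x1) y1)) (phi (mu (psi x2) y2)))"])
        (intro bilinI lin_rules, simp add: 1 psi_phi)
    finally show "comul B (mul B u v) = sweedler B B (comul B u) (\<lambda>x1 x2. sweedler B B (comul B v) (\<lambda>y1 y2. tens B B (mul B x1 y1) (mul B x2 y2)))" .
    show "counit B (mul B u v) = counit B u * counit B v" by (simp add: u v mulB counitB)
  next
    show "comul B (unit B) = tens B B (unit B) (unit B)"
      unfolding unitB comulB tens_tn by (rule sw_one[where ?s2.0=pscl]) (intro bilinI lin_rules)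
    show "counit B (unit B) = 1" by (simp add: unitB counitB)
  qed
qed

lemma transport_antipode:
  assumes T: "lin s s T" "\<And>x. cv T P x = s (ep x) one" "\<And>x. cv P T x = s (ep x) one"
  shows "is_antipode B (\<lambda>y. phi (T (psi y)))"
  unfolding is_antipode_def
proof (intro conjI ballI)
  note L = bilinI lin_rules lin_comp[OF T(1)]
  show "linear_map B B (\<lambda>y. phi (T (psi y)))" by (rule linear_map_lin) (intro L, rule phi_mem)
  fix y assume "y \<in> car B"
  then obtain x where y: "y = phi x" using phi_psi by metis
  have "sweedler B B (comul B (phi x)) (\<lambda>x1 x2. mul B (phi (T (psi x1))) x2) = sw x (\<lambda>a b. phi (mu (T (psi (phi a))) (psi (phi b))))"
    by (rule conv_B[where ?s3.0="scl B" and G = "\<lambda>x1 x2. phi (mu (T (psi x1)) (psi x2))"]) (intro L, simp add: mulB psi_phi)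
  also have "\<dots> = sw x (\<lambda>a b. phi (mu (T a) (P b)))" by (rule sw_cong_P) (simp add: psi_phi)
  also have "\<dots> = phi (cv T P x)" by (simp add: cv_def sw_hom[OF lin_phi])
  finally show "sweedler B B (comul B y) (\<lambda>x1 x2. mul B (phi (T (psi x1))) x2) = scl B (counit B y) (unit B)"
    by (simp add: y T(2) counitB unitB linD(2)[OF lin_phi])
  have "sweedler B B (comul B (phi x)) (\<lambda>x1 x2. mul B x1 (phi (T (psi x2)))) = sw x (\<lambda>a b. phi (mu (psi (phi a)) (T (psi (phi b)))))"
    by (rule conv_B[where ?s3.0="scl B" and G = "\<lambda>x1 x2. phi (mu (psi x1) (T (psi x2)))"]) (intro L, simp add: mulB psi_phi)
  also have "\<dots> = sw x (\<lambda>a b. phi (mu (P a) (T b)))" by (rule sw_cong_P) (simp add: psi_phi)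
  also have "\<dots> = phi (cv P T x)" by (simp add: cv_def sw_hom[OF lin_phi])
  finally show "sweedler B B (comul B y) (\<lambda>x1 x2. mul B x1 (phi (T (psi x2)))) = scl B (counit B y) (unit B)"
    by (simp add: y T(3) counitB unitB linD(2)[OF lin_phi])
qed

end

section \<open>The isomorphism and the operations of the bosonization\<close>

context split_raw
begin

definition phi :: "'a \<Rightarrow> ('k, 'a, 'a) tensor" where "phi a = sw a (\<lambda>x y. tn s s (tau x) (pi y))"

definition psi :: "('k, 'a, 'a) tensor \<Rightarrow> 'a" where "psi = tlift s s mu"

abbreviation "Bos \<equiv> bosonization Hr R one m xi"

lemma lin_phi: "lin s pscl phi" "lin pscl s psi"
  unfolding phi_def[abs_def] psi_def by (intro bilinI lin_rules lin_tlift)+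

lemma lin_phi_rule: "lin s0 s f \<Longrightarrow> lin s0 pscl (\<lambda>x. phi (f x))"
  using lin_comp lin_phi by blast

lemma psi_phi: "psi (phi a) = P a"
  using decompose[OF lin_id[OF vs], of a] by (simp add: phi_def psi_def sw_hom[OF lin_tlift[OF bilin_mu]] tlift_tn[OF bilin_mu])

lemma phi_mem: "phi a \<in> car (tensor R Hr)"
  unfolding phi_def by (intro sw_mem tn_mem) auto

lemma phi_mul: assumes h: "pi h = h" shows "phi (mu w h) = sw w (\<lambda>x y. tn s s (tau x) (mu (pi y) h))"
proof -
  note L = bilinI lin_rules
  have ts: "tn s s (s c x) y = pscl c (tn s s x y)" for c x y by (rule linD(2)[OF bilinD(1)[OF bilin_tn[OF vs vs]]])
  have "phi (mu w h) = sw w (\<lambda>x y. sw h (\<lambda>h1 h2. tn s s (tau (mu x h1)) (pi (mu y h2))))"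
    unfolding phi_def by (rule sw_mu[where ?s2.0=pscl]) (intro L)
  also have "\<dots> = sw w (\<lambda>x y. sw h (\<lambda>h1 h2. tn s s (tau (mu x (pi h1))) (pi (mu y (pi h2)))))"
    by (subst sw_H[OF h, where ?s2.0=pscl and G = "\<lambda>h1 h2. tn s s (tau (mu _ h1)) (pi (mu _ h2))"], intro L, simp)
  also have "\<dots> = sw w (\<lambda>x y. sw h (\<lambda>h1 h2. pscl (ep h1) (tn s s (tau x) (mu (pi y) (pi h2)))))" by (simp add: ts)
  also have "\<dots> = sw w (\<lambda>x y. tn s s (tau x) (mu (pi y) (pi (P h))))"
    by (subst counit_l[where ?s2.0=pscl], intro L, simp)
  finally show ?thesis by (simp add: h)
qed

text \<open>For r in R the second leg stays in R, where \<pi> is the counit. Together with right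
  H-linearity of \<open>phi\<close> this shows that multiplication inverts \<open>phi\<close> on
  pure tensors.\<close>

lemma phi_tn: assumes r: "tau r = r" and h: "pi h = h" shows "phi (mu r h) = tn s s r h"
proof -
  note L = bilinI lin_rules
  have ts: "tn s s x (s c y) = pscl c (tn s s x y)" for c x y by (rule linD(2)[OF bilinD(2)[OF bilin_tn[OF vs vs]]])
  have ms: "mu (s c one) y = s c (P y)" for c y by (simp add: linD(2)[OF bilinD(1)[OF bilin_mu]])
  have "phi (mu r h) = sw r (\<lambda>x y. tn s s (tau x) (mu (pi (tau y)) h))"
    unfolding phi_mul[OF h]
    by (rule sym, rule sw_R[OF _ r, where ?s2.0=pscl and F = "\<lambda>x y. tn s s (tau x) (mu (pi y) h)"]) (intro L)
  also have "\<dots> = sw r (\<lambda>x y. pscl (ep y) (tn s s (tau x) (P h)))" by (simp add: ts ms)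
  also have "\<dots> = tn s s (tau (P r)) (P h)" by (intro counit_r L)
  finally show ?thesis using pi_P(2)[of h] by (simp add: r h)
qed

lemma phi_psi: assumes "y \<in> car (tensor R Hr)" shows "phi (psi y) = y"
proof -
  obtain ps where ps: "presents R Hr ps y" using exists_presentation[OF vspaces(1,2) assms] by blast
  have y: "y = (\<Sum>p\<leftarrow>ps. tn s s (fst p) (snd p))" using ps by (simp add: presents_def tens_tn case_prod_beta')
  have l: "lin pscl pscl (\<lambda>t. phi (psi t))" using lin_comp[OF lin_phi] .
  have "phi (psi y) = (\<Sum>p\<leftarrow>ps. phi (psi (tn s s (fst p) (snd p))))" unfolding y by (rule linear_sum_list[OF l])
  also have "\<dots> = y"
    unfolding y
  proof (intro arg_cong[where f = sum_list] map_cong refl)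
    fix p assume "p \<in> set ps"
    then have "tau (fst p) = fst p" "pi (snd p) = snd p" using ps by (auto simp: presents_def in_tau in_pi)
    then show "phi (psi (tn s s (fst p) (snd p))) = tn s s (fst p) (snd p)"
      by (simp add: psi_def tlift_tn[OF bilin_mu] phi_tn)
  qed
  finally show ?thesis .
qed

lemma conv_phi:
  assumes G: "bilin s s s3 G" and FG: "\<And>a b. F (tau a) (pi b) = G (tau a) (pi b)"
  shows "sweedler R Hr (phi x) F = sw x (\<lambda>a b. G (tau a) (pi b))"
proof -
  have "sweedler R Hr (phi x) F = tlift s s G (phi x)"
    using sweedler_tlift[of R Hr s3 G F "phi x"] G FG phi_mem by auto
  then show ?thesis by (simp add: phi_def sw_hom[OF lin_tlift[OF G]] tlift_tn[OF G])
qed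

lemma Bos_counit: "counit Bos (phi x) = ep x"
proof -
  have "counit Bos (phi x) = sw x (\<lambda>a b. ep (tau a) * ep (pi b))"
    unfolding bosonization_def bialgebra.simps coalgebra.simps
    by (simp add: conv_phi[where ?s3.0="(*)" and G = "\<lambda>r h. ep r * ep h"] bilinI lin_rules)
  also have "\<dots> = sw x (\<lambda>a b. ep (mu (tau a) (pi b)))" by simp
  also have "\<dots> = ep (P x)" by (rule decompose) (rule lin_ep)
  finally show ?thesis by simp
qed

text \<open>On a pure tensor r # h the smash coproduct is compared with \<Delta>(rh): its first
  factor is \<open>phi\<close> of r_1 h_1 by \<open>phi_mul\<close>, its second \<open>phi\<close>
  of r_2 h_2 by \<open>phi_tn\<close>. Then \<open>decompose\<close> passes from \<tau>(x_1)
  \<pi>(x_2) to x.\<close>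

lemma Bos_comul: "comul Bos (phi x) = sw x (\<lambda>a b. tn pscl pscl (phi a) (phi b))"
proof -
  note L = bilinI lin_rules lin_phi_rule
  let ?t = "tn (pscl :: 'k \<Rightarrow> ('k, 'a, 'a) tensor \<Rightarrow> _) (pscl :: 'k \<Rightarrow> ('k, 'a, 'a) tensor \<Rightarrow> _)"
  let ?J = "\<lambda>r h. sweedler R R (comul R r) (\<lambda>r1 r2. sweedler Hr R (coact R r2) (\<lambda>g r0. sweedler Hr Hr (comul Hr h) (\<lambda>h1 h2.
      tens (tensor R Hr) (tensor R Hr) (tens R Hr r1 (mul Hr g h1)) (tens R Hr r0 h2))))"
  have J: "?J r h = sw (mu r h) (\<lambda>a b. ?t (phi a) (phi b))" if r: "tau r = r" and h: "pi h = h" for r h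
  proof -
    have 1: "sweedler Hr Hr (comul Hr h) (\<lambda>h1 h2. tens (tensor R Hr) (tensor R Hr) (tens R Hr r1 (mul Hr (pi g) h1)) (tens R Hr r0 h2)) =
        sw h (\<lambda>h1 h2. ?t (tn s s r1 (mu (pi g) h1)) (tn s s r0 h2))" for r1 g r0
      by (rule conv_H[OF h, where ?s3.0=pscl]) (intro L, simp add: tens_tn)
    have 2: "sweedler Hr R (coact R r2) (\<lambda>g r0. sweedler Hr Hr (comul Hr h) (\<lambda>h1 h2.
      tens (tensor R Hr) (tensor R Hr) (tens R Hr r1 (mul Hr g h1)) (tens R Hr r0 h2))) =
        sw r2 (\<lambda>g r0. sw h (\<lambda>h1 h2. ?t (tn s s r1 (mu (pi g) h1)) (tn s s (tau r0) h2)))" for r1 r2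
      by (rule conv_coact[where ?s3.0=pscl and G = "\<lambda>g r0. sw h (\<lambda>h1 h2. ?t (tn s s r1 (mu g h1)) (tn s s r0 h2))"]) (intro L, rule 1)
    have "?J r h = sw r (\<lambda>r1 r2. sw (tau r2) (\<lambda>g r0. sw h (\<lambda>h1 h2. ?t (tn s s (tau r1) (mu (pi g) h1)) (tn s s (tau r0) h2))))"
      by (rule conv_R[where ?s3.0=pscl and G = "\<lambda>r1 r2. sw r2 (\<lambda>g r0. sw h (\<lambda>h1 h2. ?t (tn s s r1 (mu (pi g) h1)) (tn s s (tau r0) h2)))"]) (intro L, rule 2)
    also have "\<dots> = sw r (\<lambda>r1 r2. sw r2 (\<lambda>g r0. sw h (\<lambda>h1 h2. ?t (tn s s (tau r1) (mu (pi g) h1)) (tn s s (tau r0) h2))))"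
      by (rule sw_R[OF _ r, where ?s2.0=pscl and F = "\<lambda>r1 r2. sw r2 (\<lambda>g r0. sw h (\<lambda>h1 h2. ?t (tn s s (tau r1) (mu (pi g) h1)) (tn s s (tau r0) h2)))"]) (intro L)
    also have "\<dots> = sw r (\<lambda>q r0. sw q (\<lambda>r1 g. sw h (\<lambda>h1 h2. ?t (tn s s (tau r1) (mu (pi g) h1)) (tn s s (tau r0) h2))))"
      by (rule sym, rule coassoc[where ?s2.0=pscl]) (intro L)+
    also have "\<dots> = sw r (\<lambda>q r0. sw h (\<lambda>h1 h2. ?t (sw q (\<lambda>r1 g. tn s s (tau r1) (mu (pi g) h1))) (tn s s (tau r0) h2)))"
      by (subst sw_swap) (simp add: sw_hom[OF bilinD(1)[OF bilin_tn[OF vs_pscl vs_pscl]]])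
    also have "\<dots> = sw r (\<lambda>q r0. sw h (\<lambda>h1 h2. ?t (sw q (\<lambda>r1 g. tn s s (tau r1) (mu (pi g) (pi h1)))) (tn s s (tau r0) (pi h2))))"
      by (subst sw_H[OF h, where ?s2.0=pscl and G = "\<lambda>h1 h2. ?t (sw _ (\<lambda>r1 g. tn s s (tau r1) (mu (pi g) h1))) (tn s s (tau _) h2)"], intro L, simp)
    also have "\<dots> = sw r (\<lambda>q r0. sw h (\<lambda>h1 h2. ?t (phi (mu q (pi h1))) (phi (mu (tau r0) (pi h2)))))"
      by (simp add: phi_mul[symmetric] phi_tn)
    also have "\<dots> = sw r (\<lambda>q r0. sw h (\<lambda>h1 h2. ?t (phi (mu q h1)) (phi (mu (tau r0) h2))))"
      by (subst sw_H[OF h, where ?s2.0=pscl and G = "\<lambda>h1 h2. ?t (phi (mu _ h1)) (phi (mu (tau _) h2))"], intro L, simp)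
    also have "\<dots> = sw r (\<lambda>q r0. sw h (\<lambda>h1 h2. ?t (phi (mu q h1)) (phi (mu r0 h2))))"
      by (rule sw_R[OF _ r, where ?s2.0=pscl and F = "\<lambda>q r0. sw h (\<lambda>h1 h2. ?t (phi (mu q h1)) (phi (mu r0 h2)))"]) (intro L)
    also have "\<dots> = sw (mu r h) (\<lambda>a b. ?t (phi a) (phi b))"
      by (rule sym, rule sw_mu[where ?s2.0=pscl]) (intro L)
    finally show ?thesis .
  qed
  have "comul Bos (phi x) = sweedler R Hr (phi x) ?J"
    by (simp add: bosonization_def)
  also have "\<dots> = sw x (\<lambda>r h. sw (mu (tau r) (pi h)) (\<lambda>a b. ?t (phi a) (phi b)))"
    by (rule conv_phi[where ?s3.0=pscl and G = "\<lambda>r h. sw (mu r h) (\<lambda>a b. ?t (phi a) (phi b))"]) (intro L, rule J, simp_all)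
  also have "\<dots> = sw (P x) (\<lambda>a b. ?t (phi a) (phi b))"
    by (rule decompose[where ?s2.0=pscl]) (intro L)
  finally show ?thesis by simp
qed

end

context split_raw
begin

text \<open>On pure tensors r # h and t # k the formula \<open>?I\<close> is \<open>phi\<close> of
  rhtk. \<open>merge\<close> reassembles the legs of r, \<open>pi_act_absorb\<close> turns the acted
  t_2 followed by h_3 into the product of a leg of h with t_2, and k passes through because
  \<open>phi\<close> is right H-linear.\<close>

lemma Bos_mul: "mul Bos (phi x) (phi y) = phi (mu x y)"
proof -
  note L = bilinI lin_rules lin_phi_rule
  let ?I = "\<lambda>r h t k. sweedler R R (comul R r) (\<lambda>r1 r2. sweedler Hr R (coact R r2) (\<lambda>g r0.
        sweedler Hr Hr (comul Hr h) (\<lambda>h1 h'. sweedler Hr Hr (comul Hr h') (\<lambda>h2 h3.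
        sweedler R R (comul R t) (\<lambda>t1 t2.
          tens R Hr (m (tens R R r1 (act R (mul Hr g h1) t1)))
          (mul Hr (mul Hr (xi (tens R R r0 (act R h2 t2))) h3) k))))))"
  have I: "?I r h t k = phi (mu (mu r h) (mu t k))"
    if r: "tau r = r" and h: "pi h = h" and t: "tau t = t" and k: "pi k = k" for r h t k
  proof -
    let ?K = "\<lambda>r1 g r0 h1 h2 h3 t1 t2. tn s s (tau (mu r1 (mu g (mu h1 t1)))) (mu (mu (pi (mu r0 (tau (mu (pi h2) t2)))) h3) k)"
    let ?Z = "\<lambda>r1 g r0. sw h (\<lambda>h1 h'. sw h' (\<lambda>h2 h3. sw t (\<lambda>t1 t2. ?K r1 g r0 h1 h2 h3 (tau t1) (tau t2))))"
    have pk: "pi (mu a k) = mu (pi a) k" for a using pi_mu(2)[of a k] by (simp add: k)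
    have 5: "sweedler R R (comul R t) (\<lambda>t1 t2. tens R Hr (m (tens R R r1 (act R (mul Hr (pi g) (pi h1)) t1)))
          (mul Hr (mul Hr (xi (tens R R r0 (act R (pi h2) t2))) (pi h3)) k)) =
        sw t (\<lambda>t1 t2. ?K r1 (pi g) r0 (pi h1) (pi h2) (pi h3) (tau t1) (tau t2))" for r1 g r0 h1 h2 h3
      by (rule conv_R[where ?s3.0=pscl and G = "\<lambda>t1 t2. ?K r1 (pi g) r0 (pi h1) (pi h2) (pi h3) t1 t2"])
        (intro L, simp add: tens_tn assoc k)
    have 4: "sweedler Hr Hr (comul Hr (pi h')) (\<lambda>h2 h3. sweedler R R (comul R t) (\<lambda>t1 t2. tens R Hr (m (tens R R r1 (act R (mul Hr (pi g) (pi h1)) t1)))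
          (mul Hr (mul Hr (xi (tens R R r0 (act R h2 t2))) h3) k))) =
        sw (pi h') (\<lambda>h2 h3. sw t (\<lambda>t1 t2. ?K r1 (pi g) r0 (pi h1) h2 h3 (tau t1) (tau t2)))" for r1 g r0 h1 h'
      by (rule conv_H[where ?s3.0=pscl]) (simp, intro L, rule 5)
    have 3: "sweedler Hr Hr (comul Hr h) (\<lambda>h1 h'. sweedler Hr Hr (comul Hr h') (\<lambda>h2 h3. sweedler R R (comul R t) (\<lambda>t1 t2. tens R Hr (m (tens R R r1 (act R (mul Hr (pi g) h1) t1)))
          (mul Hr (mul Hr (xi (tens R R r0 (act R h2 t2))) h3) k)))) = ?Z r1 (pi g) r0" for r1 g r0
      by (rule conv_H[OF h, where ?s3.0=pscl]) (intro L, rule 4)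
    have 2: "sweedler Hr R (coact R r2) (\<lambda>g r0. sweedler Hr Hr (comul Hr h) (\<lambda>h1 h'. sweedler Hr Hr (comul Hr h') (\<lambda>h2 h3. sweedler R R (comul R t) (\<lambda>t1 t2. tens R Hr (m (tens R R r1 (act R (mul Hr g h1) t1)))
          (mul Hr (mul Hr (xi (tens R R r0 (act R h2 t2))) h3) k))))) = sw r2 (\<lambda>g r0. ?Z r1 (pi g) (tau r0))" for r1 r2
      by (rule conv_coact[where ?s3.0=pscl and G = "\<lambda>g r0. ?Z r1 g r0"]) (intro L, rule 3)
    have "?I r h t k = sw r (\<lambda>r1 r2. sw (tau r2) (\<lambda>g r0. ?Z (tau r1) (pi g) (tau r0)))"
      by (rule conv_R[where ?s3.0=pscl and G = "\<lambda>r1 r2. sw r2 (\<lambda>g r0. ?Z r1 (pi g) (tau r0))"]) (intro L, rule 2)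
    also have "\<dots> = sw r (\<lambda>r1 r2. sw r2 (\<lambda>g r0. ?Z (tau r1) (pi g) (tau r0)))"
      by (rule sw_R[OF _ r, where ?s2.0=pscl and F = "\<lambda>r1 r2. sw r2 (\<lambda>g r0. ?Z (tau r1) (pi g) (tau r0))"]) (intro L)
    also have "\<dots> = sw r (\<lambda>r1 r2. sw r2 (\<lambda>g r0. ?Z (tau r1) (pi g) r0))"
      by (rule sw_R2[OF _ _ _ r, where ?s3.0=pscl and F = "\<lambda>r1 g r0. ?Z (tau r1) (pi g) r0"]) (intro L)+
    also have "\<dots> = sw r (\<lambda>q r0. ?Z q one r0)"
    proof -
      have "sw r (\<lambda>r1 r2. sw r2 (\<lambda>g r0. ?Z (mu (tau r1) (pi g)) one r0)) = sw r (\<lambda>q r0. ?Z q one r0)"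
        by (rule merge[where ?s3.0=pscl and F = "\<lambda>q r0. ?Z q one r0"]) (intro L)+
      then show ?thesis by (simp add: assoc)
    qed
    also have "\<dots> = sw r (\<lambda>q r0. sw h (\<lambda>h1 h2. sw t (\<lambda>t1 t2. tn s s (tau (mu (mu q h1) t1)) (mu (pi (mu (mu r0 h2) t2)) k))))"
    proof -
      have "?Z q one r0 = sw h (\<lambda>h1 h2. sw t (\<lambda>t1 t2. tn s s (tau (mu (mu q h1) t1)) (mu (pi (mu (mu r0 h2) t2)) k)))" for q r0
      proof -
        have lr: "lin s s (\<lambda>x. mu x k)" by (intro L)
        have inner: "sw (pi h') (\<lambda>h2 h3. mu (mu (pi (mu r0 (tau (mu (pi h2) (tau t2))))) h3) k) =
            mu (pi (mu r0 (mu (pi h') (tau t2)))) k" for h' t2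
          using pi_act_absorb[of "tau t2" h' r0] by (simp flip: sw_hom[OF lr])
        have "?Z q one r0 = sw h (\<lambda>h1 h'. sw (pi h') (\<lambda>h2 h3. sw t (\<lambda>t1 t2. ?K q one r0 (pi h1) h2 h3 (tau t1) (tau t2))))"
          by (rule sw_H[OF h, symmetric, where ?s2.0=pscl]) (intro L)
        also have "\<dots> = sw h (\<lambda>h1 h'. sw t (\<lambda>t1 t2. tn s s (tau (mu (mu q (pi h1)) t1)) (mu (pi (mu r0 (mu (pi h') (tau t2)))) k)))"
          \<comment> \<open>The \<xi>-component is summed over the last legs of h first, so that
            \<open>inner\<close> applies; in the other component \<open>tau_mu_tau\<close> removes
            the projection of t_1.\<close>
          by (subst sw_swap) (simp only: sw_hom[OF bilinD(2)[OF bilin_tn[OF vs vs]], symmetric] inner, simp only: assoc[symmetric] tau_mu_tau mu_one mu_P)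
        also have "\<dots> = sw h (\<lambda>h1 h'. sw t (\<lambda>t1 t2. tn s s (tau (mu (mu q (pi h1)) t1)) (mu (pi (mu r0 (mu (pi h') t2))) k)))"
          by (subst sw_R[OF _ t, where ?s2.0=pscl and F = "\<lambda>t1 t2. tn s s (tau (mu (mu q (pi _)) t1)) (mu (pi (mu r0 (mu (pi _) t2))) k)"], intro L, simp)
        also have "\<dots> = sw h (\<lambda>h1 h'. sw t (\<lambda>t1 t2. tn s s (tau (mu (mu q h1) t1)) (mu (pi (mu r0 (mu h' t2))) k)))"
          by (rule sw_H[OF h, where ?s2.0=pscl]) (intro L)
        finally show ?thesis by (simp add: assoc)
      qed
      then show ?thesis by simp
    qed
    also have "\<dots> = sw (mu r h) (\<lambda>x y. sw t (\<lambda>t1 t2. tn s s (tau (mu x t1)) (mu (pi (mu y t2)) k)))"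
      by (rule sym, rule sw_mu[where ?s2.0=pscl]) (intro L)
    also have "\<dots> = sw (mu (mu r h) t) (\<lambda>x y. tn s s (tau x) (mu (pi y) k))"
      by (rule sym, rule sw_mu[where ?s2.0=pscl]) (intro L)
    also have "\<dots> = phi (mu (mu (mu r h) t) k)" by (rule phi_mul[OF k, symmetric])
    finally show ?thesis by (simp add: assoc)
  qed
  have "mul Bos (phi x) (phi y) = sweedler R Hr (phi x) (\<lambda>r h. sweedler R Hr (phi y) (\<lambda>t k. ?I r h t k))"
    by (simp add: bosonization_def)
  also have "\<dots> = sw x (\<lambda>a b. sw y (\<lambda>c d. phi (mu (mu (tau a) (pi b)) (mu (tau c) (pi d)))))"
  proof (rule conv_phi[where ?s3.0=pscl and G = "\<lambda>r h. sw y (\<lambda>c d. phi (mu (mu r h) (mu (tau c) (pi d))))"])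
    show "bilin s s pscl (\<lambda>r h. sw y (\<lambda>c d. phi (mu (mu r h) (mu (tau c) (pi d)))))" by (intro L)
    fix a b
    show "sweedler R Hr (phi y) (\<lambda>t k. ?I (tau a) (pi b) t k) = sw y (\<lambda>c d. phi (mu (mu (tau a) (pi b)) (mu (tau c) (pi d))))"
      by (rule conv_phi[where ?s3.0=pscl and G = "\<lambda>t k. phi (mu (mu (tau a) (pi b)) (mu t k))"]) (intro L, rule I, simp_all)
  qed
  also have "\<dots> = sw x (\<lambda>a b. phi (mu (mu (tau a) (pi b)) (P y)))"
    by (subst decompose[where ?s2.0=pscl and f = "\<lambda>z. phi (mu (mu (tau _) (pi _)) z)"], intro L, simp)
  also have "\<dots> = phi (mu (P x) (P y))"
    by (rule decompose[where ?s2.0=pscl and f = "\<lambda>z. phi (mu z (P y))"]) (intro L)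
  finally show ?thesis by simp
qed

lemma Bos_unit: "unit Bos = phi one"
  unfolding phi_def by (subst sw_one[where ?s2.0=pscl]) (intro bilinI lin_rules, simp add: bosonization_def tens_tn)

lemma Bos_transport: "transport s P dl ep mu one Bos phi psi"
proof (rule transport.intro[OF tbialg_axioms], rule transport_axioms.intro)
  have c: "car Bos = car (tensor R Hr)" "scl Bos = pscl" by (simp_all add: bosonization_def)
  show "is_vspace Bos" using vspaces(3)[of R Hr] unfolding is_vspace_def c by simp
  show "lin s (scl Bos) phi" "lin (scl Bos) s psi" unfolding c by (rule lin_phi)+
  show "phi x \<in> car Bos" for x unfolding c by (rule phi_mem)
  show "phi (psi t) = t" if "t \<in> car Bos" for t using that unfolding c by (rule phi_psi)
  show "comul Bos (phi x) = sw x (\<lambda>a b. tn (scl Bos) (scl Bos) (phi a) (phi b))" for x unfolding c by (rule Bos_comul)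
qed (rule psi_phi Bos_mul Bos_counit Bos_unit)+

end

section \<open>Assembling the isomorphism\<close>

context corad_hopf
begin

lemma A_sweedler:
  assumes "x \<in> car A" "bilin s s s2 G" "\<And>v w. v \<in> car A \<Longrightarrow> w \<in> car A \<Longrightarrow> F v w = G v w"
  shows "sweedler A A (comul A x) F = sw x G"
proof -
  have "comul A x \<in> car (tensor A A)"
    using A assms(1) by (simp add: is_bialgebra_def is_coalgebra_def linear_map_def)
  then have "sweedler A A (comul A x) F = swt s s (comul A x) G"
    using sweedler_swt[OF V V, of s2 G F "comul A x"] assms by simp
  moreover have "comul A x = dl x" using assms(1) by (simp add: dl_def P(3))
  ultimately show ?thesis using sw_swt[OF assms(2)] by simp
qed

lemma splitting:
  obtains pi where "split_raw s P dl ep mu one pi (\<lambda>x. S (pi x)) H S" "range pi = Hc"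
proof -
  obtain pi where pi: "lin s s pi \<and> (\<forall>x. pi x \<in> Hc) \<and> (\<forall>x\<in>Hc. pi x = x) \<and> (\<forall>x. ep (pi x) = ep x) \<and> (\<forall>x. pi (P x) = pi x) \<and>
     (\<forall>h\<in>Hc. \<forall>a. pi (mu h a) = mu h (pi a) \<and> pi (mu a h) = mu (pi a) h) \<and>
     (\<forall>a. dl (pi a) = sw a (\<lambda>x y. tn s s (pi x) (pi y)))"
    using exists_bilinear_projection ..
  then have l: "lin s s pi" and mem: "\<And>x. pi x \<in> Hc" and id: "\<And>x. x \<in> Hc \<Longrightarrow> pi x = x"
    and e: "\<And>x. ep (pi x) = ep x" and pP: "\<And>x. pi (P x) = pi x"
    and pmu: "\<And>h a. h \<in> Hc \<Longrightarrow> pi (mu h a) = mu h (pi a)" "\<And>h a. h \<in> Hc \<Longrightarrow> pi (mu a h) = mu (pi a) h"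
    and dpi: "\<And>a. dl (pi a) = sw a (\<lambda>x y. tn s s (pi x) (pi y))"
    by simp_all
  interpret g: thopf s pi "\<lambda>x. dl (pi x)" "\<lambda>x. ep (pi x)" "\<lambda>x y. mu (pi x) (pi y)" one "\<lambda>x. S (pi x)"
    by (rule H_thopf[OF l mem id])
  note GS = H_sw[OF g.thopf_axioms]
  have idem: "pi (pi x) = pi x" for x using id mem by simp
  have ran: "range pi = Hc" using mem id by (metis rangeI subsetI subset_antisym image_subset_iff)
  have swp: "sw (pi x) F = sw x (\<lambda>a b. F (pi a) (pi b))" if F: "bilin s s s2 F" for x F and s2 :: "'k \<Rightarrow> 'z::ab_group_add \<Rightarrow> 'z"
  proof -
    have 1: "sw z F = tlift s s F (dl z)" for z using sw_hom[OF lin_tlift[OF F], of z "tn s s"] by (simp add: sw_tn tlift_tn[OF F])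
    show ?thesis unfolding 1 dpi by (simp add: sw_hom[OF lin_tlift[OF F]] tlift_tn[OF F])
  qed
  note Lr = bilinI lin_rules
  have gsw: "g.sw x F = sw x (\<lambda>a b. F (pi a) (pi b))" if "bilin s s s2 F" for x F and s2 :: "'k \<Rightarrow> 'z::ab_group_add \<Rightarrow> 'z"
    using GS[OF that] swp[OF that] by simp
  have Spi: "pi (S (pi x)) = S (pi x)" for x by (rule g.S_P(2))
  have "split_raw s P dl ep mu one pi (\<lambda>x. S (pi x)) H S"
  proof (intro split_raw.intro split.intro split_axioms.intro split_raw_axioms.intro tbialg_axioms)
    show "lin s s pi" "\<And>x. pi (P x) = pi x" "\<And>x. P (pi x) = pi x" "\<And>x. pi (pi x) = pi x" "\<And>x. ep (pi x) = ep x"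
      "pi one = one" "\<And>x y. pi (mu (pi x) y) = mu (pi x) (pi y)" "\<And>x y. pi (mu x (pi y)) = mu (pi x) (pi y)"
      "\<And>a. dl (pi a) = sw a (\<lambda>x y. tn s s (pi x) (pi y))" "lin s s (\<lambda>x. S (pi x))"
      "\<And>x. S (pi (pi x)) = S (pi x)" "\<And>x. pi (S (pi x)) = S (pi x)"
      using l pP H_total(1) mem idem e id Hc_sub(3) pmu dpi g.lin_S Spi by simp_all
    have b: "bilin s s s (\<lambda>x y. mu (pi (S (pi x))) (pi y))" "bilin s s s (\<lambda>x y. mu (pi x) (pi (S (pi y))))"
      "bilin s s pscl (\<lambda>x y. tn s s (S (pi y)) (S (pi x)))"
      by (intro Lr l g.lin_S')+
    fix a x y
    have "g.sw a (\<lambda>x y. mu (pi (S (pi x))) (pi y)) = sw a (\<lambda>x y. mu (pi (S (pi (pi x)))) (pi (pi y)))"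
      by (rule gsw[OF b(1)])
    then show "sw a (\<lambda>x y. mu (S (pi x)) (pi y)) = s (ep a) one" using g.antip0(1)[of a] by (simp add: idem Spi e)
    have "g.sw a (\<lambda>x y. mu (pi x) (pi (S (pi y)))) = sw a (\<lambda>x y. mu (pi (pi x)) (pi (S (pi (pi y)))))"
      by (rule gsw[OF b(2)])
    then show "sw a (\<lambda>x y. mu (pi x) (S (pi y))) = s (ep a) one" using g.antip0(2)[of a] by (simp add: idem Spi e)
    show "S (pi (mu (pi x) (pi y))) = mu (S (pi y)) (S (pi x))" using g.S_mu[of x y] by (simp add: Spi)
    have "dl (S (pi a)) = g.sw (S (pi a)) (tn s s)" using g.sw_tn[of "S (pi a)"] by (simp add: Spi)
    also have "\<dots> = g.sw a (\<lambda>a b. tn s s (S (pi b)) (S (pi a)))" by (rule g.sw_S[OF bilin_tn[OF vs vs]])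
    also have "\<dots> = sw a (\<lambda>a b. tn s s (S (pi (pi b))) (S (pi (pi a))))"
      by (rule gsw[OF b(3)])
    finally show "dl (S (pi a)) = sw a (\<lambda>x y. tn s s (S (pi y)) (S (pi x)))" by (simp add: idem)
    show "ep (S (pi x)) = ep x" using g.ep_S[of x] by (simp add: Spi e)
    show "S (pi one) = one" by (rule g.S_one)
    show "car H = range pi" "scl H = s" "unit H = one" by (simp_all add: ran one_def)
    show "is_hopf_algebra H S" using H_bialgebra S by (simp add: is_hopf_algebra_def)
    show "comul H x = dl x" "counit H x = ep x" "S x = S (pi x)" if "pi x = x" for x
      using that mem[of x] H_total by simp_all
    show "mul H x y = mu x y" if "pi x = x" "pi y = y" for x y
      using that mem[of x] mem[of y] H_total by simp
  qed
  then show ?thesis using that ran by blast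
qed

lemma A_antipode:
  assumes "lin s s G" "\<And>x. P (G x) = G x" "\<And>x. cv G P x = s (ep x) one" "\<And>x. cv P G x = s (ep x) one"
  shows "is_antipode A G"
  unfolding is_antipode_def
proof (intro conjI ballI)
  note L = bilinI lin_rules lin_comp[OF assms(1)] assms(1)
  show "linear_map A A G" by (rule linear_map_lin) (use assms carA in auto)
  fix x assume x: "x \<in> car A"
  have Px: "P x = x" and e: "counit A x = ep x" using x by (simp_all add: P(3) ep_def)
  have "sweedler A A (comul A x) (\<lambda>x1 x2. mul A (G x1) x2) = sw x (\<lambda>a b. mu (G a) (P b))"
    by (rule A_sweedler[OF x, where ?s2.0=s]) (intro L, simp add: assms(2) mu_def P(3))
  then show "sweedler A A (comul A x) (\<lambda>x1 x2. mul A (G x1) x2) = scl A (counit A x) (unit A)"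
    using assms(3)[of x] by (simp add: cv_def e one_def)
  have "sweedler A A (comul A x) (\<lambda>x1 x2. mul A x1 (G x2)) = sw x (\<lambda>a b. mu (P a) (G b))"
    by (rule A_sweedler[OF x, where ?s2.0=s]) (intro L, simp add: assms(2) mu_def P(3))
  then show "sweedler A A (comul A x) (\<lambda>x1 x2. mul A x1 (G x2)) = scl A (counit A x) (unit A)"
    using assms(4)[of x] by (simp add: cv_def e one_def)
qed

lemma isomorphic_to_bosonization:
  "\<exists>(R :: ('k, 'a, 'a) yd_coalgebra) u m \<xi> \<phi> S\<^sub>A S\<^sub>B.
     dual_yd_quadruple H S R u m \<xi> \<and>
     is_bialgebra_iso A (bosonization H R u m \<xi>) \<phi> \<and>
     is_hopf_algebra_iso A S\<^sub>A (bosonization H R u m \<xi>) S\<^sub>B \<phi>"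
proof -
  obtain pi where sp: "split_raw s P dl ep mu one pi (\<lambda>x. S (pi x)) H S" and ran: "range pi = Hc"
    by (rule splitting)
  interpret r: split_raw s P dl ep mu one pi "\<lambda>x. S (pi x)" H S by (rule sp)
  \<comment> \<open>For this instance the rule rewrites \<open>S x\<close> to
    \<open>S (pi x)\<close> and could be applied again to its own result.\<close>
  note [simp del] = r.Hr_ops(4)
  interpret t: transport s P dl ep mu one r.Bos r.phi r.psi by (rule r.Bos_transport)
  interpret c: tbialg_corad s P dl ep mu one Hc
    by (intro tbialg_corad.intro tbialg_axioms corad)
  obtain G where G: "lin s s G" "\<And>x. P (G x) = G x" "\<And>x. cv G P x = s (ep x) one" "\<And>x. cv P G x = s (ep x) one"
  proof (rule c.exists_antipode[OF r.lin_S])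
    fix x assume x: "x \<in> Hc"
    then have px: "pi x = x" using ran r.in_pi by auto
    have "sw x (\<lambda>a b. mu (S (pi a)) (P b)) = sw (pi x) (\<lambda>a b. mu (S (pi a)) (P b))" by (simp add: px)
    also have "\<dots> = sw x (\<lambda>a b. mu (S (pi a)) (pi b))"
      by (subst r.sw_pi[where ?s2.0=s], intro bilinI lin_rules, simp)
    finally show "cv (\<lambda>x. S (pi x)) P x = s (ep x) one" using r.S_antip(1)[of x] by (simp add: cv_def)
    have "sw x (\<lambda>a b. mu (P a) (S (pi b))) = sw (pi x) (\<lambda>a b. mu (P a) (S (pi b)))" by (simp add: px)
    also have "\<dots> = sw x (\<lambda>a b. mu (pi a) (S (pi b)))"
      by (subst r.sw_pi[where ?s2.0=s], intro bilinI lin_rules, simp)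
    finally show "cv P (\<lambda>x. S (pi x)) x = s (ep x) one" using r.S_antip(2)[of x] by (simp add: cv_def)
  qed (rule that)
  \<comment> \<open>The antipode of the bosonization is the antipode of A carried over by
    \<open>phi\<close>, so that compatibility with \<open>phi\<close> reduces to \<open>psi\<close>
    being its inverse.\<close>
  define SB where "SB = (\<lambda>y. r.phi (G (r.psi y)))"
  have AS: "is_antipode A G" by (rule A_antipode[OF G])
  have BS: "is_antipode r.Bos SB" unfolding SB_def by (rule t.transport_antipode[OF G(1,3,4)])
  have iso: "is_bialgebra_iso A r.Bos r.phi"
    unfolding is_bialgebra_iso_def
  proof (intro conjI ballI A t.transport_bialgebra)
    show "linear_map A r.Bos r.phi" by (rule linear_map_lin) (rule t.lin_phi, rule t.phi_mem)
    show "bij_betw r.phi (car A) (car r.Bos)"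
      by (rule bij_betw_byWitness[where f' = r.psi])
        (auto simp: t.phi_mem t.phi_psi t.psi_phi carA, metis P(2) carA t.phi_psi t.psi_phi)
    fix x assume x: "x \<in> car A"
    show "comul r.Bos (r.phi x) = sweedler A A (comul A x) (\<lambda>a b. tens r.Bos r.Bos (r.phi a) (r.phi b))"
      unfolding t.comulB tens_tn
      by (rule sym, rule A_sweedler[OF x, where ?s2.0=pscl]) (intro bilinI lin_rules, simp)
    have "counit A x = ep x" using x by (simp add: ep_def P(3))
    then show "counit r.Bos (r.phi x) = counit A x" by (simp only: t.counitB)
    show "r.phi (mul A x y) = mul r.Bos (r.phi x) (r.phi y)" if "y \<in> car A" for y
    proof -
      have "mul A x y = mu x y" using x that by (simp add: mu_def P(3))
      then show ?thesis by (simp only: t.mulB)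
    qed
  next
    show "r.phi (unit A) = unit r.Bos" by (simp only: t.unitB one_def[symmetric])
  qed
  have "is_hopf_algebra_iso A G r.Bos SB r.phi"
    unfolding is_hopf_algebra_iso_def is_hopf_algebra_def
    using A AS BS iso t.transport_bialgebra by (simp add: SB_def t.psi_phi P(3))
  with iso r.quadruple show ?thesis by blast
qed

end

theorem theorem5p24:
  fixes A :: "('k::field, 'a::ab_group_add) bialgebra"
    and H :: "('k, 'a) bialgebra"
    and S :: "'a \<Rightarrow> 'a"
  assumes "is_bialgebra A"
    and "H = A\<lparr>car := coradical A\<rparr>"
    and "sub_bialgebra A (coradical A)"
    and "semisimple_algebra H"
    and "is_antipode H S"
  shows "\<exists>(R :: ('k, 'a, 'a) yd_coalgebra) u m \<xi> \<phi> S\<^sub>A S\<^sub>B.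
           dual_yd_quadruple H S R u m \<xi> \<and>
           is_bialgebra_iso A (bosonization H R u m \<xi>) \<phi> \<and>
           is_hopf_algebra_iso A S\<^sub>A (bosonization H R u m \<xi>) S\<^sub>B \<phi>"
proof -
  interpret corad_hopf A "coradical A" S
    using assms by unfold_locales simp_all
  show ?thesis using isomorphic_to_bosonization assms(2) by simp
qed

end
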